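(* Let $\mathbf{x}$ be a mixed multiplicity system of $N$ with respect to the ideals $J,\mathbf{I}$ of the type $(k_0,\mathbf{k})\in\mathbb{N}^{d+1}$, and let $\mathbf{x}^*$ be the image of $\mathbf{x}$ in $\bigcup_{i=0}^dT_i$. Then $$e\big(J^{[k_0+1]},\mathbf{I}^{[\mathbf{k}]};N\big)=\chi(\mathbf{x}^*,\mathcal{N})=\widetilde{e}(\mathbf{x}^*,\mathcal{N}).$$
   Context: $\mathbb{N}$ denotes the nonnegative integers, $d\ge1$. $(R,\mathfrak{n})$ is a Noetherian local ring with infinite residue field, $N$ is a finitely generated $R$-module, $J,I_1,\ldots,I_d$ are ideals of $R$ with $J$ being $\mathfrak{n}$-primary. Put $\mathbf{I}=I_1,\ldots,I_d$, $I_0=J$, $I=JI_1\cdots I_d$, and $\mathbb{I}^{\mathbf{n}}=I_1^{n_1}\cdots I_d^{n_d}$. For a submodule $L$ of a module $N$, $L:I^\infty=\bigcup_{t\ge0}\{m\in N: I^tm\subseteq L\}$. "For all large $\mathbf{n}$" (or $\mathbf{n}\gg\mathbf{0}$) means every component is sufficiently large. $\dim 0=-\infty$. Mixed multiplicities of ideals: let $T=\bigoplus_{n\ge0,\,\mathbf{n}\ge\mathbf{0}}J^n\mathbb{I}^{\mathbf{n}}/J^{n+1}\mathbb{I}^{\mathbf{n}}$, a standard $\mathbb{N}^{d+1}$-graded algebra over the Artinian local ring $R/J$, and $\mathcal{N}=\bigoplus_{n\ge0,\,\mathbf{n}\ge\mathbf{0}}J^n\mathbb{I}^{\mathbf{n}}N/J^{n+1}\mathbb{I}^{\mathbf{n}}N$,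 a finitely generated $\mathbb{N}^{d+1}$-graded $T$-module. Put $T_i=I_i/JI_i$ for $0\le i\le d$ (the component of $T$ in degree the $i$-th unit vector). For all large $(n_0,\mathbf{n})$ the length of $\mathcal{N}_{(n_0,\mathbf{n})}$ is given by a polynomial, written uniquely as $\sum_{(k_0,\mathbf{k})\in\mathbb{N}^{d+1}}e(\mathcal{N};k_0,\mathbf{k})\prod_{i=0}^d\binom{n_i+k_i}{k_i}$ with integer coefficients. The mixed multiplicity $e(J^{[k_0+1]},\mathbf{I}^{[\mathbf{k}]};N)$ is defined if $e(\mathcal{N};h_0,\mathbf{h})=0$ for all $(h_0,\mathbf{h})\ne(k_0,\mathbf{k})$ with $(h_0,\mathbf{h})\ge(k_0,\mathbf{k})$ componentwise; then $e(J^{[k_0+1]},\mathbf{I}^{[\mathbf{k}]};N):=e(\mathcal{N};k_0,\mathbf{k})$. Mixed multiplicity systems of $N$: an element $a\in R$ is a Rees superficial element of $N$ with respect to $J,\mathbf{I}$ if for some $i\in\{0,\ldots,d\}$, $a\in I_i$ and $aN\cap J^{n_0}\mathbb{I}^{\mathbf{n}}I_iN=aJ^{n_0}\mathbb{I}^{\mathbf{n}}N$ for all $(n_0,\mathbf{n})\gg\mathbf{0}$; it is then counted as an element of $I_i$, and its image $a^*$ is taken in $T_i$. A sequence $x_1,\ldots,x_t$ is a Rees superficial sequence of $N$ if each $x_{j+1}$ is a Rees superficial element of $N/(x_1,\ldots,x_j)N$ ($0\le j<t$); it is of the type $(k_0,\mathbf{k})$ if it consists of $k_0$ elements of $J$,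 $k_1$ elements of $I_1$, ..., $k_d$ elements of $I_d$ (in any order). A Rees superficial sequence $\mathbf{x}$ of the type $(k_0,\mathbf{k})$ is a mixed multiplicity system of $N$ with respect to $J,\mathbf{I}$ of the type $(k_0,\mathbf{k})$ if $\dim N/(\mathbf{x}N:I^\infty)\le1$. Graded notions: let $M$ be a finitely generated $\mathbb{N}^{d+1}$-graded $T$-module, $T_{++}=\bigoplus_{\mathbf{n}\ge(1,\ldots,1)}T_{\mathbf{n}}$, and $\mathrm{Supp}_{++}M$ the set of homogeneous primes $P$ of $T$ not containing $T_{++}$ with $M_P\ne0$ (dimension = supremum of lengths of chains of primes, $\dim\emptyset=-\infty$). A sequence $\mathbf{y}=y_1,\ldots,y_n$ of elements of $\bigcup_{i=0}^dT_i$ is a mixed multiplicity system of $M$ if $\dim\mathrm{Supp}_{++}(M/\mathbf{y}M)\le0$. (If $\mathbf{x}$ is a mixed multiplicity system of $N$ with respect to $J,\mathbf{I}$ then $\mathbf{x}^*$ is one of $\mathcal{N}$.) For such $\mathbf{y}$, the mixed multiplicity symbol $\widetilde{e}(\mathbf{y},M)$ is defined inductively: if $n=0$, the length of $M_{\mathbf{n}}$ is a constant $c$ for $\mathbf{n}\gg\mathbf{0}$ and $\widetilde{e}(\emptyset,M)=c$; if $n>0$, $\widetilde{e}(\mathbf{y},M)=\widetilde{e}(\mathbf{y}',M/y_1M)-\widetilde{e}(\mathbf{y}',0_M:y_1)$ with $\mathbf{y}'=y_2,\ldots,y_n$ and $0_M:y_1=\{m\in M:y_1m=0\}$. The Euler–Poincaré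 characteristic is $\chi(\mathbf{y},M)=\sum_{i=0}^n(-1)^i\ell[H_i(\mathbf{y},M)_{\mathbf{n}}]$ for $\mathbf{n}\gg\mathbf{0}$ (a constant), where $\ell$ is length over $R/J$ and $H_i(\mathbf{y},M)$ is the $i$-th graded Koszul homology module of $M$ with respect to $\mathbf{y}$. *)

theory Defs
  imports "HOL-Algebra.Algebra" "HOL-Library.Extended_Real"
begin

section \<open>Commutative algebra\<close>

definition local_ring :: "('a, 'r) ring_scheme \<Rightarrow> 'a set \<Rightarrow> bool" where
  "local_ring R m \<longleftrightarrow> cring R \<and> maximalideal m R \<and> (\<forall>m'. maximalideal m' R \<longrightarrow> m' = m)"

definition ideal_radical :: "('a, 'r) ring_scheme \<Rightarrow> 'a set \<Rightarrow> 'a set" where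
  "ideal_radical R Q = {a \<in> carrier R. \<exists>t::nat. a [^]\<^bsub>R\<^esub> t \<in> Q}"

definition primary_ideal :: "'a set \<Rightarrow> ('a, 'r) ring_scheme \<Rightarrow> bool" where
  "primary_ideal Q R \<longleftrightarrow> ideal Q R \<and> carrier R \<noteq> Q \<and>
     (\<forall>a\<in>carrier R. \<forall>b\<in>carrier R. a \<otimes>\<^bsub>R\<^esub> b \<in> Q \<longrightarrow> a \<in> Q \<or> (\<exists>t::nat. b [^]\<^bsub>R\<^esub> t \<in> Q))"

text \<open>The supremum of the empty set in \<^typ>\<open>ereal\<close> is $-\infty$, so the zero ring has
  dimension $-\infty$.\<close>

definition krull_dim :: "('a, 'r) ring_scheme \<Rightarrow> ereal" where
  "krull_dim R = Sup {ereal (real l) | l. \<exists>P::nat \<Rightarrow> 'a set.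
     (\<forall>i\<le>l. primeideal (P i) R) \<and> (\<forall>i<l. P i \<subset> P (Suc i))}"

definition module_ann :: "('a, 'r) ring_scheme \<Rightarrow> ('a, 'm, 'z) module_scheme \<Rightarrow> 'a set" where
  "module_ann R M = {r \<in> carrier R. \<forall>m\<in>carrier M. r \<odot>\<^bsub>M\<^esub> m = \<zero>\<^bsub>M\<^esub>}"

definition module_dim :: "('a, 'r) ring_scheme \<Rightarrow> ('a, 'm, 'z) module_scheme \<Rightarrow> ereal" where
  "module_dim R M = krull_dim (R Quot (module_ann R M))"

definition submodule_gen ::
    "('a, 'r) ring_scheme \<Rightarrow> ('a, 'm, 'z) module_scheme \<Rightarrow> 'm set \<Rightarrow> 'm set" where
  "submodule_gen R M S = \<Inter>{H. submodule H R M \<and> S \<subseteq> H}"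

definition fin_gen_module :: "('a, 'r) ring_scheme \<Rightarrow> ('a, 'm, 'z) module_scheme \<Rightarrow> bool" where
  "fin_gen_module R M \<longleftrightarrow> (\<exists>S. finite S \<and> S \<subseteq> carrier M \<and> submodule_gen R M S = carrier M)"

definition set_smult ::
    "('a, 'r) ring_scheme \<Rightarrow> ('a, 'm, 'z) module_scheme \<Rightarrow> 'a set \<Rightarrow> 'm set" where
  "set_smult R M A = submodule_gen R M {a \<odot>\<^bsub>M\<^esub> m | a m. a \<in> A \<and> m \<in> carrier M}"

definition mod_length :: "('a, 'r) ring_scheme \<Rightarrow> ('a, 'm, 'z) module_scheme \<Rightarrow> enat" where
  "mod_length R M = Sup {enat l | l. \<exists>C::nat \<Rightarrow> 'm set.
     (\<forall>i\<le>l. submodule (C i) R M) \<and> (\<forall>i<l. C i \<subset> C (Suc i))}"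

text \<open>The module of cosets \<open>A/B\<close>, for submodules \<open>B \<subseteq> A\<close> of \<open>M\<close>. The
  ring fields \<^const>\<open>monoid.mult\<close> and \<^const>\<open>monoid.one\<close> of a module record play no role.\<close>

definition quot_mod ::
    "('a, 'm, 'z) module_scheme \<Rightarrow> 'm set \<Rightarrow> 'm set \<Rightarrow> ('a, 'm set) module" where
  "quot_mod M A B = \<lparr>carrier = (\<lambda>a. B +>\<^bsub>M\<^esub> a) ` A,
     monoid.mult = undefined, monoid.one = undefined,
     ring.zero = B, ring.add = set_add M, smult = (\<lambda>r Y. \<Union>x\<in>Y. B +>\<^bsub>M\<^esub> (r \<odot>\<^bsub>M\<^esub> x))\<rparr>"

definition self_module :: "('a, 'r) ring_scheme \<Rightarrow> ('a, 'a) module" where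
  "self_module R = \<lparr>carrier = carrier R, monoid.mult = monoid.mult R, monoid.one = monoid.one R,
     ring.zero = ring.zero R, ring.add = ring.add R, smult = monoid.mult R\<rparr>"

definition colon_infty ::
    "('a, 'r) ring_scheme \<Rightarrow> ('a, 'm, 'z) module_scheme \<Rightarrow> 'm set \<Rightarrow> 'a set \<Rightarrow> 'm set" where
  "colon_infty R M L K =
     (\<Union>t::nat. {m \<in> carrier M. \<forall>a \<in> K [^]\<^bsub>ideals_set R\<^esub> t. a \<odot>\<^bsub>M\<^esub> m \<in> L})"


section \<open>Multidegrees\<close>

text \<open>$\mathbb N^{d+1}$ is the set of functions on \<^typ>\<open>nat\<close> that vanish beyond \<open>d\<close>.\<close>

definition degs :: "nat \<Rightarrow> (nat \<Rightarrow> nat) set" where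
  "degs d = {n. \<forall>i>d. n i = 0}"

definition unit_deg :: "nat \<Rightarrow> nat \<Rightarrow> nat" where
  "unit_deg i = (\<lambda>j. if j = i then 1 else 0)"

definition for_large :: "nat \<Rightarrow> ((nat \<Rightarrow> nat) \<Rightarrow> bool) \<Rightarrow> bool" where
  "for_large d P \<longleftrightarrow> (\<exists>m. \<forall>n\<in>degs d. (\<forall>i\<le>d. m \<le> n i) \<longrightarrow> P n)"

definition eventual_value :: "nat \<Rightarrow> ((nat \<Rightarrow> nat) \<Rightarrow> int) \<Rightarrow> int" where
  "eventual_value d f = (THE c. for_large d (\<lambda>n. f n = c))"


section \<open>Graded rings and modules\<close>

text \<open>The additional field gives the homogeneous components.\<close>

record 'a graded_ring = "'a ring" +
  rpiece :: "(nat \<Rightarrow> nat) \<Rightarrow> 'a set"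

record ('a, 'm) graded_module = "('a, 'm) module" +
  piece :: "(nat \<Rightarrow> nat) \<Rightarrow> 'm set"

text \<open>The length of a homogeneous component over the degree zero part of the ring. For the
  ring \<open>assoc_ring\<close> below, the latter is $R/J$.\<close>

definition piece_length ::
    "('t, 'r) graded_ring_scheme \<Rightarrow> ('t, 'm, 'z) graded_module_scheme \<Rightarrow> (nat \<Rightarrow> nat) \<Rightarrow> int" where
  "piece_length T M n =
     int (the_enat (mod_length (T\<lparr>carrier := rpiece T (\<lambda>_. 0)\<rparr>) (M\<lparr>carrier := piece M n\<rparr>)))"

definition graded_quot ::
    "('t, 'm, 'z) graded_module_scheme \<Rightarrow> 'm set \<Rightarrow> 'm set \<Rightarrow> ('t, 'm set) graded_module" where
  "graded_quot M A B = module.extend (quot_mod M A B)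
     (graded_module.fields (\<lambda>n. (\<lambda>a. B +>\<^bsub>M\<^esub> a) ` (A \<inter> piece M n)))"

subsection \<open>Mixed multiplicity symbol\<close>

text \<open>Quotients change the type of elements, so the recursion runs over subquotients \<open>A/B\<close>
  of a fixed module: for \<open>M = A/B\<close> one has \<open>M/yM = A/(B + yA)\<close> and
  \<open>0\<^sub>M : y = {a \<in> A. ya \<in> B}/B\<close>. An element of a sequence is a pair of the index \<open>i\<close>
  of the component $T_i$ it is taken from and the element itself, since the latter does not
  determine the former.\<close>

fun mm_symbol_sub :: "nat \<Rightarrow> ('t, 'r) graded_ring_scheme \<Rightarrow> (nat \<times> 't) list \<Rightarrow>
    ('t, 'm, 'z) graded_module_scheme \<Rightarrow> 'm set \<Rightarrow> 'm set \<Rightarrow> int" where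
  "mm_symbol_sub d T [] M A B = eventual_value d (piece_length T (graded_quot M A B))"
| "mm_symbol_sub d T ((i, y) # ys) M A B =
     mm_symbol_sub d T ys M A (B <+>\<^bsub>M\<^esub> ((\<lambda>a. y \<odot>\<^bsub>M\<^esub> a) ` A))
     - mm_symbol_sub d T ys M {a \<in> A. y \<odot>\<^bsub>M\<^esub> a \<in> B} B"

definition mm_symbol :: "nat \<Rightarrow> ('t, 'r) graded_ring_scheme \<Rightarrow> (nat \<times> 't) list \<Rightarrow>
    ('t, 'm, 'z) graded_module_scheme \<Rightarrow> int" where
  "mm_symbol d T ys M = mm_symbol_sub d T ys M (carrier M) {\<zero>\<^bsub>M\<^esub>}"

subsection \<open>Koszul homology\<close>

text \<open>The value \<open>f S\<close> is the coefficient of the basis element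
  $e_{s_1}\wedge\dots\wedge e_{s_p}$, where $S=\{s_1<\dots<s_p\}$; this basis element has the
  degree \<open>koszul_deg ys S\<close>.\<close>

definition koszul_deg :: "(nat \<times> 't) list \<Rightarrow> nat set \<Rightarrow> nat \<Rightarrow> nat" where
  "koszul_deg ys S = (\<lambda>l. card {s \<in> S. fst (ys ! s) = l})"

definition koszul_module :: "(nat \<times> 't) list \<Rightarrow> ('t, 'm, 'z) graded_module_scheme \<Rightarrow> nat \<Rightarrow>
    ('t, nat set \<Rightarrow> 'm) graded_module" where
  "koszul_module ys M p =
    (let K = {f. (\<forall>S. f S \<in> carrier M) \<and>
                 (\<forall>S. \<not> (S \<subseteq> {..<length ys} \<and> card S = p) \<longrightarrow> f S = \<zero>\<^bsub>M\<^esub>)}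
     in \<lparr>carrier = K, monoid.mult = undefined, monoid.one = undefined,
         ring.zero = (\<lambda>_. \<zero>\<^bsub>M\<^esub>),
         ring.add = (\<lambda>f g S. f S \<oplus>\<^bsub>M\<^esub> g S), smult = (\<lambda>t f S. t \<odot>\<^bsub>M\<^esub> f S),
         piece = (\<lambda>n. {f \<in> K. \<forall>S. S \<subseteq> {..<length ys} \<and> card S = p \<longrightarrow>
            (if koszul_deg ys S \<le> n then f S \<in> piece M (\<lambda>l. n l - koszul_deg ys S l)
             else f S = \<zero>\<^bsub>M\<^esub>)})\<rparr>)"

text \<open>From $\partial(e_{s_1}\wedge\dots\wedge e_{s_p}) = \sum_j (-1)^{j-1} y_{s_j}\,
  e_{s_1}\wedge\dots\widehat{e_{s_j}}\dots\wedge e_{s_p}$.\<close>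

definition koszul_diff :: "(nat \<times> 't) list \<Rightarrow> ('t, 'm, 'z) graded_module_scheme \<Rightarrow>
    (nat set \<Rightarrow> 'm) \<Rightarrow> (nat set \<Rightarrow> 'm)" where
  "koszul_diff ys M f = (\<lambda>S. \<Oplus>\<^bsub>M\<^esub> s \<in> {..<length ys} - S.
     (if even (card {t \<in> S. t < s}) then snd (ys ! s) \<odot>\<^bsub>M\<^esub> f (insert s S)
      else \<ominus>\<^bsub>M\<^esub> (snd (ys ! s) \<odot>\<^bsub>M\<^esub> f (insert s S))))"

definition koszul_homology :: "(nat \<times> 't) list \<Rightarrow> ('t, 'm, 'z) graded_module_scheme \<Rightarrow> nat \<Rightarrow>
    ('t, (nat set \<Rightarrow> 'm) set) graded_module" where
  "koszul_homology ys M p = graded_quot (koszul_module ys M p)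
     {f \<in> carrier (koszul_module ys M p). koszul_diff ys M f = (\<lambda>_. \<zero>\<^bsub>M\<^esub>)}
     (koszul_diff ys M ` carrier (koszul_module ys M (Suc p)))"

definition euler_char :: "nat \<Rightarrow> ('t, 'r) graded_ring_scheme \<Rightarrow> (nat \<times> 't) list \<Rightarrow>
    ('t, 'm, 'z) graded_module_scheme \<Rightarrow> int" where
  "euler_char d T ys M = eventual_value d
     (\<lambda>n. \<Sum>p\<le>length ys. (- 1) ^ p * piece_length T (koszul_homology ys M p) n)"


section \<open>The associated graded ring and module\<close>

text \<open>Throughout, \<open>I 0\<close> is the ideal \<open>J\<close> and \<open>I 1, \<dots>, I d\<close> are the other ideals. Thus
  \<open>ideal_mpow R I d n\<close> is $J^{n_0} I_1^{n_1}\cdots I_d^{n_d}$.\<close>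

definition ideal_mpow ::
    "('a, 'r) ring_scheme \<Rightarrow> (nat \<Rightarrow> 'a set) \<Rightarrow> nat \<Rightarrow> (nat \<Rightarrow> nat) \<Rightarrow> 'a set" where
  "ideal_mpow R I d n = (\<Otimes>\<^bsub>ideals_set R\<^esub> i \<in> {..d}. I i [^]\<^bsub>ideals_set R\<^esub> n i)"

text \<open>$J^{n_0+1}I_1^{n_1}\cdots I_d^{n_d}N$, the denominator in degree \<open>n\<close>.\<close>

definition gr_den :: "('a, 'r) ring_scheme \<Rightarrow> (nat \<Rightarrow> 'a set) \<Rightarrow> nat \<Rightarrow>
    ('a, 'm, 'z) module_scheme \<Rightarrow> (nat \<Rightarrow> nat) \<Rightarrow> 'm set" where
  "gr_den R I d N n = set_smult R N (ideal_mpow R I d (n(0 := Suc (n 0))))"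

definition gr_comp :: "('a, 'r) ring_scheme \<Rightarrow> (nat \<Rightarrow> 'a set) \<Rightarrow> nat \<Rightarrow>
    ('a, 'm, 'z) module_scheme \<Rightarrow> (nat \<Rightarrow> nat) \<Rightarrow> ('a, 'm set) module" where
  "gr_comp R I d N n = quot_mod N (set_smult R N (ideal_mpow R I d n)) (gr_den R I d N n)"

definition gr_elem :: "('a, 'r) ring_scheme \<Rightarrow> (nat \<Rightarrow> 'a set) \<Rightarrow> nat \<Rightarrow>
    ('a, 'm, 'z) module_scheme \<Rightarrow> (nat \<Rightarrow> nat) \<Rightarrow> 'm \<Rightarrow> (nat \<Rightarrow> nat) \<Rightarrow> 'm set" where
  "gr_elem R I d N u a =
     (\<lambda>n\<in>degs d. if n = u then gr_den R I d N n +>\<^bsub>N\<^esub> a else gr_den R I d N n)"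

text \<open>$\mathcal N$, as the direct sum of its components; the scalar multiplication is the
  convolution of the products $(a + \dots)(m + \dots) = am + \dots$ of cosets.\<close>

definition assoc_module :: "('a, 'r) ring_scheme \<Rightarrow> (nat \<Rightarrow> 'a set) \<Rightarrow> nat \<Rightarrow>
    ('a, 'm, 'z) module_scheme \<Rightarrow> ((nat \<Rightarrow> nat) \<Rightarrow> 'a set, (nat \<Rightarrow> nat) \<Rightarrow> 'm set) graded_module" where
  "assoc_module R I d N =
    (let Q = gr_comp R I d N;
         C = {f \<in> (\<Pi>\<^sub>E n\<in>degs d. carrier (Q n)). finite {n \<in> degs d. f n \<noteq> \<zero>\<^bsub>Q n\<^esub>}}
     in \<lparr>carrier = C, monoid.mult = undefined, monoid.one = undefined,
         ring.zero = (\<lambda>n\<in>degs d. \<zero>\<^bsub>Q n\<^esub>),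
         ring.add = (\<lambda>f g. \<lambda>n\<in>degs d. f n \<oplus>\<^bsub>Q n\<^esub> g n),
         smult = (\<lambda>t f. \<lambda>n\<in>degs d. \<Oplus>\<^bsub>Q n\<^esub> u \<in> {u. u \<le> n}.
           (\<Union>a \<in> t u. \<Union>m \<in> f (\<lambda>i. n i - u i). gr_den R I d N n +>\<^bsub>N\<^esub> (a \<odot>\<^bsub>N\<^esub> m))),
         piece = (\<lambda>n. {f \<in> C. \<forall>u\<in>degs d. u \<noteq> n \<longrightarrow> f u = \<zero>\<^bsub>Q u\<^esub>})\<rparr>)"

definition assoc_ring :: "('a, 'r) ring_scheme \<Rightarrow> (nat \<Rightarrow> 'a set) \<Rightarrow> nat \<Rightarrow>
    ((nat \<Rightarrow> nat) \<Rightarrow> 'a set) graded_ring" where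
  "assoc_ring R I d =
    (let G = assoc_module R I d (self_module R)
     in \<lparr>carrier = carrier G, monoid.mult = smult G,
         monoid.one = gr_elem R I d (self_module R) (\<lambda>_. 0) \<one>\<^bsub>R\<^esub>,
         ring.zero = ring.zero G, ring.add = ring.add G, rpiece = piece G\<rparr>)"

definition star_seq :: "('a, 'r) ring_scheme \<Rightarrow> (nat \<Rightarrow> 'a set) \<Rightarrow> nat \<Rightarrow> (nat \<times> 'a) list \<Rightarrow>
    (nat \<times> ((nat \<Rightarrow> nat) \<Rightarrow> 'a set)) list" where
  "star_seq R I d xs = map (\<lambda>(i, a). (i, gr_elem R I d (self_module R) (unit_deg i) a)) xs"


section \<open>Mixed multiplicities of ideals\<close>

definition hilbert_coeffs ::
    "nat \<Rightarrow> ((nat \<Rightarrow> nat) \<Rightarrow> int) \<Rightarrow> ((nat \<Rightarrow> nat) \<Rightarrow> int) \<Rightarrow> bool" where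
  "hilbert_coeffs d H e \<longleftrightarrow> finite {k. e k \<noteq> 0} \<and> {k. e k \<noteq> 0} \<subseteq> degs d \<and>
     for_large d (\<lambda>n. H n =
       (\<Sum>k | e k \<noteq> 0. e k * (\<Prod>i\<le>d. int ((n i + k i) choose k i))))"

definition mm_coeff :: "('a, 'r) ring_scheme \<Rightarrow> (nat \<Rightarrow> 'a set) \<Rightarrow> nat \<Rightarrow>
    ('a, 'm, 'z) module_scheme \<Rightarrow> (nat \<Rightarrow> nat) \<Rightarrow> int" where
  "mm_coeff R I d N =
     (THE e. hilbert_coeffs d (piece_length (assoc_ring R I d) (assoc_module R I d N)) e)"

text \<open>\<open>mixed_mult R I d N k\<close> is $e(J^{[k_0+1]}, I_1^{[k_1]},\dots,I_d^{[k_d]}; N)$; it is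
  meaningful only when \<open>mixed_mult_defined R I d N k\<close> holds.\<close>

definition mixed_mult_defined :: "('a, 'r) ring_scheme \<Rightarrow> (nat \<Rightarrow> 'a set) \<Rightarrow> nat \<Rightarrow>
    ('a, 'm, 'z) module_scheme \<Rightarrow> (nat \<Rightarrow> nat) \<Rightarrow> bool" where
  "mixed_mult_defined R I d N k \<longleftrightarrow>
     (\<forall>h\<in>degs d. h \<noteq> k \<and> k \<le> h \<longrightarrow> mm_coeff R I d N h = 0)"

definition mixed_mult :: "('a, 'r) ring_scheme \<Rightarrow> (nat \<Rightarrow> 'a set) \<Rightarrow> nat \<Rightarrow>
    ('a, 'm, 'z) module_scheme \<Rightarrow> (nat \<Rightarrow> nat) \<Rightarrow> int" where
  "mixed_mult R I d N k = mm_coeff R I d N k"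


section \<open>Mixed multiplicity systems\<close>

text \<open>As above, a pair \<open>(i, a)\<close> stands for \<open>a\<close> counted as an element of \<open>I i\<close>.\<close>

definition rees_superficial :: "('a, 'r) ring_scheme \<Rightarrow> (nat \<Rightarrow> 'a set) \<Rightarrow> nat \<Rightarrow>
    ('a, 'm, 'z) module_scheme \<Rightarrow> nat \<times> 'a \<Rightarrow> bool" where
  "rees_superficial R I d N x \<longleftrightarrow> (case x of (i, a) \<Rightarrow> i \<le> d \<and> a \<in> I i \<and>
     for_large d (\<lambda>n.
       ((\<lambda>m. a \<odot>\<^bsub>N\<^esub> m) ` carrier N) \<inter> set_smult R N (ideal_mpow R I d n \<cdot>\<^bsub>R\<^esub> I i)
       = (\<lambda>m. a \<odot>\<^bsub>N\<^esub> m) ` set_smult R N (ideal_mpow R I d n)))"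

definition seq_smult ::
    "('a, 'r) ring_scheme \<Rightarrow> ('a, 'm, 'z) module_scheme \<Rightarrow> (nat \<times> 'a) list \<Rightarrow> 'm set" where
  "seq_smult R N xs = set_smult R N (snd ` set xs)"

definition rees_superficial_seq :: "('a, 'r) ring_scheme \<Rightarrow> (nat \<Rightarrow> 'a set) \<Rightarrow> nat \<Rightarrow>
    ('a, 'm, 'z) module_scheme \<Rightarrow> (nat \<times> 'a) list \<Rightarrow> bool" where
  "rees_superficial_seq R I d N xs \<longleftrightarrow> (\<forall>j<length xs.
     rees_superficial R I d (quot_mod N (carrier N) (seq_smult R N (take j xs))) (xs ! j))"

definition seq_type :: "(nat \<times> 'a) list \<Rightarrow> nat \<Rightarrow> nat" where
  "seq_type xs = (\<lambda>i. length (filter (\<lambda>x. fst x = i) xs))"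

definition mm_system :: "('a, 'r) ring_scheme \<Rightarrow> (nat \<Rightarrow> 'a set) \<Rightarrow> nat \<Rightarrow>
    ('a, 'm, 'z) module_scheme \<Rightarrow> (nat \<times> 'a) list \<Rightarrow> (nat \<Rightarrow> nat) \<Rightarrow> bool" where
  "mm_system R I d N xs k \<longleftrightarrow> rees_superficial_seq R I d N xs \<and> seq_type xs = k \<and>
     module_dim R (quot_mod N (carrier N)
       (colon_infty R N (seq_smult R N xs) (ideal_mpow R I d (\<lambda>i. if i \<le> d then 1 else 0)))) \<le> 1"

end

theory Submission
  imports Defs
begin

no_notation Sum_Type.Plus (infixr \<open><+>\<close> 65)

text \<open>Let $H(n)$ be the length of the component of degree \<open>n\<close> of $\mathcal N$, and let $c_1,\dots,c_t$ be
  the indices of the ideals that the elements $x_1,\dots,x_t$ of the system are taken from. Write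
  $\nabla_c f(n) = f(n) - f(n - e_c)$ for the backward difference. All three invariants are the
  constant value, in large degrees, of the iterated difference
  $\nabla_{c_1}\cdots\nabla_{c_t}H$; that this function is eventually constant is the heart of
  the matter.

  For the Euler-Poincare characteristic, the Koszul complex in degree \<open>n\<close> is a finite complex of
  modules of finite length. Its Euler characteristic is an alternating sum of lengths of shifted
  components of $\mathcal N$, and this sum is the iterated difference (\<open>euler_in_degree\<close>,
  \<open>koszul_sum_nabl\<close>). For the mixed multiplicity symbol, multiplication by an element $x$ of
  $T_c$ on a graded module $M$ has the cokernel $M/xM$ and the kernel $0_M:x$, so that
  $\nabla_c$ of the Hilbert function of $M$ is the Hilbert function of $M/xM$ minus a shift of the
  one of $0_M:x$ (\<open>len_difference\<close>). Hence the symbol and the iterated differences satisfy the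
  same recursion (\<open>symbol_difference\<close>). For the mixed multiplicity, $\nabla_c$ shifts the
  coefficients of a polynomial in the binomial basis by the unit vector $e_c$
  (\<open>hilbert_coeffs_nabl\<close>). If $\nabla_{c_1}\cdots\nabla_{c_t}H$ is eventually a constant, then by
  the uniqueness of the coefficients the coefficient at \<open>k\<close> is that constant and those at larger
  degrees vanish; in particular, the mixed multiplicity is defined.

  The recursion ends in subquotients $A/B$ of $\mathcal N$ that are annihilated by all of
  $x_1,\dots,x_t$, and it remains to see that their lengths are constant in large degrees. They
  are numerical polynomials: Hilbert functions are sums of Hilbert functions for one generator
  fewer (\<open>hilb_rational\<close>), where the chains of colon modules that occur become stationary by a
  version of the Hilbert basis theorem (\<open>family_acc\<close>). They are bounded: the multiples of a high
  power of each $x_j$ can be added to $A$ and to $B$ without changing $A/B$, so that its length is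
  bounded in terms of $\mathcal N/(x_1,\dots,x_t)\mathcal N$ (\<open>leaf_bounded\<close>). Finally, the length of the
  components of $\mathcal N/(x_1,\dots,x_t)\mathcal N$ is bounded because the sequence is a
  mixed multiplicity system (\<open>mixed_system_bounded\<close>): in large degrees it is at most the length of
  \<open>L/zL\<close> for $L = N/(\mathbf xN:I^\infty)$ and an element \<open>z\<close> of the product $I$ of the ideals such that \<open>L/zL\<close> has finite
  length, which exists since \<open>L\<close> has dimension at most one and $I$ annihilates no nonzero element
  of it. A bounded numerical polynomial is constant.

  The modules are handled inside \<open>N\<close>: a graded subquotient of $\mathcal N$ is given by families
  of submodules of \<open>N\<close>, one for each degree, between the denominators and the numerators of
  $\mathcal N$.\<close>

section \<open>Lengths of subquotients\<close>

definition strict_chain :: "'x set set \<Rightarrow> nat \<Rightarrow> (nat \<Rightarrow> 'x set) \<Rightarrow> bool" where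
  "strict_chain \<L> l C \<longleftrightarrow> (\<forall>i\<le>l. C i \<in> \<L>) \<and> (\<forall>i<l. C i \<subset> C (Suc i))"

definition chain_len :: "'x set set \<Rightarrow> enat" where
  "chain_len \<L> = Sup {enat l | l. \<exists>C. strict_chain \<L> l C}"

lemma mod_length_chain_len: "mod_length R M = chain_len {H. submodule H R M}"
  by (simp add: mod_length_def chain_len_def strict_chain_def)

text \<open>Since a chain can be truncated, the lengths of chains form an initial segment of the natural
  numbers.\<close>

lemma chain_len_ge_iff:
  assumes "\<L> \<noteq> {}"
  shows "enat l \<le> chain_len \<L> \<longleftrightarrow> (\<exists>C. strict_chain \<L> l C)"
proof
  assume le: "enat l \<le> chain_len \<L>"
  show "\<exists>C. strict_chain \<L> l C"
  proof (rule ccontr)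
    assume no: "\<not> (\<exists>C. strict_chain \<L> l C)"
    obtain A where "A \<in> \<L>" using assms by blast
    then have "strict_chain \<L> 0 (\<lambda>_. A)" by (simp add: strict_chain_def)
    then have l0: "l > 0" using no by (cases l) auto
    have bound: "l' \<le> l - 1" if C: "strict_chain \<L> l' C" for l' C
    proof (rule ccontr)
      assume "\<not> l' \<le> l - 1"
      then have "strict_chain \<L> l C" using C by (auto simp: strict_chain_def)
      then show False using no by blast
    qed
    have "chain_len \<L> \<le> enat (l - 1)"
      unfolding chain_len_def
    proof (rule Sup_least)
      fix x assume "x \<in> {enat l |l. \<exists>C. strict_chain \<L> l C}"
      then obtain l' C where "x = enat l'" "strict_chain \<L> l' C" by blast
      then show "x \<le> enat (l - 1)" using bound by simp
    qed
    then have "enat l \<le> enat (l - 1)" using le order_trans by blast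
    then show False using l0 by simp
  qed
next
  assume "\<exists>C. strict_chain \<L> l C"
  then show "enat l \<le> chain_len \<L>"
    unfolding chain_len_def using Sup_upper[of "enat l" "{enat l |l. \<exists>C. strict_chain \<L> l C}"]
    by blast
qed

lemma enat_le_via:
  assumes "\<And>l. enat l \<le> x \<Longrightarrow> enat l \<le> y"
  shows "x \<le> y"
proof (cases y)
  case (enat n)
  then have "\<not> enat (Suc n) \<le> x" using assms[of "Suc n"] by auto
  then show ?thesis using enat by (cases x) auto
qed simp

lemma chain_len_mono_map:
  assumes "\<And>C. C \<in> \<L> \<Longrightarrow> \<phi> C \<in> \<L>'"
    and "\<And>C C'. C \<in> \<L> \<Longrightarrow> C' \<in> \<L> \<Longrightarrow> C \<subset> C' \<Longrightarrow> \<phi> C \<subset> \<phi> C'"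
  shows "chain_len \<L> \<le> chain_len \<L>'"
proof -
  have "strict_chain \<L>' l (\<lambda>i. \<phi> (C i))" if "strict_chain \<L> l C" for l C
    unfolding strict_chain_def
  proof (intro conjI allI impI)
    have C: "C i \<in> \<L>" if "i \<le> l" for i
      using \<open>strict_chain \<L> l C\<close> that by (simp add: strict_chain_def)
    show "\<phi> (C i) \<in> \<L>'" if "i \<le> l" for i
      using assms(1)[OF C[OF that]] .
    have "C i \<subset> C (Suc i)" if "i < l" for i
      using \<open>strict_chain \<L> l C\<close> that by (simp add: strict_chain_def)
    then show "\<phi> (C i) \<subset> \<phi> (C (Suc i))" if "i < l" for i
      using assms(2)[OF C[of i] C[of "Suc i"]] that by simp
  qed
  then show ?thesis unfolding chain_len_def by (intro Sup_subset_mono) blast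
qed

text \<open>The traces of a strict chain, and its sums with a submodule, may have repetitions; these are
  dropped here.\<close>

lemma strict_subchain:
  fixes D :: "nat \<Rightarrow> 'x set"
  assumes "\<And>i. i \<le> l \<Longrightarrow> D i \<in> \<L>" "\<And>i. i < l \<Longrightarrow> D i \<subseteq> D (Suc i)"
  shows "\<exists>C. strict_chain \<L> (card {i. i < l \<and> D i \<noteq> D (Suc i)}) C \<and>
     C (card {i. i < l \<and> D i \<noteq> D (Suc i)}) = D l"
  using assms
proof (induction l)
  case 0
  then show ?case by (intro exI[of _ D]) (simp add: strict_chain_def)
next
  case (Suc l)
  let ?k = "card {i. i < l \<and> D i \<noteq> D (Suc i)}"
  have pre: "\<And>i. i \<le> l \<Longrightarrow> D i \<in> \<L>" "\<And>i. i < l \<Longrightarrow> D i \<subseteq> D (Suc i)"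
    using Suc.prems by simp_all
  obtain C where C: "strict_chain \<L> ?k C" "C ?k = D l"
    using Suc.IH[OF pre] by blast
  show ?case
  proof (cases "D l = D (Suc l)")
    case True
    then have "{i. i < Suc l \<and> D i \<noteq> D (Suc i)} = {i. i < l \<and> D i \<noteq> D (Suc i)}"
      using less_Suc_eq by blast
    then show ?thesis using C True by auto
  next
    case False
    then have "{i. i < Suc l \<and> D i \<noteq> D (Suc i)} = insert l {i. i < l \<and> D i \<noteq> D (Suc i)}"
      using less_Suc_eq by blast
    then have k: "card {i. i < Suc l \<and> D i \<noteq> D (Suc i)} = Suc ?k" by simp
    have "strict_chain \<L> (Suc ?k) (C(Suc ?k := D (Suc l)))"
      unfolding strict_chain_def
    proof (intro conjI allI impI)
      fix i assume "i < Suc ?k"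
      then consider "i < ?k" | "i = ?k" by linarith
      then show "(C(Suc ?k := D (Suc l))) i \<subset> (C(Suc ?k := D (Suc l))) (Suc i)"
      proof cases
        case 2
        then show ?thesis using C(2) False Suc.prems(2)[OF lessI] by (simp add: psubset_eq)
      qed (use C(1) in \<open>simp add: strict_chain_def\<close>)
    qed (use C(1) Suc.prems(1)[OF order_refl] in \<open>auto simp: le_Suc_eq strict_chain_def\<close>)
    then show ?thesis unfolding k by (intro exI[of _ "C(Suc ?k := D (Suc l))"]) (simp del: fun_upd_apply, simp)
  qed
qed

text \<open>The degree zero part of the associated graded ring and the modules of cosets come as bare
  records. Lengths and the isomorphism theorems need no more of them than an abelian group with
  additive operators.\<close>

locale operator_group = M?: abelian_group M
  for R :: "('t, 'r) ring_scheme" and M :: "('t, 'm, 'z) module_scheme" (structure) +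
  assumes op_closed [simp, intro]: "\<lbrakk>r \<in> carrier R; x \<in> carrier M\<rbrakk> \<Longrightarrow> r \<odot> x \<in> carrier M"
    and op_add: "\<lbrakk>r \<in> carrier R; x \<in> carrier M; y \<in> carrier M\<rbrakk> \<Longrightarrow> r \<odot> (x \<oplus> y) = r \<odot> x \<oplus> r \<odot> y"
begin

abbreviation sub :: "'m set \<Rightarrow> bool" where "sub H \<equiv> submodule H R M"

lemma subI:
  assumes "H \<subseteq> carrier M" "\<zero> \<in> H" "\<And>a. a \<in> H \<Longrightarrow> \<ominus> a \<in> H"
    "\<And>a b. a \<in> H \<Longrightarrow> b \<in> H \<Longrightarrow> a \<oplus> b \<in> H"
    "\<And>r a. r \<in> carrier R \<Longrightarrow> a \<in> H \<Longrightarrow> r \<odot> a \<in> H"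
  shows "sub H"
  apply (intro submodule.intro subgroup.intro)
  using assms unfolding submodule_axioms_def by (simp_all add: a_inv_def)

lemma sub_subset: "sub H \<Longrightarrow> H \<subseteq> carrier M"
  and sub_carr: "sub H \<Longrightarrow> a \<in> H \<Longrightarrow> a \<in> carrier M"
  and sub_zero: "sub H \<Longrightarrow> \<zero> \<in> H"
  and sub_add: "sub H \<Longrightarrow> a \<in> H \<Longrightarrow> b \<in> H \<Longrightarrow> a \<oplus> b \<in> H"
  and sub_neg: "sub H \<Longrightarrow> a \<in> H \<Longrightarrow> \<ominus> a \<in> H"
  and sub_op: "sub H \<Longrightarrow> r \<in> carrier R \<Longrightarrow> a \<in> H \<Longrightarrow> r \<odot> a \<in> H"
proof -
  assume H: "sub H"
  interpret S: subgroup H "add_monoid M" using H submodule.axioms(1) by blast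
  show "H \<subseteq> carrier M" using S.subset by simp
  show "a \<in> H \<Longrightarrow> a \<in> carrier M" using S.subset by auto
  show "\<zero> \<in> H" using S.one_closed by simp
  show "a \<in> H \<Longrightarrow> b \<in> H \<Longrightarrow> a \<oplus> b \<in> H" using S.m_closed by simp
  show "a \<in> H \<Longrightarrow> \<ominus> a \<in> H" using S.m_inv_closed by (simp add: a_inv_def)
  show "r \<in> carrier R \<Longrightarrow> a \<in> H \<Longrightarrow> r \<odot> a \<in> H" using submodule.smult_closed[OF H] .
qed

lemma sub_minus: "sub H \<Longrightarrow> a \<in> H \<Longrightarrow> b \<in> H \<Longrightarrow> a \<ominus> b \<in> H"
  using sub_add sub_neg by (simp add: a_minus_def)

lemma op_zero: "r \<in> carrier R \<Longrightarrow> r \<odot> \<zero> = \<zero>"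
  using op_add[of r \<zero> \<zero>] by (metis op_closed M.add.r_cancel_one' M.l_zero M.zero_closed)

lemma op_neg: "r \<in> carrier R \<Longrightarrow> x \<in> carrier M \<Longrightarrow> r \<odot> (\<ominus> x) = \<ominus> (r \<odot> x)"
  by (metis op_add op_zero op_closed M.a_inv_closed M.l_neg M.minus_equality)

lemma sub_carrier: "sub (carrier M)"
  by (rule subI) auto

lemma sub_zero_set: "sub {\<zero>}"
  by (rule subI) (auto simp: op_zero)

lemma sub_inter:
  assumes H: "sub H" and K: "sub K"
  shows "sub (H \<inter> K)"
  by (rule subI) (simp_all add: sub_zero[OF H] sub_zero[OF K] sub_add[OF H] sub_add[OF K]
      sub_neg[OF H] sub_neg[OF K] sub_op[OF H] sub_op[OF K] sub_subset[OF H] le_infI1)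

lemma set_addI: "a \<in> H \<Longrightarrow> b \<in> K \<Longrightarrow> a \<oplus> b \<in> H <+> K"
  by (auto simp: set_add_def set_mult_def)

lemma set_addE: "c \<in> H <+> K \<Longrightarrow> (\<And>a b. a \<in> H \<Longrightarrow> b \<in> K \<Longrightarrow> c = a \<oplus> b \<Longrightarrow> P) \<Longrightarrow> P"
  by (auto simp: set_add_def set_mult_def)

lemma set_add_mono: "H \<subseteq> H' \<Longrightarrow> K \<subseteq> K' \<Longrightarrow> H <+> K \<subseteq> H' <+> K'"
  by (auto elim!: set_addE intro: set_addI)

lemma sub_sum: "sub H \<Longrightarrow> sub K \<Longrightarrow> sub (H <+> K)"
proof (rule subI)
  assume H: "sub H" and K: "sub K"
  note c = sub_carr[OF H] sub_carr[OF K]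
  show "H <+> K \<subseteq> carrier M" using c by (auto elim!: set_addE)
  show "\<zero> \<in> H <+> K" using set_addI[OF sub_zero[OF H] sub_zero[OF K]] by simp
  show "\<ominus> a \<in> H <+> K" if "a \<in> H <+> K" for a
    using that
  proof (rule set_addE)
    fix x y assume "x \<in> H" "y \<in> K" "a = x \<oplus> y"
    then show "\<ominus> a \<in> H <+> K"
      using set_addI[of "\<ominus> x" H "\<ominus> y" K] c sub_neg[OF H] sub_neg[OF K] by (simp add: M.minus_add)
  qed
  show "a \<oplus> b \<in> H <+> K" if a: "a \<in> H <+> K" and b: "b \<in> H <+> K" for a b
    using a
  proof (rule set_addE)
    fix x y assume 1: "x \<in> H" "y \<in> K" "a = x \<oplus> y"
    show "a \<oplus> b \<in> H <+> K" using b
    proof (rule set_addE)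
      fix x' y' assume 2: "x' \<in> H" "y' \<in> K" "b = x' \<oplus> y'"
      have "a \<oplus> b = (x \<oplus> x') \<oplus> (y \<oplus> y')" using 1 2 c by (simp add: M.a_ac)
      then show "a \<oplus> b \<in> H <+> K"
        using set_addI[of "x \<oplus> x'" H "y \<oplus> y'" K] 1 2 sub_add[OF H] sub_add[OF K] by simp
    qed
  qed
  show "r \<odot> a \<in> H <+> K" if r: "r \<in> carrier R" and a: "a \<in> H <+> K" for r a
    using a
  proof (rule set_addE)
    fix x y assume "x \<in> H" "y \<in> K" "a = x \<oplus> y"
    then show "r \<odot> a \<in> H <+> K"
      using set_addI[of "r \<odot> x" H "r \<odot> y" K] c r sub_op[OF H] sub_op[OF K] by (simp add: op_add)
  qed
qed

lemma subset_sum_left: "sub K \<Longrightarrow> H \<subseteq> carrier M \<Longrightarrow> H \<subseteq> H <+> K"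
proof
  fix x assume "sub K" "H \<subseteq> carrier M" "x \<in> H"
  then show "x \<in> H <+> K" using set_addI[of x H \<zero> K] sub_zero[of K] by auto
qed

lemma subset_sum_right: "sub H \<Longrightarrow> K \<subseteq> carrier M \<Longrightarrow> K \<subseteq> H <+> K"
proof
  fix x assume "sub H" "K \<subseteq> carrier M" "x \<in> K"
  then show "x \<in> H <+> K" using set_addI[of \<zero> H x K] sub_zero[of H] by auto
qed

lemma sum_subset: "sub L \<Longrightarrow> H \<subseteq> L \<Longrightarrow> K \<subseteq> L \<Longrightarrow> H <+> K \<subseteq> L"
  by (auto elim!: set_addE intro: sub_add)

text \<open>The modular law, in the form in which chains use it.\<close>

lemma modular_eq:
  assumes "sub H" "sub K" "sub L" "H \<subseteq> K" "H \<inter> L = K \<inter> L" "H <+> L = K <+> L"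
  shows "H = K"
proof
  show "K \<subseteq> H"
  proof
    fix k assume k: "k \<in> K"
    then have "k \<in> H <+> L" using assms subset_sum_left[of L K] sub_subset by auto
    then obtain h l where hl: "h \<in> H" "l \<in> L" "k = h \<oplus> l" by (rule set_addE)
    then have c: "h \<in> carrier M" "l \<in> carrier M" using assms sub_carr by blast+
    then have "l = \<ominus> h \<oplus> k" using hl by (simp add: M.r_neg1)
    moreover have "\<ominus> h \<oplus> k \<in> K"
      using hl(1) k assms(4) sub_add[OF assms(2)] sub_neg[OF assms(2)] by blast
    ultimately have "l \<in> K" by metis
    then have "l \<in> H" using hl assms(5) by auto
    then show "k \<in> H" using hl sub_add[OF assms(1)] by auto
  qed
qed fact

end

text \<open>The length of the subquotient \<open>A/B\<close>, as the length of the interval from \<open>B\<close> to \<open>A\<close>.\<close>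

definition sq_len :: "('t, 'r) ring_scheme \<Rightarrow> ('t, 'm, 'z) module_scheme \<Rightarrow> 'm set \<Rightarrow> 'm set \<Rightarrow> enat" where
  "sq_len R M B A = chain_len {C. submodule C R M \<and> B \<subseteq> C \<and> C \<subseteq> A}"

context operator_group
begin

lemma sq_len_ge_iff:
  assumes "sub B" "B \<subseteq> A"
  shows "enat l \<le> sq_len R M B A \<longleftrightarrow>
    (\<exists>C. strict_chain {C. sub C \<and> B \<subseteq> C \<and> C \<subseteq> A} l C)"
  unfolding sq_len_def by (rule chain_len_ge_iff) (use assms in blast)

text \<open>By the modular law, a chain from \<open>B\<close> to \<open>A\<close> loses no step if one takes both its traces on \<open>C\<close>
  and its sums with \<open>C\<close>; conversely, chains on both sides of \<open>C\<close> can be joined.\<close>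

lemma sq_len_add:
  assumes B: "sub B" and C: "sub C" and A: "sub A" and BC: "B \<subseteq> C" and CA: "C \<subseteq> A"
  shows "sq_len R M B A = sq_len R M B C + sq_len R M C A"
proof (rule antisym)
  show "sq_len R M B A \<le> sq_len R M B C + sq_len R M C A"
  proof (rule enat_le_via)
    fix l assume "enat l \<le> sq_len R M B A"
    then obtain F where F: "\<forall>i\<le>l. sub (F i) \<and> B \<subseteq> F i \<and> F i \<subseteq> A" "\<forall>i<l. F i \<subset> F (Suc i)"
      using sq_len_ge_iff[of B A l] assms by (auto simp: strict_chain_def)
    let ?G = "\<lambda>i. F i \<inter> C" and ?K = "\<lambda>i. F i <+> C"
    let ?SG = "{i. i < l \<and> ?G i \<noteq> ?G (Suc i)}" and ?SK = "{i. i < l \<and> ?K i \<noteq> ?K (Suc i)}"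
    have 1: "\<exists>C'. strict_chain {H. sub H \<and> B \<subseteq> H \<and> H \<subseteq> C} (card ?SG) C' \<and> C' (card ?SG) = ?G l"
      by (rule strict_subchain) (use F B C BC sub_inter in auto)
    have g: "enat (card ?SG) \<le> sq_len R M B C"
      using 1 sq_len_ge_iff[of B C] B BC by blast
    have 2: "\<exists>C'. strict_chain {H. sub H \<and> C \<subseteq> H \<and> H \<subseteq> A} (card ?SK) C' \<and> C' (card ?SK) = ?K l"
    proof (rule strict_subchain)
      fix i assume "i \<le> l"
      then show "?K i \<in> {H. sub H \<and> C \<subseteq> H \<and> H \<subseteq> A}"
        using F C A CA sub_sum sum_subset[OF A] subset_sum_right[of "F i" C] sub_subset[OF C] by auto
    next
      fix i assume "i < l"
      then show "?K i \<subseteq> ?K (Suc i)" using F by (intro set_add_mono) auto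
    qed
    have k: "enat (card ?SK) \<le> sq_len R M C A"
      using 2 sq_len_ge_iff[of C A] C CA by blast
    have "{..<l} \<subseteq> ?SG \<union> ?SK"
    proof
      fix i assume "i \<in> {..<l}"
      then show "i \<in> ?SG \<union> ?SK"
        using F modular_eq[of "F i" "F (Suc i)" C] C by fastforce
    qed
    then have "l \<le> card (?SG \<union> ?SK)" using card_mono[of "?SG \<union> ?SK" "{..<l}"] by simp
    also have "\<dots> \<le> card ?SG + card ?SK" by (rule card_Un_le)
    finally have "enat l \<le> enat (card ?SG) + enat (card ?SK)" by simp
    also have "\<dots> \<le> sq_len R M B C + sq_len R M C A" using g k by (rule add_mono)
    finally show "enat l \<le> sq_len R M B C + sq_len R M C A" .
  qed
next
  show "sq_len R M B C + sq_len R M C A \<le> sq_len R M B A"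
  proof (rule enat_le_via)
    fix l assume "enat l \<le> sq_len R M B C + sq_len R M C A"
    then obtain l1 l2 where l: "l = l1 + l2" "enat l1 \<le> sq_len R M B C" "enat l2 \<le> sq_len R M C A"
    proof (cases "sq_len R M B C")
      case (enat b)
      show ?thesis
      proof (cases "sq_len R M C A")
        case (enat a)
        then show ?thesis using that[of "min l b" "l - b"] \<open>sq_len R M B C = enat b\<close>
            \<open>enat l \<le> sq_len R M B C + sq_len R M C A\<close> by auto
      next
        case infinity
        then show ?thesis using that[of 0 l] by (simp add: zero_enat_def[symmetric])
      qed
    next
      case infinity
      then show ?thesis using that[of l 0] by (simp add: zero_enat_def[symmetric])
    qed
    obtain F where F: "\<forall>i\<le>l1. sub (F i) \<and> B \<subseteq> F i \<and> F i \<subseteq> C" "\<forall>i<l1. F i \<subset> F (Suc i)"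
      using l sq_len_ge_iff[of B C] B BC by (auto simp: strict_chain_def)
    obtain G where G: "\<forall>i\<le>l2. sub (G i) \<and> C \<subseteq> G i \<and> G i \<subseteq> A" "\<forall>i<l2. G i \<subset> G (Suc i)"
      using l sq_len_ge_iff[of C A] C CA by (auto simp: strict_chain_def)
    define K where "K = (\<lambda>i. if i \<le> l1 then F i else G (i - l1))"
    have "\<forall>i\<le>l. sub (K i) \<and> B \<subseteq> K i \<and> K i \<subseteq> A"
    proof (intro allI impI)
      fix i assume i: "i \<le> l"
      show "sub (K i) \<and> B \<subseteq> K i \<and> K i \<subseteq> A"
      proof (cases "i \<le> l1")
        case True
        then show ?thesis using F(1)[rule_format, of i] CA
          by (simp add: K_def subset_trans[OF _ CA])
      next
        case False
        then show ?thesis using G(1)[rule_format, of "i - l1"] i l(1)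
          by (simp add: K_def subset_trans[OF BC])
      qed
    qed
    moreover have "\<forall>i<l. K i \<subset> K (Suc i)"
    proof (intro allI impI)
      fix i assume i: "i < l"
      consider "i < l1" | "i = l1" | "i > l1" by linarith
      then show "K i \<subset> K (Suc i)"
      proof cases
        case 2
        have "G 0 \<subset> G (Suc 0)" using G(2) i l(1) 2 by simp
        moreover have "F i \<subseteq> C" "C \<subseteq> G 0" using F(1)[rule_format, of i] G(1)[rule_format, of 0] 2 by simp_all
        ultimately show ?thesis using 2 by (auto simp: K_def)
      next
        case 3
        then have "G (i - l1) \<subset> G (Suc (i - l1))" using G(2) i l(1) by simp
        then show ?thesis using 3 by (simp add: K_def Suc_diff_le)
      qed (use F(2) in \<open>simp add: K_def\<close>)
    qed
    ultimately have "strict_chain {C. sub C \<and> B \<subseteq> C \<and> C \<subseteq> A} l K"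
      by (simp add: strict_chain_def)
    then show "enat l \<le> sq_len R M B A"
      using sq_len_ge_iff[of B A l] B BC CA by blast
  qed
qed

lemma sq_len_self: "sub A \<Longrightarrow> sq_len R M A A = 0"
proof -
  assume A: "sub A"
  have "\<not> strict_chain {C. sub C \<and> A \<subseteq> C \<and> C \<subseteq> A} 1 C" for C
  proof
    assume "strict_chain {C. sub C \<and> A \<subseteq> C \<and> C \<subseteq> A} 1 C"
    then have "C 0 \<in> {C. sub C \<and> A \<subseteq> C \<and> C \<subseteq> A}" "C 1 \<in> {C. sub C \<and> A \<subseteq> C \<and> C \<subseteq> A}"
      "C 0 \<subset> C 1" by (simp_all add: strict_chain_def)
    then show False by blast
  qed
  then have "\<not> enat 1 \<le> sq_len R M A A"
    using sq_len_ge_iff[OF A order_refl, of 1] by blast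
  then show ?thesis by (metis ileI1 one_eSuc one_enat_def not_gr_zero)
qed

lemma sq_len_mono:
  assumes "sub B" "sub B'" "sub A" "sub A'" "B \<subseteq> B'" "B' \<subseteq> A'" "A' \<subseteq> A"
  shows "sq_len R M B' A' \<le> sq_len R M B A"
  using sq_len_add[of B B' A] sq_len_add[of B' A' A] assms
  by (metis add.commute dual_order.trans le_iff_add)

end

text \<open>The operators on the two sides may differ, since the components of the associated graded
  module are compared with modules over the ground ring.\<close>

lemma
  fixes M (structure) and M' (structure)
  assumes M: "operator_group R M" and M': "operator_group R' M'" and A: "submodule A R M"
    and f: "\<And>a. a \<in> A \<Longrightarrow> f a \<in> carrier M'"
    and add: "\<And>a b. a \<in> A \<Longrightarrow> b \<in> A \<Longrightarrow> f (a \<oplus>\<^bsub>M\<^esub> b) = f a \<oplus>\<^bsub>M'\<^esub> f b"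
  shows hom_zero: "f \<zero>\<^bsub>M\<^esub> = \<zero>\<^bsub>M'\<^esub>"
    and hom_neg: "a \<in> A \<Longrightarrow> f (\<ominus>\<^bsub>M\<^esub> a) = \<ominus>\<^bsub>M'\<^esub> f a"
    and hom_image: "submodule C R M \<Longrightarrow> C \<subseteq> A \<Longrightarrow>
      (\<And>r'. r' \<in> carrier R' \<Longrightarrow> \<exists>r\<in>carrier R. \<forall>a\<in>A. f (r \<odot>\<^bsub>M\<^esub> a) = r' \<odot>\<^bsub>M'\<^esub> f a) \<Longrightarrow>
      submodule (f ` C) R' M'"
    and hom_preimage: "submodule H R' M' \<Longrightarrow>
      (\<And>r. r \<in> carrier R \<Longrightarrow> \<exists>r'\<in>carrier R'. \<forall>a\<in>A. f (r \<odot>\<^bsub>M\<^esub> a) = r' \<odot>\<^bsub>M'\<^esub> f a) \<Longrightarrow>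
      submodule {a \<in> A. f a \<in> H} R M"
proof -
  interpret M: operator_group R M by fact
  interpret M': operator_group R' M' by fact
  have cA: "a \<in> carrier M" if "a \<in> A" for a using that A M.sub_carr by blast
  show f0: "f \<zero>\<^bsub>M\<^esub> = \<zero>\<^bsub>M'\<^esub>"
    using add[of "\<zero>\<^bsub>M\<^esub>" "\<zero>\<^bsub>M\<^esub>"] f[of "\<zero>\<^bsub>M\<^esub>"] M.sub_zero[OF A]
    by (metis M.l_zero M.zero_closed M'.add.r_cancel_one')
  show fneg: "f (\<ominus>\<^bsub>M\<^esub> a) = \<ominus>\<^bsub>M'\<^esub> f a" if "a \<in> A" for a
    using add[of "\<ominus>\<^bsub>M\<^esub> a" a] that M.sub_neg[OF A that] f0 f cA
    by (metis M'.minus_equality M.l_neg)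
  show "submodule (f ` C) R' M'" if sC: "submodule C R M" and CA: "C \<subseteq> A"
    and op: "\<And>r'. r' \<in> carrier R' \<Longrightarrow> \<exists>r\<in>carrier R. \<forall>a\<in>A. f (r \<odot>\<^bsub>M\<^esub> a) = r' \<odot>\<^bsub>M'\<^esub> f a"
  proof (rule M'.subI)
    show "f ` C \<subseteq> carrier M'" using CA f by blast
    show "\<zero>\<^bsub>M'\<^esub> \<in> f ` C" using f0 M.sub_zero[OF sC] by (metis image_eqI)
    show "\<ominus>\<^bsub>M'\<^esub> a \<in> f ` C" if "a \<in> f ` C" for a
      using that fneg CA M.sub_neg[OF sC] by (auto, metis image_eqI subsetD)
    show "a \<oplus>\<^bsub>M'\<^esub> b \<in> f ` C" if "a \<in> f ` C" "b \<in> f ` C" for a b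
      using that add CA M.sub_add[OF sC] by (auto, metis image_eqI subsetD)
    show "r \<odot>\<^bsub>M'\<^esub> a \<in> f ` C" if "r \<in> carrier R'" "a \<in> f ` C" for r a
      using that op[OF that(1)] CA M.sub_op[OF sC] by (auto, metis image_eqI subsetD)
  qed
  show "submodule {a \<in> A. f a \<in> H} R M" if sH: "submodule H R' M'"
    and op: "\<And>r. r \<in> carrier R \<Longrightarrow> \<exists>r'\<in>carrier R'. \<forall>a\<in>A. f (r \<odot>\<^bsub>M\<^esub> a) = r' \<odot>\<^bsub>M'\<^esub> f a"
  proof (rule M.subI)
    show "{a \<in> A. f a \<in> H} \<subseteq> carrier M" using cA by auto
    show "\<zero>\<^bsub>M\<^esub> \<in> {a \<in> A. f a \<in> H}" using f0 M.sub_zero[OF A] M'.sub_zero[OF sH] by auto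
    show "\<ominus>\<^bsub>M\<^esub> a \<in> {a \<in> A. f a \<in> H}" if "a \<in> {a \<in> A. f a \<in> H}" for a
      using that fneg M.sub_neg[OF A] M'.sub_neg[OF sH] by auto
    show "a \<oplus>\<^bsub>M\<^esub> b \<in> {a \<in> A. f a \<in> H}" if "a \<in> {a \<in> A. f a \<in> H}" "b \<in> {a \<in> A. f a \<in> H}" for a b
      using that add M.sub_add[OF A] M'.sub_add[OF sH] by auto
    show "r \<odot>\<^bsub>M\<^esub> a \<in> {a \<in> A. f a \<in> H}" if "r \<in> carrier R" "a \<in> {a \<in> A. f a \<in> H}" for r a
      using that op[OF that(1)] M.sub_op[OF A] M'.sub_op[OF sH] by fastforce
  qed
qed

text \<open>All isomorphism theorems for lengths are instances of one statement: a homomorphism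
  \<open>A \<rightarrow> A'\<close> that is onto modulo \<open>B'\<close> induces an isomorphism of the subquotient of \<open>A\<close> by
  the preimage of \<open>B'\<close> with \<open>A'/B'\<close>.\<close>

lemma sq_len_hom:
  fixes M (structure) and M' (structure)
  assumes M: "operator_group R M" and M': "operator_group R' M'"
    and A: "submodule A R M" and A': "submodule A' R' M'" and B': "submodule B' R' M'" "B' \<subseteq> A'"
    and f: "\<And>a. a \<in> A \<Longrightarrow> f a \<in> A'"
    and add: "\<And>a b. a \<in> A \<Longrightarrow> b \<in> A \<Longrightarrow> f (a \<oplus>\<^bsub>M\<^esub> b) = f a \<oplus>\<^bsub>M'\<^esub> f b"
    and onto: "\<And>a'. a' \<in> A' \<Longrightarrow> \<exists>a\<in>A. \<exists>b\<in>B'. a' = f a \<oplus>\<^bsub>M'\<^esub> b"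
    and op1: "\<And>r. r \<in> carrier R \<Longrightarrow> \<exists>r'\<in>carrier R'. \<forall>a\<in>A. f (r \<odot>\<^bsub>M\<^esub> a) = r' \<odot>\<^bsub>M'\<^esub> f a"
    and op2: "\<And>r'. r' \<in> carrier R' \<Longrightarrow> \<exists>r\<in>carrier R. \<forall>a\<in>A. f (r \<odot>\<^bsub>M\<^esub> a) = r' \<odot>\<^bsub>M'\<^esub> f a"
    and B: "B = {a \<in> A. f a \<in> B'}"
  shows "sq_len R M B A = sq_len R' M' B' A'"
proof -
  interpret M: operator_group R M by fact
  interpret M': operator_group R' M' by fact
  have cA: "a \<in> carrier M" if "a \<in> A" for a using that A M.sub_carr by blast
  have cA': "a \<in> carrier M'" if "a \<in> A'" for a using that A' M'.sub_carr by blast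
  have fA': "a \<in> A \<Longrightarrow> f a \<in> carrier M'" for a using f cA' by blast
  note fneg = hom_neg[OF M M' A fA' add]
  define \<phi> where "\<phi> C = f ` C <+>\<^bsub>M'\<^esub> B'" for C
  define \<psi> where "\<psi> H = {a \<in> A. f a \<in> H}" for H
  let ?L = "{C. submodule C R M \<and> B \<subseteq> C \<and> C \<subseteq> A}"
  let ?L' = "{C. submodule C R' M' \<and> B' \<subseteq> C \<and> C \<subseteq> A'}"
  have \<phi>L: "\<phi> C \<in> ?L'" if C: "C \<in> ?L" for C
  proof -
    have sC: "submodule C R M" and CA: "C \<subseteq> A" using C by auto
    have "submodule (f ` C) R' M'" by (rule hom_image[OF M M' A fA' add sC CA op2])
    then have "submodule (\<phi> C) R' M'" using M'.sub_sum B' by (auto simp: \<phi>_def)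
    moreover have "\<phi> C \<subseteq> A'" unfolding \<phi>_def by (rule M'.sum_subset) (use A' B' f CA in auto)
    moreover have "B' \<subseteq> \<phi> C" unfolding \<phi>_def
      using M'.subset_sum_right \<open>submodule (f ` C) R' M'\<close> B' M'.sub_subset by blast
    ultimately show ?thesis by simp
  qed
  have \<psi>L: "\<psi> H \<in> ?L" if H: "H \<in> ?L'" for H
  proof -
    have sH: "submodule H R' M'" and BH: "B' \<subseteq> H" using H by auto
    have "submodule (\<psi> H) R M" unfolding \<psi>_def by (rule hom_preimage[OF M M' A fA' add sH op1])
    then show ?thesis using BH B by (auto simp: \<psi>_def)
  qed
  have \<psi>\<phi>: "\<psi> (\<phi> C) = C" if C: "C \<in> ?L" for C
  proof
    have sC: "submodule C R M" and CA: "C \<subseteq> A" and BC: "B \<subseteq> C" using C by auto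
    show "C \<subseteq> \<psi> (\<phi> C)"
    proof
      fix c assume c: "c \<in> C"
      then have "f c \<oplus>\<^bsub>M'\<^esub> \<zero>\<^bsub>M'\<^esub> \<in> \<phi> C"
        unfolding \<phi>_def using M'.sub_zero[OF B'(1)] by (intro M'.set_addI) auto
      then show "c \<in> \<psi> (\<phi> C)" using c CA f cA' by (auto simp: \<psi>_def)
    qed
    show "\<psi> (\<phi> C) \<subseteq> C"
    proof
      fix a assume "a \<in> \<psi> (\<phi> C)"
      then have a: "a \<in> A" "f a \<in> \<phi> C" by (auto simp: \<psi>_def)
      then obtain c b where cb: "c \<in> C" "b \<in> B'" "f a = f c \<oplus>\<^bsub>M'\<^esub> b"
        unfolding \<phi>_def by (auto elim!: M'.set_addE)
      have c: "c \<in> A" using cb CA by auto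
      have "f (a \<oplus>\<^bsub>M\<^esub> \<ominus>\<^bsub>M\<^esub> c) = f a \<oplus>\<^bsub>M'\<^esub> \<ominus>\<^bsub>M'\<^esub> f c"
        using add a c fneg M.sub_neg[OF A] by simp
      also have "\<dots> = b" using cb(3) cA'[OF f[OF c]] cA'[of b] cb(2) B'(2)
        by (simp add: M'.a_ac M'.r_neg subsetD)
      finally have "a \<oplus>\<^bsub>M\<^esub> \<ominus>\<^bsub>M\<^esub> c \<in> B"
        using cb B a c M.sub_neg[OF A] M.sub_add[OF A] by auto
      then have "(a \<oplus>\<^bsub>M\<^esub> \<ominus>\<^bsub>M\<^esub> c) \<oplus>\<^bsub>M\<^esub> c \<in> C" using BC cb M.sub_add[OF sC] by blast
      then show "a \<in> C" using a c cA by (simp add: M.a_assoc M.l_neg)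
    qed
  qed
  have \<phi>\<psi>: "\<phi> (\<psi> H) = H" if H: "H \<in> ?L'" for H
  proof
    have sH: "submodule H R' M'" and BH: "B' \<subseteq> H" and HA: "H \<subseteq> A'" using H by auto
    show "\<phi> (\<psi> H) \<subseteq> H" unfolding \<phi>_def by (rule M'.sum_subset) (use sH BH in \<open>auto simp: \<psi>_def\<close>)
    show "H \<subseteq> \<phi> (\<psi> H)"
    proof
      fix h assume h: "h \<in> H"
      then obtain a b where ab: "a \<in> A" "b \<in> B'" "h = f a \<oplus>\<^bsub>M'\<^esub> b" using onto HA by blast
      then have c: "f a \<in> carrier M'" "b \<in> carrier M'" using f cA' B' by auto
      have "f a = h \<oplus>\<^bsub>M'\<^esub> \<ominus>\<^bsub>M'\<^esub> b" using ab c by (simp add: M'.a_assoc M'.r_neg)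
      moreover have "h \<oplus>\<^bsub>M'\<^esub> \<ominus>\<^bsub>M'\<^esub> b \<in> H"
        using h ab(2) BH M'.sub_add[OF sH] M'.sub_neg[OF sH] by blast
      ultimately have "f a \<in> H" by metis
      then show "h \<in> \<phi> (\<psi> H)" using ab unfolding \<phi>_def \<psi>_def by (auto intro!: M'.set_addI)
    qed
  qed
  have \<phi>m: "\<phi> C \<subseteq> \<phi> C'" if "C \<subseteq> C'" for C C' unfolding \<phi>_def using that by (intro M'.set_add_mono) auto
  have \<psi>m: "\<psi> C \<subseteq> \<psi> C'" if "C \<subseteq> C'" for C C' using that by (auto simp: \<psi>_def)
  have "chain_len ?L \<le> chain_len ?L'"
  proof (rule chain_len_mono_map[of _ \<phi>])
    fix C C' assume *: "C \<in> ?L" "C' \<in> ?L" "C \<subset> C'"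
    then have "\<phi> C \<noteq> \<phi> C'" using \<psi>\<phi> by (metis psubset_eq)
    then show "\<phi> C \<subset> \<phi> C'" using \<phi>m[of C C'] *(3) by (simp add: psubset_eq)
  qed (rule \<phi>L)
  moreover have "chain_len ?L' \<le> chain_len ?L"
  proof (rule chain_len_mono_map[of _ \<psi>])
    fix C C' assume *: "C \<in> ?L'" "C' \<in> ?L'" "C \<subset> C'"
    then have "\<psi> C \<noteq> \<psi> C'" using \<phi>\<psi> by (metis psubset_eq)
    then show "\<psi> C \<subset> \<psi> C'" using \<psi>m[of C C'] *(3) by (simp add: psubset_eq)
  qed (rule \<psi>L)
  ultimately show ?thesis unfolding sq_len_def by (rule antisym)
qed

section \<open>Numerical functions of several variables\<close>

definition lower :: "nat \<Rightarrow> (nat \<Rightarrow> nat) \<Rightarrow> nat \<Rightarrow> nat" where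
  "lower i n = n(i := n i - 1)"

definition raise :: "nat \<Rightarrow> (nat \<Rightarrow> nat) \<Rightarrow> nat \<Rightarrow> nat" where
  "raise i n = n(i := Suc (n i))"

text \<open>Truncated subtraction makes the difference vanish where \<open>n i = 0\<close>; only large degrees matter.\<close>

definition nab :: "nat \<Rightarrow> ((nat \<Rightarrow> nat) \<Rightarrow> int) \<Rightarrow> (nat \<Rightarrow> nat) \<Rightarrow> int" where
  "nab i f = (\<lambda>n. f n - f (lower i n))"

primrec nabl :: "nat list \<Rightarrow> ((nat \<Rightarrow> nat) \<Rightarrow> int) \<Rightarrow> (nat \<Rightarrow> nat) \<Rightarrow> int" where
  "nabl [] f = f"
| "nabl (c # cs) f = nabl cs (nab c f)"

lemma nabl_append: "nabl (cs @ ds) f = nabl ds (nabl cs f)"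
  by (induction cs arbitrary: f) auto

lemma nabl_diff: "nabl cs (\<lambda>n. f n - g n) = (\<lambda>n. nabl cs f n - nabl cs g n)"
proof (induction cs arbitrary: f g)
  case (Cons c cs)
  have "nab c (\<lambda>n. f n - g n) = (\<lambda>n. nab c f n - nab c g n)"
    by (auto simp: nab_def)
  then show ?case using Cons by simp
qed simp

lemma nabl_zero: "nabl cs (\<lambda>n. 0) = (\<lambda>n. 0)"
proof (induction cs)
  case (Cons c cs)
  have "nab c (\<lambda>n. 0) = (\<lambda>n. 0)" by (auto simp: nab_def)
  then show ?case using Cons by simp
qed simp

lemma lower_raise [simp]: "lower i (raise i n) = n"
  by (simp add: lower_def raise_def)

lemma raise_lower: "n i \<noteq> 0 \<Longrightarrow> raise i (lower i n) = n"
  by (simp add: lower_def raise_def)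

lemma raise_commute: "raise i (raise j n) = raise j (raise i n)"
  by (auto simp: raise_def fun_eq_iff)

lemma lower_degs [intro]: "n \<in> degs d \<Longrightarrow> lower i n \<in> degs d"
  by (auto simp: degs_def lower_def)

lemma raise_degs [intro]: "n \<in> degs d \<Longrightarrow> i \<le> d \<Longrightarrow> raise i n \<in> degs d"
  by (auto simp: degs_def raise_def)

lemma upd_degs: "n \<in> degs d \<Longrightarrow> i \<le> d \<Longrightarrow> n(i := x) \<in> degs d"
  by (auto simp: degs_def)

lemma for_large_mono: "for_large d P \<Longrightarrow> (\<And>n. n \<in> degs d \<Longrightarrow> P n \<Longrightarrow> Q n) \<Longrightarrow> for_large d Q"
  unfolding for_large_def by blast

lemma for_large_all: "(\<And>n. n \<in> degs d \<Longrightarrow> Q n) \<Longrightarrow> for_large d Q"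
  unfolding for_large_def by blast

lemma for_large_conj:
  assumes "for_large d P" "for_large d Q"
  shows "for_large d (\<lambda>n. P n \<and> Q n)"
proof -
  obtain a b where a: "\<forall>n\<in>degs d. (\<forall>i\<le>d. a \<le> n i) \<longrightarrow> P n"
    and b: "\<forall>n\<in>degs d. (\<forall>i\<le>d. b \<le> n i) \<longrightarrow> Q n"
    using assms unfolding for_large_def by metis
  have "\<forall>n\<in>degs d. (\<forall>i\<le>d. max a b \<le> n i) \<longrightarrow> P n \<and> Q n" using a b by simp
  then show ?thesis unfolding for_large_def by blast
qed

lemma for_large_ge: "for_large d (\<lambda>n. \<forall>i\<le>d. m \<le> n i)"
  unfolding for_large_def by blast

lemma for_large_lower:
  assumes "for_large d P"
  shows "for_large d (\<lambda>n. P (lower i n))"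
proof -
  obtain m where m: "\<forall>n\<in>degs d. (\<forall>i\<le>d. m \<le> n i) \<longrightarrow> P n"
    using assms unfolding for_large_def by metis
  have "\<forall>n\<in>degs d. (\<forall>j\<le>d. Suc m \<le> n j) \<longrightarrow> P (lower i n)"
  proof (intro ballI impI)
    fix n assume n: "n \<in> degs d" and "\<forall>j\<le>d. Suc m \<le> n j"
    then have "\<forall>j\<le>d. m \<le> lower i n j" by (auto simp: lower_def Suc_le_eq less_imp_le)
    then show "P (lower i n)" using m lower_degs[OF n] by blast
  qed
  then show ?thesis unfolding for_large_def by blast
qed

lemma for_large_ex: "for_large d P \<Longrightarrow> \<exists>n\<in>degs d. P n"
proof -
  assume "for_large d P"
  then obtain m where m: "\<forall>n\<in>degs d. (\<forall>i\<le>d. m \<le> n i) \<longrightarrow> P n"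
    unfolding for_large_def by metis
  have "(\<lambda>i. if i \<le> d then m else 0) \<in> degs d" by (auto simp: degs_def)
  then show ?thesis using m by fastforce
qed

lemma eventual_value_eq:
  assumes "for_large d (\<lambda>n. f n = c)"
  shows "eventual_value d f = c"
  unfolding eventual_value_def
proof (rule the_equality)
  fix c' assume "for_large d (\<lambda>n. f n = c')"
  from for_large_ex[OF for_large_conj[OF this assms]] show "c' = c" by auto
qed fact

lemma for_large_nab_cong:
  assumes "for_large d (\<lambda>n. f n = g n)"
  shows "for_large d (\<lambda>n. nab i f n = nab i g n)"
  by (rule for_large_mono[OF for_large_conj[OF assms for_large_lower[OF assms, of i]]])
    (simp add: nab_def)

lemma for_large_nabl_cong:
  "for_large d (\<lambda>n. f n = g n) \<Longrightarrow> for_large d (\<lambda>n. nabl cs f n = nabl cs g n)"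
proof (induction cs arbitrary: f g)
  case (Cons c cs)
  then show ?case using for_large_nab_cong[OF Cons.prems, of c] by simp
qed simp

subsection \<open>The binomial basis\<close>

definition bin_basis :: "nat \<Rightarrow> (nat \<Rightarrow> nat) \<Rightarrow> (nat \<Rightarrow> nat) \<Rightarrow> int" where
  "bin_basis d k n = (\<Prod>i\<le>d. int ((n i + k i) choose k i))"

lemma hilbert_coeffs_iff:
  "hilbert_coeffs d f e \<longleftrightarrow> finite {k. e k \<noteq> 0} \<and> {k. e k \<noteq> 0} \<subseteq> degs d \<and>
     for_large d (\<lambda>n. f n = (\<Sum>k | e k \<noteq> 0. e k * bin_basis d k n))"
  by (simp add: hilbert_coeffs_def bin_basis_def)

lemma bin_basis_0 [simp]: "bin_basis d (\<lambda>_. 0) n = 1"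
  by (simp add: bin_basis_def)

lemma bin_basis_split:
  assumes "i \<le> d"
  shows "bin_basis d k n = int ((n i + k i) choose k i) * (\<Prod>j\<in>{..d}-{i}. int ((n j + k j) choose k j))"
  unfolding bin_basis_def using assms by (subst prod.remove[of _ i]) auto

lemma bin_basis_nab:
  assumes "i \<le> d" "n i \<noteq> 0"
  shows "bin_basis d k n - bin_basis d k (lower i n)
    = (if k i = 0 then 0 else bin_basis d (lower i k) n)"
proof -
  let ?r = "\<Prod>j\<in>{..d}-{i}. int ((n j + k j) choose k j)"
  have 1: "bin_basis d k (lower i n) = int ((n i - 1 + k i) choose k i) * ?r"
    unfolding bin_basis_split[OF assms(1)]
    by (intro arg_cong2[where f="(*)"] prod.cong) (auto simp: lower_def)
  have 2: "bin_basis d (lower i k) n = int ((n i + (k i - 1)) choose (k i - 1)) * ?r"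
    unfolding bin_basis_split[OF assms(1)]
    by (intro arg_cong2[where f="(*)"] prod.cong) (auto simp: lower_def)
  obtain m where m: "n i = Suc m" using assms(2) by (cases "n i") auto
  show ?thesis
  proof (cases "k i")
    case 0
    then show ?thesis unfolding 1 by (simp add: bin_basis_split[OF assms(1), of k n])
  next
    case (Suc j)
    have "int (Suc m + Suc j choose Suc j) - int (m + Suc j choose Suc j) = int (Suc m + j choose j)"
      by simp
    then show ?thesis unfolding 1 2 bin_basis_split[OF assms(1), of k n] using m Suc
      by (simp add: left_diff_distrib[symmetric])
  qed
qed

lemma hilbert_sum_superset:
  assumes "finite F" "{k. e k \<noteq> (0::int)} \<subseteq> F"
  shows "(\<Sum>k | e k \<noteq> 0. e k * g k) = (\<Sum>k\<in>F. e k * g k)"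
  by (rule sum.mono_neutral_left) (use assms in auto)

lemma hilbert_coeffs_cong:
  assumes "hilbert_coeffs d f e" "for_large d (\<lambda>n. f n = g n)"
  shows "hilbert_coeffs d g e"
proof -
  have "for_large d (\<lambda>n. f n = (\<Sum>k | e k \<noteq> 0. e k * bin_basis d k n))"
    using assms by (simp add: hilbert_coeffs_iff)
  from for_large_conj[OF this assms(2)]
  have "for_large d (\<lambda>n. g n = (\<Sum>k | e k \<noteq> 0. e k * bin_basis d k n))"
    by (rule for_large_mono) simp
  then show ?thesis using assms(1) by (simp add: hilbert_coeffs_iff)
qed

lemma hilbert_coeffs_add:
  assumes "hilbert_coeffs d f e" "hilbert_coeffs d f' e'"
  shows "hilbert_coeffs d (\<lambda>n. f n + c * f' n) (\<lambda>k. e k + c * e' k)"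
proof -
  let ?S = "{k. e k \<noteq> 0} \<union> {k. e' k \<noteq> 0}"
  have fin: "finite ?S" using assms by (auto simp: hilbert_coeffs_iff)
  have sub: "{k. e k + c * e' k \<noteq> 0} \<subseteq> ?S" by auto
  have "(\<Sum>k | e k + c * e' k \<noteq> 0. (e k + c * e' k) * bin_basis d k n)
    = (\<Sum>k | e k \<noteq> 0. e k * bin_basis d k n) + c * (\<Sum>k | e' k \<noteq> 0. e' k * bin_basis d k n)" for n
  proof -
    have "(\<Sum>k | e k + c * e' k \<noteq> 0. (e k + c * e' k) * bin_basis d k n)
      = (\<Sum>k\<in>?S. (e k + c * e' k) * bin_basis d k n)"
      by (rule hilbert_sum_superset) (use fin sub in auto)
    also have "\<dots> = (\<Sum>k\<in>?S. e k * bin_basis d k n) + c * (\<Sum>k\<in>?S. e' k * bin_basis d k n)"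
      by (simp add: sum.distrib sum_distrib_left distrib_right mult.assoc)
    also have "(\<Sum>k\<in>?S. e k * bin_basis d k n) = (\<Sum>k | e k \<noteq> 0. e k * bin_basis d k n)"
      by (rule hilbert_sum_superset[symmetric]) (use fin in auto)
    also have "(\<Sum>k\<in>?S. e' k * bin_basis d k n) = (\<Sum>k | e' k \<noteq> 0. e' k * bin_basis d k n)"
      by (rule hilbert_sum_superset[symmetric]) (use fin in auto)
    finally show ?thesis .
  qed
  note sum_eq = this
  have large: "for_large d (\<lambda>n. f n = (\<Sum>k | e k \<noteq> 0. e k * bin_basis d k n) \<and>
     f' n = (\<Sum>k | e' k \<noteq> 0. e' k * bin_basis d k n))"
    by (rule for_large_conj) (use assms in \<open>simp_all add: hilbert_coeffs_iff\<close>)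
  have "for_large d (\<lambda>n. f n + c * f' n
     = (\<Sum>k | e k + c * e' k \<noteq> 0. (e k + c * e' k) * bin_basis d k n))"
    by (rule for_large_mono[OF large]) (simp only: sum_eq)
  moreover have "?S \<subseteq> degs d" using assms by (auto simp: hilbert_coeffs_iff)
  ultimately show ?thesis unfolding hilbert_coeffs_iff
    using finite_subset[OF sub fin] subset_trans[OF sub] by blast
qed

text \<open>Pascal's rule turns a difference into a shift of the coefficients.\<close>

lemma hilbert_coeffs_nab:
  assumes e: "hilbert_coeffs d f e" and i: "i \<le> d"
  shows "hilbert_coeffs d (nab i f) (\<lambda>k. e (raise i k))"
proof -
  let ?S = "{k. e k \<noteq> 0}"
  have fin: "finite ?S" and S: "?S \<subseteq> degs d" using e by (auto simp: hilbert_coeffs_iff)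
  have sub: "{k. e (raise i k) \<noteq> 0} \<subseteq> lower i ` ?S"
    by (metis (mono_tags, lifting) image_iff lower_raise mem_Collect_eq subsetI)
  have eq: "(\<Sum>k\<in>?S. e k * bin_basis d k n) - (\<Sum>k\<in>?S. e k * bin_basis d k (lower i n))
      = (\<Sum>k | e (raise i k) \<noteq> 0. e (raise i k) * bin_basis d k n)" if "n i \<noteq> 0" for n
  proof -
    have "(\<Sum>k\<in>?S. e k * bin_basis d k n) - (\<Sum>k\<in>?S. e k * bin_basis d k (lower i n))
      = (\<Sum>k\<in>?S. e k * (if k i = 0 then 0 else bin_basis d (lower i k) n))"
      by (simp only: sum_subtractf[symmetric] right_diff_distrib[symmetric] bin_basis_nab[where n = n, OF i that])
    also have "\<dots> = (\<Sum>k\<in>{k \<in> ?S. k i \<noteq> 0}. e k * bin_basis d (lower i k) n)"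
      by (rule sum.mono_neutral_cong_right) (use fin in auto)
    also have "\<dots> = (\<Sum>k | e (raise i k) \<noteq> 0. e (raise i k) * bin_basis d k n)"
      by (rule sum.reindex_bij_witness[of _ "raise i" "lower i"])
        (auto simp: raise_lower, simp add: raise_def)
    finally show ?thesis .
  qed
  have l: "for_large d (\<lambda>n. f n = (\<Sum>k\<in>?S. e k * bin_basis d k n))"
    using e by (simp add: hilbert_coeffs_iff)
  have "for_large d (\<lambda>n. nab i f n = (\<Sum>k | e (raise i k) \<noteq> 0. e (raise i k) * bin_basis d k n))"
  proof (rule for_large_mono[OF for_large_conj[OF for_large_conj[OF l for_large_lower[OF l, of i]] for_large_ge[of d 1]]])
    fix n assume *: "(f n = (\<Sum>k\<in>?S. e k * bin_basis d k n) \<and>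
      f (lower i n) = (\<Sum>k\<in>?S. e k * bin_basis d k (lower i n))) \<and> (\<forall>i\<le>d. 1 \<le> n i)"
    then have "n i \<noteq> 0" using i by force
    then show "nab i f n = (\<Sum>k | e (raise i k) \<noteq> 0. e (raise i k) * bin_basis d k n)"
      using eq[of n] * by (simp add: nab_def)
  qed
  moreover have "{k. e (raise i k) \<noteq> 0} \<subseteq> degs d" using sub S by auto
  ultimately show ?thesis unfolding hilbert_coeffs_iff
    using finite_subset[OF sub finite_imageI[OF fin]] by blast
qed

lemma hilbert_coeffs_lower:
  assumes "hilbert_coeffs d f e" "i \<le> d"
  shows "\<exists>e'. hilbert_coeffs d (\<lambda>n. f (lower i n)) e'"
  using hilbert_coeffs_add[OF assms(1) hilbert_coeffs_nab[OF assms], of "- 1"]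
  by (auto simp: nab_def)

lemma hilbert_coeffs_nabl:
  "hilbert_coeffs d f e \<Longrightarrow> set cs \<subseteq> {..d} \<Longrightarrow>
    hilbert_coeffs d (nabl cs f) (\<lambda>k. e (\<lambda>i. k i + count_list cs i))"
proof (induction cs arbitrary: f e)
  case (Cons c cs)
  have "hilbert_coeffs d (nab c f) (\<lambda>k. e (raise c k))"
    using hilbert_coeffs_nab[OF Cons.prems(1)] Cons.prems(2) by simp
  from Cons.IH[OF this] have "hilbert_coeffs d (nabl (c # cs) f)
      (\<lambda>k. e (raise c (\<lambda>i. k i + count_list cs i)))"
    using Cons.prems by simp
  moreover have "raise c (\<lambda>i. k i + count_list cs i) = (\<lambda>i. k i + count_list (c # cs) i)" for k
    by (auto simp: raise_def)
  ultimately show ?case by simp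
qed simp

lemma count_list_replicate: "count_list (replicate m x) i = (if i = x then m else 0)"
  by (induction m) auto

lemma count_list_concat: "count_list (concat xss) i = sum_list (map (\<lambda>xs. count_list xs i) xss)"
  by (induction xss) auto

lemma ex_list_of_degree:
  assumes "k \<in> degs d"
  shows "\<exists>cs. set cs \<subseteq> {..d} \<and> count_list cs = k"
proof -
  let ?cs = "concat (map (\<lambda>i. replicate (k i) i) [0..<Suc d])"
  have "count_list ?cs i = k i" for i
  proof -
    have "count_list ?cs i = (\<Sum>j\<leftarrow>[0..<Suc d]. if i = j then k j else 0)"
      by (simp add: count_list_concat comp_def count_list_replicate)
    also have "\<dots> = (\<Sum>j\<in>{0..<Suc d}. if i = j then k j else 0)"
      by (metis atLeastLessThan_upt sum_set_upt_conv_sum_list_nat)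
    also have "\<dots> = k i" using assms by (auto simp: degs_def)
    finally show ?thesis .
  qed
  then have "count_list ?cs = k" by blast
  moreover have "set ?cs \<subseteq> {..d}" by auto
  ultimately show ?thesis by blast
qed

text \<open>Applying the differences prescribed by a maximal degree of the support leaves only the
  coefficient at that degree.\<close>

lemma nabl_maximal:
  assumes e: "hilbert_coeffs d f e" and k: "e k \<noteq> 0" and max: "\<And>h. e h \<noteq> 0 \<Longrightarrow> k \<le> h \<Longrightarrow> h = k"
    and cs: "set cs \<subseteq> {..d}" "count_list cs = k"
  shows "for_large d (\<lambda>n. nabl cs f n = e k)"
proof -
  have "{h. e (\<lambda>i. h i + k i) \<noteq> 0} = {\<lambda>_. 0}"
  proof (intro equalityI subsetI)
    fix h assume "h \<in> {h. e (\<lambda>i. h i + k i) \<noteq> 0}"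
    then have "(\<lambda>i. h i + k i) = k" using max[of "\<lambda>i. h i + k i"] by (simp add: le_fun_def)
    then show "h \<in> {\<lambda>_. 0}" by (auto simp: fun_eq_iff)
  qed (use k in auto)
  then show ?thesis
    using hilbert_coeffs_nabl[OF e cs(1)] unfolding cs(2) hilbert_coeffs_iff by simp
qed

text \<open>Two different expansions differ at some maximal degree, and the differences of that degree
  isolate the coefficient.\<close>

lemma hilbert_coeffs_unique:
  assumes "hilbert_coeffs d f e" "hilbert_coeffs d f e'"
  shows "e = e'"
proof (rule ccontr)
  assume "e \<noteq> e'"
  let ?g = "\<lambda>k. e k + (-1) * e' k"
  have g: "hilbert_coeffs d (\<lambda>n. 0) ?g"
    using hilbert_coeffs_add[OF assms, of "-1"] by simp
  have fin: "finite {k. ?g k \<noteq> 0}" using g by (simp add: hilbert_coeffs_iff)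
  have "{k. ?g k \<noteq> 0} \<noteq> {}" using \<open>e \<noteq> e'\<close> by (auto simp: fun_eq_iff)
  then obtain k where k: "?g k \<noteq> 0" "\<And>h. ?g h \<noteq> 0 \<Longrightarrow> k \<le> h \<Longrightarrow> h = k"
    using finite_has_maximal[OF fin] by auto
  then have "k \<in> degs d" using g by (auto simp: hilbert_coeffs_iff)
  then obtain cs where cs: "set cs \<subseteq> {..d}" "count_list cs = k" using ex_list_of_degree by blast
  have "for_large d (\<lambda>n. nabl cs (\<lambda>n. 0) n = ?g k)" by (rule nabl_maximal[OF g k cs])
  then have "?g k = 0" using for_large_ex by (auto simp: nabl_zero)
  then show False using k by simp
qed

lemma nabl_bounded:
  "for_large d (\<lambda>n. \<bar>f n\<bar> \<le> b) \<Longrightarrow> \<exists>b'. for_large d (\<lambda>n. \<bar>nabl cs f n\<bar> \<le> b')"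
proof (induction cs arbitrary: f b)
  case (Cons c cs)
  have "for_large d (\<lambda>n. \<bar>nab c f n\<bar> \<le> b + b)"
    by (rule for_large_mono[OF for_large_conj[OF Cons.prems for_large_lower[OF Cons.prems, of c]]])
      (auto simp: nab_def abs_le_iff)
  from Cons.IH[OF this] show ?case by simp
qed auto

text \<open>Otherwise some iterated difference would be bounded and yet grow linearly.\<close>

lemma bounded_polynomial_constant:
  assumes e: "hilbert_coeffs d f e" and b: "for_large d (\<lambda>n. \<bar>f n\<bar> \<le> b)"
  shows "\<exists>c. for_large d (\<lambda>n. f n = c)"
proof (cases "{k. e k \<noteq> 0} \<subseteq> {\<lambda>_. 0}")
  case True
  then consider "{k. e k \<noteq> 0} = {}" | "{k. e k \<noteq> 0} = {\<lambda>_. 0}" by blast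
  then show ?thesis
  proof cases
    case 1
    then have "for_large d (\<lambda>n. f n = 0)" using e unfolding hilbert_coeffs_iff 1 by simp
    then show ?thesis by blast
  next
    case 2
    then have "for_large d (\<lambda>n. f n = e (\<lambda>_. 0))" using e unfolding hilbert_coeffs_iff 2 by simp
    then show ?thesis by blast
  qed
next
  case False
  then obtain k0 where k0: "e k0 \<noteq> 0" "k0 \<noteq> (\<lambda>_. 0)" by blast
  have fin: "finite {k. e k \<noteq> 0}" using e by (simp add: hilbert_coeffs_iff)
  obtain k where k: "e k \<noteq> 0" "k0 \<le> k" and max: "\<And>h. e h \<noteq> 0 \<Longrightarrow> k \<le> h \<Longrightarrow> h = k"
    using finite_has_maximal2[OF fin, of k0] k0 by auto
  obtain i where i: "k0 i \<noteq> 0" using k0(2) by auto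
  then have ki: "k i \<noteq> 0" using k(2) by (metis le_fun_def le_zero_eq)
  have "{k. e k \<noteq> 0} \<subseteq> degs d" using e by (simp add: hilbert_coeffs_iff)
  moreover have "k \<in> {k. e k \<noteq> 0}" using k(1) by simp
  ultimately have kd: "k \<in> degs d" by (rule subsetD)
  have "\<forall>j>d. k j = 0" using kd by (simp add: degs_def)
  then have "\<not> d < i" using ki by (metis)
  then have id: "i \<le> d" by simp
  have "\<exists>cs. set cs \<subseteq> {..d} \<and> count_list cs = lower i k"
    by (intro ex_list_of_degree lower_degs kd)
  then obtain cs where cs: "set cs \<subseteq> {..d}" "count_list cs = lower i k"
    by (elim exE conjE)
  have cc: "count_list (cs @ [i]) = k"
  proof
    fix j show "count_list (cs @ [i]) j = k j"
      using fun_cong[OF cs(2), of j] ki by (cases "j = i") (auto simp: lower_def)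
  qed
  have "set (cs @ [i]) \<subseteq> {..d}" using cs(1) id by simp
  from nabl_maximal[OF e k(1) max this cc]
  have "for_large d (\<lambda>n. nab i (nabl cs f) n = e k)" by (simp add: nabl_append)
  then obtain m1 where m1: "\<forall>n\<in>degs d. (\<forall>i\<le>d. m1 \<le> n i) \<longrightarrow> nab i (nabl cs f) n = e k"
    unfolding for_large_def by blast
  obtain b' m2 where m2: "\<forall>n\<in>degs d. (\<forall>i\<le>d. m2 \<le> n i) \<longrightarrow> \<bar>nabl cs f n\<bar> \<le> b'"
    using nabl_bounded[OF b, of cs] unfolding for_large_def by metis
  define n where "n t = (\<lambda>j. if j \<le> d then max m1 m2 + (if j = i then t else 0) else 0)" for t :: nat
  have n: "n t \<in> degs d" "\<forall>j\<le>d. m1 \<le> n t j" "\<forall>j\<le>d. m2 \<le> n t j" for t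
    by (auto simp: n_def degs_def)
  have lown: "lower i (n (Suc t)) = n t" for t
    using id by (auto simp: lower_def n_def)
  have lin: "nabl cs f (n t) = nabl cs f (n 0) + int t * e k" for t
  proof (induction t)
    case (Suc t)
    have "nab i (nabl cs f) (n (Suc t)) = e k" using m1 n by blast
    then have "nabl cs f (n (Suc t)) = nabl cs f (n t) + e k" by (simp add: nab_def lown)
    then show ?case using Suc by (simp add: algebra_simps)
  qed simp
  let ?t = "nat (2 * b' + 1)"
  have bt: "\<bar>nabl cs f (n t)\<bar> \<le> b'" for t using m2 n by blast
  then have "0 \<le> b'" using abs_ge_zero order_trans by blast
  have "\<bar>int ?t * e k\<bar> \<le> 2 * b'" using lin[of ?t] bt[of ?t] bt[of 0] by linarith
  moreover have "\<bar>int ?t * e k\<bar> \<ge> int ?t * 1" using k(1) by (auto simp: abs_mult intro!: mult_left_mono)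
  ultimately show ?thesis using \<open>0 \<le> b'\<close> by simp
qed

subsection \<open>Functions with a rational generating series\<close>

text \<open>The coefficient of $t^m$ in $1/(1-t)^r$.\<close>

definition comp_count :: "nat \<Rightarrow> nat \<Rightarrow> int" where
  "comp_count r m = (case r of 0 \<Rightarrow> if m = 0 then 1 else 0 | Suc j \<Rightarrow> int ((m + j) choose j))"

text \<open>The coefficient functions of the linear combinations of the series
  $t^s/\prod_i(1-t_i)^{r_i}$. Unlike the eventual polynomials, they are closed under summation
  along a direction.\<close>

inductive rational_series :: "nat \<Rightarrow> ((nat \<Rightarrow> nat) \<Rightarrow> int) \<Rightarrow> bool" for d where
  base: "rational_series d (\<lambda>n. \<Prod>i\<le>d. comp_count (r i) (n i))"
| add: "rational_series d f \<Longrightarrow> rational_series d g \<Longrightarrow> rational_series d (\<lambda>n. f n + g n)"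
| scale: "rational_series d f \<Longrightarrow> rational_series d (\<lambda>n. c * f n)"
| shift: "rational_series d f \<Longrightarrow> i \<le> d \<Longrightarrow> rational_series d (\<lambda>n. if n i = 0 then 0 else f (lower i n))"
| cong: "rational_series d f \<Longrightarrow> (\<And>n. n \<in> degs d \<Longrightarrow> f n = g n) \<Longrightarrow> rational_series d g"

lemma comp_count_sum: "(\<Sum>b\<le>m. comp_count r (m - b)) = comp_count (Suc r) m"
proof -
  have "(\<Sum>b\<le>m. comp_count r (m - b)) = (\<Sum>a\<le>m. comp_count r a)"
    by (rule sum.reindex_bij_witness[of _ "\<lambda>a. m - a" "\<lambda>a. m - a"]) auto
  also have "\<dots> = comp_count (Suc r) m"
  proof (cases r)
    case 0
    then show ?thesis by (induction m) (auto simp: comp_count_def)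
  next
    case (Suc j)
    then show ?thesis by (induction m) (auto simp: comp_count_def)
  qed
  finally show ?thesis .
qed

text \<open>Summation in the direction \<open>i\<close> divides the series by $1-t_i$.\<close>

lemma rational_series_sum:
  assumes "rational_series d f" "i \<le> d"
  shows "rational_series d (\<lambda>n. \<Sum>b\<le>n i. f (n(i := n i - b)))"
  using assms
proof (induction rule: rational_series.induct)
  case (base r)
  have "(\<Sum>b\<le>n i. \<Prod>j\<le>d. comp_count (r j) ((n(i := n i - b)) j))
    = (\<Prod>j\<le>d. comp_count ((raise i r) j) (n j))" for n
  proof -
    have 1: "(\<Prod>j\<le>d. comp_count (r j) ((n(i := n i - b)) j))
      = comp_count (r i) (n i - b) * (\<Prod>j\<in>{..d}-{i}. comp_count (r j) (n j))" for b
    proof -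
      have "(\<Prod>j\<le>d. comp_count (r j) ((n(i := n i - b)) j)) = comp_count (r i) (n i - b) *
         (\<Prod>j\<in>{..d}-{i}. comp_count (r j) ((n(i := n i - b)) j))"
        using base by (subst prod.remove[of _ i]) auto
      also have "(\<Prod>j\<in>{..d}-{i}. comp_count (r j) ((n(i := n i - b)) j))
         = (\<Prod>j\<in>{..d}-{i}. comp_count (r j) (n j))" by (rule prod.cong) auto
      finally show ?thesis .
    qed
    have "(\<Prod>j\<le>d. comp_count ((raise i r) j) (n j)) = comp_count (Suc (r i)) (n i) *
         (\<Prod>j\<in>{..d}-{i}. comp_count (raise i r j) (n j))"
      using base by (subst prod.remove[of _ i]) (auto simp: raise_def)
    also have "(\<Prod>j\<in>{..d}-{i}. comp_count (raise i r j) (n j))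
         = (\<Prod>j\<in>{..d}-{i}. comp_count (r j) (n j))" by (rule prod.cong) (auto simp: raise_def)
    finally show ?thesis unfolding 1 comp_count_sum[symmetric] by (simp add: sum_distrib_right)
  qed
  then show ?case using rational_series.base[of d "raise i r"] by simp
next
  case (add f g)
  then show ?case using rational_series.add by (simp add: sum.distrib)
next
  case (scale f c)
  then show ?case using rational_series.scale[of d _ c] by (simp add: sum_distrib_left[symmetric])
next
  case (shift f j)
  let ?F = "\<lambda>n. \<Sum>b\<le>n i. f (n(i := n i - b))"
  have "(if n j = 0 then 0 else ?F (lower j n))
    = (\<Sum>b\<le>n i. if (n(i := n i - b)) j = 0 then 0 else f (lower j (n(i := n i - b))))" for n
  proof (cases "j = i")
    case False
    then have "(lower j n)(i := lower j n i - b) = lower j (n(i := n i - b))" for b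
      by (auto simp: lower_def)
    then show ?thesis using False by (simp add: lower_def)
  next
    case True
    show ?thesis
    proof (cases "n i")
      case 0
      then show ?thesis using True by simp
    next
      case (Suc m)
      then have "(lower i n)(i := m - b) = lower i (n(i := Suc m - b))" if "b \<le> m" for b
        using that by (auto simp: lower_def)
      moreover have "lower i n i = m" using Suc by (simp add: lower_def)
      ultimately show ?thesis using True Suc by (simp add: Suc_diff_le)
    qed
  qed
  then show ?case using rational_series.shift[OF shift.IH[OF shift.prems] shift.hyps(2)] by simp
next
  case (cong f g)
  show ?case
    by (rule rational_series.cong[OF cong.IH[OF cong.prems]])
      (intro sum.cong refl cong.hyps upd_degs cong.prems)
qed

text \<open>A factor with $r_i=0$ vanishes in large degrees, and the other factors are binomial
  coefficients.\<close>

lemma rational_series_polynomial: "rational_series d f \<Longrightarrow> \<exists>e. hilbert_coeffs d f e"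
proof (induction rule: rational_series.induct)
  case (base r)
  show ?case
  proof (cases "\<exists>i\<le>d. r i = 0")
    case True
    then obtain i where i: "i \<le> d" "r i = 0" by blast
    have "for_large d (\<lambda>n. (\<Prod>i\<le>d. comp_count (r i) (n i)) = (0::int))"
    proof (rule for_large_mono[OF for_large_ge[of d 1]])
      fix n :: "nat \<Rightarrow> nat" assume "\<forall>i\<le>d. 1 \<le> n i"
      then have "comp_count (r i) (n i) = 0" using i by (auto simp: comp_count_def)
      then show "(\<Prod>i\<le>d. comp_count (r i) (n i)) = (0::int)"
        using i by (intro prod_zero bexI[of _ i]) auto
    qed
    then have "hilbert_coeffs d (\<lambda>n. \<Prod>i\<le>d. comp_count (r i) (n i)) (\<lambda>_. 0)"
      by (simp add: hilbert_coeffs_iff)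
    then show ?thesis by blast
  next
    case False
    define k where "k = (\<lambda>i. if i \<le> d then r i - 1 else 0)"
    have "(\<Prod>i\<le>d. comp_count (r i) (n i)) = bin_basis d k n" for n
      unfolding bin_basis_def
    proof (rule prod.cong)
      fix i assume "i \<in> {..d}"
      then show "comp_count (r i) (n i) = int (n i + k i choose k i)"
        using False by (auto simp: comp_count_def k_def split: nat.split)
    qed simp
    then have "hilbert_coeffs d (\<lambda>n. \<Prod>i\<le>d. comp_count (r i) (n i)) (\<lambda>h. if h = k then 1 else 0)"
      by (auto simp: hilbert_coeffs_iff degs_def k_def intro!: for_large_all)
    then show ?thesis by blast
  qed
next
  case (add f g)
  then show ?case using hilbert_coeffs_add[of d f _ g _ 1] by auto
next
  case (scale f c)
  have "hilbert_coeffs d (\<lambda>n. 0) (\<lambda>_. 0)" by (simp add: hilbert_coeffs_iff for_large_all)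
  then show ?case using hilbert_coeffs_add[of d "\<lambda>n. 0" "\<lambda>_. 0" f _ c] scale by auto
next
  case (shift f i)
  then obtain e where e: "hilbert_coeffs d (\<lambda>n. f (lower i n)) e"
    using hilbert_coeffs_lower by blast
  have "for_large d (\<lambda>n. f (lower i n) = (if n i = 0 then 0 else f (lower i n)))"
    by (rule for_large_mono[OF for_large_ge[of d 1]]) (use shift in auto)
  from hilbert_coeffs_cong[OF e this] show ?case by (rule exI[of _ e])
next
  case (cong f g)
  then show ?case using hilbert_coeffs_cong[of d f _ g] for_large_all[of d "\<lambda>n. f n = g n"] by blast
qed

section \<open>Graded families of submodules\<close>

locale noetherian_module = module R N
  for R :: "('a, 'r) ring_scheme" and N :: "('a, 'm, 'z) module_scheme" (structure) +
  assumes sub_acc: "\<And>C::nat \<Rightarrow> 'm set. (\<And>t. submodule (C t) R N) \<Longrightarrow> (\<And>t. C t \<subseteq> C (Suc t)) \<Longrightarrow>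
    \<exists>t0. \<forall>t\<ge>t0. C t = C t0"

sublocale noetherian_module \<subseteq> operator_group R N
  by unfold_locales (simp_all add: smult_r_distr)

context noetherian_module
begin

lemma smult_commute:
  "\<lbrakk>a \<in> carrier R; b \<in> carrier R; x \<in> carrier N\<rbrakk> \<Longrightarrow> a \<odot> (b \<odot> x) = b \<odot> (a \<odot> x)"
  by (metis R.m_comm smult_assoc1)

lemma sub_image:
  assumes g: "g \<in> carrier R" and H: "sub H"
  shows "sub ((\<lambda>v. g \<odot> v) ` H)"
proof (rule hom_image[OF operator_group_axioms operator_group_axioms sub_carrier _ _ H sub_subset[OF H]])
  show "\<exists>r\<in>carrier R. \<forall>a\<in>carrier N. g \<odot> (r \<odot> a) = r' \<odot> (g \<odot> a)" if "r' \<in> carrier R" for r'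
    using smult_commute[OF g that] that by blast
qed (simp_all add: g op_add)

lemma sub_preimage:
  assumes g: "g \<in> carrier R" and H: "sub H" and K: "sub K"
  shows "sub {v \<in> H. g \<odot> v \<in> K}"
proof (rule hom_preimage[OF operator_group_axioms operator_group_axioms H _ _ K])
  show "\<exists>r'\<in>carrier R. \<forall>a\<in>H. g \<odot> (r \<odot> a) = r' \<odot> (g \<odot> a)" if "r \<in> carrier R" for r
    using smult_commute[OF g that] sub_carr[OF H] that by blast
qed (use sub_carr[OF H] g in \<open>simp_all add: op_add\<close>)

text \<open>The component of degree \<open>n\<close> of the Rees module of \<open>N\<close>: the sum of the submodules \<open>xN\<close> over the
  monomials \<open>x\<close> of degree \<open>n\<close> in the generators, where the pair \<open>(i, g)\<close> stands for a generator
  \<open>g\<close> whose degree is the \<open>i\<close>-th unit vector. The recursion on the list of generators allows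
  inductions in the manner of the Hilbert basis theorem.\<close>

function gen_span :: "(nat \<times> 'a) list \<Rightarrow> (nat \<Rightarrow> nat) \<Rightarrow> 'm set" where
  "gen_span [] n = (if n = (\<lambda>_. 0) then carrier N else {\<zero>})"
| "gen_span ((i, g) # gs) n = (if n i = 0 then gen_span gs n
     else gen_span gs n <+> (\<lambda>v. g \<odot> v) ` gen_span ((i, g) # gs) (lower i n))"
  by pat_completeness auto
termination
  by (relation "measures [\<lambda>(gs, n). length gs, \<lambda>(gs, n). n (fst (hd gs))]") (auto simp: lower_def)

declare gen_span.simps(2) [simp del]

definition gens_in :: "nat \<Rightarrow> (nat \<times> 'a) list \<Rightarrow> bool" where
  "gens_in d gs \<longleftrightarrow> (\<forall>(i, g)\<in>set gs. i \<le> d \<and> g \<in> carrier R)"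

lemma gens_in_Cons [simp]:
  "gens_in d ((i, g) # gs) \<longleftrightarrow> i \<le> d \<and> g \<in> carrier R \<and> gens_in d gs"
  by (auto simp: gens_in_def)

lemma sub_gen_span: "gens_in d gs \<Longrightarrow> sub (gen_span gs n)"
proof (induction gs n rule: gen_span.induct)
  case (1 n)
  then show ?case by (simp add: sub_carrier sub_zero_set)
next
  case (2 i g gs n)
  then show ?case
    by (simp add: gen_span.simps(2)[of i g gs n] sub_sum sub_image)
qed

lemma gen_span_carr: "gens_in d gs \<Longrightarrow> v \<in> gen_span gs n \<Longrightarrow> v \<in> carrier N"
  using sub_gen_span sub_carr by blast

lemma gen_span_tail:
  assumes "gens_in d ((i, g) # gs)"
  shows "gen_span gs n \<subseteq> gen_span ((i, g) # gs) n"
proof (cases "n i = 0")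
  case False
  have "gen_span gs n \<subseteq> gen_span gs n <+> (\<lambda>v. g \<odot> v) ` gen_span ((i, g) # gs) (lower i n)"
  proof (rule subset_sum_left)
    show "sub ((\<lambda>v. g \<odot> v) ` gen_span ((i, g) # gs) (lower i n))"
      using assms by (intro sub_image sub_gen_span[OF assms]) simp
    show "gen_span gs n \<subseteq> carrier N" using assms by (intro sub_subset sub_gen_span[of d]) simp
  qed
  then show ?thesis using False by (simp add: gen_span.simps(2)[of i g gs n])
qed (simp add: gen_span.simps(2)[of i g gs n])

lemma gen_span_head:
  assumes "gens_in d ((i, g) # gs)" "v \<in> gen_span ((i, g) # gs) n"
  shows "g \<odot> v \<in> gen_span ((i, g) # gs) (raise i n)"
proof -
  have g: "gens_in d gs" "g \<in> carrier R" using assms by auto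
  have c: "g \<odot> v \<in> carrier N" using gen_span_carr[OF assms] g by simp
  have "\<zero> \<oplus> g \<odot> v \<in> gen_span gs (raise i n) <+> (\<lambda>v. g \<odot> v) ` gen_span ((i, g) # gs) n"
    by (rule set_addI) (use assms sub_zero[OF sub_gen_span[OF g(1)]] in auto)
  then show ?thesis using c
    by (simp add: gen_span.simps(2)[of i g gs "raise i n"]) (simp add: raise_def)
qed

lemma raise_lower_commute: "n i \<noteq> 0 \<Longrightarrow> raise j (lower i n) = lower i (raise j n)"
  by (auto simp: raise_def lower_def fun_eq_iff)

lemma gen_span_closed:
  assumes "gens_in d gs" "(j, h) \<in> set gs" "v \<in> gen_span gs n"
  shows "h \<odot> v \<in> gen_span gs (raise j n)"
  using assms
proof (induction gs n arbitrary: v rule: gen_span.induct)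
  case (2 i g gs n v)
  have g: "g \<in> carrier R" "gens_in d gs" using "2.prems"(1) by auto
  have h: "h \<in> carrier R" using "2.prems"(1,2) by (auto simp: gens_in_def)
  show ?case
  proof (cases "(j, h) = (i, g)")
    case True
    then show ?thesis using gen_span_head[OF "2.prems"(1) "2.prems"(3)] by simp
  next
    case False
    then have jh: "(j, h) \<in> set gs" using "2.prems"(2) by auto
    note tail = gen_span_tail[OF "2.prems"(1)]
    show ?thesis
    proof (cases "n i = 0")
      case True
      then have "v \<in> gen_span gs n" using "2.prems"(3) by (simp add: gen_span.simps(2)[of i g gs n])
      then have "h \<odot> v \<in> gen_span gs (raise j n)" by (rule "2.IH"(1)[OF True g(2) jh])
      then show ?thesis using tail by blast
    next
      case n: False
      then have "v \<in> gen_span gs n <+> (\<lambda>v. g \<odot> v) ` gen_span ((i, g) # gs) (lower i n)"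
        using "2.prems"(3) by (simp add: gen_span.simps(2)[of i g gs n])
      then obtain a u where au: "a \<in> gen_span gs n" "u \<in> gen_span ((i, g) # gs) (lower i n)"
        "v = a \<oplus> g \<odot> u" by (auto elim!: set_addE)
      have c: "a \<in> carrier N" "u \<in> carrier N"
        using au gen_span_carr[OF g(2)] gen_span_carr[OF "2.prems"(1)] by auto
      have "h \<odot> a \<in> gen_span ((i, g) # gs) (raise j n)"
        using "2.IH"(2)[OF n g(2) jh au(1)] tail by blast
      moreover have "h \<odot> u \<in> gen_span ((i, g) # gs) (raise j (lower i n))"
        by (rule "2.IH"(3)[OF n "2.prems"(1,2) au(2)])
      then have "g \<odot> (h \<odot> u) \<in> gen_span ((i, g) # gs) (raise j n)"
        using gen_span_head[OF "2.prems"(1), of "h \<odot> u" "raise j (lower i n)"]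
        by (simp add: raise_commute[of i j] raise_lower[of n i, OF n])
      ultimately show ?thesis
        using au(3) c g h sub_add[OF sub_gen_span[OF "2.prems"(1)]] by (simp add: op_add smult_commute)
    qed
  qed
qed simp

text \<open>A graded submodule of \<open>gen_span gs\<close>, given by its components.\<close>

definition family :: "(nat \<times> 'a) list \<Rightarrow> ((nat \<Rightarrow> nat) \<Rightarrow> 'm set) \<Rightarrow> bool" where
  "family gs A \<longleftrightarrow> (\<forall>n. sub (A n)) \<and> (\<forall>n. A n \<subseteq> gen_span gs n) \<and>
     (\<forall>i g n v. (i, g) \<in> set gs \<longrightarrow> v \<in> A n \<longrightarrow> g \<odot> v \<in> A (raise i n))"

lemma familyI:
  assumes "\<And>n. sub (A n)" "\<And>n v. v \<in> A n \<Longrightarrow> v \<in> gen_span gs n"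
    "\<And>i g n v. (i, g) \<in> set gs \<Longrightarrow> v \<in> A n \<Longrightarrow> g \<odot> v \<in> A (raise i n)"
  shows "family gs A"
  unfolding family_def using assms by (simp add: subsetI)

lemma family_sub: "family gs A \<Longrightarrow> sub (A n)"
  and family_span: "family gs A \<Longrightarrow> A n \<subseteq> gen_span gs n"
  and family_closed: "family gs A \<Longrightarrow> (i, g) \<in> set gs \<Longrightarrow> v \<in> A n \<Longrightarrow> g \<odot> v \<in> A (raise i n)"
  by (simp_all add: family_def)

definition fam_colon :: "nat \<Rightarrow> 'a \<Rightarrow> (nat \<times> 'a) list \<Rightarrow> ((nat \<Rightarrow> nat) \<Rightarrow> 'm set) \<Rightarrow> (nat \<Rightarrow> nat) \<Rightarrow> 'm set" where
  "fam_colon i g gs A n = {v \<in> gen_span gs n. g \<odot> v \<in> A (raise i n)}"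

text \<open>The part of \<open>A + gE\<close> in the span of the remaining generators, where \<open>E\<close> is the span of all of
  them: the image of \<open>A\<close> after dividing by \<open>g\<close>, described without leaving \<open>N\<close>.\<close>

definition fam_trace :: "nat \<Rightarrow> 'a \<Rightarrow> (nat \<times> 'a) list \<Rightarrow> ((nat \<Rightarrow> nat) \<Rightarrow> 'm set) \<Rightarrow> (nat \<Rightarrow> nat) \<Rightarrow> 'm set" where
  "fam_trace i g gs A n = gen_span gs n \<inter>
     (if n i = 0 then A n else A n <+> (\<lambda>v. g \<odot> v) ` gen_span ((i, g) # gs) (lower i n))"

lemma family_colon:
  assumes gs: "gens_in d gs" and x: "x \<in> carrier R" and A: "family gs A"
  shows "family gs (fam_colon i x gs A)"
proof (rule familyI)
  show "sub (fam_colon i x gs A n)" for n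
    unfolding fam_colon_def by (rule sub_preimage[OF x sub_gen_span[OF gs] family_sub[OF A]])
  show "v \<in> gen_span gs n" if "v \<in> fam_colon i x gs A n" for n v
    using that by (simp add: fam_colon_def)
  fix j h n v assume jh: "(j, h) \<in> set gs" and v: "v \<in> fam_colon i x gs A n"
  have h: "h \<in> carrier R" using jh gs by (auto simp: gens_in_def)
  have v': "v \<in> gen_span gs n" "x \<odot> v \<in> A (raise i n)" using v by (auto simp: fam_colon_def)
  have "h \<odot> (x \<odot> v) \<in> A (raise j (raise i n))" by (rule family_closed[OF A, OF jh v'(2)])
  moreover have "h \<odot> (x \<odot> v) = x \<odot> (h \<odot> v)"
    by (rule smult_commute[OF h x gen_span_carr[OF gs v'(1)]])
  ultimately have "x \<odot> (h \<odot> v) \<in> A (raise i (raise j n))"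
    by (simp add: raise_commute[of i j])
  then show "h \<odot> v \<in> fam_colon i x gs A (raise j n)"
    using gen_span_closed[OF gs jh v'(1)] by (simp add: fam_colon_def)
qed

lemma fam_colon_mono: "(\<And>n. A n \<subseteq> B n) \<Longrightarrow> fam_colon i x gs A n \<subseteq> fam_colon i x gs B n"
  by (auto simp: fam_colon_def)

lemma fam_colon_extends:
  assumes A: "family gs A" and x: "\<And>n v. v \<in> A n \<Longrightarrow> x \<odot> v \<in> A (raise i n)"
  shows "A n \<subseteq> fam_colon i x gs A n"
  using family_span[OF A, of n] x by (auto simp: fam_colon_def)

lemma fam_trace_mono: "(\<And>n. A n \<subseteq> B n) \<Longrightarrow> fam_trace i x gs A n \<subseteq> fam_trace i x gs B n"
proof
  fix v assume AB: "\<And>n. A n \<subseteq> B n" and "v \<in> fam_trace i x gs A n"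
  then show "v \<in> fam_trace i x gs B n"
    using set_add_mono[OF AB[of n] order_refl] AB[of n] by (auto simp: fam_trace_def split: if_splits)
qed

lemma family_trace:
  assumes gs: "gens_in d ((i, g) # gs)" and A: "family ((i, g) # gs) A"
  shows "family gs (fam_trace i g gs A)"
proof (rule familyI)
  have g: "g \<in> carrier R" and gs': "gens_in d gs" using gs by auto
  have sg: "sub (A n <+> (\<lambda>v. g \<odot> v) ` gen_span ((i, g) # gs) m)" for n m
    by (intro sub_sum family_sub[OF A] sub_image[OF g] sub_gen_span[OF gs])
  show "sub (fam_trace i g gs A n)" for n
    unfolding fam_trace_def using sub_inter[OF sub_gen_span[OF gs'] sg] sub_inter[OF sub_gen_span[OF gs'] family_sub[OF A]]
    by auto
  show "v \<in> gen_span gs n" if "v \<in> fam_trace i g gs A n" for n v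
    using that by (simp add: fam_trace_def)
  fix j h n v assume jh: "(j, h) \<in> set gs" and v: "v \<in> fam_trace i g gs A n"
  have h: "h \<in> carrier R" using jh gs' by (auto simp: gens_in_def)
  have jh': "(j, h) \<in> set ((i, g) # gs)" using jh by simp
  have hv: "h \<odot> v \<in> gen_span gs (raise j n)"
    using v gen_span_closed[OF gs' jh] by (simp add: fam_trace_def)
  show "h \<odot> v \<in> fam_trace i g gs A (raise j n)"
  proof (cases "n i = 0")
    case True
    then have hA: "h \<odot> v \<in> A (raise j n)" using v family_closed[OF A, OF jh'] by (simp add: fam_trace_def)
    moreover have "A (raise j n) \<subseteq> A (raise j n) <+> (\<lambda>v. g \<odot> v) ` gen_span ((i, g) # gs) (lower i (raise j n))"
      by (intro subset_sum_left sub_image[OF g] sub_gen_span[OF gs] sub_subset family_sub[OF A])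
    ultimately show ?thesis using hv by (auto simp: fam_trace_def)
  next
    case False
    then obtain a u where au: "a \<in> A n" "u \<in> gen_span ((i, g) # gs) (lower i n)" "v = a \<oplus> g \<odot> u"
      using v by (auto simp: fam_trace_def elim!: set_addE)
    have c: "a \<in> carrier N" "u \<in> carrier N"
      using au sub_carr[OF family_sub[OF A]] gen_span_carr[OF gs] by auto
    have 1: "h \<odot> a \<in> A (raise j n)" using family_closed[OF A, OF jh' au(1)] .
    have 2: "h \<odot> u \<in> gen_span ((i, g) # gs) (lower i (raise j n))"
      using gen_span_closed[OF gs jh' au(2)] False by (simp add: raise_lower_commute)
    have "h \<odot> v = h \<odot> a \<oplus> g \<odot> (h \<odot> u)" using au c h g by (simp add: op_add smult_commute)
    then have "h \<odot> v \<in> A (raise j n) <+> (\<lambda>v. g \<odot> v) ` gen_span ((i, g) # gs) (lower i (raise j n))"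
      using set_addI[OF 1 imageI[OF 2]] by simp
    moreover have "raise j n i \<noteq> 0" using False by (simp add: raise_def)
    ultimately show ?thesis using hv by (simp add: fam_trace_def)
  qed
qed

definition same_traces :: "nat \<Rightarrow> 'a \<Rightarrow> (nat \<times> 'a) list \<Rightarrow> ((nat \<Rightarrow> nat) \<Rightarrow> 'm set) \<Rightarrow>
    ((nat \<Rightarrow> nat) \<Rightarrow> 'm set) \<Rightarrow> bool" where
  "same_traces i g gs A B \<longleftrightarrow> family ((i, g) # gs) A \<and> family ((i, g) # gs) B \<and>
     (\<forall>n. A n \<subseteq> B n) \<and>
     (\<forall>a n. fam_trace i g gs ((fam_colon i g ((i, g) # gs) ^^ a) A) n
          = fam_trace i g gs ((fam_colon i g ((i, g) # gs) ^^ a) B) n)"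

text \<open>By induction on the degree in \<open>g\<close>, a family is determined among those above it by the traces of
  its iterated colons: an element of \<open>B\<close> is congruent modulo \<open>A\<close> to a multiple \<open>gu\<close> because the
  traces agree, and \<open>u\<close> lies in the colon of \<open>B\<close>, one degree below.\<close>

lemma same_traces_level:
  assumes gs: "gens_in d ((i, g) # gs)"
  shows "same_traces i g gs A B \<Longrightarrow> \<forall>n. n i = m \<longrightarrow> B n \<subseteq> A n"
proof (induction m arbitrary: A B)
  case 0
  show ?case
  proof (intro allI impI)
    fix n :: "nat \<Rightarrow> nat" assume n0: "n i = 0"
    have fB: "family ((i, g) # gs) B" using 0 by (simp add: same_traces_def)
    have tr0: "fam_trace i g gs ((fam_colon i g ((i, g) # gs) ^^ 0) A) n
        = fam_trace i g gs ((fam_colon i g ((i, g) # gs) ^^ 0) B) n"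
      using 0 unfolding same_traces_def by blast
    have tr: "fam_trace i g gs A n = fam_trace i g gs B n" using tr0 by simp
    have E: "gen_span ((i, g) # gs) n = gen_span gs n" using n0 by (simp add: gen_span.simps(2)[of i g gs n])
    have "gen_span gs n \<inter> A n = gen_span gs n \<inter> B n" using tr by (simp add: fam_trace_def n0)
    moreover have "B n \<subseteq> gen_span gs n" using family_span[OF fB, of n] E by simp
    ultimately show "B n \<subseteq> A n" by blast
  qed
next
  case (Suc m)
  let ?D = "fam_colon i g ((i, g) # gs)"
  have fA: "family ((i, g) # gs) A" and fB: "family ((i, g) # gs) B" and AB: "A n \<subseteq> B n"
    and tr: "fam_trace i g gs ((?D ^^ a) A) n = fam_trace i g gs ((?D ^^ a) B) n" for a n
    using Suc.prems unfolding same_traces_def by blast+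
  have g: "g \<in> carrier R" and gs': "gens_in d gs" using gs by auto
  have ig: "(i, g) \<in> set ((i, g) # gs)" by simp
  have IH: "\<forall>n. n i = m \<longrightarrow> ?D B n \<subseteq> ?D A n"
  proof (rule Suc.IH)
    show "same_traces i g gs (?D A) (?D B)"
      unfolding same_traces_def
    proof (intro conjI allI)
      show "family ((i, g) # gs) (?D A)" by (rule family_colon[OF gs g fA])
      show "family ((i, g) # gs) (?D B)" by (rule family_colon[OF gs g fB])
      show "?D A n \<subseteq> ?D B n" for n by (rule fam_colon_mono) (rule AB)
      show "fam_trace i g gs ((?D ^^ a) (?D A)) n = fam_trace i g gs ((?D ^^ a) (?D B)) n" for a n
        using tr[of "Suc a" n] by (simp add: funpow_swap1)
    qed
  qed
  show ?case
  proof (intro allI impI subsetI)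
    fix n v assume ni: "n i = Suc m" and v: "v \<in> B n"
    have n: "n i \<noteq> 0" and l: "lower i n i = m" using ni by (simp_all add: lower_def)
    have vE: "v \<in> gen_span ((i, g) # gs) n" by (rule subsetD[OF family_span[OF fB] v])
    then obtain w u where wu: "w \<in> gen_span gs n" "u \<in> gen_span ((i, g) # gs) (lower i n)"
      "v = w \<oplus> g \<odot> u" using n by (auto simp: gen_span.simps(2)[of i g gs n] elim!: set_addE)
    have c: "v \<in> carrier N" "w \<in> carrier N" "u \<in> carrier N"
      using vE wu gen_span_carr[OF gs] gen_span_carr[OF gs'] by auto
    have "w = v \<oplus> g \<odot> (\<ominus> u)" using wu c g by (simp add: op_neg M.a_assoc M.r_neg)
    moreover have "\<ominus> u \<in> gen_span ((i, g) # gs) (lower i n)" using sub_neg[OF sub_gen_span[OF gs]] wu by simp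
    ultimately have "w \<in> fam_trace i g gs B n"
      using wu(1) v n set_addI[of v "B n" "g \<odot> (\<ominus> u)"] by (simp add: fam_trace_def)
    then have "w \<in> fam_trace i g gs A n" using tr[of 0 n] by simp
    then obtain a u' where au: "a \<in> A n" "u' \<in> gen_span ((i, g) # gs) (lower i n)" "w = a \<oplus> g \<odot> u'"
      using n by (auto simp: fam_trace_def elim!: set_addE)
    have c': "a \<in> carrier N" "u' \<in> carrier N"
      using au sub_carr[OF family_sub[OF fA]] gen_span_carr[OF gs] by auto
    have v2: "v = a \<oplus> g \<odot> (u' \<oplus> u)" using wu au c c' g by (simp add: op_add M.a_assoc)
    have uu: "u' \<oplus> u \<in> gen_span ((i, g) # gs) (lower i n)"
      using au wu sub_add[OF sub_gen_span[OF gs]] by simp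
    have "g \<odot> (u' \<oplus> u) = \<ominus> a \<oplus> v" using v2 c c' g by (simp add: M.r_neg1)
    then have "g \<odot> (u' \<oplus> u) \<in> B n"
      using v au(1) AB[of n] sub_add[OF family_sub[OF fB]] sub_neg[OF family_sub[OF fB]]
      by (metis subsetD)
    then have "u' \<oplus> u \<in> ?D B (lower i n)" using uu raise_lower[of n i] n by (simp add: fam_colon_def)
    then have "u' \<oplus> u \<in> ?D A (lower i n)" using IH l by blast
    then have "g \<odot> (u' \<oplus> u) \<in> A n" using raise_lower[of n i] n by (simp add: fam_colon_def)
    then have "a \<oplus> g \<odot> (u' \<oplus> u) \<in> A n" by (rule sub_add[OF family_sub[OF fA] au(1)])
    then show "v \<in> A n" by (simp only: v2)
  qed
qed

lemma same_traces_eq: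
  assumes "gens_in d ((i, g) # gs)" "same_traces i g gs A B"
  shows "B n \<subseteq> A n"
  using same_traces_level[OF assms, of "n i"] by blast

lemma funpow_colon_family:
  assumes gs: "gens_in d gs" and x: "x \<in> carrier R" and A: "family gs A"
  shows "family gs ((fam_colon i x gs ^^ a) A)"
proof (induction a)
  case (Suc a)
  show ?case unfolding funpow.simps comp_def by (rule family_colon[OF gs x Suc])
qed (simp add: A)

lemma funpow_colon_mono:
  assumes "\<And>n. A n \<subseteq> B n"
  shows "(fam_colon i x gs ^^ a) A n \<subseteq> (fam_colon i x gs ^^ a) B n"
proof (induction a arbitrary: n)
  case (Suc a)
  show ?case unfolding funpow.simps comp_def by (rule fam_colon_mono) (rule Suc)
qed (simp add: assms)

lemma colon_by_closed:
  assumes "family gs A" "\<And>n v. v \<in> A n \<Longrightarrow> x \<odot> v \<in> A (raise i n)"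
    "\<And>n v. v \<in> gen_span gs n \<Longrightarrow> x \<odot> v \<in> gen_span gs (raise i n)"
  shows "v \<in> (fam_colon i x gs ^^ a) A n \<Longrightarrow> x \<odot> v \<in> (fam_colon i x gs ^^ a) A (raise i n)"
proof (induction a arbitrary: n v)
  case (Suc a)
  then show ?case using assms(3)[of v n] by (simp add: fam_colon_def)
qed (simp add: assms(2))

lemma funpow_colon_extends:
  assumes gs: "gens_in d gs" and x: "x \<in> carrier R" and A: "family gs A"
    and cl: "\<And>n v. v \<in> A n \<Longrightarrow> x \<odot> v \<in> A (raise i n)"
    "\<And>n v. v \<in> gen_span gs n \<Longrightarrow> x \<odot> v \<in> gen_span gs (raise i n)"
    and ab: "a \<le> b"
  shows "(fam_colon i x gs ^^ a) A n \<subseteq> (fam_colon i x gs ^^ b) A n"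
  using ab
proof (induction b arbitrary: n rule: dec_induct)
  case (step b)
  have "(fam_colon i x gs ^^ b) A n \<subseteq> fam_colon i x gs ((fam_colon i x gs ^^ b) A) n"
    by (rule fam_colon_extends[OF funpow_colon_family[OF gs x A]])
      (rule colon_by_closed[OF A cl])
  then show ?case using step.IH[of n] by simp
qed simp

lemma ascending_le:
  fixes C :: "nat \<Rightarrow> (nat \<Rightarrow> nat) \<Rightarrow> 'm set"
  assumes "\<And>t n. C t n \<subseteq> C (Suc t) n" "s \<le> t"
  shows "C s n \<subseteq> C t n"
  using assms(2) by (induction rule: dec_induct) (use assms(1) in auto)

definition ascending :: "(nat \<times> 'a) list \<Rightarrow> (nat \<Rightarrow> (nat \<Rightarrow> nat) \<Rightarrow> 'm set) \<Rightarrow> bool" where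
  "ascending gs C \<longleftrightarrow> (\<forall>t. family gs (C t)) \<and> (\<forall>t n. C t n \<subseteq> C (Suc t) n)"

text \<open>The Hilbert basis theorem for families. The traces of the iterated colons of an ascending chain
  form a double sequence that ascends in both directions, and they are families for one generator
  fewer. Their diagonal becomes stationary, and so does each of the remaining finitely many rows;
  the traces determine the chain.\<close>

theorem family_acc:
  assumes "gens_in d gs" "ascending gs C"
  shows "\<exists>t0. \<forall>t\<ge>t0. C t = C t0"
  using assms
proof (induction gs arbitrary: C)
  case Nil
  have fam: "family [] (C t)" and asc: "C t n \<subseteq> C (Suc t) n" for t n
    using Nil.prems(2) unfolding ascending_def by blast+
  define z :: "nat \<Rightarrow> nat" where "z = (\<lambda>_. 0)"
  have "\<exists>t0. \<forall>t\<ge>t0. C t z = C t0 z"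
    by (rule sub_acc) (rule family_sub[OF fam], rule asc)
  then obtain t0 where t0: "\<And>t. t \<ge> t0 \<Longrightarrow> C t z = C t0 z" by blast
  have "C t n = {\<zero>}" if "n \<noteq> z" for t n
    using family_span[OF fam[of t], of n] sub_zero[OF family_sub[OF fam[of t], of n]] that
    by (auto simp: z_def)
  then have "C t n = C t0 n" if "t \<ge> t0" for t n
    using t0[OF that] by (cases "n = z") auto
  then show ?case by blast
next
  case (Cons ig gs C)
  obtain i g where ig: "ig = (i, g)" by (cases ig)
  note gs = Cons.prems(1)[unfolded ig]
  have fam: "family ((i, g) # gs) (C t)" and asc: "C t n \<subseteq> C (Suc t) n" for t n
    using Cons.prems(2) unfolding ascending_def ig by blast+
  have g: "g \<in> carrier R" and gs': "gens_in d gs" using gs by auto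
  let ?D = "fam_colon i g ((i, g) # gs)"
  define Q where "Q a t = fam_trace i g gs ((?D ^^ a) (C t))" for a t
  have famQ: "family gs (Q a t)" for a t
    unfolding Q_def by (rule family_trace[OF gs funpow_colon_family[OF gs g fam]])
  have clE: "g \<odot> v \<in> gen_span ((i, g) # gs) (raise i n)" if "v \<in> gen_span ((i, g) # gs) n" for v n
    by (rule gen_span_head[OF gs that])
  have clC: "g \<odot> v \<in> C t (raise i n)" if "v \<in> C t n" for v n t
    using family_closed[OF fam, of i g v t n] that by simp
  have Qt: "Q a s n \<subseteq> Q a t n" if "s \<le> t" for a s t n
    unfolding Q_def by (intro fam_trace_mono funpow_colon_mono ascending_le[of C, OF asc that])
  have Qa: "Q a t n \<subseteq> Q b t n" if "a \<le> b" for a b t n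
    unfolding Q_def by (intro fam_trace_mono funpow_colon_extends[OF gs g fam clC clE that])
  have "\<exists>t0. \<forall>t\<ge>t0. Q t t = Q t0 t0"
  proof (rule Cons.IH[OF gs'], unfold ascending_def, intro conjI allI)
    show "family gs (Q t t)" for t by (rule famQ)
    show "Q t t n \<subseteq> Q (Suc t) (Suc t) n" for t n
      using Qt[of t "Suc t" t n] Qa[of t "Suc t" "Suc t" n] by simp
  qed
  then obtain m where m: "\<And>t. t \<ge> m \<Longrightarrow> Q t t = Q m m" by blast
  have big: "Q a t = Q m m" if "a \<ge> m" "t \<ge> m" for a t
  proof
    fix n
    have "Q m m n \<subseteq> Q a t n" using Qt[OF that(2), of m n] Qa[OF that(1), of t n] by blast
    moreover have "Q a t n \<subseteq> Q (max a t) (max a t) n"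
      using Qt[of t "max a t" a n] Qa[of a "max a t" "max a t" n] by auto
    ultimately show "Q a t n = Q m m n" using m[of "max a t"] that(1) by auto
  qed
  have "\<exists>s. \<forall>t\<ge>s. Q a t = Q a s" for a
    by (rule Cons.IH[OF gs'], unfold ascending_def, intro conjI allI famQ) (rule Qt, simp)
  then obtain s where s: "\<And>a t. t \<ge> s a \<Longrightarrow> Q a t = Q a (s a)" by metis
  \<comment> \<open>The rows from \<open>m\<close> on are stationary from column \<open>m\<close> on, the row \<open>a < m\<close> from column \<open>s a\<close> on.\<close>
  define t0 where "t0 = Max (insert m (s ` {..<m}))"
  have t0: "m \<le> t0" "a < m \<Longrightarrow> s a \<le> t0" for a unfolding t0_def by (auto intro: Max_ge)
  have Qeq: "Q a t = Q a t0" if "t \<ge> t0" for a t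
  proof (cases "a < m")
    case True
    then show ?thesis using s[of a t] s[of a t0] t0(2)[of a] that by simp
  next
    case False
    then show ?thesis using big[of a t] big[of a t0] t0(1) that by simp
  qed
  have "C t = C t0" if t: "t \<ge> t0" for t
  proof
    fix n
    have le: "C t0 n \<subseteq> C t n" for n by (rule ascending_le[of C, OF asc t])
    have "C t n \<subseteq> C t0 n"
    proof (rule same_traces_eq[OF gs, where A = "C t0" and B = "C t"], unfold same_traces_def, intro conjI allI fam le)
      show "fam_trace i g gs ((?D ^^ a) (C t0)) n = fam_trace i g gs ((?D ^^ a) (C t)) n" for a n
        using Qeq[OF t, of a] unfolding Q_def by (rule fun_cong[OF sym])
    qed
    then show "C t n = C t0 n" using le by blast
  qed
  then show ?case by blast
qed

end

context operator_group
begin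

lemma sq_len_sum:
  assumes "sub A" "sub A'" "sub B'" "B' \<subseteq> A'" "A \<subseteq> A'" "A' \<subseteq> A <+> B'"
  shows "sq_len R M (A \<inter> B') A = sq_len R M B' A'"
proof (rule sq_len_hom[where f = "\<lambda>a. a"])
  show "operator_group R M" "operator_group R M" by unfold_locales
  show "\<exists>a\<in>A. \<exists>b\<in>B'. a' = a \<oplus> b" if "a' \<in> A'" for a'
    using assms(6) that by (auto elim!: set_addE dest!: subsetD)
qed (use assms in auto)

lemma set_add_swap:
  assumes "sub A" "sub B" "sub C"
  shows "A <+> (B <+> C) \<subseteq> (A <+> C) <+> B" "(A <+> C) <+> B \<subseteq> (A <+> B) <+> C"
proof -
  note s = assms sub_sum[OF assms(1,3)] sub_sum[OF assms(1,2)]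
  have 1: "A \<subseteq> A <+> C" "C \<subseteq> A <+> C" "A \<subseteq> A <+> B" "B \<subseteq> A <+> B"
    using assms by (auto intro!: subset_sum_left subset_sum_right sub_subset del: subsetI)
  have 2: "A <+> C \<subseteq> (A <+> C) <+> B" "B \<subseteq> (A <+> C) <+> B"
      "A <+> B \<subseteq> (A <+> B) <+> C" "C \<subseteq> (A <+> B) <+> C"
    using s by (auto intro!: subset_sum_left subset_sum_right sub_subset del: subsetI)
  show "A <+> (B <+> C) \<subseteq> (A <+> C) <+> B"
    using s 1 2 by (intro sum_subset sub_sum) auto
  show "(A <+> C) <+> B \<subseteq> (A <+> B) <+> C"
    using s 1 2 by (intro sum_subset sub_sum) auto
qed

end

context noetherian_module
begin

lemma sq_len_smult:
  assumes g: "g \<in> carrier R" and A: "sub A" and A': "sub A'" and B': "sub B'" "B' \<subseteq> A'"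
    and f: "\<And>a. a \<in> A \<Longrightarrow> g \<odot> a \<in> A'" and onto: "\<And>a'. a' \<in> A' \<Longrightarrow> \<exists>a\<in>A. \<exists>b\<in>B'. a' = g \<odot> a \<oplus> b"
  shows "sq_len R N {a \<in> A. g \<odot> a \<in> B'} A = sq_len R N B' A'"
proof (rule sq_len_hom[where f = "\<lambda>a. g \<odot> a"])
  show "operator_group R N" "operator_group R N" by unfold_locales
  show "g \<odot> (a \<oplus> b) = g \<odot> a \<oplus> g \<odot> b" if "a \<in> A" "b \<in> A" for a b
    using op_add[OF g] sub_carr[OF A] that by simp
  show "\<exists>r'\<in>carrier R. \<forall>a\<in>A. g \<odot> (r \<odot> a) = r' \<odot> (g \<odot> a)" if "r \<in> carrier R" for r
    using smult_commute[OF g that] sub_carr[OF A] that by blast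
  show "\<exists>r'\<in>carrier R. \<forall>a\<in>A. g \<odot> (r' \<odot> a) = r \<odot> (g \<odot> a)" if "r \<in> carrier R" for r
    using smult_commute[OF g that] sub_carr[OF A] that by blast
qed (use assms in auto)

subsection \<open>Hilbert functions of families\<close>

definition hilb :: "(nat \<times> 'a) list \<Rightarrow> ((nat \<Rightarrow> nat) \<Rightarrow> 'm set) \<Rightarrow> (nat \<Rightarrow> nat) \<Rightarrow> enat" where
  "hilb gs A n = sq_len R N (A n) (gen_span gs n)"

lemma hilb_step_0:
  assumes A: "family ((i, g) # gs) A" and n: "n i = 0"
  shows "hilb ((i, g) # gs) A n = hilb gs (fam_trace i g gs A) n"
proof -
  have "gen_span gs n \<inter> A n = A n"
    using family_span[OF A, of n] n by (auto simp: gen_span.simps(2)[of i g gs n])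
  then show ?thesis using n by (simp add: hilb_def fam_trace_def gen_span.simps(2)[of i g gs n])
qed

text \<open>With \<open>E\<close> the span, \<open>E/A\<close> has the quotient \<open>E/(A + gE)\<close>, which is measured by the trace, and the
  submodule \<open>(A + gE)/A\<close>, which multiplication by \<open>g\<close> identifies with \<open>E/(A : g)\<close>.\<close>

lemma hilb_step:
  assumes gs: "gens_in d ((i, g) # gs)" and A: "family ((i, g) # gs) A" and n: "n i \<noteq> 0"
  shows "hilb ((i, g) # gs) A n = hilb gs (fam_trace i g gs A) n
     + hilb ((i, g) # gs) (fam_colon i g ((i, g) # gs) A) (lower i n)"
proof -
  have g: "g \<in> carrier R" and gs': "gens_in d gs" using gs by auto
  let ?E = "gen_span ((i, g) # gs)" and ?D = "fam_colon i g ((i, g) # gs) A"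
  let ?P = "(\<lambda>v. g \<odot> v) ` ?E (lower i n)"
  let ?G = "A n <+> ?P"
  have sA: "sub (A n)" and sE: "sub (?E m)" and sP: "sub ?P" and sE': "sub (gen_span gs n)" for m
    using family_sub[OF A] sub_gen_span[OF gs] sub_image[OF g] sub_gen_span[OF gs'] by auto
  have sG: "sub ?G" by (rule sub_sum[OF sA sP])
  have En: "?E n = gen_span gs n <+> ?P" using n by (simp add: gen_span.simps(2)[of i g gs n])
  have PE: "?P \<subseteq> ?E n" unfolding En by (rule subset_sum_right[OF sE' sub_subset[OF sP]])
  have AG: "A n \<subseteq> ?G" and PG: "?P \<subseteq> ?G"
    by (rule subset_sum_left[OF sP sub_subset[OF sA]], rule subset_sum_right[OF sA sub_subset[OF sP]])
  have GE: "?G \<subseteq> ?E n" by (rule sum_subset[OF sE family_span[OF A] PE])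
  have rl: "raise i (lower i n) = n" by (rule raise_lower[of n i, OF n])
  have "sq_len R N {a \<in> ?E (lower i n). g \<odot> a \<in> A n} (?E (lower i n)) = sq_len R N (A n) ?G"
  proof (rule sq_len_smult[OF g sE sG sA AG])
    show "g \<odot> a \<in> ?G" if "a \<in> ?E (lower i n)" for a using PG that by blast
    show "\<exists>a\<in>?E (lower i n). \<exists>b\<in>A n. a' = g \<odot> a \<oplus> b" if "a' \<in> ?G" for a'
      using that
    proof (rule set_addE)
      fix b p assume b: "b \<in> A n" and p: "p \<in> ?P" and a': "a' = b \<oplus> p"
      then have "a' = p \<oplus> b" using sub_carr[OF sA] sub_carr[OF sP] by (simp add: M.a_comm)
      then show ?thesis using b p by auto
    qed
  qed
  then have 1: "hilb ((i, g) # gs) ?D (lower i n) = sq_len R N (A n) ?G"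
    by (simp add: hilb_def fam_colon_def rl)
  have "sq_len R N (gen_span gs n \<inter> ?G) (gen_span gs n) = sq_len R N ?G (?E n)"
  proof (rule sq_len_sum[OF sE' sE sG GE])
    show "gen_span gs n \<subseteq> ?E n" by (rule gen_span_tail[OF gs])
    show "?E n \<subseteq> gen_span gs n <+> ?G"
      unfolding En by (rule set_add_mono[OF order_refl PG])
  qed
  then have 2: "hilb gs (fam_trace i g gs A) n = sq_len R N ?G (?E n)"
    using n by (simp add: hilb_def fam_trace_def)
  have "hilb ((i, g) # gs) A n = sq_len R N (A n) ?G + sq_len R N ?G (?E n)"
    unfolding hilb_def by (rule sq_len_add[OF sA sG sE AG GE])
  then show ?thesis using 1 2 by (simp add: add.commute)
qed

text \<open>Iterating the last formula writes the Hilbert function as the sum over \<open>a \<le> n i\<close> of those of the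
  traces of the \<open>a\<close>-fold colons, at degrees with \<open>n i - a\<close> in place of \<open>n i\<close>. The colons become
  stationary, so that up to finitely many shifted terms this is a summation in the direction \<open>i\<close>
  of a single function for one generator fewer.\<close>

theorem hilb_rational:
  assumes "gens_in d gs" and Z: "sub Z" "sq_len R N Z (carrier N) \<noteq> \<infinity>"
    and "family gs A" "Z \<subseteq> A (\<lambda>_. 0)"
  shows "(\<forall>n. hilb gs A n \<noteq> \<infinity>) \<and> rational_series d (\<lambda>n. int (the_enat (hilb gs A n)))"
  using assms(1,4,5)
proof (induction gs arbitrary: A)
  case (Nil A)
  define z :: "nat \<Rightarrow> nat" where "z = (\<lambda>_. 0)"
  have s: "sub (A n)" for n by (rule family_sub[OF Nil(2)])
  have E0: "gen_span [] z = carrier N" by (simp add: z_def)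
  have h: "hilb [] A n = 0" if "n \<noteq> z" for n
  proof -
    have E: "gen_span [] n = {\<zero>}" using that by (simp add: z_def)
    then have "A n = {\<zero>}" using family_span[OF Nil(2), of n] sub_zero[OF s[of n]] by auto
    then show ?thesis unfolding hilb_def E by (simp add: sq_len_self sub_zero_set)
  qed
  have "hilb [] A z \<le> sq_len R N Z (carrier N)"
    unfolding hilb_def E0
    by (rule sq_len_mono) (use Z(1) s sub_carrier Nil(3) sub_subset[OF s] in \<open>auto simp: z_def\<close>)
  note le = this
  have fin: "hilb [] A z \<noteq> \<infinity>"
  proof
    assume "hilb [] A z = \<infinity>"
    then show False using le Z(2) by simp
  qed
  let ?c = "int (the_enat (hilb [] A z))"
  have "rational_series d (\<lambda>n. ?c * (\<Prod>i\<le>d. comp_count ((\<lambda>_. 0) i) (n i)))"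
    by (rule rational_series.scale[OF rational_series.base])
  then have "rational_series d (\<lambda>n. int (the_enat (hilb [] A n)))"
  proof (rule rational_series.cong)
    fix n assume n: "n \<in> degs d"
    show "?c * (\<Prod>i\<le>d. comp_count ((\<lambda>_. 0) i) (n i)) = int (the_enat (hilb [] A n))"
    proof (cases "n = z")
      case True
      then show ?thesis by (simp add: comp_count_def z_def)
    next
      case False
      then obtain i where i: "n i \<noteq> 0" by (auto simp: z_def fun_eq_iff)
      have "\<forall>j>d. n j = 0" using n by (simp add: degs_def)
      then have "i \<le> d" using i by (metis not_le)
      then have "(\<Prod>i\<le>d. comp_count 0 (n i)) = 0"
        using i by (intro prod_zero bexI[of _ i]) (auto simp: comp_count_def)
      then show ?thesis using h[OF False] by (simp add: zero_enat_def del: prod_zero_iff)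
    qed
  qed
  moreover have "hilb [] A n \<noteq> \<infinity>" for n using h[of n] fin by (cases "n = z") auto
  ultimately show ?case by blast
next
  case (Cons ig gs A)
  obtain i g where ig: "ig = (i, g)" by (cases ig)
  note gs = Cons.prems(1)[unfolded ig] and fA = Cons.prems(2)[unfolded ig] and ZA = Cons.prems(3)
  have g: "g \<in> carrier R" and gs': "gens_in d gs" and id: "i \<le> d" using gs by auto
  let ?D = "fam_colon i g ((i, g) # gs)" and ?E = "gen_span ((i, g) # gs)"
  define F where "F a = (?D ^^ a) A" for a
  have fF: "family ((i, g) # gs) (F a)" for a unfolding F_def by (rule funpow_colon_family[OF gs g fA])
  have FS: "F (Suc a) = ?D (F a)" for a by (simp add: F_def)
  have clE: "g \<odot> v \<in> ?E (raise i n)" if "v \<in> ?E n" for v n by (rule gen_span_head[OF gs that])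
  have clA: "g \<odot> v \<in> A (raise i n)" if "v \<in> A n" for v n
    using family_closed[OF fA, of i g v n] that by simp
  have Fmono: "F a n \<subseteq> F b n" if "a \<le> b" for a b n
    unfolding F_def by (rule funpow_colon_extends[OF gs g fA clA clE that])
  have ZF: "Z \<subseteq> F a (\<lambda>_. 0)" for a using ZA Fmono[of 0 a "\<lambda>_. 0"] by (simp add: F_def)
  define Q where "Q a = fam_trace i g gs (F a)" for a
  have fQ: "family gs (Q a)" for a unfolding Q_def by (rule family_trace[OF gs fF])
  have "F a (\<lambda>_. 0) \<subseteq> Q a (\<lambda>_. 0)" for a
    using family_span[OF fF, of a "\<lambda>_. 0"] by (auto simp: Q_def fam_trace_def gen_span.simps(2)[of i g gs "\<lambda>_. 0"])
  then have ZQ: "Z \<subseteq> Q a (\<lambda>_. 0)" for a using ZF by blast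
  have IH: "hilb gs (Q a) n \<noteq> \<infinity>" "rational_series d (\<lambda>n. int (the_enat (hilb gs (Q a) n)))" for a n
    using Cons.IH[OF gs' fQ ZQ] by blast+
  define h where "h a n = hilb ((i, g) # gs) (F a) n" for a n
  define q where "q a n = hilb gs (Q a) n" for a n
  have h0: "h a n = q a n" if "n i = 0" for a n
    unfolding h_def q_def Q_def by (rule hilb_step_0[of i g gs "F a" n, OF fF that])
  have hS: "h a n = q a n + h (Suc a) (lower i n)" if "n i \<noteq> 0" for a n
    unfolding h_def q_def Q_def FS by (rule hilb_step[of d i g gs "F a" n, OF gs fF that])
  have fin: "h a n \<noteq> \<infinity>" for a n
  proof (induction "n i" arbitrary: n a)
    case 0
    then show ?case using h0[of n a] IH(1)[of a n] by (simp add: q_def)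
  next
    case (Suc m)
    then have "n i \<noteq> 0" "m = lower i n i" by (auto simp: lower_def)
    then show ?case using hS[of n a] IH(1)[of a n] Suc.hyps(1)[of "lower i n" "Suc a"]
      by (simp add: q_def plus_eq_infty_iff_enat)
  qed
  define h' where "h' a n = int (the_enat (h a n))" for a n
  define q' where "q' a n = int (the_enat (q a n))" for a n
  have h'0: "h' a n = q' a n" if "n i = 0" for a n using h0[of n a, OF that] by (simp add: h'_def q'_def)
  have h'S: "h' a n = q' a n + h' (Suc a) (lower i n)" if "n i \<noteq> 0" for a n
    using hS[of n a, OF that] fin[of a n] fin[of "Suc a" "lower i n"] IH(1)[of a n]
    unfolding h'_def q'_def q_def[symmetric] by (cases "q a n"; cases "h (Suc a) (lower i n)") auto
  have q'r: "rational_series d (q' a)" for a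
  proof -
    have "q' a = (\<lambda>n. int (the_enat (hilb gs (Q a) n)))" by (rule ext) (simp add: q'_def q_def)
    then show ?thesis using IH(2)[of a] by simp
  qed
  have "\<exists>t0. \<forall>t\<ge>t0. Q t = Q t0"
  proof (rule family_acc[OF gs'], unfold ascending_def, intro conjI allI fQ)
    show "Q t n \<subseteq> Q (Suc t) n" for t n unfolding Q_def by (rule fam_trace_mono) (rule Fmono, simp)
  qed
  then obtain t where t: "\<And>a. a \<ge> t \<Longrightarrow> Q a = Q t" by blast
  have q't: "q' a = q' t" if "a \<ge> t" for a by (rule ext) (simp add: q'_def q_def t[OF that])
  have sum: "h' a n = (\<Sum>b\<le>n i. q' t (n(i := n i - b)))" if "a \<ge> t" for a n
    using that
  proof (induction "n i" arbitrary: n a)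
    case 0
    then have n: "n i = 0" by simp
    then have "n(i := 0) = n" by (auto simp: fun_eq_iff)
    then show ?case using h'0[of n a, OF n] q't[OF 0(2)] n by simp
  next
    case (Suc m)
    then have n: "n i = Suc m" by simp
    have l: "lower i n i = m" using n by (simp add: lower_def)
    have "h' (Suc a) (lower i n) = (\<Sum>b\<le>m. q' t ((lower i n)(i := m - b)))"
      using Suc.hyps(1)[of "lower i n" "Suc a"] l Suc.prems by simp
    also have "\<dots> = (\<Sum>b\<le>m. q' t (n(i := Suc m - Suc b)))" by (simp add: lower_def)
    finally have "h' a n = q' t n + (\<Sum>b\<le>m. q' t (n(i := Suc m - Suc b)))"
      using h'S[of n a] n q't[OF Suc.prems] by simp
    also have "\<dots> = (\<Sum>b\<le>Suc m. q' t (n(i := Suc m - b)))"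
      unfolding sum.atMost_Suc_shift using n by (simp add: fun_upd_idem)
    finally show ?case using n by simp
  qed
  have "rational_series d (h' a)" if "a \<le> t" for a
    using that
  proof (induction a rule: inc_induct)
    case base
    have "rational_series d (\<lambda>n. \<Sum>b\<le>n i. q' t (n(i := n i - b)))"
      by (rule rational_series_sum[OF q'r id])
    then show ?case by (rule rational_series.cong) (simp add: sum)
  next
    case (step a)
    have "rational_series d (\<lambda>n. q' a n + (if n i = 0 then 0 else h' (Suc a) (lower i n)))"
      by (rule rational_series.add[OF q'r rational_series.shift[OF step.IH id]])
    then show ?case
      by (rule rational_series.cong) (use h'0 h'S in auto)
  qed
  then have "rational_series d (h' 0)" by blast
  then show ?case using fin[of 0] unfolding h'_def h_def F_def ig by simp
qed

end

section \<open>Subquotients annihilated by a sequence of elements\<close>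

definition large_bounded :: "nat \<Rightarrow> ((nat \<Rightarrow> nat) \<Rightarrow> enat) \<Rightarrow> bool" where
  "large_bounded d f \<longleftrightarrow> (\<exists>b. for_large d (\<lambda>n. f n \<le> enat b))"

lemma large_bounded_le:
  assumes "large_bounded d f" "\<And>n. g n \<le> f n"
  shows "large_bounded d g"
proof -
  obtain b where "for_large d (\<lambda>n. f n \<le> enat b)" using assms(1) by (auto simp: large_bounded_def)
  then have "for_large d (\<lambda>n. g n \<le> enat b)"
    by (rule for_large_mono) (use assms(2) order_trans in blast)
  then show ?thesis by (auto simp: large_bounded_def)
qed

lemma large_bounded_add:
  assumes "large_bounded d f" "large_bounded d g"
  shows "large_bounded d (\<lambda>n. f n + g n)"
proof -
  obtain b c where "for_large d (\<lambda>n. f n \<le> enat b)" "for_large d (\<lambda>n. g n \<le> enat c)"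
    using assms by (auto simp: large_bounded_def)
  from for_large_conj[OF this] have "for_large d (\<lambda>n. f n + g n \<le> enat (b + c))"
    by (rule for_large_mono) (metis add_mono plus_enat_simps(1))
  then show ?thesis by (auto simp: large_bounded_def)
qed

context noetherian_module
begin

text \<open>If the generators are those of a family of ideals, the elements of the ideal with index \<open>i\<close> act in
  degree \<open>i\<close>, as linear combinations of its generators.\<close>

definition acts :: "(nat \<times> 'a) list \<Rightarrow> nat \<Rightarrow> 'a \<Rightarrow> bool" where
  "acts gs i x \<longleftrightarrow> x \<in> carrier R \<and> (\<forall>A. family gs A \<longrightarrow> (\<forall>n. \<forall>v\<in>A n. x \<odot> v \<in> A (raise i n)))"

lemma acts_carr: "acts gs i x \<Longrightarrow> x \<in> carrier R"
  and actsD: "acts gs i x \<Longrightarrow> family gs A \<Longrightarrow> v \<in> A n \<Longrightarrow> x \<odot> v \<in> A (raise i n)"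
  by (auto simp: acts_def)

lemma family_gen_span: "gens_in d gs \<Longrightarrow> family gs (gen_span gs)"
  by (rule familyI) (auto intro: sub_gen_span gen_span_closed)

definition fam_mul :: "nat \<Rightarrow> 'a \<Rightarrow> ((nat \<Rightarrow> nat) \<Rightarrow> 'm set) \<Rightarrow> (nat \<Rightarrow> nat) \<Rightarrow> 'm set" where
  "fam_mul i x F n = (if n i = 0 then {\<zero>} else (\<lambda>v. x \<odot> v) ` F (lower i n))"

definition fam_sum :: "((nat \<Rightarrow> nat) \<Rightarrow> 'm set) \<Rightarrow> ((nat \<Rightarrow> nat) \<Rightarrow> 'm set) \<Rightarrow> (nat \<Rightarrow> nat) \<Rightarrow> 'm set" where
  "fam_sum A B n = A n <+> B n"

lemma family_sum:
  assumes gs: "gens_in d gs" and A: "family gs A" and B: "family gs B"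
  shows "family gs (fam_sum A B)"
proof (rule familyI)
  show "sub (fam_sum A B n)" for n
    unfolding fam_sum_def by (rule sub_sum[OF family_sub[OF A] family_sub[OF B]])
  show "v \<in> gen_span gs n" if "v \<in> fam_sum A B n" for v n
    using sum_subset[OF sub_gen_span[OF gs] family_span[OF A, of n] family_span[OF B, of n]] that
    unfolding fam_sum_def by (rule subsetD)
  fix i g n v assume ig: "(i, g) \<in> set gs" and "v \<in> fam_sum A B n"
  then obtain a b where ab: "a \<in> A n" "b \<in> B n" "v = a \<oplus> b" by (auto simp: fam_sum_def elim!: set_addE)
  have g: "g \<in> carrier R" using ig gs by (auto simp: gens_in_def)
  have "g \<odot> v = g \<odot> a \<oplus> g \<odot> b"
    using ab op_add[OF g] sub_carr[OF family_sub[OF A]] sub_carr[OF family_sub[OF B]] by blast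
  then show "g \<odot> v \<in> fam_sum A B (raise i n)"
    using set_addI[OF family_closed[OF A, OF ig ab(1)] family_closed[OF B, OF ig ab(2)]]
    by (simp add: fam_sum_def)
qed

lemma fam_sum_left: "family gs A \<Longrightarrow> family gs B \<Longrightarrow> A n \<subseteq> fam_sum A B n"
  unfolding fam_sum_def
  by (rule subset_sum_left[OF family_sub[of gs B n] sub_subset[OF family_sub[of gs A n]]])

lemma fam_sum_right: "family gs A \<Longrightarrow> family gs B \<Longrightarrow> B n \<subseteq> fam_sum A B n"
  unfolding fam_sum_def
  by (rule subset_sum_right[OF family_sub[of gs A n] sub_subset[OF family_sub[of gs B n]]])

lemma fam_mul_0: "n i = 0 \<Longrightarrow> fam_mul i x F n = {\<zero>}"
  and fam_mul_pos: "n i \<noteq> 0 \<Longrightarrow> fam_mul i x F n = (\<lambda>v. x \<odot> v) ` F (lower i n)"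
  by (simp_all add: fam_mul_def)

lemma fam_mul_raise: "v \<in> F n \<Longrightarrow> x \<odot> v \<in> fam_mul i x F (raise i n)"
  by (simp add: fam_mul_def) (simp add: raise_def)

lemma family_mul:
  assumes gs: "gens_in d gs" and x: "acts gs i x" and F: "family gs F"
  shows "family gs (fam_mul i x F)"
proof (rule familyI)
  note xc = acts_carr[OF x]
  show "sub (fam_mul i x F n)" for n
    unfolding fam_mul_def using sub_zero_set sub_image[OF xc family_sub[OF F]] by simp
  show "v \<in> gen_span gs n" if vF: "v \<in> fam_mul i x F n" for v n
  proof (cases "n i = 0")
    case True
    then show ?thesis using vF sub_zero[OF sub_gen_span[OF gs]] by (simp add: fam_mul_def)
  next
    case False
    then obtain w where w: "w \<in> F (lower i n)" "v = x \<odot> w" using vF by (auto simp: fam_mul_def)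
    have "x \<odot> w \<in> F (raise i (lower i n))" by (rule actsD[OF x F, OF w(1)])
    then show ?thesis using w(2) family_span[OF F, of n] raise_lower[of n i, OF False] by auto
  qed
  fix j g n v assume jg: "(j, g) \<in> set gs" and v: "v \<in> fam_mul i x F n"
  have g: "g \<in> carrier R" using jg gs by (auto simp: gens_in_def)
  show "g \<odot> v \<in> fam_mul i x F (raise j n)"
  proof (cases "n i = 0")
    case True
    then have "v = \<zero>" using v by (simp add: fam_mul_def)
    moreover have "sub (fam_mul i x F (raise j n))"
      unfolding fam_mul_def using sub_zero_set sub_image[OF xc family_sub[OF F]] by simp
    ultimately show ?thesis using op_zero[OF g] sub_zero by simp
  next
    case False
    then obtain w where w: "w \<in> F (lower i n)" "v = x \<odot> w" using v by (auto simp: fam_mul_def)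
    have "g \<odot> w \<in> F (lower i (raise j n))"
      using family_closed[OF F, OF jg w(1)] False by (simp add: raise_lower_commute)
    moreover have "raise j n i \<noteq> 0" using False by (simp add: raise_def)
    moreover have "g \<odot> v = x \<odot> (g \<odot> w)"
      using w smult_commute[OF g xc sub_carr[OF family_sub[OF F] w(1)]] by simp
    ultimately show ?thesis by (simp add: fam_mul_def)
  qed
qed

lemma fam_mul_mono: "(\<And>n. F n \<subseteq> G n) \<Longrightarrow> fam_mul i x F n \<subseteq> fam_mul i x G n"
  by (auto simp: fam_mul_def)

lemma fam_mul_subset:
  assumes "acts gs i x" "family gs F"
  shows "fam_mul i x F n \<subseteq> F n"
proof (cases "n i = 0")
  case True
  then show ?thesis using sub_zero[OF family_sub[OF assms(2)]] by (simp add: fam_mul_def)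
next
  case False
  show ?thesis
  proof
    fix v assume "v \<in> fam_mul i x F n"
    then obtain w where w: "w \<in> F (lower i n)" "v = x \<odot> w" using False by (auto simp: fam_mul_def)
    have "x \<odot> w \<in> F (raise i (lower i n))" by (rule actsD[OF assms, OF w(1)])
    then show "v \<in> F n" using w(2) raise_lower[of n i, OF False] by simp
  qed
qed

lemma family_mul_pow:
  assumes gs: "gens_in d gs" and x: "acts gs i x"
  shows "family gs ((fam_mul i x ^^ c) (gen_span gs))"
proof (induction c)
  case 0
  show ?case using family_gen_span[OF gs] by simp
next
  case (Suc c)
  show ?case unfolding funpow.simps comp_def by (rule family_mul[OF gs x Suc])
qed

text \<open>The powers of \<open>x\<close>: bounding the quotient by \<open>x\<close> bounds those by its powers, since
  multiplication by \<open>x\<close> maps each layer onto the next one.\<close>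

lemma layer_le:
  assumes gs: "gens_in d gs" and x: "acts gs i x" and C: "family gs C" and n: "n i \<noteq> 0"
  defines "G \<equiv> \<lambda>c. fam_sum C ((fam_mul i x ^^ c) (gen_span gs))"
  shows "sq_len R N (G (Suc (Suc c)) n) (G (Suc c) n) \<le> sq_len R N (G (Suc c) (lower i n)) (G c (lower i n))"
proof -
  note xc = acts_carr[OF x] and fP = family_mul_pow[OF gs x]
  let ?P = "\<lambda>c. (fam_mul i x ^^ c) (gen_span gs)"
  have PS: "?P (Suc c) = fam_mul i x (?P c)" for c by simp
  have PSn: "?P (Suc c) n = (\<lambda>v. x \<odot> v) ` ?P c (lower i n)" for c
    unfolding PS using n by (simp add: fam_mul_def)
  have rl: "raise i (lower i n) = n" by (rule raise_lower[of n i, OF n])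
  have fG: "family gs (G c)" for c unfolding G_def by (rule family_sum[OF gs C fP])
  have Gdec: "G (Suc c) m \<subseteq> G c m" for c m
    unfolding G_def fam_sum_def PS by (rule set_add_mono[OF order_refl fam_mul_subset[OF x fP]])
  have CG: "C m \<subseteq> G c m" and PG: "?P c m \<subseteq> G c m" for c m
    unfolding G_def by (rule fam_sum_left[OF C fP], rule fam_sum_right[OF C fP])
  have xG: "x \<odot> v \<in> G (Suc c) n" if v: "v \<in> G c (lower i n)" for v c
  proof -
    from v obtain a p where ap: "a \<in> C (lower i n)" "p \<in> ?P c (lower i n)" "v = a \<oplus> p"
      unfolding G_def fam_sum_def by (rule set_addE)
    have "x \<odot> v = x \<odot> a \<oplus> x \<odot> p"
      using ap op_add[OF xc] sub_carr[OF family_sub[OF C]] sub_carr[OF family_sub[OF fP]] by blast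
    moreover have "x \<odot> a \<in> C n" using actsD[OF x C, OF ap(1)] rl by simp
    moreover have "x \<odot> p \<in> ?P (Suc c) n" unfolding PSn using ap(2) by blast
    ultimately show ?thesis unfolding G_def fam_sum_def using set_addI by simp
  qed
  have "sq_len R N {a \<in> G c (lower i n). x \<odot> a \<in> G (Suc (Suc c)) n} (G c (lower i n))
      = sq_len R N (G (Suc (Suc c)) n) (G (Suc c) n)"
  proof (rule sq_len_smult[OF xc family_sub[OF fG] family_sub[OF fG] family_sub[OF fG] Gdec xG])
    fix a' assume "a' \<in> G (Suc c) n"
    then obtain a p where ap: "a \<in> C n" "p \<in> ?P (Suc c) n" "a' = a \<oplus> p"
      unfolding G_def fam_sum_def by (rule set_addE)
    from ap(2) obtain w where w: "w \<in> ?P c (lower i n)" "p = x \<odot> w" unfolding PSn by blast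
    have "a' = x \<odot> w \<oplus> a"
      using ap w(2) sub_carr[OF family_sub[OF C]] sub_carr[OF family_sub[OF fP]] by (metis M.a_comm)
    then show "\<exists>w\<in>G c (lower i n). \<exists>b\<in>G (Suc (Suc c)) n. a' = x \<odot> w \<oplus> b"
      using w(1) ap(1) CG PG by blast
  qed
  moreover have "sq_len R N {a \<in> G c (lower i n). x \<odot> a \<in> G (Suc (Suc c)) n} (G c (lower i n))
      \<le> sq_len R N (G (Suc c) (lower i n)) (G c (lower i n))"
    by (rule sq_len_mono[OF family_sub[OF fG] sub_preimage[OF xc family_sub[OF fG] family_sub[OF fG]]
        family_sub[OF fG] family_sub[OF fG] _ _ order_refl])
      (use xG[of _ "Suc c"] Gdec[of c "lower i n"] in blast)+
  ultimately show ?thesis by simp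
qed

lemma bounded_power:
  assumes gs: "gens_in d gs" and x: "acts gs i x" and i: "i \<le> d" and C: "family gs C"
    and b: "large_bounded d (hilb gs (fam_sum C (fam_mul i x (gen_span gs))))"
  shows "large_bounded d (hilb gs (fam_sum C ((fam_mul i x ^^ c) (gen_span gs))))"
proof -
  let ?P = "\<lambda>c. (fam_mul i x ^^ c) (gen_span gs)"
  define G where "G c = fam_sum C (?P c)" for c
  note fP = family_mul_pow[OF gs x]
  have fG: "family gs (G c)" for c unfolding G_def by (rule family_sum[OF gs C fP])
  have PS: "?P (Suc c) = fam_mul i x (?P c)" for c by simp
  have Gdec: "G (Suc c) m \<subseteq> G c m" for c m
    unfolding G_def fam_sum_def PS by (rule set_add_mono[OF order_refl fam_mul_subset[OF x fP]])
  have "gen_span gs n \<subseteq> G 0 n" for n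
    unfolding G_def using fam_sum_right[OF C fP[of 0], of n] by simp
  then have G0: "G 0 n = gen_span gs n" for n using family_span[OF fG, of 0 n] by blast
  have layer: "large_bounded d (\<lambda>n. sq_len R N (G (Suc c) n) (G c n))" for c
  proof (induction c)
    case 0
    show ?case using b unfolding G0 hilb_def[abs_def] by (simp add: G_def)
  next
    case (Suc c)
    then obtain b where "for_large d (\<lambda>n. sq_len R N (G (Suc c) n) (G c n) \<le> enat b)"
      by (auto simp: large_bounded_def)
    from for_large_conj[OF for_large_lower[OF this, of i] for_large_ge[of d 1]]
    have "for_large d (\<lambda>n. sq_len R N (G (Suc (Suc c)) n) (G (Suc c) n) \<le> enat b)"
    proof (rule for_large_mono)
      fix n assume *: "sq_len R N (G (Suc c) (lower i n)) (G c (lower i n)) \<le> enat b \<and> (\<forall>i\<le>d. 1 \<le> n i)"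
      then have "n i \<noteq> 0" using i by force
      from layer_le[of d gs i x C n c, OF gs x C this] *
      show "sq_len R N (G (Suc (Suc c)) n) (G (Suc c) n) \<le> enat b" unfolding G_def using order_trans by blast
    qed
    then show ?case by (auto simp: large_bounded_def)
  qed
  have "large_bounded d (hilb gs (G c))" for c
  proof (induction c)
    case 0
    have "hilb gs (G 0) n = 0" for n unfolding hilb_def G0 by (rule sq_len_self[OF sub_gen_span[OF gs]])
    then have "for_large d (\<lambda>n. hilb gs (G 0) n \<le> enat 0)" by (intro for_large_all) (simp add: zero_enat_def[symmetric])
    then show ?case unfolding large_bounded_def by blast
  next
    case (Suc c)
    have "hilb gs (G (Suc c)) n = sq_len R N (G (Suc c) n) (G c n) + hilb gs (G c) n" for n
      unfolding hilb_def
      by (rule sq_len_add[OF family_sub[OF fG] family_sub[OF fG] sub_gen_span[OF gs] Gdec family_span[OF fG]])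
    then show ?case using large_bounded_add[OF layer[of c] Suc] by presburger
  qed
  then show ?thesis by (simp add: G_def)
qed

text \<open>Dividing by \<open>x\<close> one factor at a time moves the condition \<open>w \<in> G\<close> into the colons.\<close>

lemma power_trace:
  assumes gs: "gens_in d gs" and x: "acts gs i x"
  shows "w \<in> (fam_mul i x ^^ k) (gen_span gs) n \<Longrightarrow> w \<in> G n \<Longrightarrow>
    (k = 0 \<Longrightarrow> w \<in> gen_span gs n) \<Longrightarrow> w \<in> (fam_mul i x ^^ k) ((fam_colon i x gs ^^ k) G) n"
proof (induction k arbitrary: w n G)
  case (Suc k)
  have w: "w \<in> fam_mul i x ((fam_mul i x ^^ k) (gen_span gs)) n" using Suc.prems(1) by simp
  have "w \<in> fam_mul i x ((fam_mul i x ^^ k) ((fam_colon i x gs ^^ Suc k) G)) n"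
  proof (cases "n i = 0")
    case True
    then show ?thesis using w by (simp only: fam_mul_0)
  next
    case False
    obtain w' where w': "w' \<in> (fam_mul i x ^^ k) (gen_span gs) (lower i n)" "w = x \<odot> w'"
      using w unfolding fam_mul_pos[of n i, OF False] by blast
    have sp: "w' \<in> gen_span gs (lower i n)"
      using family_span[OF family_mul_pow[OF gs x]] w'(1) by blast
    have "w' \<in> fam_colon i x gs G (lower i n)"
      using Suc.prems(2) w'(2) sp raise_lower[of n i, OF False] by (simp add: fam_colon_def)
    from Suc.IH[of w' "lower i n" "fam_colon i x gs G", OF w'(1) this sp]
    have "w' \<in> (fam_mul i x ^^ k) ((fam_colon i x gs ^^ Suc k) G) (lower i n)"
      unfolding funpow_Suc_right comp_def .
    then show ?thesis unfolding fam_mul_pos[of n i, OF False] using w'(2) by blast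
  qed
  then show ?case unfolding funpow.simps(2)[of k "fam_mul i x"] comp_def .
qed simp

lemma funpow_mul_mono:
  assumes "\<And>n. F n \<subseteq> G n"
  shows "(fam_mul i x ^^ k) F n \<subseteq> (fam_mul i x ^^ k) G n"
proof (induction k arbitrary: n)
  case (Suc k)
  show ?case unfolding funpow.simps comp_def by (rule fam_mul_mono) (rule Suc)
qed (simp add: assms)

lemma mul_colon_subset:
  assumes F: "family gs F"
  shows "fam_mul i x (fam_colon i x gs F) n \<subseteq> F n"
proof (cases "n i = 0")
  case True
  then show ?thesis using sub_zero[OF family_sub[OF F]] by (simp add: fam_mul_def)
next
  case False
  then show ?thesis using raise_lower[of n i, OF False] by (auto simp: fam_mul_def fam_colon_def)
qed

lemma mul_colon_pow_subset:
  assumes gs: "gens_in d gs" and x: "x \<in> carrier R" and B: "family gs B"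
  shows "(fam_mul i x ^^ k) ((fam_colon i x gs ^^ k) B) n \<subseteq> B n"
proof (induction k)
  case (Suc k)
  have "(fam_mul i x ^^ Suc k) ((fam_colon i x gs ^^ Suc k) B) n
      = (fam_mul i x ^^ k) (fam_mul i x (fam_colon i x gs ((fam_colon i x gs ^^ k) B))) n"
    by (simp add: funpow_swap1)
  also have "\<dots> \<subseteq> (fam_mul i x ^^ k) ((fam_colon i x gs ^^ k) B) n"
    by (rule funpow_mul_mono) (rule mul_colon_subset[OF funpow_colon_family[OF gs x B]])
  finally show ?case using Suc by blast
qed simp

text \<open>The colons by the powers of \<open>x\<close> become stationary; from then on, the multiples of the
  power of \<open>x\<close> meet a submodule that \<open>x\<close> maps into \<open>B\<close> only within \<open>B\<close>.\<close>

lemma power_meets_trivially: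
  assumes gs: "gens_in d gs" and x: "acts gs i x" and A: "family gs A" and B: "family gs B"
    and BA: "\<And>n. B n \<subseteq> A n" and xA: "\<And>n v. v \<in> A n \<Longrightarrow> x \<odot> v \<in> B (raise i n)"
  shows "\<exists>c. \<forall>n. A n \<inter> fam_sum B ((fam_mul i x ^^ c) (gen_span gs)) n \<subseteq> B n"
proof -
  note xc = acts_carr[OF x]
  let ?D = "fam_colon i x gs" and ?P = "\<lambda>c. (fam_mul i x ^^ c) (gen_span gs)"
  have fD: "family gs ((?D ^^ k) B)" for k by (rule funpow_colon_family[OF gs xc B])
  have "\<exists>t0. \<forall>t\<ge>t0. (?D ^^ t) B = (?D ^^ t0) B"
  proof (rule family_acc[OF gs], unfold ascending_def, intro conjI allI fD)
    show "(?D ^^ t) B n \<subseteq> (?D ^^ Suc t) B n" for t n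
      by (rule funpow_colon_extends[OF gs xc B actsD[OF x B] actsD[OF x family_gen_span[OF gs]]]) simp_all
  qed
  then obtain c where c: "\<And>t. t \<ge> c \<Longrightarrow> (?D ^^ t) B = (?D ^^ c) B" by blast
  have "A n \<inter> fam_sum B (?P c) n \<subseteq> B n" for n
  proof
    fix a assume "a \<in> A n \<inter> fam_sum B (?P c) n"
    then have aA: "a \<in> A n" and "a \<in> B n <+> ?P c n" by (auto simp: fam_sum_def)
    then obtain b w where bw: "b \<in> B n" "w \<in> ?P c n" "a = b \<oplus> w" by (auto elim!: set_addE)
    have cb: "b \<in> carrier N" "w \<in> carrier N"
      using bw sub_carr[OF family_sub[OF B]] sub_carr[OF family_sub[OF family_mul_pow[OF gs x]]] by blast+
    have "w = \<ominus> b \<oplus> a" using bw cb by (simp add: M.r_neg1)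
    moreover have "\<ominus> b \<oplus> a \<in> A n"
      using aA bw(1) BA sub_add[OF family_sub[OF A]] sub_neg[OF family_sub[OF A]] by blast
    ultimately have wA: "w \<in> A n" by metis
    have wE: "w \<in> gen_span gs n" using family_span[OF A] wA by blast
    have "w \<in> ?D B n" using wE xA[OF wA] by (simp add: fam_colon_def)
    from power_trace[of d gs i x w c n "fam_colon i x gs B", OF gs x bw(2) this wE]
    have "w \<in> (fam_mul i x ^^ c) ((?D ^^ c) (?D B)) n" .
    also have "(?D ^^ c) (?D B) = (?D ^^ c) B" using c[of "Suc c"] by (simp add: funpow_swap1)
    finally have "w \<in> B n" using mul_colon_pow_subset[OF gs xc B] by blast
    then show "a \<in> B n" using bw sub_add[OF family_sub[OF B]] by blast
  qed
  then show ?thesis by blast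
qed

primrec fam_mul_list :: "(nat \<times> 'a) list \<Rightarrow> (nat \<times> 'a) list \<Rightarrow> (nat \<Rightarrow> nat) \<Rightarrow> 'm set" where
  "fam_mul_list gs [] = (\<lambda>n. {\<zero>})"
| "fam_mul_list gs (y # ys) = fam_sum (fam_mul (fst y) (snd y) (gen_span gs)) (fam_mul_list gs ys)"

lemma family_zero: "gens_in d gs \<Longrightarrow> family gs (\<lambda>n. {\<zero>})"
  by (rule familyI) (auto simp: gens_in_def op_zero intro: sub_zero[OF sub_gen_span] sub_zero_set)

lemma family_mul_list:
  assumes gs: "gens_in d gs" and ys: "\<And>y. y \<in> set ys \<Longrightarrow> acts gs (fst y) (snd y)"
  shows "family gs (fam_mul_list gs ys)"
  using ys
proof (induction ys)
  case Nil
  show ?case using family_zero[OF gs] by simp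
next
  case (Cons y ys)
  show ?case unfolding fam_mul_list.simps
    by (intro family_sum[OF gs] family_mul[OF gs] family_gen_span[OF gs] Cons) (simp_all add: Cons.prems)
qed

text \<open>Induction on the sequence, whose first element is \<open>x\<close>. For a suitable power, the submodule
  \<open>P = x\<^sup>cE\<close> of the span \<open>E\<close> satisfies \<open>A \<inter> (B + P) = B\<close>, so that \<open>A/B\<close> is isomorphic to
  \<open>(A + P)/(B + P)\<close>. Modulo \<open>B + P\<close> and the remaining elements the span is still bounded, because
  it is so modulo \<open>B\<close>, \<open>x\<close> and these elements.\<close>

theorem leaf_bounded:
  assumes gs: "gens_in d gs"
    and "\<forall>y\<in>set ys. fst y \<le> d \<and> acts gs (fst y) (snd y)"
    and "family gs A" "family gs B" "\<forall>n. B n \<subseteq> A n"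
    and "\<forall>y\<in>set ys. \<forall>n. \<forall>v\<in>A n. snd y \<odot> v \<in> B (raise (fst y) n)"
    and "large_bounded d (hilb gs (fam_sum B (fam_mul_list gs ys)))"
  shows "large_bounded d (\<lambda>n. sq_len R N (B n) (A n))"
  using assms(2-)
proof (induction ys arbitrary: A B)
  case (Nil A B)
  note A = Nil(2) and B = Nil(3)
  have "fam_sum B (fam_mul_list gs []) n = B n" for n
  proof
    show "fam_sum B (fam_mul_list gs []) n \<subseteq> B n"
      unfolding fam_sum_def fam_mul_list.simps
      by (rule sum_subset[OF family_sub[OF B] order_refl]) (simp add: sub_zero[OF family_sub[OF B]])
    show "B n \<subseteq> fam_sum B (fam_mul_list gs []) n"
      unfolding fam_mul_list.simps by (rule fam_sum_left[OF B family_zero[OF gs]])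
  qed
  then have "large_bounded d (\<lambda>n. sq_len R N (B n) (gen_span gs n))"
    using Nil(6) by (simp add: hilb_def[abs_def])
  then show ?case
    by (rule large_bounded_le)
      (rule sq_len_mono[OF family_sub[OF B] family_sub[OF B] sub_gen_span[OF gs] family_sub[OF A] order_refl
          Nil(4)[rule_format] family_span[OF A]])
next
  case (Cons y ys A B)
  obtain i x where y: "y = (i, x)" by (cases y)
  have i: "i \<le> d" and x: "acts gs i x" using Cons.prems(1) by (auto simp: y)
  have ys: "\<forall>y\<in>set ys. fst y \<le> d \<and> acts gs (fst y) (snd y)" using Cons.prems(1) by auto
  note A = Cons.prems(2) and B = Cons.prems(3) and BA = Cons.prems(4)[rule_format]
  have xA: "x \<odot> v \<in> B (raise i n)" if "v \<in> A n" for v n using Cons.prems(5) that by (auto simp: y)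
  obtain c where c: "\<And>n. A n \<inter> fam_sum B ((fam_mul i x ^^ c) (gen_span gs)) n \<subseteq> B n"
    using power_meets_trivially[OF gs x A B BA xA] by blast
  define P where "P = (fam_mul i x ^^ c) (gen_span gs)"
  define Y where "Y = fam_mul_list gs ys"
  have fP: "family gs P" unfolding P_def by (rule family_mul_pow[OF gs x])
  have fY: "family gs Y" unfolding Y_def by (rule family_mul_list[OF gs]) (use ys in blast)
  have fX: "family gs (fam_mul i x (gen_span gs))" by (rule family_mul[OF gs x family_gen_span[OF gs]])
  let ?B' = "fam_sum B P" and ?A' = "fam_sum A P"
  have fB': "family gs ?B'" and fA': "family gs ?A'" and fBY: "family gs (fam_sum B Y)"
    by (rule family_sum[OF gs B fP], rule family_sum[OF gs A fP], rule family_sum[OF gs B fY])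
  have B'A': "?B' n \<subseteq> ?A' n" for n unfolding fam_sum_def by (rule set_add_mono[OF BA order_refl])
  have fBXY: "family gs (fam_sum B (fam_mul_list gs (y # ys)))"
    unfolding fam_mul_list.simps y fst_conv snd_conv Y_def[symmetric]
    by (rule family_sum[OF gs B family_sum[OF gs fX fY]])
  have fBYX: "family gs (fam_sum (fam_sum B Y) (fam_mul i x (gen_span gs)))"
    by (rule family_sum[OF gs fBY fX])
  have "fam_sum B (fam_mul_list gs (y # ys)) n \<subseteq> fam_sum (fam_sum B Y) (fam_mul i x (gen_span gs)) n" for n
    unfolding fam_mul_list.simps y fst_conv snd_conv Y_def[symmetric] fam_sum_def
    by (rule set_add_swap(1)[OF family_sub[OF B] family_sub[OF fX] family_sub[OF fY]])
  then have "hilb gs (fam_sum (fam_sum B Y) (fam_mul i x (gen_span gs))) n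
      \<le> hilb gs (fam_sum B (fam_mul_list gs (y # ys))) n" for n
    unfolding hilb_def
    by (rule sq_len_mono[OF family_sub[OF fBXY] family_sub[OF fBYX] sub_gen_span[OF gs] sub_gen_span[OF gs]
        _ family_span[OF fBYX] order_refl])
  from bounded_power[OF gs x i fBY large_bounded_le[OF Cons.prems(6) this], of c]
  have 1: "large_bounded d (hilb gs (fam_sum (fam_sum B Y) P))" by (simp add: P_def)
  have fBYP: "family gs (fam_sum (fam_sum B Y) P)" by (rule family_sum[OF gs fBY fP])
  have fB'Y: "family gs (fam_sum ?B' Y)" by (rule family_sum[OF gs fB' fY])
  have "fam_sum (fam_sum B Y) P n \<subseteq> fam_sum ?B' Y n" for n unfolding fam_sum_def
    by (rule set_add_swap(2)[OF family_sub[OF B] family_sub[OF fP] family_sub[OF fY]])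
  then have "hilb gs (fam_sum ?B' Y) n \<le> hilb gs (fam_sum (fam_sum B Y) P) n" for n
    unfolding hilb_def
    by (rule sq_len_mono[OF family_sub[OF fBYP] family_sub[OF fB'Y] sub_gen_span[OF gs] sub_gen_span[OF gs]
        _ family_span[OF fB'Y] order_refl])
  from large_bounded_le[OF 1 this] have 2: "large_bounded d (hilb gs (fam_sum ?B' Y))" .
  have "large_bounded d (\<lambda>n. sq_len R N (?B' n) (?A' n))"
  proof (rule Cons.IH[OF ys fA' fB'])
    show "\<forall>n. ?B' n \<subseteq> ?A' n" using B'A' by blast
    show "large_bounded d (hilb gs (fam_sum ?B' (fam_mul_list gs ys)))" using 2 by (simp add: Y_def)
    show "\<forall>z\<in>set ys. \<forall>n. \<forall>v\<in>?A' n. snd z \<odot> v \<in> ?B' (raise (fst z) n)"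
    proof (intro ballI allI)
      fix z n v assume z: "z \<in> set ys" and "v \<in> ?A' n"
      then obtain a p where ap: "a \<in> A n" "p \<in> P n" "v = a \<oplus> p" by (auto simp: fam_sum_def elim!: set_addE)
      have az: "acts gs (fst z) (snd z)" using ys z by blast
      have "snd z \<odot> v = snd z \<odot> a \<oplus> snd z \<odot> p"
        using ap op_add[OF acts_carr[OF az]] sub_carr[OF family_sub[OF A]] sub_carr[OF family_sub[OF fP]] by blast
      moreover have "snd z \<odot> a \<in> B (raise (fst z) n)" using Cons.prems(5) z ap(1) by auto
      moreover have "snd z \<odot> p \<in> P (raise (fst z) n)" by (rule actsD[OF az fP, OF ap(2)])
      ultimately show "snd z \<odot> v \<in> ?B' (raise (fst z) n)" using set_addI by (simp add: fam_sum_def)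
    qed
  qed
  moreover have "sq_len R N (?B' n) (?A' n) = sq_len R N (B n) (A n)" for n
  proof -
    have "A n \<inter> ?B' n = B n" using c[of n] BA[of n] fam_sum_left[OF B fP, of n] unfolding P_def by blast
    moreover have "sq_len R N (A n \<inter> ?B' n) (A n) = sq_len R N (?B' n) (?A' n)"
    proof (rule sq_len_sum[OF family_sub[OF A] family_sub[OF fA'] family_sub[OF fB'] B'A' fam_sum_left[OF A fP]])
      show "?A' n \<subseteq> A n <+> ?B' n"
        using set_add_mono[OF order_refl fam_sum_right[OF B fP, of n], of "A n"] by (simp add: fam_sum_def)
    qed
    ultimately show ?thesis by simp
  qed
  ultimately show ?case by simp
qed

text \<open>The Hilbert function of such a subquotient is both bounded and a numerical polynomial.\<close>

theorem leaf_constant: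
  assumes gs: "gens_in d gs" and Z: "sub Z" "sq_len R N Z (carrier N) \<noteq> \<infinity>"
    and ys: "\<forall>y\<in>set ys. fst y \<le> d \<and> acts gs (fst y) (snd y)"
    and A: "family gs A" and B: "family gs B" and BA: "\<forall>n. B n \<subseteq> A n" and ZB: "Z \<subseteq> B (\<lambda>_. 0)"
    and yA: "\<forall>y\<in>set ys. \<forall>n. \<forall>v\<in>A n. snd y \<odot> v \<in> B (raise (fst y) n)"
    and b: "large_bounded d (hilb gs (fam_sum B (fam_mul_list gs ys)))"
  shows "\<exists>c. for_large d (\<lambda>n. int (the_enat (sq_len R N (B n) (A n))) = c)"
proof -
  have ZA: "Z \<subseteq> A (\<lambda>_. 0)" using ZB BA by blast
  have finA: "\<And>n. hilb gs A n \<noteq> \<infinity>" and rA: "rational_series d (\<lambda>n. int (the_enat (hilb gs A n)))"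
    using hilb_rational[OF gs Z A ZA] by blast+
  have finB: "\<And>n. hilb gs B n \<noteq> \<infinity>" and rB: "rational_series d (\<lambda>n. int (the_enat (hilb gs B n)))"
    using hilb_rational[OF gs Z B ZB] by blast+
  let ?f = "\<lambda>n. int (the_enat (sq_len R N (B n) (A n)))"
  have eq: "hilb gs B n = sq_len R N (B n) (A n) + hilb gs A n" for n
    unfolding hilb_def using BA
    by (intro sq_len_add family_sub[OF A] family_sub[OF B] sub_gen_span[OF gs] family_span[OF A]) blast
  have diff: "int (the_enat (hilb gs B n)) + (-1) * int (the_enat (hilb gs A n)) = ?f n" for n
    using eq[of n] finA[of n] finB[of n] by (cases "sq_len R N (B n) (A n)"; cases "hilb gs A n") auto
  obtain e e' where "hilbert_coeffs d (\<lambda>n. int (the_enat (hilb gs B n))) e"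
    "hilbert_coeffs d (\<lambda>n. int (the_enat (hilb gs A n))) e'"
    using rational_series_polynomial[OF rA] rational_series_polynomial[OF rB] by blast
  from hilbert_coeffs_add[OF this, of "-1"]
  have e: "hilbert_coeffs d ?f (\<lambda>k. e k + (-1) * e' k)" unfolding diff .
  obtain m where "for_large d (\<lambda>n. sq_len R N (B n) (A n) \<le> enat m)"
    using leaf_bounded[OF gs ys A B BA yA b] by (auto simp: large_bounded_def)
  then have "for_large d (\<lambda>n. \<bar>?f n\<bar> \<le> int m)"
  proof (rule for_large_mono)
    fix n assume "sq_len R N (B n) (A n) \<le> enat m"
    then show "\<bar>?f n\<bar> \<le> int m" by (cases "sq_len R N (B n) (A n)") auto
  qed
  from bounded_polynomial_constant[OF e this] show ?thesis .
qed

end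

section \<open>Noetherian rings and primes\<close>

locale noetherian_cring = noetherian_ring R + cring R for R (structure)
begin

lemma ideal_mem:
  assumes "ideal b R"
  shows "\<zero> \<in> b" "x \<in> b \<Longrightarrow> x \<in> carrier R" "x \<in> b \<Longrightarrow> y \<in> b \<Longrightarrow> x \<oplus> y \<in> b"
    "x \<in> b \<Longrightarrow> \<ominus> x \<in> b" "x \<in> b \<Longrightarrow> r \<in> carrier R \<Longrightarrow> r \<otimes> x \<in> b"
    "x \<in> b \<Longrightarrow> r \<in> carrier R \<Longrightarrow> x \<otimes> r \<in> b"
proof -
  interpret b: ideal b R by fact
  show "\<zero> \<in> b" "x \<in> b \<Longrightarrow> x \<in> carrier R" "x \<in> b \<Longrightarrow> y \<in> b \<Longrightarrow> x \<oplus> y \<in> b"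
    "x \<in> b \<Longrightarrow> \<ominus> x \<in> b" "x \<in> b \<Longrightarrow> r \<in> carrier R \<Longrightarrow> r \<otimes> x \<in> b"
    "x \<in> b \<Longrightarrow> r \<in> carrier R \<Longrightarrow> x \<otimes> r \<in> b"
    by (auto intro: b.I_l_closed b.I_r_closed)
qed

lemma ex_maximal_ideal:
  assumes "S \<noteq> {}" "\<And>b. b \<in> S \<Longrightarrow> ideal b R"
  shows "\<exists>m\<in>S. \<forall>c\<in>S. m \<subseteq> c \<longrightarrow> c = m"
proof (rule subset_Zorn_nonempty[OF assms(1)])
  fix C assume C: "C \<noteq> {}" "subset.chain S C"
  then have "subset.chain {I. ideal I R} C" using assms(2) by (auto simp: pred_on.chain_def)
  then have "\<Union>C \<in> C" by (rule ideal_chain_is_trivial[OF C(1)])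
  then show "\<Union>C \<in> S" using C(2) by (auto simp: pred_on.chain_def)
qed

lemma ideal_acc:
  assumes id: "\<And>t. ideal (C t) R" and asc: "\<And>t. C t \<subseteq> C (Suc t)"
  shows "\<exists>t0::nat. \<forall>t\<ge>t0. C t = C t0"
proof -
  have mono: "C s \<subseteq> C t" if "s \<le> t" for s t using that asc by (rule lift_Suc_mono_le[rotated])
  obtain m where m: "m \<in> range C" "\<forall>c\<in>range C. m \<subseteq> c \<longrightarrow> c = m"
    using ex_maximal_ideal[of "range C"] id by blast
  then obtain t0 where "m = C t0" by blast
  then have "\<forall>t\<ge>t0. C t = C t0" using m(2) mono by blast
  then show ?thesis by blast
qed

lemma proper_in_local:
  assumes loc: "local_ring R nn" and b: "ideal b R" "b \<noteq> carrier R"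
  shows "b \<subseteq> nn"
proof -
  let ?S = "{c. ideal c R \<and> b \<subseteq> c \<and> c \<noteq> carrier R}"
  obtain m where m: "m \<in> ?S" "\<forall>c\<in>?S. m \<subseteq> c \<longrightarrow> c = m"
    using ex_maximal_ideal[of ?S] b by blast
  have "maximalideal m R"
  proof (rule maximalidealI)
    fix c assume "ideal c R" "m \<subseteq> c" "c \<subseteq> carrier R"
    then show "c = m \<or> c = carrier R" using m by blast
  qed (use m in auto)
  then show ?thesis using loc m(1) by (auto simp: local_ring_def)
qed

definition lprod :: "'a list \<Rightarrow> 'a" where
  "lprod as = foldr (\<otimes>) as \<one>"

lemma lprod_simps [simp]: "lprod [] = \<one>" "lprod (a # as) = a \<otimes> lprod as"
  by (simp_all add: lprod_def)

lemma lprod_closed: "set as \<subseteq> carrier R \<Longrightarrow> lprod as \<in> carrier R"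
  by (induction as) auto

lemma lprod_append: "set as \<subseteq> carrier R \<Longrightarrow> set cs \<subseteq> carrier R \<Longrightarrow> lprod (as @ cs) = lprod as \<otimes> lprod cs"
  by (induction as) (auto simp: lprod_closed m_assoc)

text \<open>Primes over \<open>b\<close> whose product lies in \<open>b\<close>; repetitions are allowed.\<close>

definition prime_product :: "'a set \<Rightarrow> 'a set list \<Rightarrow> bool" where
  "prime_product b Ps \<longleftrightarrow> (\<forall>P\<in>set Ps. primeideal P R \<and> b \<subseteq> P) \<and>
     (\<forall>as. list_all2 (\<in>) as Ps \<longrightarrow> lprod as \<in> b)"

lemma list_all2_in_carrier:
  assumes "list_all2 (\<in>) as Ps" "\<forall>P\<in>set Ps. P \<subseteq> carrier R"
  shows "set as \<subseteq> carrier R"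
  using assms by (induction rule: list_all2_induct) auto

text \<open>Take a maximal counterexample \<open>m\<close>. It is not prime, and the products that belong to \<open>m + (x)\<close> and
  \<open>m + (y)\<close> with \<open>xy \<in> m\<close> combine to one for \<open>m\<close>.\<close>

lemma prime_product_exists:
  assumes "ideal b R"
  shows "\<exists>Ps. prime_product b Ps"
proof (rule ccontr)
  assume "\<nexists>Ps. prime_product b Ps"
  then have ne: "{b. ideal b R \<and> (\<nexists>Ps. prime_product b Ps)} \<noteq> {}" using assms by blast
  obtain m where m: "ideal m R" "\<nexists>Ps. prime_product m Ps"
    and max: "\<And>c. ideal c R \<Longrightarrow> m \<subset> c \<Longrightarrow> \<exists>Ps. prime_product c Ps"
    using ex_maximal_ideal[OF ne] by blast
  note mm = ideal_mem[OF m(1)]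
  have "\<one> \<notin> m"
  proof
    assume "\<one> \<in> m"
    then have "prime_product m []" by (simp add: prime_product_def)
    then show False using m(2) by blast
  qed
  have "\<not> primeideal m R"
  proof
    assume p: "primeideal m R"
    have "prime_product m [m]"
      unfolding prime_product_def
    proof (intro conjI allI impI)
      fix as assume "list_all2 (\<in>) as [m]"
      then obtain a where "as = [a]" "a \<in> m" by (auto simp: list_all2_Cons2)
      then show "lprod as \<in> m" using mm(2) by simp
    qed (use p in auto)
    then show False using m(2) by blast
  qed
  then obtain x y where xy: "x \<in> carrier R" "y \<in> carrier R" "x \<otimes> y \<in> m" "x \<notin> m" "y \<notin> m"
    using primeidealI[OF m(1) is_cring] \<open>\<one> \<notin> m\<close> by (metis one_closed)
  have big: "\<exists>Ps. prime_product (m <+> PIdl x) Ps \<and> m \<subseteq> m <+> PIdl x" if x: "x \<in> carrier R" "x \<notin> m" for x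
  proof -
    have id: "ideal (m <+> PIdl x) R" by (rule add_ideals[OF m(1) cgenideal_ideal[OF x(1)]])
    have z: "\<zero> \<in> PIdl x" by (rule ideal_mem(1)[OF cgenideal_ideal[OF x(1)]])
    have "m \<subseteq> m <+> PIdl x"
    proof
      fix a assume "a \<in> m"
      then have "a \<oplus> \<zero> \<in> m <+> PIdl x" using z unfolding set_add_def set_mult_def by auto
      then show "a \<in> m <+> PIdl x" using mm(2) \<open>a \<in> m\<close> by simp
    qed
    moreover have "\<zero> \<oplus> x \<in> m <+> PIdl x"
      using mm(1) cgenideal_self[OF x(1)] unfolding set_add_def set_mult_def by auto
    then have "x \<in> m <+> PIdl x" using x by simp
    ultimately show ?thesis using max[OF id] x(2) by blast
  qed
  obtain Ps where Ps: "prime_product (m <+> PIdl x) Ps" "m \<subseteq> m <+> PIdl x" using big xy by blast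
  obtain Qs where Qs: "prime_product (m <+> PIdl y) Qs" "m \<subseteq> m <+> PIdl y" using big xy by blast
  have carr: "\<forall>P\<in>set Ps. P \<subseteq> carrier R" "\<forall>P\<in>set Qs. P \<subseteq> carrier R"
    using Ps(1) Qs(1) ideal_mem(2) unfolding prime_product_def by (meson primeideal_def subsetI)+
  have "prime_product m (Ps @ Qs)"
    unfolding prime_product_def
  proof (intro conjI allI impI)
    show "\<forall>P\<in>set (Ps @ Qs). primeideal P R \<and> m \<subseteq> P"
    proof
      fix P assume "P \<in> set (Ps @ Qs)"
      then consider "P \<in> set Ps" | "P \<in> set Qs" by auto
      then show "primeideal P R \<and> m \<subseteq> P"
      proof cases
        case 1
        then show ?thesis using Ps(1) subset_trans[OF Ps(2)] by (simp add: prime_product_def)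
      next
        case 2
        then show ?thesis using Qs(1) subset_trans[OF Qs(2)] by (simp add: prime_product_def)
      qed
    qed
    fix cs assume "list_all2 (\<in>) cs (Ps @ Qs)"
    then obtain as bs where ab: "cs = as @ bs" "list_all2 (\<in>) as Ps" "list_all2 (\<in>) bs Qs"
      by (auto simp: list_all2_append2)
    have c: "set as \<subseteq> carrier R" "set bs \<subseteq> carrier R"
      using list_all2_in_carrier ab carr by blast+
    have "lprod as \<in> m <+> PIdl x" "lprod bs \<in> m <+> PIdl y"
      using Ps(1) Qs(1) ab unfolding prime_product_def by blast+
    then obtain u r v s where uv: "u \<in> m" "r \<in> carrier R" "lprod as = u \<oplus> r \<otimes> x"
      "v \<in> m" "s \<in> carrier R" "lprod bs = v \<oplus> s \<otimes> y"
      unfolding set_add_def set_mult_def cgenideal_def by auto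
    have "lprod cs = u \<otimes> lprod bs \<oplus> (r \<otimes> x \<otimes> v \<oplus> (r \<otimes> s) \<otimes> (x \<otimes> y))"
      using uv xy mm(2) lprod_closed[OF c(2)] unfolding ab(1) lprod_append[OF c]
      by (simp add: l_distr r_distr m_ac a_ac)
    moreover have "\<dots> \<in> m"
      using uv xy mm(3,5,6) lprod_closed[OF c(2)] by simp
    ultimately show "lprod cs \<in> m" by simp
  qed
  then show False using m(2) by blast
qed

lemma prime_avoidance_aux:
  assumes I: "ideal I R" and Q: "primeideal Q R" "\<not> I \<subseteq> Q"
    and "finite F" "\<And>P. P \<in> F \<Longrightarrow> primeideal P R \<and> \<not> P \<subseteq> Q"
  shows "\<exists>w\<in>I. w \<notin> Q \<and> (\<forall>P\<in>F. w \<in> P)"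
  using assms(4,5)
proof (induction rule: finite_induct)
  case empty
  then show ?case using Q(2) by auto
next
  case (insert P F)
  then obtain w where w: "w \<in> I" "w \<notin> Q" "\<forall>P\<in>F. w \<in> P" by auto
  obtain b where b: "b \<in> P" "b \<notin> Q" using insert.prems[of P] by auto
  have idP: "ideal P' R" if "P' \<in> insert P F" for P' using insert.prems[OF that] by (simp add: primeideal_def)
  have c: "w \<in> carrier R" "b \<in> carrier R" using ideal_mem(2)[OF I w(1)] ideal_mem(2)[OF idP b(1)] by auto
  have "w \<otimes> b \<notin> Q" using primeideal.I_prime[OF Q(1)] c w(2) b(2) by blast
  moreover have "w \<otimes> b \<in> I" by (rule ideal_mem(6)[OF I w(1) c(2)])
  moreover have "w \<otimes> b \<in> P'" if "P' \<in> insert P F" for P'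
    using ideal_mem(5)[OF idP[OF that], of b w] ideal_mem(6)[OF idP[OF that], of w b] b w c that by auto
  ultimately show ?case by blast
qed

lemma prime_avoidance:
  assumes I: "ideal I R" and "finite F" "\<And>P. P \<in> F \<Longrightarrow> primeideal P R \<and> \<not> I \<subseteq> P"
  shows "\<exists>z\<in>I. \<forall>P\<in>F. z \<notin> P"
  using assms(2,3)
proof (induction rule: finite_psubset_induct)
  case (psubset F)
  show ?case
  proof (cases "F = {}")
    case True
    then show ?thesis using ideal_mem(1)[OF I] by blast
  next
    case False
    then obtain Q where Q: "Q \<in> F" "\<And>P. P \<in> F \<Longrightarrow> P \<subseteq> Q \<Longrightarrow> P = Q"
      using finite_has_minimal[OF psubset.hyps(1)] by blast
    have "F - {Q} \<subset> F" using Q by blast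
    then obtain z where z: "z \<in> I" "\<forall>P\<in>F - {Q}. z \<notin> P" using psubset.IH[of "F - {Q}"] psubset.prems by blast
    show ?thesis
    proof (cases "z \<in> Q")
      case False
      then show ?thesis using z by blast
    next
      case True
      have "\<exists>w\<in>I. w \<notin> Q \<and> (\<forall>P\<in>F - {Q}. w \<in> P)"
      proof (rule prime_avoidance_aux[OF I])
        show "primeideal Q R" "\<not> I \<subseteq> Q" using psubset.prems Q(1) by auto
        show "primeideal P R \<and> \<not> P \<subseteq> Q" if "P \<in> F - {Q}" for P using psubset.prems Q(2)[of P] that by auto
      qed (use psubset.hyps(1) in simp)
      then obtain w where w: "w \<in> I" "w \<notin> Q" "\<forall>P\<in>F - {Q}. w \<in> P" by blast
      have zw: "z \<in> carrier R" "w \<in> carrier R" using z(1) w(1) ideal_mem(2)[OF I] by auto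
      have "z \<oplus> w \<notin> P" if P: "P \<in> F" for P
      proof
        assume s: "z \<oplus> w \<in> P"
        have idP: "ideal P R" using psubset.prems[OF P] by (simp add: primeideal_def)
        show False
        proof (cases "P = Q")
          case True
          then have "\<ominus> z \<oplus> (z \<oplus> w) \<in> Q" using ideal_mem(3,4)[OF idP] s \<open>z \<in> Q\<close> by blast
          then show False using w(2) zw by (simp add: r_neg1)
        next
          case False
          then have "(z \<oplus> w) \<oplus> \<ominus> w \<in> P" using ideal_mem(3,4)[OF idP] s w(3) P by blast
          moreover have "(z \<oplus> w) \<oplus> \<ominus> w = z" using zw by (simp add: a_assoc r_neg)
          ultimately show False using z(2) P False by auto
        qed
      qed
      moreover have "z \<oplus> w \<in> I" by (rule ideal_mem(3)[OF I z(1) w(1)])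
      ultimately show ?thesis by blast
    qed
  qed
qed

lemma quot_prime:
  assumes a: "ideal a R" and P: "primeideal P R" "a \<subseteq> P"
  shows "primeideal ((\<lambda>x. a +> x) ` P) (R Quot a)"
    and "x \<in> carrier R \<Longrightarrow> a +> x \<in> (\<lambda>x. a +> x) ` P \<Longrightarrow> x \<in> P"
proof -
  interpret a: ideal a R by fact
  interpret P: primeideal P R by fact
  have idP: "ideal P R" using P(1) by (simp add: primeideal_def)
  show lift: "x \<in> P" if x: "x \<in> carrier R" "a +> x \<in> (\<lambda>x. a +> x) ` P" for x
  proof -
    obtain p where p: "p \<in> P" "a +> x = a +> p" using x(2) by blast
    have "x \<in> a +> x" using a.a_rcos_self[OF x(1)] .
    then obtain y where "y \<in> a" "x = y \<oplus> p" unfolding p(2) by (auto simp: a_r_coset_def')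
    then show "x \<in> P" using ideal_mem(3)[OF idP] P(2) p(1) by blast
  qed
  show "primeideal ((\<lambda>x. a +> x) ` P) (R Quot a)"
  proof (rule primeidealI)
    show "ideal ((\<lambda>x. a +> x) ` P) (R Quot a)" by (rule ring_ideal_imp_quot_ideal[OF a idP])
    show "cring (R Quot a)" by (rule a.quotient_is_cring[OF is_cring])
    have "a +> \<one> \<notin> (\<lambda>x. a +> x) ` P" using lift[of \<one>] P.I_notcarr P.one_imp_carrier by auto
    moreover have "a +> \<one> \<in> carrier (R Quot a)" by (auto simp: FactRing_def A_RCOSETS_def')
    ultimately show "carrier (R Quot a) \<noteq> (\<lambda>x. a +> x) ` P" by metis
    fix S S' assume S: "S \<in> carrier (R Quot a)" and S': "S' \<in> carrier (R Quot a)"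
      and SS: "S \<otimes>\<^bsub>R Quot a\<^esub> S' \<in> (\<lambda>x. a +> x) ` P"
    obtain x y where xy: "x \<in> carrier R" "S = a +> x" "y \<in> carrier R" "S' = a +> y"
      using S S' by (auto simp: FactRing_def A_RCOSETS_def')
    then have "a +> (x \<otimes> y) \<in> (\<lambda>x. a +> x) ` P" using SS a.rcoset_mult_add[OF xy(1,3)] by (simp add: FactRing_def)
    then have "x \<otimes> y \<in> P" by (rule lift[OF m_closed[OF xy(1,3)]])
    then have "x \<in> P \<or> y \<in> P" by (rule P.I_prime[OF xy(1,3)])
    then show "S \<in> (\<lambda>x. a +> x) ` P \<or> S' \<in> (\<lambda>x. a +> x) ` P" using xy by blast
  qed
qed

text \<open>Primes over \<open>a\<close> correspond to primes of the quotient by \<open>a\<close>.\<close>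

lemma no_prime_chain:
  assumes a: "ideal a R" and dim: "krull_dim (R Quot a) \<le> 1"
    and P: "primeideal P0 R" "primeideal P1 R" "primeideal P2 R" "a \<subseteq> P0" "P0 \<subset> P1" "P1 \<subset> P2"
  shows False
proof -
  let ?q = "\<lambda>P. (\<lambda>x. a +> x) ` P"
  define C where "C i = (if i = 0 then ?q P0 else if i = 1 then ?q P1 else ?q P2)" for i :: nat
  have strict: "?q P \<subset> ?q P'" if h: "primeideal P R" "primeideal P' R" "a \<subseteq> P" "P \<subset> P'" for P P'
  proof -
    obtain x where x: "x \<in> P'" "x \<notin> P" using h(4) by blast
    have "x \<in> carrier R" using x(1) h(2) ideal_mem(2) primeideal_def by blast
    then have "a +> x \<notin> ?q P" using quot_prime(2)[OF a h(1,3)] x(2) by blast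
    then show ?thesis using x(1) h(4) by blast
  qed
  have "primeideal (?q P0) (R Quot a)" "primeideal (?q P1) (R Quot a)" "primeideal (?q P2) (R Quot a)"
    using quot_prime(1)[OF a] P by auto
  then have 1: "\<forall>i\<le>2. primeideal (C i) (R Quot a)" by (simp add: C_def)
  have "?q P0 \<subset> ?q P1" "?q P1 \<subset> ?q P2" using strict P by auto
  then have 2: "\<forall>i<2. C i \<subset> C (Suc i)" by (auto simp: C_def less_2_cases_iff)
  have "ereal (real 2) \<le> krull_dim (R Quot a)"
    unfolding krull_dim_def using 1 2 by (intro Sup_upper CollectI exI[of _ "2::nat"] exI[of _ C] conjI refl)
  then have "ereal (real 2) \<le> 1" using dim order_trans by blast
  then show False by (simp add: one_ereal_def)
qed

text \<open>The factors not inside \<open>P\<close> contribute an element outside \<open>P\<close>, and those that contain \<open>I\<close> leave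
  room for arbitrary elements of \<open>I\<close>.\<close>

lemma product_outside_prime:
  assumes I: "ideal I R" and P: "primeideal P R"
    and "\<forall>Q\<in>set Ps. ideal Q R \<and> (I \<subseteq> Q \<or> \<not> Q \<subseteq> P)"
  shows "\<exists>a\<in>carrier R. a \<notin> P \<and> (\<exists>k. \<forall>cs. length cs = k \<and> set cs \<subseteq> I \<longrightarrow>
    (\<exists>as. list_all2 (\<in>) as Ps \<and> lprod as = a \<otimes> lprod cs))"
  using assms(3)
proof (induction Ps)
  case Nil
  have "\<one> \<notin> P" using primeideal.I_notcarr[OF P] ideal.one_imp_carrier[of P R] P by (auto simp: primeideal_def)
  then show ?case by (intro bexI[of _ \<one>]) (auto intro!: exI[of _ 0])
next
  case (Cons Q Ps)
  then have "\<forall>Q\<in>set Ps. ideal Q R \<and> (I \<subseteq> Q \<or> \<not> Q \<subseteq> P)" by simp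
  from Cons.IH[OF this] obtain a where a: "a \<in> carrier R" "a \<notin> P"
    and ex: "\<exists>k. \<forall>cs. length cs = k \<and> set cs \<subseteq> I \<longrightarrow> (\<exists>as. list_all2 (\<in>) as Ps \<and> lprod as = a \<otimes> lprod cs)"
    by (elim bexE conjE)
  obtain k where k0: "\<forall>cs. length cs = k \<and> set cs \<subseteq> I \<longrightarrow> (\<exists>as. list_all2 (\<in>) as Ps \<and> lprod as = a \<otimes> lprod cs)"
    using ex by (elim exE)
  have k: "\<exists>as. list_all2 (\<in>) as Ps \<and> lprod as = a \<otimes> lprod cs" if "length cs = k" "set cs \<subseteq> I" for cs
    using k0 that by simp
  have cI: "set cs \<subseteq> I \<Longrightarrow> lprod cs \<in> carrier R" for cs
    using ideal_mem(2)[OF I] by (intro lprod_closed) blast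
  show ?case
  proof (cases "I \<subseteq> Q")
    case True
    have "\<exists>as. list_all2 (\<in>) as (Q # Ps) \<and> lprod as = a \<otimes> lprod cs"
      if cs: "length cs = Suc k" "set cs \<subseteq> I" for cs
    proof -
      obtain c cs' where c: "cs = c # cs'" "length cs' = k" using cs(1) by (auto simp: length_Suc_conv)
      then obtain as where as: "list_all2 (\<in>) as Ps" "lprod as = a \<otimes> lprod cs'" using k[of cs'] cs(2) by auto
      have "c \<in> I" "set cs' \<subseteq> I" using cs(2) c by auto
      then have "list_all2 (\<in>) (c # as) (Q # Ps)" "lprod (c # as) = a \<otimes> lprod cs"
        using as True c ideal_mem(2)[OF I, of c] cI[of cs'] a(1) by (auto simp: m_ac)
      then show ?thesis by blast
    qed
    then show ?thesis using a by blast
  next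
    case False
    then obtain b where b: "b \<in> Q" "b \<notin> P" using Cons.prems by auto
    have bc: "b \<in> carrier R" using Cons.prems b(1) ideal_mem(2)[of Q b] by auto
    have "b \<otimes> a \<notin> P" using primeideal.I_prime[OF P bc a(1)] a(2) b(2) by blast
    moreover have "\<exists>as. list_all2 (\<in>) as (Q # Ps) \<and> lprod as = b \<otimes> a \<otimes> lprod cs"
      if cs: "length cs = k" "set cs \<subseteq> I" for cs
    proof -
      obtain as where as: "list_all2 (\<in>) as Ps" "lprod as = a \<otimes> lprod cs" using k[OF cs] by blast
      have "list_all2 (\<in>) (b # as) (Q # Ps)" "lprod (b # as) = b \<otimes> a \<otimes> lprod cs"
        using as b bc a(1) cI[OF cs(2)] by (auto simp: m_assoc)
      then show ?thesis by blast
    qed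
    ultimately show ?thesis using a(1) bc by (intro bexI[of _ "b \<otimes> a"]) auto
  qed
qed

lemma saturated_power:
  assumes I: "ideal I R" and sat: "\<And>a. a \<in> carrier R \<Longrightarrow> (\<And>c. c \<in> I \<Longrightarrow> a \<otimes> c \<in> b) \<Longrightarrow> a \<in> b"
  shows "a \<in> carrier R \<Longrightarrow> \<forall>cs. length cs = k \<and> set cs \<subseteq> I \<longrightarrow> a \<otimes> lprod cs \<in> b \<Longrightarrow> a \<in> b"
proof (induction k arbitrary: a)
  case 0
  then show ?case by simp
next
  case (Suc k)
  show ?case
  proof (rule sat[OF Suc.prems(1)])
    fix c assume c: "c \<in> I"
    then have cc: "c \<in> carrier R" by (rule ideal_mem(2)[OF I])
    show "a \<otimes> c \<in> b"
    proof (rule Suc.IH)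
      show "\<forall>cs. length cs = k \<and> set cs \<subseteq> I \<longrightarrow> a \<otimes> c \<otimes> lprod cs \<in> b"
      proof (intro allI impI)
        fix cs assume cs: "length cs = k \<and> set cs \<subseteq> I"
        then have "a \<otimes> lprod (c # cs) \<in> b" using Suc.prems(2)[rule_format, of "c # cs"] c by simp
        moreover have "set cs \<subseteq> carrier R" using cs ideal_mem(2)[OF I] by blast
        ultimately show "a \<otimes> c \<otimes> lprod cs \<in> b" using Suc.prems(1) cc lprod_closed by (simp add: m_assoc)
      qed
    qed (use Suc.prems(1) cc in simp)
  qed
qed

text \<open>If no element outside \<open>a\<close> is multiplied into \<open>a\<close> by \<open>I\<close>, then the primes of a product in
  \<open>a\<close> that contain \<open>I\<close> can be dropped, and \<open>I\<close> has an element outside the others. In dimension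
  at most one, the primes over \<open>a\<close> and this element are maximal.\<close>

theorem ex_parameter:
  assumes loc: "local_ring R nn" and a: "ideal a R" and I: "ideal I R"
    and dim: "krull_dim (R Quot a) \<le> 1"
    and sat: "\<And>r. r \<in> carrier R \<Longrightarrow> (\<And>c. c \<in> I \<Longrightarrow> r \<otimes> c \<in> a) \<Longrightarrow> r \<in> a"
  shows "\<exists>z\<in>I. \<forall>P. primeideal P R \<longrightarrow> a \<subseteq> P \<longrightarrow> z \<in> P \<longrightarrow> P = nn"
proof -
  obtain Ps where Ps: "\<forall>P\<in>set Ps. primeideal P R \<and> a \<subseteq> P"
    and prod: "\<And>as. list_all2 (\<in>) as Ps \<Longrightarrow> lprod as \<in> a"
    using prime_product_exists[OF a] unfolding prime_product_def by blast
  have "\<exists>z\<in>I. \<forall>P\<in>{P \<in> set Ps. \<not> I \<subseteq> P}. z \<notin> P"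
    by (rule prime_avoidance[OF I]) (use Ps in auto)
  then obtain z where z: "z \<in> I" "\<And>P. P \<in> set Ps \<Longrightarrow> \<not> I \<subseteq> P \<Longrightarrow> z \<notin> P" by blast
  have "P = nn" if P: "primeideal P R" "a \<subseteq> P" "z \<in> P" for P
  proof (rule ccontr)
    assume "P \<noteq> nn"
    have "\<exists>Q\<in>set Ps. \<not> I \<subseteq> Q \<and> Q \<subseteq> P"
    proof (rule ccontr)
      assume no: "\<not> ?thesis"
      have "\<forall>Q\<in>set Ps. ideal Q R \<and> (I \<subseteq> Q \<or> \<not> Q \<subseteq> P)" using no Ps by (auto simp: primeideal_def)
      from product_outside_prime[OF I P(1) this]
      obtain r k where r: "r \<in> carrier R" "r \<notin> P"
        and k: "\<forall>cs. length cs = k \<and> set cs \<subseteq> I \<longrightarrow> (\<exists>as. list_all2 (\<in>) as Ps \<and> lprod as = r \<otimes> lprod cs)"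
        by blast
      have "\<forall>cs. length cs = k \<and> set cs \<subseteq> I \<longrightarrow> r \<otimes> lprod cs \<in> a" using k prod by metis
      then have "r \<in> a"
      proof (rule saturated_power[OF I _ r(1), rotated])
        show "r' \<in> a" if "r' \<in> carrier R" "\<And>c. c \<in> I \<Longrightarrow> r' \<otimes> c \<in> a" for r'
          using that by (rule sat)
      qed
      then show False using r(2) P(2) by blast
    qed
    then obtain Q where Q: "Q \<in> set Ps" "\<not> I \<subseteq> Q" "Q \<subseteq> P" by blast
    then have "Q \<subset> P" using z(2)[OF Q(1,2)] P(3) by blast
    have idP: "ideal P R" "P \<noteq> carrier R" using P(1) primeideal.I_notcarr[OF P(1)] by (auto simp: primeideal_def)
    have "P \<subset> nn" using proper_in_local[OF loc idP] \<open>P \<noteq> nn\<close> by blast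
    moreover have "primeideal nn R" using loc maximalideal_prime by (simp add: local_ring_def)
    ultimately show False using no_prime_chain[OF a dim, of Q P nn] Ps Q(1) P(1) \<open>Q \<subset> P\<close> by blast
  qed
  then show ?thesis using z(1) by blast
qed

end

section \<open>Finitely generated modules over Noetherian rings\<close>

lemma (in module) operator_group: "operator_group R M"
  by unfold_locales (simp_all add: smult_r_distr)

context operator_group
begin

lemma submodule_gen_least: "sub H \<Longrightarrow> S \<subseteq> H \<Longrightarrow> submodule_gen R M S \<subseteq> H"
  by (auto simp: submodule_gen_def)

lemma submodule_gen_mem: "s \<in> S \<Longrightarrow> s \<in> submodule_gen R M S"
  by (auto simp: submodule_gen_def)

lemma sub_submodule_gen:
  assumes "S \<subseteq> carrier M"
  shows "sub (submodule_gen R M S)"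
proof (rule subI)
  show "submodule_gen R M S \<subseteq> carrier M" by (rule submodule_gen_least[OF sub_carrier assms])
qed (use sub_zero sub_neg sub_add sub_op in \<open>simp_all add: submodule_gen_def\<close>)

end

context module
begin

interpretation operator_group R M by (rule operator_group)

lemma colon_ideal:
  assumes H: "sub H" and S: "S \<subseteq> carrier M"
  shows "ideal {r \<in> carrier R. \<forall>v\<in>S. r \<odot>\<^bsub>M\<^esub> v \<in> H} R"
proof (rule idealI)
  let ?K = "{r \<in> carrier R. \<forall>v\<in>S. r \<odot>\<^bsub>M\<^esub> v \<in> H}"
  have c: "v \<in> S \<Longrightarrow> v \<in> carrier M" for v using S by blast
  show "subgroup ?K (add_monoid R)"
  proof (rule subgroup.intro)
    show "x \<otimes>\<^bsub>add_monoid R\<^esub> y \<in> ?K" if "x \<in> ?K" "y \<in> ?K" for x y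
      using that c sub_add[OF H] by (auto simp: smult_l_distr)
    show "\<one>\<^bsub>add_monoid R\<^esub> \<in> ?K" using c sub_zero[OF H] by auto
    show "inv\<^bsub>add_monoid R\<^esub> x \<in> ?K" if "x \<in> ?K" for x
      using that c sub_neg[OF H] smult_l_minus unfolding a_inv_def[symmetric] by auto
  qed auto
  fix a x assume "a \<in> ?K" "x \<in> carrier R"
  then show "x \<otimes> a \<in> ?K" "a \<otimes> x \<in> ?K"
    using c sub_op[OF H, of x] m_comm[of a x] by (auto simp: smult_assoc1)
qed (rule ring_axioms)

primrec list_span :: "'c list \<Rightarrow> 'c set" where
  "list_span [] = {\<zero>\<^bsub>M\<^esub>}"
| "list_span (s # ss) = list_span ss <+>\<^bsub>M\<^esub> (\<lambda>r. r \<odot>\<^bsub>M\<^esub> s) ` carrier R"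

lemma sub_multiples: "s \<in> carrier M \<Longrightarrow> sub ((\<lambda>r. r \<odot>\<^bsub>M\<^esub> s) ` carrier R)"
proof (rule subI)
  assume s: "s \<in> carrier M"
  show "(\<lambda>r. r \<odot>\<^bsub>M\<^esub> s) ` carrier R \<subseteq> carrier M" using s by auto
  show "\<zero>\<^bsub>M\<^esub> \<in> (\<lambda>r. r \<odot>\<^bsub>M\<^esub> s) ` carrier R" using s by (intro image_eqI[of _ _ \<zero>]) auto
  fix a assume "a \<in> (\<lambda>r. r \<odot>\<^bsub>M\<^esub> s) ` carrier R"
  then obtain r where r: "r \<in> carrier R" "a = r \<odot>\<^bsub>M\<^esub> s" by blast
  show "\<ominus>\<^bsub>M\<^esub> a \<in> (\<lambda>r. r \<odot>\<^bsub>M\<^esub> s) ` carrier R"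
    using r s by (intro image_eqI[of _ _ "\<ominus> r"]) (auto simp: smult_l_minus)
  show "t \<odot>\<^bsub>M\<^esub> a \<in> (\<lambda>r. r \<odot>\<^bsub>M\<^esub> s) ` carrier R" if "t \<in> carrier R" for t
    using r s that by (intro image_eqI[of _ _ "t \<otimes> r"]) (auto simp: smult_assoc1)
  fix b assume "b \<in> (\<lambda>r. r \<odot>\<^bsub>M\<^esub> s) ` carrier R"
  then obtain t where t: "t \<in> carrier R" "b = t \<odot>\<^bsub>M\<^esub> s" by blast
  show "a \<oplus>\<^bsub>M\<^esub> b \<in> (\<lambda>r. r \<odot>\<^bsub>M\<^esub> s) ` carrier R"
    using r t s by (intro image_eqI[of _ _ "r \<oplus> t"]) (auto simp: smult_l_distr)
qed

lemma sub_list_span: "set ss \<subseteq> carrier M \<Longrightarrow> sub (list_span ss)"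
  by (induction ss) (auto intro: sub_zero_set sub_sum sub_multiples)

lemma list_span_contains: "set ss \<subseteq> carrier M \<Longrightarrow> set ss \<subseteq> list_span ss"
proof (induction ss)
  case (Cons s ss)
  have sl: "sub (list_span ss)" and sm: "sub ((\<lambda>r. r \<odot>\<^bsub>M\<^esub> s) ` carrier R)"
    using Cons.prems sub_list_span sub_multiples by auto
  have "s \<in> (\<lambda>r. r \<odot>\<^bsub>M\<^esub> s) ` carrier R" using Cons.prems by (intro image_eqI[of _ _ \<one>]) auto
  then have "s \<in> list_span (s # ss)" using subset_sum_right[OF sl sub_subset[OF sm]] by auto
  moreover have "set ss \<subseteq> list_span (s # ss)"
    using subset_sum_left[OF sm sub_subset[OF sl]] Cons by auto
  ultimately show ?case by simp
qed simp

text \<open>Adding one generator \<open>s\<close> at a time, a submodule \<open>C\<close> is determined by its trace on the old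
  span and the ideal of the coefficients of \<open>s\<close> modulo that span.\<close>

lemma list_span_acc:
  assumes R: "noetherian_ring R" and "set ss \<subseteq> carrier M"
    and C: "\<And>t. sub (C t)" "\<And>t. C t \<subseteq> C (Suc t)"
  shows "\<exists>t0::nat. \<forall>t\<ge>t0. C t \<inter> list_span ss = C t0 \<inter> list_span ss"
  using assms(2)
proof (induction ss)
  case Nil
  have "C t \<inter> {\<zero>\<^bsub>M\<^esub>} = {\<zero>\<^bsub>M\<^esub>}" for t using sub_zero[OF C(1)] by auto
  then show ?case by auto
next
  case (Cons s ss)
  interpret noetherian_cring R using R is_cring by (rule noetherian_cring.intro)
  have s: "s \<in> carrier M" and sl: "sub (list_span ss)" using Cons.prems sub_list_span by auto
  have mono: "C t \<subseteq> C t'" if "t \<le> t'" for t t' using that C(2) by (rule lift_Suc_mono_le[rotated])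
  define j where "j t = {r \<in> carrier R. r \<odot>\<^bsub>M\<^esub> s \<in> C t <+>\<^bsub>M\<^esub> list_span ss}" for t
  have sj: "sub (C t <+>\<^bsub>M\<^esub> list_span ss)" for t by (rule sub_sum[OF C(1) sl])
  have idj: "ideal (j t) R" for t using colon_ideal[OF sj, of "{s}" t] s by (simp add: j_def)
  have "j t \<subseteq> j (Suc t)" for t
    using set_add_mono[OF C(2) order_refl] by (auto simp: j_def)
  then obtain t1 where t1: "\<And>t. t \<ge> t1 \<Longrightarrow> j t = j t1" using ideal_acc[of j, OF idj] by blast
  obtain t2 where t2: "\<And>t. t \<ge> t2 \<Longrightarrow> C t \<inter> list_span ss = C t2 \<inter> list_span ss"
    using Cons by auto
  let ?t0 = "max t1 t2"
  have "C t \<inter> list_span (s # ss) = C ?t0 \<inter> list_span (s # ss)" if t: "t \<ge> ?t0" for t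
  proof
    show "C ?t0 \<inter> list_span (s # ss) \<subseteq> C t \<inter> list_span (s # ss)" using mono[OF t] by blast
    show "C t \<inter> list_span (s # ss) \<subseteq> C ?t0 \<inter> list_span (s # ss)"
    proof
      fix v assume v: "v \<in> C t \<inter> list_span (s # ss)"
      then have "v \<in> list_span ss <+>\<^bsub>M\<^esub> (\<lambda>r. r \<odot>\<^bsub>M\<^esub> s) ` carrier R" by simp
      then obtain w r where wr: "w \<in> list_span ss" "r \<in> carrier R" "v = w \<oplus>\<^bsub>M\<^esub> r \<odot>\<^bsub>M\<^esub> s"
        by (auto elim!: set_addE)
      have c: "w \<in> carrier M" "v \<in> carrier M" "r \<odot>\<^bsub>M\<^esub> s \<in> carrier M"
        using wr s sub_carr[OF sl] sub_carr[OF C(1)] v by auto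
      have "r \<odot>\<^bsub>M\<^esub> s = v \<oplus>\<^bsub>M\<^esub> \<ominus>\<^bsub>M\<^esub> w"
        using wr c by (simp add: M.a_comm[of w] M.a_assoc M.r_neg)
      then have "r \<odot>\<^bsub>M\<^esub> s \<in> C t <+>\<^bsub>M\<^esub> list_span ss" using v wr(1) sub_neg[OF sl] set_addI by auto
      then have "r \<in> j t" using wr(2) by (simp add: j_def)
      then have "r \<in> j ?t0" using t1[of t] t1[of ?t0] t by simp
      then obtain x w' where xw: "x \<in> C ?t0" "w' \<in> list_span ss" "r \<odot>\<^bsub>M\<^esub> s = x \<oplus>\<^bsub>M\<^esub> w'"
        by (auto simp: j_def elim!: set_addE)
      have c': "x \<in> carrier M" "w' \<in> carrier M" using xw sub_carr[OF C(1)] sub_carr[OF sl] by blast+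
      have "w \<oplus>\<^bsub>M\<^esub> w' = v \<oplus>\<^bsub>M\<^esub> \<ominus>\<^bsub>M\<^esub> x"
      proof -
        have "v = x \<oplus>\<^bsub>M\<^esub> (w \<oplus>\<^bsub>M\<^esub> w')" using wr xw c c' by (simp add: M.a_ac)
        then show ?thesis using c c' by (simp add: M.a_comm[of x] M.a_assoc M.r_neg)
      qed
      moreover have "v \<oplus>\<^bsub>M\<^esub> \<ominus>\<^bsub>M\<^esub> x \<in> C t"
        using v xw(1) mono[OF t] sub_add[OF C(1)] sub_neg[OF C(1)] by blast
      moreover have "w \<oplus>\<^bsub>M\<^esub> w' \<in> list_span ss" using wr xw sub_add[OF sl] by blast
      ultimately have "w \<oplus>\<^bsub>M\<^esub> w' \<in> C t \<inter> list_span ss" by simp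
      then have "w \<oplus>\<^bsub>M\<^esub> w' \<in> C ?t0" using t2[of t] t2[of ?t0] t by auto
      then have "x \<oplus>\<^bsub>M\<^esub> (w \<oplus>\<^bsub>M\<^esub> w') \<in> C ?t0" using xw(1) sub_add[OF C(1)] by blast
      moreover have "v = x \<oplus>\<^bsub>M\<^esub> (w \<oplus>\<^bsub>M\<^esub> w')" using wr xw c c' by (simp add: M.a_ac)
      ultimately show "v \<in> C ?t0 \<inter> list_span (s # ss)" using v by simp
    qed
  qed
  then show ?case by blast
qed

text \<open>The span of finitely many generators is the whole module.\<close>

lemma fin_gen_noetherian_module:
  assumes "noetherian_ring R" "fin_gen_module R M"
  shows "noetherian_module R M"
proof (unfold_locales)
  fix C :: "nat \<Rightarrow> 'c set" assume C: "\<And>t. sub (C t)" "\<And>t. C t \<subseteq> C (Suc t)"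
  obtain S where S: "finite S" "S \<subseteq> carrier M" "submodule_gen R M S = carrier M"
    using assms(2) by (auto simp: fin_gen_module_def)
  obtain ss where ss: "set ss = S" using finite_list[OF S(1)] by blast
  have "carrier M \<subseteq> list_span ss"
    unfolding S(3)[symmetric]
    by (rule submodule_gen_least) (use sub_list_span list_span_contains ss S(2) in auto)
  then have "C t \<inter> list_span ss = C t" for t using sub_subset[OF C(1)] by blast
  then show "\<exists>t0. \<forall>t\<ge>t0. C t = C t0"
    using list_span_acc[OF assms(1), of ss C] C ss S(2) by simp
qed

end

context noetherian_module
begin

lemma ex_maximal_sub:
  assumes "m0 \<in> S" "\<And>H. H \<in> S \<Longrightarrow> sub H"
  shows "\<exists>m\<in>S. \<forall>c\<in>S. m \<subseteq> c \<longrightarrow> c = m"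
proof (rule ccontr)
  assume "\<not> ?thesis"
  then have "\<forall>m\<in>S. \<exists>c\<in>S. m \<subset> c" by blast
  then obtain f where f: "\<And>m. m \<in> S \<Longrightarrow> f m \<in> S \<and> m \<subset> f m" by metis
  have S: "(f ^^ t) m0 \<in> S" for t by (induction t) (use assms(1) f in auto)
  have "\<exists>t0. \<forall>t\<ge>t0. (f ^^ t) m0 = (f ^^ t0) m0"
    by (rule sub_acc) (use assms(2) S f in auto)
  then obtain t0 where "(f ^^ Suc t0) m0 = (f ^^ t0) m0" by (metis le_SucI order_refl)
  then show False using f[OF S[of t0]] by simp
qed

text \<open>For a maximal \<open>K\<close> violating this, an element of \<open>N/K\<close> with a maximal annihilator generates a simple
  submodule, since that annihilator is prime and hence the maximal ideal.\<close>

theorem finite_length: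
  assumes R: "noetherian_ring R" and nn: "maximalideal nn R" and H: "sub H"
    and primes: "\<And>P. primeideal P R \<Longrightarrow> {r \<in> carrier R. \<forall>v\<in>carrier N. r \<odot> v \<in> H} \<subseteq> P \<Longrightarrow> P = nn"
  shows "sq_len R N H (carrier N) \<noteq> \<infinity>"
proof
  assume inf: "sq_len R N H (carrier N) = \<infinity>"
  interpret RR: noetherian_cring R using R R.is_cring by (rule noetherian_cring.intro)
  let ?S = "{K. sub K \<and> H \<subseteq> K \<and> sq_len R N K (carrier N) = \<infinity>}"
  have "\<exists>m\<in>?S. \<forall>c\<in>?S. m \<subseteq> c \<longrightarrow> c = m"
    by (rule ex_maximal_sub[of H]) (use H inf in auto)
  then obtain K where KS: "K \<in> ?S" and max: "\<forall>c\<in>?S. K \<subseteq> c \<longrightarrow> c = K" by (elim bexE)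
  have K: "sub K" "H \<subseteq> K" "sq_len R N K (carrier N) = \<infinity>" using KS by simp_all
  have Kmax: "sq_len R N c (carrier N) \<noteq> \<infinity>" if c: "sub c" "K \<subset> c" for c
  proof
    assume "sq_len R N c (carrier N) = \<infinity>"
    then have "c \<in> ?S" using c K(2) by auto
    then show False using max c(2) by blast
  qed
  have "K \<noteq> carrier N" using K(3) sq_len_self[OF sub_carrier] by auto
  define ann where "ann v = {r \<in> carrier R. r \<odot> v \<in> K}" for v
  have id: "ideal (ann v) R" if v: "v \<in> carrier N" for v
    using colon_ideal[OF K(1), of "{v}"] v by (simp add: ann_def)
  let ?A = "ann ` (carrier N - K)"
  have "?A \<noteq> {}" using \<open>K \<noteq> carrier N\<close> sub_subset[OF K(1)] by auto
  then have "\<exists>m\<in>?A. \<forall>c\<in>?A. m \<subseteq> c \<longrightarrow> c = m"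
    by (rule RR.ex_maximal_ideal) (use id in blast)
  then obtain m where m: "m \<in> ?A" "\<forall>c\<in>?A. m \<subseteq> c \<longrightarrow> c = m" by (elim bexE)
  then obtain v where v: "v \<in> carrier N" "v \<notin> K" and mv: "m = ann v" by blast
  have vmax: "ann w = ann v" if "w \<in> carrier N" "w \<notin> K" "ann v \<subseteq> ann w" for w
    using m(2) that unfolding mv by blast
  have "primeideal (ann v) R"
  proof (rule primeidealI[OF id[OF v(1)] R.is_cring])
    have "\<one>\<^bsub>R\<^esub> \<notin> ann v" using v by (simp add: ann_def)
    then show "carrier R \<noteq> ann v" by (metis R.one_closed)
    fix a b assume ab: "a \<in> carrier R" "b \<in> carrier R" "a \<otimes>\<^bsub>R\<^esub> b \<in> ann v"
    show "a \<in> ann v \<or> b \<in> ann v"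
    proof (cases "b \<in> ann v")
      case False
      then have bv: "b \<odot> v \<in> carrier N" "b \<odot> v \<notin> K" using ab v by (auto simp: ann_def)
      have "ann v \<subseteq> ann (b \<odot> v)"
        using ab(2) v sub_op[OF K(1) ab(2)] by (auto simp: ann_def smult_commute[OF _ ab(2) v(1)])
      then have "ann (b \<odot> v) = ann v" by (rule vmax[OF bv])
      moreover have "a \<in> ann (b \<odot> v)" using ab v by (simp add: ann_def smult_assoc1)
      ultimately show ?thesis by simp
    qed simp
  qed
  then have annv: "ann v = nn"
    by (rule primes) (use K(2) v in \<open>auto simp: ann_def\<close>)
  let ?m = "(\<lambda>r. r \<odot> v) ` carrier R"
  let ?L = "K <+> ?m"
  have sm: "sub ?m" by (rule sub_multiples[OF v(1)])
  have sL: "sub ?L" by (rule sub_sum[OF K(1) sm])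
  have KL: "K \<subseteq> ?L" by (rule subset_sum_left[OF sm sub_subset[OF K(1)]])
  have "v \<in> ?m" using v by (intro image_eqI[of _ _ "\<one>\<^bsub>R\<^esub>"]) auto
  then have vL: "v \<in> ?L" using subset_sum_right[OF K(1) sub_subset[OF sm]] by blast
  have simple: "C = ?L" if C: "sub C" "K \<subseteq> C" "C \<subseteq> ?L" "C \<noteq> K" for C
  proof -
    obtain c where c: "c \<in> C" "c \<notin> K" using C by blast
    then have "c \<in> ?L" using C by blast
    then obtain h r where hr: "h \<in> K" "r \<in> carrier R" "c = h \<oplus> r \<odot> v" by (auto elim!: set_addE)
    have hc: "h \<in> carrier N" using sub_carr[OF K(1) hr(1)] .
    have "r \<notin> nn"
    proof
      assume "r \<in> nn"
      then have "r \<odot> v \<in> K" using annv by (auto simp: ann_def)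
      then show False using c(2) hr sub_add[OF K(1)] by blast
    qed
    let ?n = "nn <+>\<^bsub>R\<^esub> PIdl\<^bsub>R\<^esub> r"
    have idn: "ideal nn R" using nn by (simp add: maximalideal_def)
    have idp: "ideal (PIdl\<^bsub>R\<^esub> r) R" by (rule R.cgenideal_ideal[OF hr(2)])
    have idnp: "ideal ?n R" by (rule R.add_ideals[OF idn idp])
    have 1: "x \<in> ?n" if "x \<in> nn" for x
    proof -
      have "x \<oplus>\<^bsub>R\<^esub> \<zero>\<^bsub>R\<^esub> \<in> ?n" using that RR.ideal_mem(1)[OF idp] unfolding set_add_def set_mult_def by auto
      then show ?thesis using RR.ideal_mem(2)[OF idn that] by simp
    qed
    have "\<zero>\<^bsub>R\<^esub> \<oplus>\<^bsub>R\<^esub> r \<in> ?n"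
      using RR.ideal_mem(1)[OF idn] R.cgenideal_self[OF hr(2)] unfolding set_add_def set_mult_def by auto
    then have "r \<in> ?n" using hr(2) by simp
    then have "?n = carrier R"
      using maximalideal.I_maximal[OF nn idnp] 1 \<open>r \<notin> nn\<close> RR.ideal_mem(2)[OF idnp] by blast
    then have "\<one>\<^bsub>R\<^esub> \<in> ?n" by simp
    then obtain p s where ps: "p \<in> nn" "s \<in> carrier R" "\<one>\<^bsub>R\<^esub> = p \<oplus>\<^bsub>R\<^esub> s \<otimes>\<^bsub>R\<^esub> r"
      unfolding set_add_def set_mult_def cgenideal_def by auto
    have pc: "p \<in> carrier R" using RR.ideal_mem(2)[OF idn ps(1)] .
    have "v = \<one>\<^bsub>R\<^esub> \<odot> v" using v by simp
    also have "\<dots> = p \<odot> v \<oplus> s \<odot> (r \<odot> v)"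
      unfolding ps(3) using pc ps(2) hr(2) v(1) by (simp add: smult_l_distr smult_assoc1)
    finally have vv: "v = p \<odot> v \<oplus> s \<odot> (r \<odot> v)" .
    have "p \<odot> v \<in> C" using ps(1) annv C(2) by (auto simp: ann_def)
    moreover have "r \<odot> v = \<ominus> h \<oplus> c" using hr hc v(1) by (simp add: M.r_neg1)
    then have "r \<odot> v \<in> C" using c(1) hr(1) C(2) sub_add[OF C(1)] sub_neg[OF C(1)] by auto
    then have "s \<odot> (r \<odot> v) \<in> C" by (rule sub_op[OF C(1) ps(2)])
    ultimately have vC: "v \<in> C" using vv sub_add[OF C(1)] by metis
    have "?m \<subseteq> C" using sub_op[OF C(1) _ vC] by blast
    then have "?L \<subseteq> C" by (rule sum_subset[OF C(1,2)])
    then show ?thesis using C(3) by blast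
  qed
  have "\<not> strict_chain {C. sub C \<and> K \<subseteq> C \<and> C \<subseteq> ?L} 2 C" for C
  proof
    assume ch: "strict_chain {C. sub C \<and> K \<subseteq> C \<and> C \<subseteq> ?L} 2 C"
    have "C i \<in> {C. sub C \<and> K \<subseteq> C \<and> C \<subseteq> ?L}" if "i \<le> 2" for i using ch that by (simp add: strict_chain_def)
    from this[of 0] this[of 1] this[of 2] have m: "K \<subseteq> C 0" "sub (C 1)" "K \<subseteq> C 1" "C 1 \<subseteq> ?L" "C 2 \<subseteq> ?L"
      by simp_all
    have "C i \<subset> C (Suc i)" if "i < 2" for i using ch that by (simp add: strict_chain_def)
    from this[of 0] this[of 1] have "C 0 \<subset> C 1" "C 1 \<subset> C 2" by (simp_all add: numeral_2_eq_2)
    moreover from this have "C 1 = ?L" using simple[OF m(2,3,4)] m(1) by blast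
    ultimately show False using m(5) by blast
  qed
  then have "\<not> enat 2 \<le> sq_len R N K ?L" using sq_len_ge_iff[OF K(1) KL, of 2] by blast
  then have "sq_len R N K ?L \<noteq> \<infinity>" by (metis enat_ord_code(3))
  moreover have "sq_len R N ?L (carrier N) \<noteq> \<infinity>" by (rule Kmax[OF sL]) (use KL vL v(2) in blast)
  moreover have "sq_len R N K (carrier N) = sq_len R N K ?L + sq_len R N ?L (carrier N)"
    by (rule sq_len_add[OF K(1) sL sub_carrier KL sub_subset[OF sL]])
  ultimately show False using K(3) by auto
qed

end

section \<open>Subquotients as modules of cosets\<close>

context operator_group
begin

lemma cosetE: "x \<in> B +> a \<Longrightarrow> (\<And>b. b \<in> B \<Longrightarrow> x = b \<oplus> a \<Longrightarrow> P) \<Longrightarrow> P"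
  by (auto simp: a_r_coset_def')

lemma cosetI: "b \<in> B \<Longrightarrow> b \<oplus> a \<in> B +> a"
  by (auto simp: a_r_coset_def')

lemma coset_self: "sub B \<Longrightarrow> a \<in> carrier M \<Longrightarrow> a \<in> B +> a"
  using cosetI[of \<zero> B a] sub_zero by simp

lemma coset_subset:
  assumes B: "sub B" and c: "a \<in> carrier M" "b \<in> carrier M" and h: "a \<ominus> b \<in> B"
  shows "B +> a \<subseteq> B +> b"
proof
  fix x assume "x \<in> B +> a"
  then obtain k where k: "k \<in> B" "x = k \<oplus> a" by (rule cosetE)
  have kc: "k \<in> carrier M" using sub_carr[OF B k(1)] .
  have "x = (k \<oplus> (a \<ominus> b)) \<oplus> b" using k c kc by (simp add: a_minus_def M.a_assoc M.l_neg)
  then show "x \<in> B +> b" using cosetI sub_add[OF B k(1) h] by simp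
qed

lemma coset_eq_iff:
  assumes B: "sub B" and c: "a \<in> carrier M" "b \<in> carrier M"
  shows "B +> a = B +> b \<longleftrightarrow> a \<ominus> b \<in> B"
proof
  assume "B +> a = B +> b"
  then have "a \<in> B +> b" using coset_self[OF B c(1)] by simp
  then obtain h where h: "h \<in> B" "a = h \<oplus> b" by (rule cosetE)
  have "a \<ominus> b = h" using h c sub_carr[OF B h(1)] by (simp add: a_minus_def M.a_assoc M.r_neg)
  then show "a \<ominus> b \<in> B" using h by simp
next
  assume h: "a \<ominus> b \<in> B"
  have "b \<ominus> a = \<ominus> (a \<ominus> b)" using c by (simp add: a_minus_def M.minus_add M.a_comm)
  then have "b \<ominus> a \<in> B" using sub_neg[OF B h] by simp
  then show "B +> a = B +> b" using coset_subset[OF B c h] coset_subset[OF B c(2,1)] by blast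
qed

lemma coset_zero: "sub B \<Longrightarrow> B +> \<zero> = B"
  using sub_carr by (force elim!: cosetE dest: cosetI[of _ B \<zero>])

lemma coset_eq_self_iff: "sub B \<Longrightarrow> a \<in> carrier M \<Longrightarrow> B +> a = B \<longleftrightarrow> a \<in> B"
  using coset_eq_iff[of B a \<zero>] coset_zero[of B] M.minus_equality[of \<zero> \<zero>] by (simp add: a_minus_def)

lemma coset_sub_iff:
  assumes B: "sub B" and A: "sub A" and BA: "B \<subseteq> A" and a: "a \<in> carrier M"
  shows "B +> a \<subseteq> A \<longleftrightarrow> a \<in> A"
proof
  assume "B +> a \<subseteq> A"
  then show "a \<in> A" using coset_self[OF B a] by blast
next
  assume "a \<in> A"
  then show "B +> a \<subseteq> A" using BA sub_add[OF A] by (blast elim!: cosetE)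
qed

lemma coset_add:
  assumes B: "sub B" and c: "a \<in> carrier M" "b \<in> carrier M"
  shows "(B +> a) <+> (B +> b) = B +> (a \<oplus> b)"
proof
  show "(B +> a) <+> (B +> b) \<subseteq> B +> (a \<oplus> b)"
  proof
    fix x assume "x \<in> (B +> a) <+> (B +> b)"
    then obtain h k where hk: "h \<in> B" "k \<in> B" "x = (h \<oplus> a) \<oplus> (k \<oplus> b)"
      by (auto elim!: set_addE cosetE)
    then have "x = (h \<oplus> k) \<oplus> (a \<oplus> b)" using c sub_carr[OF B] by (simp add: M.a_ac)
    then show "x \<in> B +> (a \<oplus> b)" using cosetI[OF sub_add[OF B hk(1,2)]] by simp
  qed
  show "B +> (a \<oplus> b) \<subseteq> (B +> a) <+> (B +> b)"
  proof
    fix x assume "x \<in> B +> (a \<oplus> b)"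
    then obtain h where h: "h \<in> B" "x = h \<oplus> (a \<oplus> b)" by (rule cosetE)
    then have "x = (h \<oplus> a) \<oplus> b" using c sub_carr[OF B] by (simp add: M.a_assoc)
    then show "x \<in> (B +> a) <+> (B +> b)" using set_addI[OF cosetI[OF h(1)] coset_self[OF B c(2)]] by simp
  qed
qed

lemma coset_smult:
  assumes B: "sub B" and r: "r \<in> carrier R" and c: "a \<in> carrier M"
  shows "(\<Union>x\<in>B +> a. B +> (r \<odot> x)) = B +> (r \<odot> a)"
proof -
  have "B +> (r \<odot> x) = B +> (r \<odot> a)" if "x \<in> B +> a" for x
    using that
  proof (rule cosetE)
    fix h assume h: "h \<in> B" "x = h \<oplus> a"
    have hc: "h \<in> carrier M" using sub_carr[OF B h(1)] .
    have "r \<odot> x \<ominus> r \<odot> a = r \<odot> h" using h hc c r by (simp add: op_add a_minus_def M.a_assoc M.r_neg)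
    then show ?thesis using coset_eq_iff[OF B] sub_op[OF B r h(1)] h(2) hc c r by simp
  qed
  then show ?thesis using coset_self[OF B c] by blast
qed

lemma quot_mod_simps:
  "carrier (quot_mod M A B) = (\<lambda>a. B +> a) ` A" "\<zero>\<^bsub>quot_mod M A B\<^esub> = B"
  "x \<oplus>\<^bsub>quot_mod M A B\<^esub> y = x <+> y"
  "r \<odot>\<^bsub>quot_mod M A B\<^esub> x = (\<Union>x\<in>x. B +> (r \<odot> x))"
  by (simp_all add: quot_mod_def)

lemma quot_operator_group:
  assumes A: "sub A" and B: "sub B"
  shows "operator_group R (quot_mod M A B)"
proof -
  note c = sub_carr[OF A] and q = quot_mod_simps
  note ca = coset_add[OF B]
  have "abelian_group (quot_mod M A B)"
  proof (rule abelian_groupI)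
    fix x y assume "x \<in> carrier (quot_mod M A B)" "y \<in> carrier (quot_mod M A B)"
    then obtain a b where ab: "a \<in> A" "b \<in> A" "x = B +> a" "y = B +> b" by (auto simp: q)
    show "x \<oplus>\<^bsub>quot_mod M A B\<^esub> y \<in> carrier (quot_mod M A B)"
      using ab c sub_add[OF A] by (simp add: q ca)
    show "x \<oplus>\<^bsub>quot_mod M A B\<^esub> y = y \<oplus>\<^bsub>quot_mod M A B\<^esub> x"
      using ab c by (simp add: q ca M.a_comm)
    fix z assume "z \<in> carrier (quot_mod M A B)"
    then obtain e where "e \<in> A" "z = B +> e" by (auto simp: q)
    then show "x \<oplus>\<^bsub>quot_mod M A B\<^esub> y \<oplus>\<^bsub>quot_mod M A B\<^esub> z = x \<oplus>\<^bsub>quot_mod M A B\<^esub> (y \<oplus>\<^bsub>quot_mod M A B\<^esub> z)"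
      using ab c by (simp add: q ca M.a_assoc)
  next
    show z: "\<zero>\<^bsub>quot_mod M A B\<^esub> \<in> carrier (quot_mod M A B)"
      using sub_zero[OF A] coset_zero[OF B] by (auto simp: q intro: image_eqI[of _ _ \<zero>])
    fix x assume "x \<in> carrier (quot_mod M A B)"
    then obtain a where a: "a \<in> A" "x = B +> a" by (auto simp: q)
    show "\<zero>\<^bsub>quot_mod M A B\<^esub> \<oplus>\<^bsub>quot_mod M A B\<^esub> x = x"
      using a c ca[of \<zero> a] coset_zero[OF B] by (simp add: q)
    show "\<exists>y\<in>carrier (quot_mod M A B). y \<oplus>\<^bsub>quot_mod M A B\<^esub> x = \<zero>\<^bsub>quot_mod M A B\<^esub>"
      using a c ca[of "\<ominus> a" a] coset_zero[OF B] sub_neg[OF A a(1)] by (auto simp: q M.l_neg)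
  qed
  then show ?thesis
  proof (rule operator_group.intro, unfold_locales)
    fix r x assume r: "r \<in> carrier R" "x \<in> carrier (quot_mod M A B)"
    then obtain a where a: "a \<in> A" "x = B +> a" by (auto simp: q)
    show "r \<odot>\<^bsub>quot_mod M A B\<^esub> x \<in> carrier (quot_mod M A B)"
      using a r c coset_smult[OF B r(1)] sub_op[OF A r(1)] by (simp add: q)
    fix y assume "y \<in> carrier (quot_mod M A B)"
    then obtain b where b: "b \<in> A" "y = B +> b" by (auto simp: q)
    show "r \<odot>\<^bsub>quot_mod M A B\<^esub> (x \<oplus>\<^bsub>quot_mod M A B\<^esub> y)
      = r \<odot>\<^bsub>quot_mod M A B\<^esub> x \<oplus>\<^bsub>quot_mod M A B\<^esub> r \<odot>\<^bsub>quot_mod M A B\<^esub> y"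
      using a b r c coset_smult[OF B r(1)] ca by (simp add: q op_add)
  qed
qed

lemma set_smult_quot:
  assumes Z: "sub Z" and K: "K \<subseteq> carrier R"
  shows "set_smult R (quot_mod M (carrier M) Z) K = (\<lambda>v. Z +> v) ` set_smult R M K"
proof -
  let ?Q = "quot_mod M (carrier M) Z"
  interpret Q: operator_group R ?Q by (rule quot_operator_group[OF sub_carrier Z])
  note q = quot_mod_simps
  have S: "{a \<odot> m | a m. a \<in> K \<and> m \<in> carrier M} \<subseteq> carrier M" using K by auto
  have sN: "sub (set_smult R M K)" unfolding set_smult_def by (rule sub_submodule_gen[OF S])
  note cN = sub_carr[OF sN]
  have sm: "r \<odot>\<^bsub>?Q\<^esub> (Z +> v) = Z +> (r \<odot> v)" if "r \<in> carrier R" "v \<in> carrier M" for r v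
    using coset_smult[OF Z that] by (simp add: q)
  have ad: "(Z +> v) \<oplus>\<^bsub>?Q\<^esub> (Z +> w) = Z +> (v \<oplus> w)" if "v \<in> carrier M" "w \<in> carrier M" for v w
    using coset_add[OF Z that] by (simp add: q)
  have SQ: "{a \<odot>\<^bsub>?Q\<^esub> m | a m. a \<in> K \<and> m \<in> carrier ?Q} \<subseteq> carrier ?Q" using K Q.op_closed by blast
  have sQ: "submodule (set_smult R ?Q K) R ?Q" unfolding set_smult_def by (rule Q.sub_submodule_gen[OF SQ])
  show ?thesis
  proof
    show "set_smult R ?Q K \<subseteq> (\<lambda>v. Z +> v) ` set_smult R M K"
      unfolding set_smult_def[of R ?Q]
    proof (rule Q.submodule_gen_least)
      show "submodule ((\<lambda>v. Z +> v) ` set_smult R M K) R ?Q"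
      proof (rule hom_image[OF operator_group_axioms Q.operator_group_axioms sub_carrier _ _ sN sub_subset[OF sN]])
        show "\<exists>r\<in>carrier R. \<forall>v\<in>carrier M. Z +> (r \<odot> v) = r' \<odot>\<^bsub>?Q\<^esub> (Z +> v)" if "r' \<in> carrier R" for r'
          using sm that by auto
      qed (simp_all add: ad q(1))
      show "{a \<odot>\<^bsub>?Q\<^esub> m | a m. a \<in> K \<and> m \<in> carrier ?Q} \<subseteq> (\<lambda>v. Z +> v) ` set_smult R M K"
      proof
        fix y assume "y \<in> {a \<odot>\<^bsub>?Q\<^esub> m | a m. a \<in> K \<and> m \<in> carrier ?Q}"
        then obtain a v where av: "a \<in> K" "v \<in> carrier M" "y = a \<odot>\<^bsub>?Q\<^esub> (Z +> v)" by (auto simp: q(1))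
        then have "y = Z +> (a \<odot> v)" using sm K by auto
        moreover have "a \<odot> v \<in> set_smult R M K"
          unfolding set_smult_def by (rule submodule_gen_mem) (use av in blast)
        ultimately show "y \<in> (\<lambda>v. Z +> v) ` set_smult R M K" by blast
      qed
    qed
    have "set_smult R M K \<subseteq> {v \<in> carrier M. Z +> v \<in> set_smult R ?Q K}"
      unfolding set_smult_def[of R M]
    proof (rule submodule_gen_least)
      show "sub {v \<in> carrier M. Z +> v \<in> set_smult R ?Q K}"
      proof (rule hom_preimage[OF operator_group_axioms Q.operator_group_axioms sub_carrier _ _ sQ])
        show "\<exists>r'\<in>carrier R. \<forall>v\<in>carrier M. Z +> (r \<odot> v) = r' \<odot>\<^bsub>?Q\<^esub> (Z +> v)" if "r \<in> carrier R" for r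
          using sm that by auto
      qed (simp_all add: ad q(1))
      show "{a \<odot> m | a m. a \<in> K \<and> m \<in> carrier M} \<subseteq> {v \<in> carrier M. Z +> v \<in> set_smult R ?Q K}"
      proof
        fix y assume "y \<in> {a \<odot> m | a m. a \<in> K \<and> m \<in> carrier M}"
        then obtain a v where av: "a \<in> K" "v \<in> carrier M" "y = a \<odot> v" by auto
        then have "Z +> y = a \<odot>\<^bsub>?Q\<^esub> (Z +> v)" using sm K by auto
        moreover have "a \<odot>\<^bsub>?Q\<^esub> (Z +> v) \<in> set_smult R ?Q K"
          unfolding set_smult_def by (rule Q.submodule_gen_mem) (use av in \<open>auto simp: q(1)\<close>)
        ultimately show "y \<in> {v \<in> carrier M. Z +> v \<in> set_smult R ?Q K}" using av K by auto
      qed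
    qed
    then show "(\<lambda>v. Z +> v) ` set_smult R M K \<subseteq> set_smult R ?Q K" by auto
  qed
qed

end

section \<open>Products of powers of ideals\<close>

lemma raise_eq_add: "raise i n = (\<lambda>j. n j + unit_deg i j)"
  by (auto simp: raise_def unit_deg_def)

locale ideal_system = noetherian_module R N
  for R :: "('a, 'r) ring_scheme" and N :: "('a, 'm, 'z) module_scheme" (structure) +
  fixes I :: "nat \<Rightarrow> 'a set" and d :: nat
  assumes noetherian: "noetherian_ring R" and ideals: "\<And>i. i \<le> d \<Longrightarrow> ideal (I i) R"

sublocale ideal_system \<subseteq> NR: noetherian_cring R
  using noetherian R.is_cring by (rule noetherian_cring.intro)

context ideal_system
begin

interpretation IS: comm_monoid "ideals_set R" by (rule R.ideals_set_is_comm_monoid)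

lemma IS_simps: "x \<in> carrier (ideals_set R) \<longleftrightarrow> ideal x R" "x \<otimes>\<^bsub>ideals_set R\<^esub> y = x \<cdot>\<^bsub>R\<^esub> y"
  "\<one>\<^bsub>ideals_set R\<^esub> = carrier R"
  by (simp_all add: ideals_set_def)

abbreviation mpow :: "(nat \<Rightarrow> nat) \<Rightarrow> 'a set" where "mpow n \<equiv> ideal_mpow R I d n"

lemma pow_closed: "(\<lambda>i. I i [^]\<^bsub>ideals_set R\<^esub> (n i :: nat)) \<in> {..d} \<rightarrow> carrier (ideals_set R)"
  using ideals IS_simps(1) by (auto intro!: IS.nat_pow_closed)

lemma ideal_mpow: "ideal (mpow n) R"
  unfolding ideal_mpow_def IS_simps(1)[symmetric] by (rule IS.finprod_closed[OF pow_closed])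

lemma mpow_add: "mpow (\<lambda>i. u i + v i) = mpow u \<cdot>\<^bsub>R\<^esub> mpow v"
proof -
  have "mpow (\<lambda>i. u i + v i) = finprod (ideals_set R)
      (\<lambda>i. I i [^]\<^bsub>ideals_set R\<^esub> u i \<otimes>\<^bsub>ideals_set R\<^esub> I i [^]\<^bsub>ideals_set R\<^esub> v i) {..d}"
    unfolding ideal_mpow_def
  proof (rule IS.finprod_cong')
    fix i assume "i \<in> {..d}"
    then have "I i \<in> carrier (ideals_set R)" using ideals IS_simps(1) by simp
    then show "I i [^]\<^bsub>ideals_set R\<^esub> (u i + v i) = I i [^]\<^bsub>ideals_set R\<^esub> u i \<otimes>\<^bsub>ideals_set R\<^esub> I i [^]\<^bsub>ideals_set R\<^esub> v i"
      by (simp add: IS.nat_pow_mult)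
  qed (use pow_closed[of u] pow_closed[of v] in \<open>auto simp: Pi_iff\<close>)
  also have "\<dots> = mpow u \<otimes>\<^bsub>ideals_set R\<^esub> mpow v"
    unfolding ideal_mpow_def by (rule IS.finprod_multf[OF pow_closed pow_closed])
  finally show ?thesis by (simp add: IS_simps)
qed

lemma mpow_0: "mpow (\<lambda>_. 0) = carrier R"
  unfolding ideal_mpow_def using IS.finprod_one[of "{..d}"] by (simp add: IS_simps)

lemma mpow_unit:
  assumes "i \<le> d"
  shows "mpow (unit_deg i) = I i"
proof -
  have c: "I j \<in> carrier (ideals_set R)" if "j \<le> d" for j using ideals that IS_simps(1) by simp
  have "mpow (unit_deg i) = finprod (ideals_set R) (\<lambda>j. if i = j then I j else \<one>\<^bsub>ideals_set R\<^esub>) {..d}"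
    unfolding ideal_mpow_def
    by (rule IS.finprod_cong') (use c in \<open>auto simp: unit_deg_def\<close>)
  also have "\<dots> = I i" by (rule IS.finprod_singleton) (use c assms in auto)
  finally show ?thesis .
qed

lemma mpow_raise: "i \<le> d \<Longrightarrow> mpow (raise i n) = mpow n \<cdot>\<^bsub>R\<^esub> I i"
  unfolding raise_eq_add mpow_add by (simp add: mpow_unit)

lemma mpow_mult: "a \<in> mpow u \<Longrightarrow> b \<in> mpow v \<Longrightarrow> a \<otimes>\<^bsub>R\<^esub> b \<in> mpow (\<lambda>i. u i + v i)"
  unfolding mpow_add by (rule ideal_prod.prod)

lemma mpow_carr: "a \<in> mpow n \<Longrightarrow> a \<in> carrier R"
  by (rule NR.ideal_mem(2)[OF ideal_mpow])

lemma mpow_cong: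
  assumes "\<And>i. i \<le> d \<Longrightarrow> u i = v i"
  shows "mpow u = mpow v"
  unfolding ideal_mpow_def
  by (rule IS.finprod_cong') (use assms pow_closed[of v] in auto)

lemma mpow_antimono:
  assumes "\<And>i. i \<le> d \<Longrightarrow> u i \<le> v i"
  shows "mpow v \<subseteq> mpow u"
proof -
  have "mpow v = mpow (\<lambda>i. u i + (v i - u i))" by (rule mpow_cong) (use assms in simp)
  also have "\<dots> \<subseteq> mpow u"
    unfolding mpow_add using R.ideal_prod_inter[OF ideal_mpow ideal_mpow] by blast
  finally show ?thesis .
qed

lemma pow_mpow: "mpow u [^]\<^bsub>ideals_set R\<^esub> (t::nat) = mpow (\<lambda>i. t * u i)"
proof (induction t)
  case 0
  then show ?case by (simp add: mpow_0 IS_simps)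
next
  case (Suc t)
  have "mpow u [^]\<^bsub>ideals_set R\<^esub> Suc t = mpow (\<lambda>i. t * u i) \<cdot>\<^bsub>R\<^esub> mpow u"
    using Suc by (simp add: IS_simps)
  also have "\<dots> = mpow (\<lambda>i. t * u i + u i)" by (rule mpow_add[symmetric])
  finally show ?case by (simp add: add.commute)
qed

definition U :: "(nat \<Rightarrow> nat) \<Rightarrow> 'm set" where
  "U n = set_smult R N (mpow n)"

lemma sub_set_smult: "K \<subseteq> carrier R \<Longrightarrow> sub (set_smult R N K)"
  unfolding set_smult_def by (rule sub_submodule_gen) auto

lemma set_smult_mem: "a \<in> K \<Longrightarrow> v \<in> carrier N \<Longrightarrow> a \<odot> v \<in> set_smult R N K"
  unfolding set_smult_def by (rule submodule_gen_mem) blast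

lemma set_smult_least:
  assumes "sub H" "\<And>a v. a \<in> K \<Longrightarrow> v \<in> carrier N \<Longrightarrow> a \<odot> v \<in> H"
  shows "set_smult R N K \<subseteq> H"
  unfolding set_smult_def by (rule submodule_gen_least) (use assms in auto)

lemma sub_U: "sub (U n)"
  unfolding U_def using ideal_mpow NR.ideal_mem(2) by (intro sub_set_smult) blast

lemma U_mem: "a \<in> mpow n \<Longrightarrow> v \<in> carrier N \<Longrightarrow> a \<odot> v \<in> U n"
  unfolding U_def by (rule set_smult_mem)

lemma U_least: "sub H \<Longrightarrow> (\<And>a v. a \<in> mpow n \<Longrightarrow> v \<in> carrier N \<Longrightarrow> a \<odot> v \<in> H) \<Longrightarrow> U n \<subseteq> H"
  unfolding U_def by (rule set_smult_least)

lemma U_0: "U (\<lambda>_. 0) = carrier N"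
proof
  show "carrier N \<subseteq> U (\<lambda>_. 0)" using U_mem[of "\<one>\<^bsub>R\<^esub>" "\<lambda>_. 0"] by (auto simp: mpow_0)
qed (rule sub_subset[OF sub_U])

lemma U_mult: "a \<in> mpow u \<Longrightarrow> m \<in> U v \<Longrightarrow> a \<odot> m \<in> U (\<lambda>i. u i + v i)"
proof -
  assume a: "a \<in> mpow u" and m: "m \<in> U v"
  have "U v \<subseteq> {m \<in> carrier N. a \<odot> m \<in> U (\<lambda>i. u i + v i)}"
  proof (rule U_least[OF sub_preimage[OF mpow_carr[OF a] sub_carrier sub_U]])
    fix b w assume b: "b \<in> mpow v" and w: "w \<in> carrier N"
    have "a \<odot> (b \<odot> w) = (a \<otimes>\<^bsub>R\<^esub> b) \<odot> w" using a b w mpow_carr by (simp add: smult_assoc1)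
    then show "b \<odot> w \<in> {m \<in> carrier N. a \<odot> m \<in> U (\<lambda>i. u i + v i)}"
      using U_mem[OF mpow_mult[OF a b] w] b w mpow_carr by simp
  qed
  then show ?thesis using m by blast
qed

lemma U_raise_mem: "i \<le> d \<Longrightarrow> a \<in> I i \<Longrightarrow> v \<in> U n \<Longrightarrow> a \<odot> v \<in> U (raise i n)"
  using U_mult[of a "unit_deg i" v n] by (simp add: raise_eq_add mpow_unit add.commute)

lemma U_raise_least:
  assumes i: "i \<le> d" and H: "sub H" and c: "\<And>a v. a \<in> I i \<Longrightarrow> v \<in> U n \<Longrightarrow> a \<odot> v \<in> H"
  shows "U (raise i n) \<subseteq> H"
proof (rule U_least[OF H])
  fix e v assume e: "e \<in> mpow (raise i n)" and v: "v \<in> carrier N"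
  have carr: "b \<in> mpow n \<Longrightarrow> b \<in> carrier R" "a \<in> I i \<Longrightarrow> a \<in> carrier R" for a b
    using mpow_carr NR.ideal_mem(2)[OF ideals[OF i]] by auto
  have "e \<in> mpow n \<cdot>\<^bsub>R\<^esub> I i" using e mpow_raise[OF i] by simp
  then have "e \<in> carrier R \<and> e \<odot> v \<in> H"
  proof (induction rule: ideal_prod.induct)
    case (prod b a)
    have "(b \<otimes>\<^bsub>R\<^esub> a) \<odot> v = a \<odot> (b \<odot> v)"
      using prod carr v by (simp add: smult_assoc1[symmetric] R.m_comm)
    then show ?case using c[OF prod(2) U_mem[OF prod(1) v]] prod carr by simp
  next
    case (sum x y)
    then show ?case using v sub_add[OF H] by (simp add: smult_l_distr)
  qed
  then show "e \<odot> v \<in> H" by simp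
qed

lemma U_antimono: "(\<And>i. i \<le> d \<Longrightarrow> u i \<le> v i) \<Longrightarrow> U v \<subseteq> U u"
  using mpow_antimono[of u v] U_mem by (intro U_least[OF sub_U]) blast

subsection \<open>Generators\<close>

definition generating :: "(nat \<times> 'a) list \<Rightarrow> bool" where
  "generating gs \<longleftrightarrow> gens_in d gs \<and> (\<forall>i\<le>d. I i = Idl\<^bsub>R\<^esub> {g. (i, g) \<in> set gs}) \<and>
     (\<forall>(i, g)\<in>set gs. g \<in> I i)"

lemma ex_generating: "\<exists>gs. generating gs"
proof -
  have "\<exists>S. finite S \<and> S \<subseteq> carrier R \<and> I i = Idl\<^bsub>R\<^esub> S" if "i \<le> d" for i
    using noetherian_ring.finetely_gen[OF noetherian ideals[OF that]] by blast
  then obtain S where S: "\<And>i. i \<le> d \<Longrightarrow> finite (S i) \<and> S i \<subseteq> carrier R \<and> I i = Idl\<^bsub>R\<^esub> (S i)" by metis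
  have "finite (SIGMA i:{..d}. S i)" using S by (intro finite_SigmaI) auto
  then obtain gs where gs: "set gs = (SIGMA i:{..d}. S i)" using finite_list by blast
  have "{g. (i, g) \<in> set gs} = S i" if "i \<le> d" for i using that by (auto simp: gs)
  moreover have "S i \<subseteq> I i" if "i \<le> d" for i using S[OF that] R.genideal_self by auto
  ultimately have "generating gs" using S by (auto simp: generating_def gens_in_def gs subset_iff)
  then show ?thesis by blast
qed

lemma acts_ideal:
  assumes gs: "generating gs" and i: "i \<le> d" and x: "x \<in> I i"
  shows "acts gs i x"
  unfolding acts_def
proof (intro conjI allI ballI impI)
  show "x \<in> carrier R" using NR.ideal_mem(2)[OF ideals[OF i] x] .
  fix A n v assume A: "family gs A" and v: "v \<in> A n"
  have vc: "v \<in> carrier N" using sub_carr[OF family_sub[OF A] v] .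
  note sA = family_sub[OF A, of "raise i n"]
  let ?K = "{r \<in> carrier R. r \<odot> v \<in> A (raise i n)}"
  have "ideal ?K R" using colon_ideal[OF sA, of "{v}"] vc by simp
  moreover have "{g. (i, g) \<in> set gs} \<subseteq> ?K"
  proof
    fix g assume "g \<in> {g. (i, g) \<in> set gs}"
    then have ig: "(i, g) \<in> set gs" by simp
    then have "g \<in> carrier R" using gs by (auto simp: generating_def gens_in_def)
    then show "g \<in> ?K" using family_closed[OF A, OF ig v] by simp
  qed
  ultimately have "Idl\<^bsub>R\<^esub> {g. (i, g) \<in> set gs} \<subseteq> ?K" by (rule R.genideal_minimal)
  then show "x \<odot> v \<in> A (raise i n)" using gs i x by (auto simp: generating_def)
qed

lemma gen_span_subset_U:
  assumes "n \<in> degs d"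
  shows "gens_in d gs \<Longrightarrow> (\<forall>(i, g)\<in>set gs. g \<in> I i) \<Longrightarrow> gen_span gs n \<subseteq> U n"
  using assms
proof (induction gs n rule: gen_span.induct)
  case (1 n)
  then show ?case using sub_zero[OF sub_U[of n]] U_0 by simp
next
  case (2 i g gs n)
  have i: "i \<le> d" and g: "g \<in> I i" and gs: "gens_in d gs" "\<forall>(i, g)\<in>set gs. g \<in> I i"
    using "2.prems" by auto
  show ?case
  proof (cases "n i = 0")
    case True
    then show ?thesis using "2.IH"(1)[OF True gs "2.prems"(3)] by (simp add: gen_span.simps(2)[of i g gs n])
  next
    case False
    have "gen_span ((i, g) # gs) (lower i n) \<subseteq> U (lower i n)"
      by (rule "2.IH"(3)[OF False "2.prems"(1,2) lower_degs[OF "2.prems"(3)]])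
    then have "(\<lambda>v. g \<odot> v) ` gen_span ((i, g) # gs) (lower i n) \<subseteq> U n"
      using U_raise_mem[OF i g, of _ "lower i n"] raise_lower[of n i, OF False] by auto
    then have "gen_span gs n <+> (\<lambda>v. g \<odot> v) ` gen_span ((i, g) # gs) (lower i n) \<subseteq> U n"
      by (rule sum_subset[OF sub_U "2.IH"(2)[OF False gs "2.prems"(3)]])
    then show ?thesis using False by (simp add: gen_span.simps(2)[of i g gs n])
  qed
qed

lemma gen_span_0: "gen_span gs (\<lambda>_. 0) = carrier N"
proof (induction gs)
  case (Cons ig gs)
  then show ?case by (cases ig) (simp add: gen_span.simps(2))
qed simp

text \<open>This applies the results about families to the filtration by products of powers.\<close>

lemma gen_span_eq_U:
  assumes gs: "generating gs" and n: "n \<in> degs d"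
  shows "gen_span gs n = U n"
proof
  have gi: "gens_in d gs" using gs by (simp add: generating_def)
  show "gen_span gs n \<subseteq> U n" by (rule gen_span_subset_U[OF n gi]) (use gs in \<open>simp add: generating_def\<close>)
  show "U n \<subseteq> gen_span gs n"
    using n
  proof (induction "\<Sum>i\<le>d. n i" arbitrary: n rule: less_induct)
    case less
    show ?case
    proof (cases "n = (\<lambda>_. 0)")
      case True
      then show ?thesis using U_0 gen_span_0 by simp
    next
      case False
      then obtain i where i: "n i \<noteq> 0" by auto
      have "\<forall>j>d. n j = 0" using less.prems by (simp add: degs_def)
      then have id: "i \<le> d" using i by (metis not_le)
      have rl: "raise i (lower i n) = n" by (rule raise_lower[of n i, OF i])
      have "(\<Sum>j\<le>d. lower i n j) < (\<Sum>j\<le>d. n j)"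
        by (rule sum_strict_mono_ex1) (use i id in \<open>auto simp: lower_def\<close>)
      then have IH: "U (lower i n) \<subseteq> gen_span gs (lower i n)"
        by (rule less.hyps[OF _ lower_degs[OF less.prems]])
      have "U (raise i (lower i n)) \<subseteq> gen_span gs n"
      proof (rule U_raise_least[OF id sub_gen_span[OF gi]])
        fix a v assume "a \<in> I i" "v \<in> U (lower i n)"
        then show "a \<odot> v \<in> gen_span gs n"
          using actsD[OF acts_ideal[OF gs id] family_gen_span[OF gi], of a v "lower i n"] IH rl by auto
      qed
      then show ?thesis using rl by simp
    qed
  qed
qed

end

section \<open>Bounding the Hilbert function modulo a mixed multiplicity system\<close>

context noetherian_module
begin

lemma fam_mul_list_least:
  assumes "sub H" "\<And>y. y \<in> set ys \<Longrightarrow> fam_mul (fst y) (snd y) (gen_span gs) n \<subseteq> H"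
  shows "fam_mul_list gs ys n \<subseteq> H"
  using assms(2)
proof (induction ys)
  case Nil
  then show ?case using sub_zero[OF assms(1)] by simp
next
  case (Cons y ys)
  have "fam_mul_list gs (y # ys) n = fam_mul (fst y) (snd y) (gen_span gs) n <+> fam_mul_list gs ys n"
    by (simp add: fam_sum_def)
  also have "\<dots> \<subseteq> H" by (rule sum_subset[OF assms(1) Cons.prems Cons.IH[OF Cons.prems]]) simp_all
  finally show ?case .
qed

lemma fam_mul_list_mem:
  assumes gs: "gens_in d gs" and ys: "\<And>y. y \<in> set ys \<Longrightarrow> acts gs (fst y) (snd y)" and y: "y \<in> set ys"
  shows "fam_mul (fst y) (snd y) (gen_span gs) n \<subseteq> fam_mul_list gs ys n"
  using ys y
proof (induction ys)
  case (Cons z ys)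
  have f1: "family gs (fam_mul (fst z) (snd z) (gen_span gs))"
    by (rule family_mul[OF gs Cons.prems(1) family_gen_span[OF gs]]) simp
  have f2: "family gs (fam_mul_list gs ys)" by (rule family_mul_list[OF gs Cons.prems(1)]) simp
  show ?case
  proof (cases "y = z")
    case True
    then show ?thesis using fam_sum_left[OF f1 f2, of n] by simp
  next
    case False
    then have "y \<in> set ys" using Cons.prems(2) by simp
    then have "fam_mul (fst y) (snd y) (gen_span gs) n \<subseteq> fam_mul_list gs ys n"
      using Cons.IH Cons.prems(1) by simp
    then show ?thesis using fam_sum_right[OF f1 f2, of n] by simp
  qed
qed simp

lemma gen_span_outside:
  "gens_in d gs \<Longrightarrow> n \<notin> degs d \<Longrightarrow> gen_span gs n = {\<zero>}"
proof (induction gs n rule: gen_span.induct)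
  case (1 n)
  then show ?case by (auto simp: degs_def)
next
  case (2 i g gs n)
  have i: "i \<le> d" and g: "g \<in> carrier R" and gs: "gens_in d gs" using "2.prems" by auto
  show ?case
  proof (cases "n i = 0")
    case True
    then show ?thesis using "2.IH"(1)[OF True gs "2.prems"(2)] by (simp add: gen_span.simps(2)[of i g gs n])
  next
    case False
    have "lower i n \<notin> degs d" using raise_degs[of "lower i n" d i] i "2.prems"(2) raise_lower[of n i, OF False] by auto
    then have "gen_span ((i, g) # gs) (lower i n) = {\<zero>}" by (rule "2.IH"(3)[OF False "2.prems"(1)])
    then show ?thesis using "2.IH"(2)[OF False gs "2.prems"(2)] False
      by (simp add: gen_span.simps(2)[of i g gs n] set_add_def set_mult_def op_zero[OF g])
  qed
qed

end

context ideal_system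
begin

text \<open>The denominators of the associated graded module. Families vanish outside the multidegrees,
  hence the span and not the products of powers.\<close>

definition den :: "(nat \<times> 'a) list \<Rightarrow> (nat \<Rightarrow> nat) \<Rightarrow> 'm set" where
  "den gs n = gen_span gs (raise 0 n)"

lemma den_eq: "generating gs \<Longrightarrow> n \<in> degs d \<Longrightarrow> den gs n = U (raise 0 n)"
  unfolding den_def by (rule gen_span_eq_U) auto

lemma family_den:
  assumes gs: "generating gs"
  shows "family gs (den gs)"
proof (rule familyI)
  have gi: "gens_in d gs" using gs by (simp add: generating_def)
  show "sub (den gs n)" for n unfolding den_def by (rule sub_gen_span[OF gi])
  show "v \<in> gen_span gs n" if "v \<in> den gs n" for v n
  proof (cases "n \<in> degs d")
    case True
    have "U (raise 0 n) \<subseteq> U n" by (rule U_antimono) (simp add: raise_def)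
    then show ?thesis using that den_eq[OF gs True] gen_span_eq_U[OF gs True] by auto
  next
    case False
    then have "raise 0 n \<notin> degs d" using lower_degs[of "raise 0 n" d 0] by auto
    then have "v = \<zero>" using that gen_span_outside[OF gi] by (simp add: den_def)
    then show ?thesis using sub_zero[OF sub_gen_span[OF gi]] by simp
  qed
  show "g \<odot> v \<in> den gs (raise i n)" if "(i, g) \<in> set gs" "v \<in> den gs n" for i g n v
    using gen_span_closed[OF gi that(1), of v "raise 0 n"] that(2) by (simp add: den_def raise_commute[of 0 i])
qed

text \<open>The condition on a Rees superficial element of \<open>N/Z\<close>, pulled back to \<open>N\<close>.\<close>

lemma superficial_step:
  assumes Z: "sub Z" and s: "rees_superficial R I d (quot_mod N (carrier N) Z) (i, a)"
  shows "i \<le> d" "a \<in> I i"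
    "for_large d (\<lambda>n. \<forall>v\<in>carrier N. a \<odot> v \<in> U (raise i n) <+> Z \<longrightarrow> (\<exists>w\<in>U n. a \<odot> v \<ominus> a \<odot> w \<in> Z))"
proof -
  let ?Q = "quot_mod N (carrier N) Z"
  show i: "i \<le> d" and a: "a \<in> I i" using s by (auto simp: rees_superficial_def)
  have ac: "a \<in> carrier R" using NR.ideal_mem(2)[OF ideals[OF i] a] .
  have sm: "a \<odot>\<^bsub>?Q\<^esub> (Z +> v) = Z +> (a \<odot> v)" if "v \<in> carrier N" for v
    using coset_smult[OF Z ac that] by (simp add: quot_mod_simps)
  have cQ: "carrier ?Q = (\<lambda>v. Z +> v) ` carrier N" by (simp add: quot_mod_simps)
  have sQ: "set_smult R ?Q (mpow n) = (\<lambda>v. Z +> v) ` U n" for n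
    unfolding U_def by (rule set_smult_quot[OF Z]) (use mpow_carr in blast)
  have "for_large d (\<lambda>n. ((\<lambda>m. a \<odot>\<^bsub>?Q\<^esub> m) ` carrier ?Q) \<inter> set_smult R ?Q (mpow n \<cdot>\<^bsub>R\<^esub> I i)
       = (\<lambda>m. a \<odot>\<^bsub>?Q\<^esub> m) ` set_smult R ?Q (mpow n))"
    using s by (simp add: rees_superficial_def)
  then show "for_large d (\<lambda>n. \<forall>v\<in>carrier N. a \<odot> v \<in> U (raise i n) <+> Z \<longrightarrow> (\<exists>w\<in>U n. a \<odot> v \<ominus> a \<odot> w \<in> Z))"
  proof (rule for_large_mono)
    fix n assume eq: "((\<lambda>m. a \<odot>\<^bsub>?Q\<^esub> m) ` carrier ?Q) \<inter> set_smult R ?Q (mpow n \<cdot>\<^bsub>R\<^esub> I i)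
       = (\<lambda>m. a \<odot>\<^bsub>?Q\<^esub> m) ` set_smult R ?Q (mpow n)"
    show "\<forall>v\<in>carrier N. a \<odot> v \<in> U (raise i n) <+> Z \<longrightarrow> (\<exists>w\<in>U n. a \<odot> v \<ominus> a \<odot> w \<in> Z)"
    proof (intro ballI impI)
      fix v assume v: "v \<in> carrier N" and av: "a \<odot> v \<in> U (raise i n) <+> Z"
      obtain u x where ux: "u \<in> U (raise i n)" "x \<in> Z" "a \<odot> v = u \<oplus> x" using av by (rule set_addE)
      have uc: "u \<in> carrier N" "x \<in> carrier N" using ux sub_carr[OF sub_U] sub_carr[OF Z] by blast+
      have "a \<odot> v \<ominus> u = x" unfolding ux(3) using uc by (simp add: a_minus_def M.a_comm[of u x] M.a_assoc M.r_neg)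
      then have "Z +> (a \<odot> v) = Z +> u" using coset_eq_iff[OF Z _ uc(1), of "a \<odot> v"] ac v ux(2) by simp
      then have "Z +> (a \<odot> v) \<in> set_smult R ?Q (mpow n \<cdot>\<^bsub>R\<^esub> I i)"
        using sQ[of "raise i n"] ux(1) mpow_raise[OF i, of n] by auto
      moreover have "Z +> (a \<odot> v) \<in> (\<lambda>m. a \<odot>\<^bsub>?Q\<^esub> m) ` carrier ?Q"
        using sm[OF v] v cQ by (metis imageI)
      ultimately have "Z +> (a \<odot> v) \<in> (\<lambda>m. a \<odot>\<^bsub>?Q\<^esub> m) ` set_smult R ?Q (mpow n)" using eq by blast
      then obtain w where w: "w \<in> U n" "Z +> (a \<odot> v) = a \<odot>\<^bsub>?Q\<^esub> (Z +> w)" unfolding sQ by blast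
      have wc: "w \<in> carrier N" using sub_carr[OF sub_U w(1)] .
      have "a \<odot> v \<ominus> a \<odot> w \<in> Z" using coset_eq_iff[OF Z, of "a \<odot> v" "a \<odot> w"] w(2) sm[OF wc] ac v wc by simp
      then show "\<exists>w\<in>U n. a \<odot> v \<ominus> a \<odot> w \<in> Z" using w(1) by blast
    qed
  qed
qed

lemma superficial_seq_mem:
  assumes s: "rees_superficial_seq R I d N xs" and y: "y \<in> set xs"
  shows "fst y \<le> d" "snd y \<in> I (fst y)"
proof -
  obtain j where "j < length xs" "xs ! j = y" using y by (auto simp: in_set_conv_nth)
  then have "rees_superficial R I d (quot_mod N (carrier N) (seq_smult R N (take j xs))) y"
    using s unfolding rees_superficial_seq_def by blast
  then show "fst y \<le> d" "snd y \<in> I (fst y)" by (auto simp: rees_superficial_def split: prod.splits)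
qed

lemma sub_seq_smult:
  assumes "\<forall>y\<in>set ys. fst y \<le> d \<and> snd y \<in> I (fst y)"
  shows "sub (seq_smult R N ys)"
  unfolding seq_smult_def by (rule sub_set_smult) (use assms NR.ideal_mem(2)[OF ideals] in blast)

text \<open>An element of the intersection is a multiple \<open>av\<close> by the last element of the sequence, modulo
  the submodule \<open>Z\<close> that the previous ones generate. As \<open>a\<close> is superficial for \<open>N/Z\<close>, one may choose
  \<open>v\<close> in the power one degree below; what remains lies in \<open>Z\<close> and in the same power, where the
  induction hypothesis applies.\<close>

lemma superficial_trace:
  assumes gs: "generating gs" and s: "rees_superficial_seq R I d N xs" and j: "j \<le> length xs"
  shows "for_large d (\<lambda>n. seq_smult R N (take j xs) \<inter> U n \<subseteq> fam_mul_list gs (take j xs) n)"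
  using j
proof (induction j)
  case 0
  have "seq_smult R N [] \<subseteq> {\<zero>}"
    unfolding seq_smult_def by (rule set_smult_least[OF sub_zero_set]) simp
  then show ?case by (intro for_large_all) auto
next
  case (Suc j)
  have gi: "gens_in d gs" using gs by (simp add: generating_def)
  let ?T = "take j xs" and ?T' = "take (Suc j) xs"
  obtain i a where ia: "xs ! j = (i, a)" by (cases "xs ! j")
  have T': "?T' = ?T @ [(i, a)]" using Suc.prems ia by (simp add: take_Suc_conv_app_nth)
  have mem: "\<forall>y\<in>set ys. fst y \<le> d \<and> snd y \<in> I (fst y)" if "set ys \<subseteq> set xs" for ys
    using superficial_seq_mem[OF s] that by blast
  have sT: "sub (seq_smult R N ?T)" by (rule sub_seq_smult[OF mem[OF set_take_subset]])
  have "rees_superficial R I d (quot_mod N (carrier N) (seq_smult R N ?T)) (i, a)"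
    using s Suc.prems ia unfolding rees_superficial_seq_def by (metis Suc_le_lessD)
  note st = superficial_step[OF sT this]
  have ac: "a \<in> carrier R" using NR.ideal_mem(2)[OF ideals[OF st(1)] st(2)] .
  have actsT: "acts gs (fst y) (snd y)" if "y \<in> set ?T'" for y
    using mem[OF set_take_subset, of "Suc j"] that acts_ideal[OF gs] by blast
  have sY: "sub (fam_mul_list gs ?T' n)" for n by (rule family_sub[OF family_mul_list[OF gi actsT]])
  have YY: "fam_mul_list gs ?T n \<subseteq> fam_mul_list gs ?T' n" for n
    by (rule fam_mul_list_least[OF sY], rule fam_mul_list_mem[OF gi actsT]) (simp_all add: T')
  have Ya: "fam_mul i a (gen_span gs) n \<subseteq> fam_mul_list gs ?T' n" for n
    using fam_mul_list_mem[of d gs ?T' "(i, a)" n, OF gi actsT] by (simp add: T')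
  have sa: "sub ((\<lambda>v. a \<odot> v) ` carrier N)" by (rule sub_image[OF ac sub_carrier])
  have XS: "seq_smult R N ?T' \<subseteq> seq_smult R N ?T <+> (\<lambda>v. a \<odot> v) ` carrier N"
    unfolding seq_smult_def[of R N ?T']
  proof (rule set_smult_least[OF sub_sum[OF sT sa]])
    fix b v assume "b \<in> snd ` set ?T'" and v: "v \<in> carrier N"
    then consider "b \<in> snd ` set ?T" | "b = a" by (auto simp: T')
    then show "b \<odot> v \<in> seq_smult R N ?T <+> (\<lambda>v. a \<odot> v) ` carrier N"
    proof cases
      case 1
      then have "b \<odot> v \<in> seq_smult R N ?T" unfolding seq_smult_def by (rule set_smult_mem[OF _ v])
      then show ?thesis using subset_sum_left[OF sa sub_subset[OF sT]] by blast
    next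
      case 2
      then show ?thesis using v subset_sum_right[OF sT sub_subset[OF sa]] by blast
    qed
  qed
  have IH: "for_large d (\<lambda>n. seq_smult R N ?T \<inter> U n \<subseteq> fam_mul_list gs ?T n)" using Suc by simp
  show ?case
  proof (rule for_large_mono[OF for_large_conj[OF for_large_conj[OF IH for_large_lower[OF st(3), of i]] for_large_ge[of d 1]]])
    fix n assume n: "n \<in> degs d" and *: "(seq_smult R N ?T \<inter> U n \<subseteq> fam_mul_list gs ?T n \<and>
      (\<forall>v\<in>carrier N. a \<odot> v \<in> U (raise i (lower i n)) <+> seq_smult R N ?T \<longrightarrow>
        (\<exists>w\<in>U (lower i n). a \<odot> v \<ominus> a \<odot> w \<in> seq_smult R N ?T))) \<and> (\<forall>i\<le>d. 1 \<le> n i)"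
    then have ni: "n i \<noteq> 0" using st(1) by force
    have rl: "raise i (lower i n) = n" by (rule raise_lower[of n i, OF ni])
    show "seq_smult R N ?T' \<inter> U n \<subseteq> fam_mul_list gs ?T' n"
    proof
      fix v assume v: "v \<in> seq_smult R N ?T' \<inter> U n"
      then have "v \<in> seq_smult R N ?T <+> (\<lambda>v. a \<odot> v) ` carrier N" using XS by blast
      then obtain x q where xq: "x \<in> seq_smult R N ?T" "q \<in> carrier N" "v = x \<oplus> a \<odot> q"
        by (auto elim!: set_addE)
      have c: "x \<in> carrier N" "v \<in> carrier N" "a \<odot> q \<in> carrier N"
        using xq sub_carr[OF sT] v sub_carr[OF sub_U] ac by auto
      have "a \<odot> q = v \<oplus> \<ominus> x" using xq c by (simp add: M.a_comm[of x] M.a_assoc M.r_neg)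
      then have "a \<odot> q \<in> U (raise i (lower i n)) <+> seq_smult R N ?T"
        using v xq(1) sub_neg[OF sT] set_addI rl by auto
      then obtain w where w: "w \<in> U (lower i n)" "a \<odot> q \<ominus> a \<odot> w \<in> seq_smult R N ?T"
        using * xq(2) by blast
      have wc: "w \<in> carrier N" using sub_carr[OF sub_U w(1)] .
      have aw: "a \<odot> w \<in> U n" using U_raise_mem[OF st(1,2) w(1)] rl by simp
      have e: "v \<ominus> a \<odot> w = x \<oplus> (a \<odot> q \<ominus> a \<odot> w)" using xq(3) c wc ac by (simp add: a_minus_def M.a_assoc)
      have "v \<ominus> a \<odot> w \<in> seq_smult R N ?T" unfolding e by (rule sub_add[OF sT xq(1) w(2)])
      moreover have "v \<ominus> a \<odot> w \<in> U n" using v aw by (intro sub_minus[OF sub_U]) auto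
      ultimately have "v \<ominus> a \<odot> w \<in> fam_mul_list gs ?T' n" using * YY by blast
      moreover have "a \<odot> w \<in> fam_mul_list gs ?T' n"
        using Ya[of n] w(1) gen_span_eq_U[OF gs lower_degs[OF n]] ni by (auto simp: fam_mul_pos)
      ultimately have "(v \<ominus> a \<odot> w) \<oplus> a \<odot> w \<in> fam_mul_list gs ?T' n" by (rule sub_add[OF sY])
      then show "v \<in> fam_mul_list gs ?T' n" using c wc ac by (simp add: a_minus_def M.a_assoc M.l_neg)
    qed
  qed
qed

text \<open>The Artin-Rees property in the form needed here. The subfamilies generated by the
  components of bounded degree ascend to \<open>A\<close>, hence one of them is \<open>A\<close>, and then components of
  large degree are multiples by large powers.\<close>

lemma family_eventually_in:
  assumes gs: "generating gs" and A: "family gs A" and Z: "sub Z"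
    and AZ: "\<And>n a v. v \<in> A n \<Longrightarrow> a \<in> mpow (\<lambda>i. t * (if i \<le> d then 1 else 0)) \<Longrightarrow> a \<odot> v \<in> Z"
  shows "for_large d (\<lambda>n. A n \<subseteq> Z)"
proof -
  have gi: "gens_in d gs" using gs by (simp add: generating_def)
  \<comment> \<open>The products that generate, in degree \<open>n\<close>, the subfamily generated by the components of \<open>A\<close> in
    degrees with all entries at most \<open>t\<close>.\<close>
  define S where "S t n = {a \<odot> m |a m u. u \<in> degs d \<and> u \<le> n \<and> (\<forall>i. u i \<le> t) \<and>
     a \<in> mpow (\<lambda>i. n i - u i) \<and> m \<in> A u}" for t :: nat and n :: "nat \<Rightarrow> nat"
  define C where "C t n = (if n \<in> degs d then submodule_gen R N (S t n) else {\<zero>})" for t n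
  have mA: "m \<in> carrier N" if "m \<in> A u" for m u using sub_carr[OF family_sub[OF A] that] .
  have Sc: "S t n \<subseteq> carrier N" for t n unfolding S_def using mA mpow_carr by blast
  have sC: "sub (C t n)" for t n unfolding C_def using sub_submodule_gen[OF Sc] sub_zero_set by simp
  have SU: "S t n \<subseteq> U n" for t n
  proof
    fix x assume "x \<in> S t n"
    then obtain a m u where x: "x = a \<odot> m" "u \<in> degs d" "u \<le> n" "a \<in> mpow (\<lambda>i. n i - u i)" "m \<in> A u"
      unfolding S_def by blast
    have "m \<in> U u" using family_span[OF A, of u] x(5) gen_span_eq_U[OF gs x(2)] by blast
    from U_mult[OF x(4) this] have "x \<in> U (\<lambda>i. n i - u i + u i)" using x(1) by simp
    moreover have "(\<lambda>i. n i - u i + u i) = n" using x(3) by (auto simp: le_fun_def)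
    ultimately show "x \<in> U n" by simp
  qed
  have famC: "family gs (C t)" for t
  proof (rule familyI)
    show "sub (C t n)" for n by (rule sC)
    show "v \<in> gen_span gs n" if "v \<in> C t n" for v n
    proof (cases "n \<in> degs d")
      case True
      then have "C t n \<subseteq> U n" unfolding C_def using submodule_gen_least[OF sub_U SU] by simp
      then show ?thesis using that gen_span_eq_U[OF gs True] by blast
    next
      case False
      then show ?thesis using that sub_zero[OF sub_gen_span[OF gi]] by (simp add: C_def)
    qed
    fix i g n v assume ig: "(i, g) \<in> set gs" and v: "v \<in> C t n"
    have i: "i \<le> d" and g: "g \<in> I i" using ig gs by (auto simp: generating_def gens_in_def)
    have gc: "g \<in> carrier R" using NR.ideal_mem(2)[OF ideals[OF i] g] .
    show "g \<odot> v \<in> C t (raise i n)"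
    proof (cases "n \<in> degs d")
      case False
      then show ?thesis using v op_zero[OF gc] sub_zero[OF sC] by (simp add: C_def)
    next
      case True
      have "submodule_gen R N (S t n) \<subseteq> {v \<in> carrier N. g \<odot> v \<in> C t (raise i n)}"
      proof (rule submodule_gen_least[OF sub_preimage[OF gc sub_carrier sC]])
        show "S t n \<subseteq> {v \<in> carrier N. g \<odot> v \<in> C t (raise i n)}"
        proof
          fix x assume xS: "x \<in> S t n"
          then obtain a m u where x: "x = a \<odot> m" "u \<in> degs d" "u \<le> n" "\<forall>i. u i \<le> t"
            "a \<in> mpow (\<lambda>i. n i - u i)" "m \<in> A u" unfolding S_def by blast
          have ac: "a \<in> carrier R" using mpow_carr x(5) .
          have "a \<otimes>\<^bsub>R\<^esub> g \<in> mpow (\<lambda>j. n j - u j + unit_deg i j)"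
            using mpow_mult[OF x(5), of g "unit_deg i"] g mpow_unit[OF i] by simp
          moreover have "(\<lambda>j. n j - u j + unit_deg i j) = (\<lambda>j. raise i n j - u j)"
            using x(3) by (auto simp: le_fun_def unit_deg_def raise_def Suc_diff_le)
          ultimately have ag: "a \<otimes>\<^bsub>R\<^esub> g \<in> mpow (\<lambda>j. raise i n j - u j)" by simp
          have "u \<le> raise i n" using x(3) by (auto simp: le_fun_def raise_def le_SucI)
          then have "(a \<otimes>\<^bsub>R\<^esub> g) \<odot> m \<in> S t (raise i n)" unfolding S_def using x ag by blast
          then have "(a \<otimes>\<^bsub>R\<^esub> g) \<odot> m \<in> C t (raise i n)"
            unfolding C_def using raise_degs[OF True i] submodule_gen_mem by simp
          moreover have "(a \<otimes>\<^bsub>R\<^esub> g) \<odot> m = g \<odot> x"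
            unfolding x(1) using ac gc mA[OF x(6)] by (simp add: smult_assoc1 smult_commute)
          ultimately show "x \<in> {v \<in> carrier N. g \<odot> v \<in> C t (raise i n)}" using xS Sc by auto
        qed
      qed
      then show ?thesis using v True by (auto simp: C_def)
    qed
  qed
  have "\<exists>t0. \<forall>t\<ge>t0. C t = C t0"
  proof (rule family_acc[OF gi], unfold ascending_def, intro conjI allI famC)
    fix t n
    have "S t n \<subseteq> S (Suc t) n" unfolding S_def using le_SucI by blast
    then have "submodule_gen R N (S t n) \<subseteq> submodule_gen R N (S (Suc t) n)"
      by (intro submodule_gen_least[OF sub_submodule_gen[OF Sc]]) (use submodule_gen_mem in blast)
    then show "C t n \<subseteq> C (Suc t) n" by (simp add: C_def)
  qed
  then obtain t0 where t0: "\<And>t. t \<ge> t0 \<Longrightarrow> C t = C t0" by blast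
  have AC: "A n \<subseteq> C t0 n" if n: "n \<in> degs d" for n
  proof
    fix v assume v: "v \<in> A n"
    let ?t = "t0 + (\<Sum>i\<le>d. n i)"
    have "n i \<le> ?t" for i
    proof (cases "i \<le> d")
      case True
      then have "n i \<le> (\<Sum>i\<le>d. n i)" by (intro member_le_sum) auto
      then show ?thesis by simp
    next
      case False
      then show ?thesis using n by (simp add: degs_def)
    qed
    moreover have "\<one>\<^bsub>R\<^esub> \<in> mpow (\<lambda>i. n i - n i)" using mpow_0 by simp
    ultimately have "\<one>\<^bsub>R\<^esub> \<odot> v \<in> S ?t n" unfolding S_def using n v by blast
    then have "v \<in> C ?t n" unfolding C_def using n submodule_gen_mem mA[OF v] by simp
    then show "v \<in> C t0 n" using t0[of ?t] by simp
  qed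
  show ?thesis
  proof (rule for_large_mono[OF for_large_ge[of d "t0 + t"]])
    fix n assume n: "n \<in> degs d" and large: "\<forall>i\<le>d. t0 + t \<le> n i"
    have "submodule_gen R N (S t0 n) \<subseteq> Z"
    proof (rule submodule_gen_least[OF Z])
      show "S t0 n \<subseteq> Z"
      proof
        fix x assume "x \<in> S t0 n"
        then obtain a m u where x: "x = a \<odot> m" "\<forall>i. u i \<le> t0" "a \<in> mpow (\<lambda>i. n i - u i)" "m \<in> A u"
          unfolding S_def by blast
        have "mpow (\<lambda>i. n i - u i) \<subseteq> mpow (\<lambda>i. t * (if i \<le> d then 1 else 0))"
        proof (rule mpow_antimono)
          fix i assume "i \<le> d"
          then have "t0 + t \<le> n i" "u i \<le> t0" using large x(2) by auto
          then have "t \<le> n i - u i" by arith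
          then show "t * (if i \<le> d then 1 else 0) \<le> n i - u i" by simp
        qed
        then show "x \<in> Z" using x(1) AZ[OF x(4)] x(3) by blast
      qed
    qed
    then show "A n \<subseteq> Z" using AC[OF n] n by (simp add: C_def)
  qed
qed

lemma prime_pow_mem:
  assumes P: "primeideal P R" and z: "z \<in> carrier R"
  shows "z [^]\<^bsub>R\<^esub> (k::nat) \<in> P \<Longrightarrow> z \<in> P"
proof (induction k)
  case 0
  have "ideal P R" using P by (simp add: primeideal_def)
  then show ?case using 0 ideal.one_imp_carrier[of P R] primeideal.I_notcarr[OF P] by auto
next
  case (Suc k)
  then show ?case using primeideal.I_prime[OF P, of "z [^]\<^bsub>R\<^esub> k" z] z by auto
qed

abbreviation ones :: "nat \<Rightarrow> nat" where "ones \<equiv> \<lambda>i. if i \<le> d then 1 else 0"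

lemma pow_in_mpow: "z \<in> mpow ones \<Longrightarrow> z [^]\<^bsub>R\<^esub> (k::nat) \<in> mpow (\<lambda>i. k * ones i)"
proof (induction k)
  case 0
  then show ?case by (simp add: mpow_0)
next
  case (Suc k)
  have "(\<lambda>i. k * ones i + ones i) = (\<lambda>i. Suc k * ones i)" by auto
  then show ?case using mpow_mult[OF Suc.IH[OF Suc.prems] Suc.prems] by simp
qed

text \<open>The saturation \<open>W\<close> of \<open>Z\<close>; by the ascending chain condition a single power of the ideal
  carries it into \<open>Z\<close>.\<close>

lemma colon_infty_facts:
  assumes Z: "sub Z"
  defines "W \<equiv> colon_infty R N Z (mpow ones)"
  shows "sub W" "\<exists>t. \<forall>a\<in>mpow (\<lambda>i. t * ones i). \<forall>v\<in>W. a \<odot> v \<in> Z" "Z \<subseteq> W"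
    "\<And>v. v \<in> carrier N \<Longrightarrow> (\<And>c. c \<in> mpow ones \<Longrightarrow> c \<odot> v \<in> W) \<Longrightarrow> v \<in> W"
proof -
  define F where "F t = {m \<in> carrier N. \<forall>a\<in>mpow (\<lambda>i. t * ones i). a \<odot> m \<in> Z}" for t
  have WF: "W = (\<Union>t. F t)" unfolding W_def colon_infty_def F_def pow_mpow by simp
  have sF: "sub (F t)" for t
  proof (rule subI)
    show "\<zero> \<in> F t" unfolding F_def using sub_zero[OF Z] op_zero mpow_carr by auto
    show "\<ominus> a \<in> F t" if "a \<in> F t" for a
      using that sub_neg[OF Z] op_neg mpow_carr unfolding F_def by auto
    show "a \<oplus> b \<in> F t" if "a \<in> F t" "b \<in> F t" for a b
      using that sub_add[OF Z] op_add mpow_carr unfolding F_def by auto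
    show "r \<odot> a \<in> F t" if r: "r \<in> carrier R" and a: "a \<in> F t" for r a
    proof -
      have "c \<odot> (r \<odot> a) \<in> Z" if "c \<in> mpow (\<lambda>i. t * ones i)" for c
        using smult_commute[OF mpow_carr[OF that] r, of a] a that sub_op[OF Z r] by (auto simp: F_def)
      then show ?thesis using r a by (simp add: F_def)
    qed
  qed (auto simp: F_def)
  have asc: "F t \<subseteq> F (Suc t)" for t
    using mpow_antimono[of "\<lambda>i. t * ones i" "\<lambda>i. Suc t * ones i"] by (auto simp: F_def)
  obtain t where t: "\<And>s. s \<ge> t \<Longrightarrow> F s = F t" using sub_acc[of F, OF sF asc] by blast
  have mono: "F s \<subseteq> F s'" if "s \<le> s'" for s s' using that asc by (rule lift_Suc_mono_le[rotated])
  have Ft: "F s \<subseteq> F t" for s using t[of s] mono[of s t] by (cases "s \<le> t") auto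
  then have W: "W = F t" unfolding WF by blast
  show "sub W" unfolding W by (rule sF)
  show "\<exists>t. \<forall>a\<in>mpow (\<lambda>i. t * ones i). \<forall>v\<in>W. a \<odot> v \<in> Z"
    unfolding W by (rule exI[of _ t]) (simp add: F_def)
  show "Z \<subseteq> W" unfolding W F_def using sub_carr[OF Z] sub_op[OF Z] mpow_carr by blast
  fix v assume v: "v \<in> carrier N" and c: "\<And>c. c \<in> mpow ones \<Longrightarrow> c \<odot> v \<in> W"
  have "e \<odot> v \<in> Z" if "e \<in> mpow (\<lambda>i. Suc t * ones i)" for e
  proof -
    have "(\<lambda>i. Suc t * ones i) = (\<lambda>i. t * ones i + ones i)" by auto
    then have "e \<in> mpow (\<lambda>i. t * ones i) \<cdot>\<^bsub>R\<^esub> mpow ones" using that mpow_add[of "\<lambda>i. t * ones i" ones] by simp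
    then have "e \<in> carrier R \<and> e \<odot> v \<in> Z"
    proof (induction rule: ideal_prod.induct)
      case (prod a b)
      have "(a \<otimes>\<^bsub>R\<^esub> b) \<odot> v = a \<odot> (b \<odot> v)" using prod v mpow_carr by (simp add: smult_assoc1)
      moreover have "b \<odot> v \<in> F t" using c[OF prod(2)] W by simp
      ultimately show ?case using prod mpow_carr by (auto simp: F_def)
    next
      case (sum x y)
      then show ?case using v sub_add[OF Z] by (simp add: smult_l_distr)
    qed
    then show ?thesis by simp
  qed
  then have "v \<in> F (Suc t)" using v by (simp add: F_def)
  then show "v \<in> W" using Ft W by blast
qed

text \<open>Multiplication by \<open>z\<close> maps \<open>L/E\<close> onto \<open>zL/zE\<close>, so that the length of \<open>E/zE\<close> does not exceed
  that of \<open>L/zL\<close> if \<open>L/E\<close> has finite length; here \<open>L\<close> is \<open>N/W\<close>.\<close>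

lemma quotient_by_parameter:
  assumes W: "sub W" and E: "sub E" "W \<subseteq> E" and z: "z \<in> carrier R"
    and fin: "sq_len R N E (carrier N) \<noteq> \<infinity>"
  shows "sq_len R N ((\<lambda>v. z \<odot> v) ` E <+> W) E \<le> sq_len R N ((\<lambda>v. z \<odot> v) ` carrier N <+> W) (carrier N)"
proof -
  let ?F = "(\<lambda>v. z \<odot> v) ` E <+> W" and ?H = "(\<lambda>v. z \<odot> v) ` carrier N <+> W"
  have sz: "sub ((\<lambda>v. z \<odot> v) ` E)" "sub ((\<lambda>v. z \<odot> v) ` carrier N)"
    using sub_image[OF z] E(1) sub_carrier by auto
  have sF: "sub ?F" and sH: "sub ?H" using sub_sum W sz by auto
  have FE: "?F \<subseteq> E" by (rule sum_subset[OF E(1) _ E(2)]) (use sub_op[OF E(1) z] in blast)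
  have FH: "?F \<subseteq> ?H" by (rule set_add_mono[OF image_mono[OF sub_subset[OF E(1)]] order_refl])
  have zF: "(\<lambda>v. z \<odot> v) ` E \<subseteq> ?F" "W \<subseteq> ?F"
    by (rule subset_sum_left[OF W sub_subset[OF sz(1)]], rule subset_sum_right[OF sz(1) sub_subset[OF W]])
  have zH: "(\<lambda>v. z \<odot> v) ` carrier N \<subseteq> ?H" by (rule subset_sum_left[OF W sub_subset[OF sz(2)]])
  have "sq_len R N {a \<in> carrier N. z \<odot> a \<in> ?F} (carrier N) = sq_len R N ?F ?H"
  proof (rule sq_len_smult[OF z sub_carrier sH sF FH])
    show "z \<odot> a \<in> ?H" if "a \<in> carrier N" for a using zH that by blast
    show "\<exists>a\<in>carrier N. \<exists>b\<in>?F. a' = z \<odot> a \<oplus> b" if "a' \<in> ?H" for a'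
      using that by (rule set_addE) (use zF(2) in blast)
  qed
  moreover have "sq_len R N {a \<in> carrier N. z \<odot> a \<in> ?F} (carrier N) \<le> sq_len R N E (carrier N)"
    by (rule sq_len_mono[OF E(1) sub_preimage[OF z sub_carrier sF] sub_carrier sub_carrier])
      (use zF(1) sub_subset[OF E(1)] in auto)
  ultimately have 1: "sq_len R N ?F ?H \<le> sq_len R N E (carrier N)" by simp
  have "sq_len R N ?F E + sq_len R N E (carrier N) = sq_len R N ?F (carrier N)"
    by (rule sq_len_add[OF sF E(1) sub_carrier FE sub_subset[OF E(1)], symmetric])
  also have "\<dots> = sq_len R N ?F ?H + sq_len R N ?H (carrier N)"
    by (rule sq_len_add[OF sF sH sub_carrier FH sub_subset[OF sH]])
  also have "\<dots> \<le> sq_len R N E (carrier N) + sq_len R N ?H (carrier N)" using 1 by (rule add_right_mono)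
  finally have "sq_len R N E (carrier N) + sq_len R N ?F E \<le> sq_len R N E (carrier N) + sq_len R N ?H (carrier N)"
    by (simp add: add.commute)
  then show ?thesis using fin by (simp add: enat_add_left_cancel_le)
qed

text \<open>Let \<open>W\<close> be the saturation of the submodule \<open>Z\<close> generated by the sequence, and \<open>L = N/W\<close>. Since
  \<open>L\<close> has dimension at most one and the product of all ideals annihilates no nonzero element of it,
  that product contains some \<open>z\<close> for which \<open>L/zL\<close> has finite length. As \<open>z\<close> maps \<open>U n\<close> into the
  denominator, this length bounds that of \<open>U n\<close> modulo the denominator and \<open>W\<close>. In large degrees,
  \<open>W\<close> may be replaced by \<open>Z\<close> by the Artin-Rees property, and \<open>Z\<close> by the products of the elements of
  the sequence with lower powers, because the sequence is superficial.\<close>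

theorem mixed_system_bounded:
  assumes gs: "generating gs" and loc: "local_ring R nn"
    and s: "rees_superficial_seq R I d N xs"
    and dim: "module_dim R (quot_mod N (carrier N) (colon_infty R N (seq_smult R N xs) (mpow ones))) \<le> 1"
  shows "large_bounded d (hilb gs (fam_sum (den gs) (fam_mul_list gs xs)))"
proof -
  have gi: "gens_in d gs" using gs by (simp add: generating_def)
  define Z where "Z = seq_smult R N xs"
  define W where "W = colon_infty R N Z (mpow ones)"
  define a where "a = {r \<in> carrier R. \<forall>v\<in>carrier N. r \<odot> v \<in> W}"
  have mem: "\<forall>y\<in>set xs. fst y \<le> d \<and> snd y \<in> I (fst y)" using superficial_seq_mem[OF s] by blast
  have Z: "sub Z" unfolding Z_def by (rule sub_seq_smult[OF mem])
  note Wf = colon_infty_facts[OF Z, folded W_def]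
  note W = Wf(1)
  obtain t where t: "\<forall>a\<in>mpow (\<lambda>i. t * ones i). \<forall>v\<in>W. a \<odot> v \<in> Z" using Wf(2) by blast
  have ida: "ideal a R" unfolding a_def by (rule colon_ideal[OF W]) simp
  have "module_ann R (quot_mod N (carrier N) W) = a"
  proof -
    let ?Q = "quot_mod N (carrier N) W"
    have "(\<forall>m\<in>carrier ?Q. r \<odot>\<^bsub>?Q\<^esub> m = \<zero>\<^bsub>?Q\<^esub>) \<longleftrightarrow> (\<forall>v\<in>carrier N. r \<odot> v \<in> W)"
      if r: "r \<in> carrier R" for r
    proof -
      have "r \<odot>\<^bsub>?Q\<^esub> (W +> v) = W +> (r \<odot> v)" if "v \<in> carrier N" for v
        using coset_smult[OF W r that] by (simp add: quot_mod_simps)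
      then show ?thesis using coset_eq_self_iff[OF W] r by (simp add: quot_mod_simps(1,2))
    qed
    then show ?thesis unfolding module_ann_def a_def by blast
  qed
  then have dima: "krull_dim (R Quot a) \<le> 1" using dim unfolding module_dim_def W_def Z_def by simp
  have nn: "maximalideal nn R" using loc by (simp add: local_ring_def)
  have "\<exists>z\<in>mpow ones. \<forall>P. primeideal P R \<longrightarrow> a \<subseteq> P \<longrightarrow> z \<in> P \<longrightarrow> P = nn"
  proof (rule NR.ex_parameter[OF loc ida ideal_mpow dima])
    fix r assume r: "r \<in> carrier R" and rc: "\<And>c. c \<in> mpow ones \<Longrightarrow> r \<otimes>\<^bsub>R\<^esub> c \<in> a"
    have "r \<odot> v \<in> W" if v: "v \<in> carrier N" for v
    proof (rule Wf(4))
      fix c assume c: "c \<in> mpow ones"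
      have "c \<odot> (r \<odot> v) = (r \<otimes>\<^bsub>R\<^esub> c) \<odot> v" using r v mpow_carr[OF c] by (simp add: smult_assoc1 smult_commute)
      then show "c \<odot> (r \<odot> v) \<in> W" using rc[OF c] v by (simp add: a_def)
    qed (use r v in simp)
    then show "r \<in> a" using r by (simp add: a_def)
  qed
  then obtain z where z: "z \<in> mpow ones" and zP: "\<And>P. primeideal P R \<Longrightarrow> a \<subseteq> P \<Longrightarrow> z \<in> P \<Longrightarrow> P = nn" by blast
  have zc: "z \<in> carrier R" by (rule mpow_carr[OF z])
  have finite: "sq_len R N E (carrier N) \<noteq> \<infinity>"
    if E: "sub E" "W \<subseteq> E" and k: "\<And>v. v \<in> carrier N \<Longrightarrow> (z [^]\<^bsub>R\<^esub> k) \<odot> v \<in> E" for E and k :: nat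
  proof (rule finite_length[OF noetherian nn E(1)])
    fix P assume P: "primeideal P R" "{r \<in> carrier R. \<forall>v\<in>carrier N. r \<odot> v \<in> E} \<subseteq> P"
    have "a \<subseteq> P" using P(2) E(2) by (auto simp: a_def)
    moreover have "z [^]\<^bsub>R\<^esub> k \<in> P" using P(2) k zc by auto
    then have "z \<in> P" by (rule prime_pow_mem[OF P(1) zc])
    ultimately show "P = nn" by (rule zP[OF P(1)])
  qed
  have sz: "sub ((\<lambda>v. z \<odot> v) ` carrier N)" by (rule sub_image[OF zc sub_carrier])
  define H where "H = (\<lambda>v. z \<odot> v) ` carrier N <+> W"
  have "sq_len R N H (carrier N) \<noteq> \<infinity>"
  proof (rule finite[of _ 1])
    show "sub H" unfolding H_def by (rule sub_sum[OF sz W])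
    show "W \<subseteq> H" unfolding H_def by (rule subset_sum_right[OF sz sub_subset[OF W]])
    show "(z [^]\<^bsub>R\<^esub> (1::nat)) \<odot> v \<in> H" if "v \<in> carrier N" for v
      using subset_sum_left[OF W sub_subset[OF sz]] that zc by (auto simp: H_def)
  qed
  then obtain b where b: "sq_len R N H (carrier N) = enat b" by auto
  have bound: "sq_len R N (U n \<inter> (U (raise 0 n) <+> W)) (U n) \<le> enat b" if n: "n \<in> degs d" for n
  proof -
    define E where "E = U n <+> W"
    define G where "G = U (raise 0 n) <+> W"
    have sE: "sub E" and sG: "sub G" unfolding E_def G_def using sub_sum sub_U W by auto
    have UE: "U n \<subseteq> E" and WE: "W \<subseteq> E" and UG: "U (raise 0 n) \<subseteq> G" and WG: "W \<subseteq> G"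
      unfolding E_def G_def
      using subset_sum_left[OF W sub_subset[OF sub_U]] subset_sum_right[OF sub_U sub_subset[OF W]] by auto
    have U1: "U (raise 0 n) \<subseteq> U n" by (rule U_antimono) (simp add: raise_def)
    have GE: "G \<subseteq> E" unfolding G_def by (rule sum_subset[OF sE order_trans[OF U1 UE] WE])
    let ?k = "\<Sum>i\<le>d. n i"
    have finE: "sq_len R N E (carrier N) \<noteq> \<infinity>"
    proof (rule finite[OF sE WE, of ?k])
      fix v assume v: "v \<in> carrier N"
      have "mpow (\<lambda>i. ?k * ones i) \<subseteq> mpow n"
      proof (rule mpow_antimono)
        fix i assume "i \<le> d"
        then show "n i \<le> ?k * ones i" using member_le_sum[of i "{..d}" n] by simp
      qed
      then show "(z [^]\<^bsub>R\<^esub> ?k) \<odot> v \<in> E" using pow_in_mpow[OF z, of ?k] U_mem[OF _ v] UE by blast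
    qed
    have zU: "z \<odot> u \<in> U (raise 0 n)" if "u \<in> U n" for u
    proof -
      have "U (\<lambda>i. ones i + n i) \<subseteq> U (raise 0 n)" by (rule U_antimono) (auto simp: raise_def)
      then show ?thesis using U_mult[OF z that] by blast
    qed
    have "(\<lambda>v. z \<odot> v) ` E \<subseteq> G"
    proof
      fix x assume "x \<in> (\<lambda>v. z \<odot> v) ` E"
      then obtain u w where uw: "u \<in> U n" "w \<in> W" "x = z \<odot> (u \<oplus> w)" by (auto simp: E_def elim!: set_addE)
      have "x = z \<odot> u \<oplus> z \<odot> w" using uw op_add[OF zc] sub_carr[OF sub_U] sub_carr[OF W] by auto
      then show "x \<in> G" unfolding G_def using set_addI[OF zU[OF uw(1)] sub_op[OF W zc uw(2)]] by simp
    qed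
    then have FG: "(\<lambda>v. z \<odot> v) ` E <+> W \<subseteq> G" by (rule sum_subset[OF sG _ WG])
    have "sq_len R N (U n \<inter> G) (U n) = sq_len R N G E"
    proof (rule sq_len_sum[OF sub_U sE sG GE UE])
      show "E \<subseteq> U n <+> G" unfolding E_def by (rule set_add_mono[OF order_refl WG])
    qed
    also have "\<dots> \<le> sq_len R N ((\<lambda>v. z \<odot> v) ` E <+> W) E"
      by (rule sq_len_mono[OF sub_sum[OF sub_image[OF zc sE] W] sG sE sE FG GE order_refl])
    also have "\<dots> \<le> enat b"
      using quotient_by_parameter[OF W sE WE zc finE] b unfolding H_def by simp
    finally show ?thesis unfolding G_def .
  qed
  have "family gs (\<lambda>n. W \<inter> gen_span gs n)"
  proof (rule familyI)
    show "g \<odot> v \<in> W \<inter> gen_span gs (raise i n)" if "(i, g) \<in> set gs" "v \<in> W \<inter> gen_span gs n" for i g n v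
      using gen_span_closed[OF gi that(1), of v n] that gi sub_op[OF W, of g v] by (auto simp: gens_in_def)
  qed (use sub_inter[OF W sub_gen_span[OF gi]] in auto)
  then have WZ: "for_large d (\<lambda>n. W \<inter> gen_span gs n \<subseteq> Z)"
    by (rule family_eventually_in[OF gs _ Z]) (use t in auto)
  have tr: "for_large d (\<lambda>n. Z \<inter> U n \<subseteq> fam_mul_list gs xs n)"
    using superficial_trace[OF gs s, of "length xs"] by (simp add: Z_def)
  have acts: "acts gs (fst y) (snd y)" if "y \<in> set xs" for y using acts_ideal[OF gs] mem that by blast
  have fY: "family gs (fam_mul_list gs xs)" by (rule family_mul_list[OF gi acts])
  note fD = family_den[OF gs]
  have fDY: "family gs (fam_sum (den gs) (fam_mul_list gs xs))" by (rule family_sum[OF gi fD fY])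
  have "for_large d (\<lambda>n. hilb gs (fam_sum (den gs) (fam_mul_list gs xs)) n \<le> enat b)"
  proof (rule for_large_mono[OF for_large_conj[OF WZ tr]])
    fix n assume n: "n \<in> degs d" and *: "W \<inter> gen_span gs n \<subseteq> Z \<and> Z \<inter> U n \<subseteq> fam_mul_list gs xs n"
    note En = gen_span_eq_U[OF gs n] and Dn = den_eq[OF gs n]
    have "U n \<inter> (U (raise 0 n) <+> W) \<subseteq> fam_sum (den gs) (fam_mul_list gs xs) n"
    proof
      fix v assume v: "v \<in> U n \<inter> (U (raise 0 n) <+> W)"
      then obtain u w where uw: "u \<in> U (raise 0 n)" "w \<in> W" "v = u \<oplus> w" by (auto elim!: set_addE)
      have c: "u \<in> carrier N" "w \<in> carrier N" using uw sub_carr[OF sub_U] sub_carr[OF W] by auto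
      have "U (raise 0 n) \<subseteq> U n" by (rule U_antimono) (simp add: raise_def)
      then have "\<ominus> u \<oplus> v \<in> U n" using v uw(1) sub_add[OF sub_U] sub_neg[OF sub_U] by blast
      then have "w \<in> U n" using uw(3) c by (simp add: M.r_neg1)
      then have "w \<in> fam_mul_list gs xs n" using * uw(2) En by blast
      then show "v \<in> fam_sum (den gs) (fam_mul_list gs xs) n"
        unfolding fam_sum_def Dn uw(3) by (rule set_addI[OF uw(1)])
    qed
    then have "sq_len R N (fam_sum (den gs) (fam_mul_list gs xs) n) (U n)
        \<le> sq_len R N (U n \<inter> (U (raise 0 n) <+> W)) (U n)"
      using family_span[OF fDY, of n] En
      by (intro sq_len_mono[OF sub_inter[OF sub_U sub_sum[OF sub_U W]] family_sub[OF fDY] sub_U sub_U]) auto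
    then show "hilb gs (fam_sum (den gs) (fam_mul_list gs xs)) n \<le> enat b"
      using bound[OF n] unfolding hilb_def En by (rule order_trans)
  qed
  then show ?thesis unfolding large_bounded_def by blast
qed

end

section \<open>Lengths of graded components\<close>

lemma submodule_cong:
  assumes "carrier M = carrier M'" "ring.add M = ring.add M'" "ring.zero M = ring.zero M'" "smult M = smult M'"
  shows "submodule H R M \<longleftrightarrow> submodule H R M'"
  unfolding submodule_def subgroup_def submodule_axioms_def m_inv_def using assms by simp

context operator_group
begin

lemma restrict_operator_group:
  assumes P: "sub P"
  shows "operator_group R (M\<lparr>carrier := P\<rparr>)"
proof -
  note c = sub_carr[OF P]
  have "abelian_group (M\<lparr>carrier := P\<rparr>)"
  proof (rule abelian_groupI)
    fix x assume "x \<in> carrier (M\<lparr>carrier := P\<rparr>)"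
    then show "\<exists>y\<in>carrier (M\<lparr>carrier := P\<rparr>). y \<oplus>\<^bsub>M\<lparr>carrier := P\<rparr>\<^esub> x = \<zero>\<^bsub>M\<lparr>carrier := P\<rparr>\<^esub>"
      using sub_neg[OF P, of x] c by (intro bexI[of _ "\<ominus> x"]) (auto simp: M.l_neg)
  qed (use sub_zero[OF P] sub_add[OF P] c in \<open>auto simp: M.a_ac\<close>)
  then show ?thesis
    by (rule operator_group.intro, unfold_locales) (use sub_op[OF P] c in \<open>auto simp: op_add\<close>)
qed

lemma sub_restrict_iff:
  assumes P: "sub P"
  shows "submodule H R (M\<lparr>carrier := P\<rparr>) \<longleftrightarrow> sub H \<and> H \<subseteq> P"
proof -
  interpret P: operator_group R "M\<lparr>carrier := P\<rparr>" by (rule restrict_operator_group[OF P])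
  have inv: "\<ominus>\<^bsub>M\<lparr>carrier := P\<rparr>\<^esub> x = \<ominus> x" if "x \<in> P" for x
    by (rule P.minus_equality) (use that sub_neg[OF P that] sub_carr[OF P that] in \<open>auto simp: M.l_neg\<close>)
  show ?thesis
  proof
    assume H: "submodule H R (M\<lparr>carrier := P\<rparr>)"
    then have HP: "H \<subseteq> P" using P.sub_subset by auto
    have "sub H"
    proof (rule subI)
      show "H \<subseteq> carrier M" using HP sub_subset[OF P] by blast
      show "\<ominus> a \<in> H" if "a \<in> H" for a using P.sub_neg[OF H that] inv[of a] HP that by auto
    qed (use P.sub_zero[OF H] P.sub_add[OF H] P.sub_op[OF H] in auto)
    then show "sub H \<and> H \<subseteq> P" using HP by simp
  next
    assume H: "sub H \<and> H \<subseteq> P"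
    then have HP: "H \<subseteq> P" and sH: "sub H" by auto
    show "submodule H R (M\<lparr>carrier := P\<rparr>)"
    proof (rule P.subI)
      show "\<ominus>\<^bsub>M\<lparr>carrier := P\<rparr>\<^esub> a \<in> H" if "a \<in> H" for a using sub_neg[OF sH that] inv[of a] HP that by auto
    qed (use HP sub_zero[OF sH] sub_add[OF sH] sub_op[OF sH] in auto)
  qed
qed

lemma mod_length_restrict: "sub P \<Longrightarrow> mod_length R (M\<lparr>carrier := P\<rparr>) = sq_len R M {\<zero>} P"
  unfolding mod_length_chain_len sq_len_def
  using sub_restrict_iff sub_zero by (metis (no_types, lifting) empty_subsetI insert_subset)

end

lemma graded_quot_fields:
  "carrier (graded_quot M A B) = carrier (quot_mod M A B)"
  "ring.add (graded_quot M A B) = ring.add (quot_mod M A B)"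
  "ring.zero (graded_quot M A B) = ring.zero (quot_mod M A B)"
  "smult (graded_quot M A B) = smult (quot_mod M A B)"
  "piece (graded_quot M A B) n = (\<lambda>a. B +>\<^bsub>M\<^esub> a) ` (A \<inter> piece M n)"
  by (simp_all add: graded_quot_def module.extend_def graded_module.fields_def)

lemma mod_length_graded_quot:
  fixes M :: "('t, 'm, 'z) graded_module_scheme"
  assumes M: "operator_group R M" and A: "submodule A R M" and B: "submodule B R M" and BA: "B \<subseteq> A"
    and P: "submodule (piece M n) R M"
  shows "mod_length R ((graded_quot M A B)\<lparr>carrier := piece (graded_quot M A B) n\<rparr>)
    = sq_len R M (B \<inter> piece M n) (A \<inter> piece M n)"
proof -
  interpret M: operator_group R M by fact
  let ?Q = "quot_mod M A B" and ?q = "\<lambda>a. B +>\<^bsub>M\<^esub> a"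
  have Qg: "operator_group R ?Q" by (rule M.quot_operator_group[OF A B])
  then interpret Q: operator_group R ?Q .
  note q = M.quot_mod_simps
  have AP: "submodule (A \<inter> piece M n) R M" by (rule M.sub_inter[OF A P])
  note c = M.sub_carr[OF A] M.sub_carr[OF AP]
  have sm: "r \<odot>\<^bsub>?Q\<^esub> ?q v = ?q (r \<odot>\<^bsub>M\<^esub> v)" if "r \<in> carrier R" "v \<in> A" for r v
    using M.coset_smult[OF B that(1) c(1)[OF that(2)]] by (simp add: q)
  have ad: "?q v \<oplus>\<^bsub>?Q\<^esub> ?q w = ?q (v \<oplus>\<^bsub>M\<^esub> w)" if "v \<in> A" "w \<in> A" for v w
    using M.coset_add[OF B c(1)[OF that(1)] c(1)[OF that(2)]] by (simp add: q)
  let ?P = "?q ` (A \<inter> piece M n)"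
  have sP: "submodule ?P R ?Q"
  proof (rule hom_image[OF M Qg A _ _ AP])
    show "\<exists>r\<in>carrier R. \<forall>a\<in>A. ?q (r \<odot>\<^bsub>M\<^esub> a) = r' \<odot>\<^bsub>?Q\<^esub> ?q a" if "r' \<in> carrier R" for r'
      using sm that by auto
  qed (simp_all add: ad q(1))
  have "mod_length R ((graded_quot M A B)\<lparr>carrier := piece (graded_quot M A B) n\<rparr>)
      = mod_length R (?Q\<lparr>carrier := ?P\<rparr>)"
    unfolding mod_length_chain_len
    by (intro arg_cong[where f = chain_len] Collect_cong submodule_cong)
      (simp_all add: graded_quot_fields)
  also have "\<dots> = sq_len R ?Q {\<zero>\<^bsub>?Q\<^esub>} ?P" by (rule Q.mod_length_restrict[OF sP])
  also have "\<dots> = sq_len R M (B \<inter> piece M n) (A \<inter> piece M n)"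
  proof (rule sq_len_hom[OF M Qg AP sP Q.sub_zero_set, symmetric])
    show "{\<zero>\<^bsub>?Q\<^esub>} \<subseteq> ?P" using Q.sub_zero[OF sP] by simp
    show "?q a \<in> ?P" if "a \<in> A \<inter> piece M n" for a using that by blast
    show "?q (a \<oplus>\<^bsub>M\<^esub> b) = ?q a \<oplus>\<^bsub>?Q\<^esub> ?q b" if "a \<in> A \<inter> piece M n" "b \<in> A \<inter> piece M n" for a b
      using ad that by simp
    show "\<exists>a\<in>A \<inter> piece M n. \<exists>b\<in>{\<zero>\<^bsub>?Q\<^esub>}. a' = ?q a \<oplus>\<^bsub>?Q\<^esub> b" if "a' \<in> ?P" for a'
    proof -
      have "a' \<oplus>\<^bsub>?Q\<^esub> \<zero>\<^bsub>?Q\<^esub> = a'" using Q.sub_carr[OF sP that] by simp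
      then show ?thesis using that by force
    qed
    show "\<exists>r'\<in>carrier R. \<forall>a\<in>A \<inter> piece M n. ?q (r \<odot>\<^bsub>M\<^esub> a) = r' \<odot>\<^bsub>?Q\<^esub> ?q a" if "r \<in> carrier R" for r
      using sm[OF that] that by (intro bexI[of _ r]) auto
    show "\<exists>r\<in>carrier R. \<forall>a\<in>A \<inter> piece M n. ?q (r \<odot>\<^bsub>M\<^esub> a) = r' \<odot>\<^bsub>?Q\<^esub> ?q a" if "r' \<in> carrier R" for r'
      using sm[OF that] that by (intro bexI[of _ r']) auto
    show "B \<inter> piece M n = {a \<in> A \<inter> piece M n. ?q a \<in> {\<zero>\<^bsub>?Q\<^esub>}}"
      using BA M.coset_eq_self_iff[OF B] c(1) by (auto simp: q)
  qed
  finally show ?thesis .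
qed

section \<open>The Koszul complex\<close>

lemma raise_le_iff: "raise i u \<le> n \<longleftrightarrow> u \<le> n \<and> u i < n i"
proof
  assume a: "raise i u \<le> n"
  have "raise i u j \<le> n j" for j using a by (simp add: le_fun_def)
  from this[of i] this show "u \<le> n \<and> u i < n i"
    unfolding le_fun_def by (metis Suc_le_eq fun_upd_other fun_upd_same less_imp_le_nat raise_def)
next
  assume a: "u \<le> n \<and> u i < n i"
  show "raise i u \<le> n"
    unfolding le_fun_def
  proof
    show "raise i u j \<le> n j" for j
      using a by (cases "j = i") (simp_all add: raise_def le_fun_def)
  qed
qed

lemma le_lower_iff:
  assumes "n i \<noteq> 0"
  shows "raise i u \<le> n \<longleftrightarrow> u \<le> lower i n"
proof -
  have "raise i u j \<le> n j \<longleftrightarrow> u j \<le> lower i n j" for j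
    using assms by (cases "j = i") (auto simp: raise_def lower_def)
  then show ?thesis by (simp add: le_fun_def)
qed

text \<open>The projections stand for the decomposition into homogeneous components.\<close>

locale graded_operators = operator_group T0 G
  for T0 :: "('t, 'r) ring_scheme" and G :: "('t, 'm, 'z) graded_module_scheme" (structure) +
  fixes proj :: "(nat \<Rightarrow> nat) \<Rightarrow> 'm \<Rightarrow> 'm"
  assumes sub_piece: "submodule (piece G n) T0 G"
    and proj_piece: "x \<in> carrier G \<Longrightarrow> proj n x \<in> piece G n"
    and proj_add: "x \<in> carrier G \<Longrightarrow> y \<in> carrier G \<Longrightarrow> proj n (x \<oplus> y) = proj n x \<oplus> proj n y"
    and proj_id: "x \<in> piece G n \<Longrightarrow> proj n x = x"
begin

definition homogeneous :: "nat \<Rightarrow> 't \<Rightarrow> bool" where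
  "homogeneous i y \<longleftrightarrow>
     (\<forall>x\<in>carrier G. y \<odot> x \<in> carrier G) \<and>
     (\<forall>x\<in>carrier G. \<forall>x'\<in>carrier G. y \<odot> (x \<oplus> x') = y \<odot> x \<oplus> y \<odot> x') \<and>
     (\<forall>r\<in>carrier T0. \<forall>x\<in>carrier G. y \<odot> (r \<odot> x) = r \<odot> (y \<odot> x)) \<and>
     (\<forall>n. \<forall>x\<in>piece G n. y \<odot> x \<in> piece G (raise i n)) \<and>
     (\<forall>n. \<forall>x\<in>carrier G. proj n (y \<odot> x) = (if n i = 0 then \<zero> else y \<odot> proj (lower i n) x))"

end

locale koszul = graded_operators T0 G proj
  for T0 :: "('t, 'r) ring_scheme" and G :: "('t, 'm, 'z) graded_module_scheme" (structure)
    and proj :: "(nat \<Rightarrow> nat) \<Rightarrow> 'm \<Rightarrow> 'm" +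
  fixes ys :: "(nat \<times> 't) list"
  assumes homog: "\<And>y. y \<in> set ys \<Longrightarrow> homogeneous (fst y) (snd y)"
    and commuting: "\<And>y y' x. y \<in> set ys \<Longrightarrow> y' \<in> set ys \<Longrightarrow> x \<in> carrier G \<Longrightarrow>
      snd y \<odot> (snd y' \<odot> x) = snd y' \<odot> (snd y \<odot> x)"
begin

abbreviation L :: "nat set" where "L \<equiv> {..<length ys}"

definition act :: "nat \<Rightarrow> 'm \<Rightarrow> 'm" where "act s x = snd (ys ! s) \<odot> x"

lemma act_facts:
  assumes "s \<in> L"
  shows "x \<in> carrier G \<Longrightarrow> act s x \<in> carrier G"
    "x \<in> carrier G \<Longrightarrow> x' \<in> carrier G \<Longrightarrow> act s (x \<oplus> x') = act s x \<oplus> act s x'"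
    "r \<in> carrier T0 \<Longrightarrow> x \<in> carrier G \<Longrightarrow> act s (r \<odot> x) = r \<odot> act s x"
    "x \<in> piece G n \<Longrightarrow> act s x \<in> piece G (raise (fst (ys ! s)) n)"
    "x \<in> carrier G \<Longrightarrow> proj n (act s x)
       = (if n (fst (ys ! s)) = 0 then \<zero> else act s (proj (lower (fst (ys ! s)) n) x))"
  using homog[of "ys ! s"] assms unfolding homogeneous_def act_def by (auto simp: nth_mem)

lemma act_commute: "s \<in> L \<Longrightarrow> t \<in> L \<Longrightarrow> x \<in> carrier G \<Longrightarrow> act s (act t x) = act t (act s x)"
  using commuting[of "ys ! s" "ys ! t" x] by (simp add: act_def nth_mem)

lemma act_zero: "s \<in> L \<Longrightarrow> act s \<zero> = \<zero>"
  using act_facts(1,2)[of s \<zero>] act_facts(2)[of s \<zero> \<zero>] by (metis M.add.r_cancel_one' M.l_zero M.zero_closed)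

lemma act_neg: "s \<in> L \<Longrightarrow> x \<in> carrier G \<Longrightarrow> act s (\<ominus> x) = \<ominus> act s x"
  using act_facts(1,2)[of s] act_zero[of s] by (metis M.a_inv_closed M.l_neg M.minus_equality)

definition sg :: "bool \<Rightarrow> 'm \<Rightarrow> 'm" where "sg b x = (if b then x else \<ominus> x)"

lemma sg_closed [simp]: "x \<in> carrier G \<Longrightarrow> sg b x \<in> carrier G"
  and sg_zero [simp]: "sg b \<zero> = \<zero>"
  and sg_add: "x \<in> carrier G \<Longrightarrow> y \<in> carrier G \<Longrightarrow> sg b (x \<oplus> y) = sg b x \<oplus> sg b y"
  and sg_act: "s \<in> L \<Longrightarrow> x \<in> carrier G \<Longrightarrow> act s (sg b x) = sg b (act s x)"
  and sg_op: "r \<in> carrier T0 \<Longrightarrow> x \<in> carrier G \<Longrightarrow> r \<odot> sg b x = sg b (r \<odot> x)"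
  and sg_cancel: "x \<in> carrier G \<Longrightarrow> sg a (sg (\<not> b) x) \<oplus> sg b (sg a x) = \<zero>"
  and sg_sub: "sub H \<Longrightarrow> x \<in> H \<Longrightarrow> sg b x \<in> H"
  using M.minus_equality[of \<zero> \<zero>]
  by (auto simp: sg_def M.minus_add act_neg op_neg M.l_neg M.r_neg sub_neg)

definition sign :: "nat \<Rightarrow> nat set \<Rightarrow> bool" where "sign s S = even (card {t \<in> S. t < s})"

lemma diff_eq: "koszul_diff ys G f = (\<lambda>S. \<Oplus>s\<in>L - S. sg (sign s S) (act s (f (insert s S))))"
  by (simp add: koszul_diff_def sg_def sign_def act_def)

definition idx :: "nat \<Rightarrow> nat set set" where "idx p = {S. S \<subseteq> L \<and> card S = p}"

abbreviation K :: "nat \<Rightarrow> ('t, nat set \<Rightarrow> 'm) graded_module" where "K p \<equiv> koszul_module ys G p"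

abbreviation Kc :: "nat \<Rightarrow> (nat set \<Rightarrow> 'm) set" where "Kc p \<equiv> carrier (K p)"

abbreviation d :: "(nat set \<Rightarrow> 'm) \<Rightarrow> nat set \<Rightarrow> 'm" where "d \<equiv> koszul_diff ys G"

text \<open>The component of degree \<open>n\<close> of the summand that belongs to the basis element \<open>S\<close>.\<close>

definition pc :: "(nat \<Rightarrow> nat) \<Rightarrow> nat set \<Rightarrow> 'm set" where
  "pc n S = (if koszul_deg ys S \<le> n then piece G (\<lambda>l. n l - koszul_deg ys S l) else {\<zero>})"

lemma K_simps:
  "f \<in> Kc p \<longleftrightarrow> (\<forall>S. f S \<in> carrier G) \<and> (\<forall>S. S \<notin> idx p \<longrightarrow> f S = \<zero>)"
  "\<zero>\<^bsub>K p\<^esub> = (\<lambda>_. \<zero>)" "f \<oplus>\<^bsub>K p\<^esub> g = (\<lambda>S. f S \<oplus> g S)" "t \<odot>\<^bsub>K p\<^esub> f = (\<lambda>S. t \<odot> f S)"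
  "piece (K p) n = {f \<in> Kc p. \<forall>S\<in>idx p. f S \<in> pc n S}"
  by (auto simp: koszul_module_def Let_def idx_def pc_def)

lemma Kc_closed: "f \<in> Kc p \<Longrightarrow> f S \<in> carrier G"
  and Kc_zero: "f \<in> Kc p \<Longrightarrow> S \<notin> idx p \<Longrightarrow> f S = \<zero>"
  by (simp_all add: K_simps(1))

lemma sub_pc: "sub (pc n S)"
  unfolding pc_def using sub_piece sub_zero_set by simp

lemma K_operator_group: "operator_group T0 (K p)"
proof -
  have "abelian_group (K p)"
  proof (rule abelian_groupI)
    fix f assume f: "f \<in> Kc p"
    have "(\<lambda>S. \<ominus> f S) \<in> Kc p"
      using f M.minus_equality[of \<zero> \<zero>] by (auto simp: K_simps(1))
    moreover have "(\<lambda>S. \<ominus> f S) \<oplus>\<^bsub>K p\<^esub> f = \<zero>\<^bsub>K p\<^esub>"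
      using Kc_closed[OF f] by (simp add: K_simps(2,3) M.l_neg)
    ultimately show "\<exists>g\<in>Kc p. g \<oplus>\<^bsub>K p\<^esub> f = \<zero>\<^bsub>K p\<^esub>" by blast
  qed (auto simp: K_simps(1-3) fun_eq_iff M.a_ac)
  then show ?thesis
    by (rule operator_group.intro, unfold_locales) (auto simp: K_simps(1,3,4) fun_eq_iff op_add op_zero)
qed

lemma K_neg: "f \<in> Kc p \<Longrightarrow> \<ominus>\<^bsub>K p\<^esub> f = (\<lambda>S. \<ominus> f S)"
proof -
  interpret Kp: operator_group T0 "K p" by (rule K_operator_group)
  assume f: "f \<in> Kc p"
  show ?thesis
    by (rule Kp.minus_equality)
      (use f M.minus_equality[of \<zero> \<zero>] in \<open>auto simp: K_simps(1-3) fun_eq_iff M.l_neg\<close>)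
qed

lemma sub_K_piece: "submodule (piece (K p) n) T0 (K p)"
proof -
  interpret Kp: operator_group T0 "K p" by (rule K_operator_group)
  note s = sub_pc
  show ?thesis
  proof (rule Kp.subI)
    show "\<zero>\<^bsub>K p\<^esub> \<in> piece (K p) n" using sub_zero[OF s] by (simp add: K_simps)
    show "\<ominus>\<^bsub>K p\<^esub> f \<in> piece (K p) n" if "f \<in> piece (K p) n" for f
    proof -
      have f: "f \<in> Kc p" "\<forall>S\<in>idx p. f S \<in> pc n S" using that by (simp_all add: K_simps(5))
      have "\<ominus>\<^bsub>K p\<^esub> f \<in> Kc p" using f(1) by (rule Kp.a_inv_closed)
      then show ?thesis using f sub_neg[OF s] K_neg[OF f(1)] by (simp add: K_simps(5))
    qed
    show "f \<oplus>\<^bsub>K p\<^esub> g \<in> piece (K p) n" if "f \<in> piece (K p) n" "g \<in> piece (K p) n" for f g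
      using that sub_add[OF s] by (auto simp: K_simps(1,3,5))
    show "r \<odot>\<^bsub>K p\<^esub> f \<in> piece (K p) n" if "r \<in> carrier T0" "f \<in> piece (K p) n" for r f
      using that sub_op[OF s] op_zero by (auto simp: K_simps(1,4,5))
  qed (simp add: K_simps(5))
qed

lemma finite_idx: "finite (idx p)"
  unfolding idx_def by (rule finite_subset[of _ "Pow L"]) auto

lemma K_piece_length:
  "sq_len T0 (K p) {\<zero>\<^bsub>K p\<^esub>} (piece (K p) n) = (\<Sum>S\<in>idx p. sq_len T0 G {\<zero>} (pc n S))"
proof -
  interpret Kp: operator_group T0 "K p" by (rule K_operator_group)
  define P where "P F = {f \<in> piece (K p) n. \<forall>S. S \<notin> F \<longrightarrow> f S = \<zero>}" for F
  have sP: "submodule (P F) T0 (K p)" for F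
  proof -
    note s = sub_K_piece[of p n]
    show ?thesis
    proof (rule Kp.subI)
      show "P F \<subseteq> Kc p" by (auto simp: P_def K_simps(5))
      show "\<zero>\<^bsub>K p\<^esub> \<in> P F" using Kp.sub_zero[OF s] by (simp add: P_def K_simps(2))
      show "\<ominus>\<^bsub>K p\<^esub> f \<in> P F" if "f \<in> P F" for f
        using that Kp.sub_neg[OF s, of f] K_neg[of f p] M.minus_equality[of \<zero> \<zero>] Kp.sub_carr[OF s, of f]
        by (auto simp: P_def)
      show "f \<oplus>\<^bsub>K p\<^esub> g \<in> P F" if "f \<in> P F" "g \<in> P F" for f g
        using that Kp.sub_add[OF s, of f g] by (auto simp: P_def K_simps(3))
      show "r \<odot>\<^bsub>K p\<^esub> f \<in> P F" if "r \<in> carrier T0" "f \<in> P F" for r f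
        using that Kp.sub_op[OF s, of r f] op_zero by (auto simp: P_def K_simps(4))
    qed
  qed
  have "sq_len T0 (K p) {\<zero>\<^bsub>K p\<^esub>} (P F) = (\<Sum>S\<in>F. sq_len T0 G {\<zero>} (pc n S))" if "finite F" "F \<subseteq> idx p" for F
    using that
  proof (induction rule: finite_induct)
    case empty
    have "P {} = {\<zero>\<^bsub>K p\<^esub>}"
      using Kp.sub_zero[OF sub_K_piece] by (auto simp: P_def K_simps(2) fun_eq_iff)
    then show ?case using Kp.sq_len_self[OF Kp.sub_zero_set] by simp
  next
    case (insert S F)
    have Si: "S \<in> idx p" using insert.prems by simp
    have PP: "P F \<subseteq> P (insert S F)" by (auto simp: P_def)
    have "sq_len T0 (K p) (P F) (P (insert S F)) = sq_len T0 G {\<zero>} (pc n S)"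
    proof (rule sq_len_hom[OF K_operator_group _ sP sub_pc sub_zero_set, where f = "\<lambda>f. f S"])
      show "operator_group T0 G" by unfold_locales
      show "{\<zero>} \<subseteq> pc n S" using sub_zero[OF sub_pc] by simp
      show "f S \<in> pc n S" if "f \<in> P (insert S F)" for f using that Si by (simp add: P_def K_simps(5))
      show "(f \<oplus>\<^bsub>K p\<^esub> g) S = f S \<oplus> g S" for f g by (simp add: K_simps(3))
      show "\<exists>r'\<in>carrier T0. \<forall>f\<in>P (insert S F). (r \<odot>\<^bsub>K p\<^esub> f) S = r' \<odot> f S" if "r \<in> carrier T0" for r
        using that by (auto simp: K_simps(4))
      show "\<exists>r\<in>carrier T0. \<forall>f\<in>P (insert S F). (r \<odot>\<^bsub>K p\<^esub> f) S = r' \<odot> f S" if "r' \<in> carrier T0" for r'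
        using that by (auto simp: K_simps(4))
      show "P F = {f \<in> P (insert S F). f S \<in> {\<zero>}}" using insert.hyps(2) by (auto simp: P_def)
      fix a assume a: "a \<in> pc n S"
      have ac: "a \<in> carrier G" using sub_carr[OF sub_pc a] .
      have "(\<lambda>S'. if S' = S then a else \<zero>) \<in> P (insert S F)"
        using a ac Si sub_zero[OF sub_pc] by (auto simp: P_def K_simps(1,5))
      then show "\<exists>f\<in>P (insert S F). \<exists>b\<in>{\<zero>}. a = f S \<oplus> b" using ac by force
    qed
    moreover have "sq_len T0 (K p) {\<zero>\<^bsub>K p\<^esub>} (P (insert S F))
        = sq_len T0 (K p) {\<zero>\<^bsub>K p\<^esub>} (P F) + sq_len T0 (K p) (P F) (P (insert S F))"
      by (rule Kp.sq_len_add[OF Kp.sub_zero_set sP sP _ PP]) (use Kp.sub_zero[OF sP] in simp)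
    ultimately show ?case using insert by (simp add: add.commute)
  qed
  from this[OF finite_idx[of p] order_refl] have "sq_len T0 (K p) {\<zero>\<^bsub>K p\<^esub>} (P (idx p)) = (\<Sum>S\<in>idx p. sq_len T0 G {\<zero>} (pc n S))" .
  moreover have "P (idx p) = piece (K p) n" by (auto simp: P_def K_simps(1,5))
  ultimately show ?thesis by simp
qed

subsection \<open>The differential\<close>

lemma idx_insert: "s \<in> L \<Longrightarrow> s \<notin> S \<Longrightarrow> insert s S \<in> idx (Suc p) \<longleftrightarrow> S \<in> idx p"
  using finite_subset[of S L] by (auto simp: idx_def)

lemma idx_finite: "S \<in> idx p \<Longrightarrow> finite S"
  using finite_subset[of S L] by (auto simp: idx_def)

lemma finsum_hom:
  assumes "finite A" "f \<in> A \<rightarrow> carrier G"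
    and c: "\<And>x. x \<in> carrier G \<Longrightarrow> \<phi> x \<in> carrier G"
    and a: "\<And>x y. x \<in> carrier G \<Longrightarrow> y \<in> carrier G \<Longrightarrow> \<phi> (x \<oplus> y) = \<phi> x \<oplus> \<phi> y"
  shows "\<phi> (\<Oplus>s\<in>A. f s) = (\<Oplus>s\<in>A. \<phi> (f s))"
proof -
  have z: "\<phi> \<zero> = \<zero>" using a[of \<zero> \<zero>] c[of \<zero>] by (metis M.add.r_cancel_one' M.l_zero M.zero_closed)
  show ?thesis using assms(1,2)
  proof (induction rule: finite_induct)
    case empty
    then show ?case by (simp add: z)
  next
    case (insert s A)
    have f: "f s \<in> carrier G" "f \<in> A \<rightarrow> carrier G" using insert.prems by auto
    have "(\<lambda>s. \<phi> (f s)) \<in> A \<rightarrow> carrier G" using f(2) c by blast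
    then show ?case using insert f c by (simp add: a)
  qed
qed

lemma finsum_sub:
  assumes H: "sub H" and "finite A" and "\<And>s. s \<in> A \<Longrightarrow> f s \<in> H"
  shows "(\<Oplus>s\<in>A. f s) \<in> H"
  using assms(2,3)
proof (induction rule: finite_induct)
  case empty
  then show ?case using sub_zero[OF H] by simp
next
  case (insert s A)
  have c: "f \<in> A \<rightarrow> carrier G" "f s \<in> carrier G" using insert.prems sub_carr[OF H] by auto
  have "(\<Oplus>s\<in>A. f s) \<in> H" by (rule insert.IH) (use insert.prems in simp)
  then show ?case using insert.hyps insert.prems c sub_add[OF H] by simp
qed

text \<open>This cancels the terms of the twofold differential in pairs.\<close>

lemma antisymmetric_sum:
  assumes "finite A" "\<And>s t. s \<in> A \<Longrightarrow> t \<in> A \<Longrightarrow> F s t \<in> carrier G"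
    and "\<And>s t. s \<in> A \<Longrightarrow> t \<in> A \<Longrightarrow> s \<noteq> t \<Longrightarrow> F s t \<oplus> F t s = \<zero>"
  shows "(\<Oplus>s\<in>A. \<Oplus>t\<in>A - {s}. F s t) = \<zero>"
  using assms
proof (induction rule: finite_induct)
  case empty
  then show ?case by simp
next
  case (insert a A)
  have c: "F s t \<in> carrier G" if "s \<in> insert a A" "t \<in> insert a A" for s t using insert.prems(1) that .
  have IH: "(\<Oplus>s\<in>A. \<Oplus>t\<in>A - {s}. F s t) = \<zero>" by (rule insert.IH) (use insert.prems in auto)
  let ?h = "\<lambda>s. \<Oplus>t\<in>insert a A - {s}. F s t"
  have ha: "?h a = (\<Oplus>t\<in>A. F a t)" using insert.hyps(2) by simp
  have hs: "?h s = F s a \<oplus> (\<Oplus>t\<in>A - {s}. F s t)" if s: "s \<in> A" for s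
  proof -
    have "insert a A - {s} = insert a (A - {s})" using insert.hyps(2) s by auto
    then show ?thesis using insert.hyps s c by (simp add: Pi_iff)
  qed
  have hc: "?h \<in> insert a A \<rightarrow> carrier G" using c by (auto intro!: M.finsum_closed)
  have "(\<Oplus>s\<in>insert a A. ?h s) = ?h a \<oplus> (\<Oplus>s\<in>A. ?h s)"
    using insert.hyps hc by (intro M.finsum_insert) auto
  also have "(\<Oplus>s\<in>A. ?h s) = (\<Oplus>s\<in>A. F s a \<oplus> (\<Oplus>t\<in>A - {s}. F s t))"
    by (rule M.finsum_cong') (use hs c in \<open>auto intro!: M.finsum_closed M.a_closed\<close>)
  also have "\<dots> = (\<Oplus>s\<in>A. F s a) \<oplus> (\<Oplus>s\<in>A. \<Oplus>t\<in>A - {s}. F s t)"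
    by (rule M.finsum_addf) (use c in \<open>auto intro!: M.finsum_closed\<close>)
  also have "\<dots> = (\<Oplus>s\<in>A. F s a)" using IH c by (simp add: Pi_iff)
  also have "?h a \<oplus> (\<Oplus>s\<in>A. F s a) = (\<Oplus>s\<in>A. F a s \<oplus> F s a)"
    unfolding ha by (rule M.finsum_addf[symmetric]) (use c in auto)
  also have "\<dots> = (\<Oplus>s\<in>A. \<zero>)"
    by (rule M.finsum_cong') (use insert.prems(2) insert.hyps(2) in auto)
  finally show ?case by simp
qed

lemma d_term_closed: "f \<in> Kc p \<Longrightarrow> s \<in> L \<Longrightarrow> sg b (act s (f S)) \<in> carrier G"
  using Kc_closed act_facts(1) by simp

lemma d_closed:
  assumes f: "f \<in> Kc (Suc p)"
  shows "d f \<in> Kc p"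
  unfolding K_simps(1)
proof (intro conjI allI impI)
  show "d f S \<in> carrier G" for S
    unfolding diff_eq by (rule M.finsum_closed) (use d_term_closed[OF f] in auto)
  fix S assume S: "S \<notin> idx p"
  have "d f S = (\<Oplus>s\<in>L - S. \<zero>)"
    unfolding diff_eq
    by (rule M.finsum_cong') (use S idx_insert Kc_zero[OF f] act_zero in auto)
  then show "d f S = \<zero>" by simp
qed

lemma d_Kc_0: "f \<in> Kc 0 \<Longrightarrow> d f = (\<lambda>_. \<zero>)"
proof
  fix S assume f: "f \<in> Kc 0"
  have "insert s S \<notin> idx 0" for s
    using finite_subset[of "insert s S" L] by (cases "finite (insert s S)") (auto simp: idx_def card_eq_0_iff)
  then have "d f S = (\<Oplus>s\<in>L - S. \<zero>)"
    unfolding diff_eq by (intro M.finsum_cong') (use Kc_zero[OF f] act_zero in auto)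
  then show "d f S = \<zero>" by simp
qed

lemma d_add: "f \<in> Kc p \<Longrightarrow> g \<in> Kc p \<Longrightarrow> d (\<lambda>S. f S \<oplus> g S) = (\<lambda>S. d f S \<oplus> d g S)"
proof
  fix S assume f: "f \<in> Kc p" and g: "g \<in> Kc p"
  note c = Kc_closed[OF f] Kc_closed[OF g]
  have "d (\<lambda>S. f S \<oplus> g S) S = (\<Oplus>s\<in>L - S. sg (sign s S) (act s (f (insert s S))) \<oplus> sg (sign s S) (act s (g (insert s S))))"
    unfolding diff_eq
    by (rule M.finsum_cong') (use c act_facts(1,2) sg_add in auto)
  also have "\<dots> = d f S \<oplus> d g S"
    unfolding diff_eq by (rule M.finsum_addf) (use d_term_closed[OF f] d_term_closed[OF g] in auto)
  finally show "d (\<lambda>S. f S \<oplus> g S) S = d f S \<oplus> d g S" .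
qed

lemma d_op:
  assumes r: "r \<in> carrier T0" and f: "f \<in> Kc p"
  shows "d (\<lambda>S. r \<odot> f S) = (\<lambda>S. r \<odot> d f S)"
proof
  fix S
  have "r \<odot> d f S = (\<Oplus>s\<in>L - S. r \<odot> sg (sign s S) (act s (f (insert s S))))"
    unfolding diff_eq
    by (rule finsum_hom[of _ _ "\<lambda>x. r \<odot> x"]) (use d_term_closed[OF f] op_add[OF r] r in auto)
  also have "\<dots> = d (\<lambda>S. r \<odot> f S) S"
    unfolding diff_eq
    by (rule M.finsum_cong') (use Kc_closed[OF f] act_facts(1,3) sg_op r in auto)
  finally show "d (\<lambda>S. r \<odot> f S) S = r \<odot> d f S" by simp
qed

lemma sign_insert:
  assumes "finite S" "s \<notin> S" "t \<notin> S" "s < t"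
  shows "sign t (insert s S) = (\<not> sign t S)" "sign s (insert t S) = sign s S"
proof -
  have 1: "{u \<in> insert s S. u < t} = insert s {u \<in> S. u < t}" using assms(4) by blast
  have "card (insert s {u \<in> S. u < t}) = Suc (card {u \<in> S. u < t})"
    by (rule card_insert_disjoint) (use assms(1,2) in simp_all)
  then show "sign t (insert s S) = (\<not> sign t S)" unfolding sign_def 1 by (simp only: even_Suc)
  have 2: "{u \<in> insert t S. u < s} = {u \<in> S. u < s}" using assms(4) less_asym[of s t] by blast
  show "sign s (insert t S) = sign s S" unfolding sign_def 2 ..
qed

lemma d_d_zero:
  assumes f: "f \<in> Kc (Suc (Suc p))"
  shows "d (d f) = (\<lambda>_. \<zero>)"
proof
  fix S
  show "d (d f) S = \<zero>"
  proof (cases "S \<in> idx p")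
    case False
    then show ?thesis using Kc_zero[OF d_closed[OF d_closed[OF f]]] by simp
  next
    case True
    then have fS: "finite S" by (rule idx_finite)
    define F where "F s t = sg (sign s S) (sg (sign t (insert s S)) (act s (act t (f (insert t (insert s S))))))" for s t
    have Fc: "F s t \<in> carrier G" if "s \<in> L" "t \<in> L" for s t
      unfolding F_def using Kc_closed[OF f] act_facts(1) that by simp
    have inner: "sg (sign s S) (act s (d f (insert s S))) = (\<Oplus>t\<in>(L - S) - {s}. F s t)" if s: "s \<in> L - S" for s
    proof -
      have sL: "s \<in> L" using s by simp
      have LS: "L - insert s S = (L - S) - {s}" by blast
      have "sg (sign s S) (act s (d f (insert s S)))
          = (\<Oplus>t\<in>(L - S) - {s}. sg (sign s S) (act s (sg (sign t (insert s S)) (act t (f (insert t (insert s S)))))))"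
        unfolding diff_eq LS
        by (rule finsum_hom[of _ _ "\<lambda>x. sg (sign s S) (act s x)"])
          (use d_term_closed[OF f] act_facts(1,2)[OF sL] sg_add in auto)
      also have "\<dots> = (\<Oplus>t\<in>(L - S) - {s}. F s t)"
        by (rule M.finsum_cong') (use Fc sL sg_act[OF sL] Kc_closed[OF f] act_facts(1) in \<open>auto simp: F_def\<close>)
      finally show ?thesis .
    qed
    have "d (d f) S = (\<Oplus>s\<in>L - S. \<Oplus>t\<in>(L - S) - {s}. F s t)"
      unfolding diff_eq[of "d f"]
      by (rule M.finsum_cong') (use inner Fc in \<open>auto intro!: M.finsum_closed\<close>)
    also have "\<dots> = \<zero>"
    proof (rule antisymmetric_sum)
      show "finite (L - S)" by simp
      show "F s t \<in> carrier G" if "s \<in> L - S" "t \<in> L - S" for s t using Fc that by simp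
      have lt: "F s t \<oplus> F t s = \<zero>" if "s \<in> L - S" "t \<in> L - S" "s < t" for s t
      proof -
        have st: "s \<in> L" "t \<in> L" "s \<notin> S" "t \<notin> S" using that by auto
        define x where "x = act s (act t (f (insert t (insert s S))))"
        have xc: "x \<in> carrier G" unfolding x_def using Kc_closed[OF f] act_facts(1) st by simp
        have "act t (act s (f (insert s (insert t S)))) = x"
          unfolding x_def insert_commute[of s t] by (rule act_commute[OF st(2,1) Kc_closed[OF f]])
        then show ?thesis
          unfolding F_def x_def[symmetric] sign_insert[OF fS st(3,4) that(3)]
          using sg_cancel[OF xc, of "sign s S" "sign t S"] by simp
      qed
      show "F s t \<oplus> F t s = \<zero>" if "s \<in> L - S" "t \<in> L - S" "s \<noteq> t" for s t
      proof (cases "s < t")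
        case True
        then show ?thesis using lt that by simp
      next
        case False
        then have "F t s \<oplus> F s t = \<zero>" using lt[of t s] that by simp
        then show ?thesis using M.a_comm[of "F s t" "F t s"] Fc that by simp
      qed
    qed
    finally show ?thesis .
  qed
qed

lemma koszul_deg_insert:
  assumes "finite S" "s \<notin> S"
  shows "koszul_deg ys (insert s S) = raise (fst (ys ! s)) (koszul_deg ys S)"
proof
  fix l
  show "koszul_deg ys (insert s S) l = raise (fst (ys ! s)) (koszul_deg ys S) l"
  proof (cases "fst (ys ! s) = l")
    case True
    then have "{t \<in> insert s S. fst (ys ! t) = l} = insert s {t \<in> S. fst (ys ! t) = l}" by blast
    then show ?thesis using True assms by (simp add: koszul_deg_def raise_def)
  next
    case False
    then have "{t \<in> insert s S. fst (ys ! t) = l} = {t \<in> S. fst (ys ! t) = l}" by blast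
    then show ?thesis using False by (simp add: koszul_deg_def raise_def)
  qed
qed

lemma act_pc:
  assumes s: "s \<in> L" "s \<notin> S" and fS: "finite S" and x: "x \<in> pc n (insert s S)"
  shows "act s x \<in> pc n S"
proof -
  let ?i = "fst (ys ! s)" and ?D = "koszul_deg ys S"
  note ki = koszul_deg_insert[OF fS s(2)]
  show ?thesis
  proof (cases "raise ?i ?D \<le> n")
    case True
    have x': "x \<in> piece G (\<lambda>l. n l - raise ?i ?D l)" using x True by (simp add: pc_def ki)
    have "?D ?i < n ?i" using True by (simp add: raise_le_iff)
    then have "raise ?i (\<lambda>l. n l - raise ?i ?D l) = (\<lambda>l. n l - ?D l)"
      by (simp add: raise_def fun_eq_iff)
    then have "act s x \<in> piece G (\<lambda>l. n l - ?D l)" using act_facts(4)[OF s(1) x'] by simp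
    then show ?thesis using True by (simp add: pc_def raise_le_iff)
  next
    case False
    then have "x = \<zero>" using x by (simp add: pc_def ki)
    then show ?thesis using act_zero[OF s(1)] sub_zero[OF sub_pc] by simp
  qed
qed

lemma d_piece:
  assumes f: "f \<in> piece (K (Suc p)) n"
  shows "d f \<in> piece (K p) n"
proof -
  have fK: "f \<in> Kc (Suc p)" and fp: "\<And>S. S \<in> idx (Suc p) \<Longrightarrow> f S \<in> pc n S"
    using f by (simp_all add: K_simps(5))
  have "d f S \<in> pc n S" if S: "S \<in> idx p" for S
    unfolding diff_eq
    by (rule finsum_sub[OF sub_pc])
      (use fp idx_insert S idx_finite[OF S] act_pc sg_sub[OF sub_pc] in auto)
  then show ?thesis using d_closed[OF fK] by (simp add: K_simps(5))
qed

text \<open>The component of degree \<open>n\<close> of an element of the Koszul module.\<close>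

definition Kproj :: "nat \<Rightarrow> (nat \<Rightarrow> nat) \<Rightarrow> (nat set \<Rightarrow> 'm) \<Rightarrow> nat set \<Rightarrow> 'm" where
  "Kproj p n f S = (if S \<in> idx p \<and> koszul_deg ys S \<le> n then proj (\<lambda>l. n l - koszul_deg ys S l) (f S) else \<zero>)"

lemma Kproj_piece:
  assumes f: "f \<in> Kc p"
  shows "Kproj p n f \<in> piece (K p) n"
  unfolding K_simps(5,1) mem_Collect_eq
proof (intro conjI allI ballI impI)
  have "proj m (f S) \<in> carrier G" for m S by (rule sub_carr[OF sub_piece proj_piece[OF Kc_closed[OF f]]])
  then show "Kproj p n f S \<in> carrier G" for S by (simp add: Kproj_def)
  show "Kproj p n f S \<in> pc n S" if "S \<in> idx p" for S
    using proj_piece[OF Kc_closed[OF f]] that by (simp add: Kproj_def pc_def)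
qed (simp add: Kproj_def)

lemma proj_zero: "proj n \<zero> = \<zero>"
  by (rule proj_id[OF sub_zero[OF sub_piece]])

lemma proj_sg: "x \<in> carrier G \<Longrightarrow> proj n (sg b x) = sg b (proj n x)"
proof -
  assume x: "x \<in> carrier G"
  have c: "proj n y \<in> carrier G" if "y \<in> carrier G" for y using sub_carr[OF sub_piece proj_piece[OF that]] .
  have "proj n (\<ominus> x) \<oplus> proj n x = \<zero>"
    using proj_add[of "\<ominus> x" x n] x proj_zero by (simp add: M.l_neg)
  then have "proj n (\<ominus> x) = \<ominus> proj n x" using c x M.minus_equality by simp
  then show ?thesis by (simp add: sg_def)
qed

text \<open>The boundaries are the image of the whole module, not of a single component; hence a boundary
  of degree \<open>n\<close> must be shown to be the image of an element of degree \<open>n\<close>.\<close>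

lemma d_Kproj:
  assumes f: "f \<in> Kc (Suc p)" and df: "d f \<in> piece (K p) n"
  shows "d (Kproj (Suc p) n f) = d f"
proof
  fix S
  have g: "Kproj (Suc p) n f \<in> Kc (Suc p)" using Kproj_piece[OF f] by (simp add: K_simps(5))
  show "d (Kproj (Suc p) n f) S = d f S"
  proof (cases "S \<in> idx p")
    case False
    then show ?thesis using Kc_zero[OF d_closed[OF f]] Kc_zero[OF d_closed[OF g]] by simp
  next
    case S: True
    note fS = idx_finite[OF S]
    let ?D = "koszul_deg ys S"
    have ins: "insert s S \<in> idx (Suc p)" if "s \<in> L - S" for s using that S idx_insert by simp
    show ?thesis
    proof (cases "?D \<le> n")
      case False
      have "d (Kproj (Suc p) n f) S = (\<Oplus>s\<in>L - S. \<zero>)"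
        unfolding diff_eq
      proof (rule M.finsum_cong')
        fix s assume s: "s \<in> L - S"
        have "\<not> koszul_deg ys (insert s S) \<le> n" using False s fS by (simp add: koszul_deg_insert raise_le_iff)
        then show "sg (sign s S) (act s (Kproj (Suc p) n f (insert s S))) = \<zero>"
          using s act_zero by (simp add: Kproj_def)
      qed auto
      moreover have "d f S \<in> pc n S" using df S by (simp add: K_simps(5))
      ultimately show ?thesis using False by (simp add: pc_def)
    next
      case True
      let ?m = "\<lambda>l. n l - ?D l"
      have pa: "proj ?m x \<in> carrier G" if "x \<in> carrier G" for x using sub_carr[OF sub_piece proj_piece[OF that]] .
      have "d (Kproj (Suc p) n f) S = (\<Oplus>s\<in>L - S. proj ?m (sg (sign s S) (act s (f (insert s S)))))"
        unfolding diff_eq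
      proof (rule M.finsum_cong')
        show "(\<lambda>s. proj ?m (sg (sign s S) (act s (f (insert s S))))) \<in> L - S \<rightarrow> carrier G"
          using d_term_closed[OF f] pa by auto
        fix s assume s: "s \<in> L - S"
        let ?i = "fst (ys ! s)" and ?x = "f (insert s S)"
        have sL: "s \<in> L" "s \<notin> S" using s by auto
        note ki = koszul_deg_insert[OF fS sL(2)]
        have xc: "?x \<in> carrier G" by (rule Kc_closed[OF f])
        have "proj ?m (sg (sign s S) (act s ?x)) = sg (sign s S) (proj ?m (act s ?x))"
          by (rule proj_sg[OF act_facts(1)[OF sL(1) xc]])
        also have "proj ?m (act s ?x) = act s (Kproj (Suc p) n f (insert s S))"
        proof (cases "?m ?i = 0")
          case True
          then have "\<not> raise ?i ?D \<le> n" by (simp add: raise_le_iff)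
          then show ?thesis using act_facts(5)[OF sL(1) xc, of ?m] True act_zero[OF sL(1)]
            by (simp add: Kproj_def ki)
        next
          case False
          then have "raise ?i ?D \<le> n" using \<open>?D \<le> n\<close> by (simp add: raise_le_iff)
          moreover have "lower ?i ?m = (\<lambda>l. n l - raise ?i ?D l)" by (simp add: lower_def raise_def fun_eq_iff)
          ultimately show ?thesis using act_facts(5)[OF sL(1) xc, of ?m] False ins[OF s]
            by (simp add: Kproj_def ki)
        qed
        finally show "sg (sign s S) (act s (Kproj (Suc p) n f (insert s S)))
          = proj ?m (sg (sign s S) (act s ?x))" by simp
      qed simp
      also have "\<dots> = proj ?m (d f S)"
        unfolding diff_eq
        by (rule finsum_hom[symmetric]) (use d_term_closed[OF f] pa proj_add in auto)
      also have "\<dots> = d f S"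
        by (rule proj_id) (use df S True in \<open>auto simp: K_simps(5) pc_def\<close>)
      finally show ?thesis .
    qed
  qed
qed

subsection \<open>The Euler characteristic in one degree\<close>

abbreviation cycles :: "nat \<Rightarrow> (nat set \<Rightarrow> 'm) set" where
  "cycles p \<equiv> {f \<in> Kc p. d f = (\<lambda>_. \<zero>)}"

abbreviation boundaries :: "nat \<Rightarrow> (nat set \<Rightarrow> 'm) set" where
  "boundaries p \<equiv> d ` Kc (Suc p)"

lemma boundaries_subset_cycles: "boundaries p \<subseteq> cycles p"
proof
  fix g assume "g \<in> boundaries p"
  then obtain f where f: "f \<in> Kc (Suc p)" "g = d f" by blast
  have "d (d f) = (\<lambda>_. \<zero>)"
  proof (cases p)
    case 0
    then show ?thesis using d_Kc_0 d_closed[OF f(1)] by simp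
  next
    case (Suc q)
    then show ?thesis using d_d_zero f(1) by simp
  qed
  then show "g \<in> cycles p" using f d_closed by simp
qed

lemma sub_cycles: "submodule (cycles p) T0 (K p)"
proof (cases p)
  case 0
  then have "cycles p = Kc p" using d_Kc_0 by blast
  then show ?thesis using operator_group.sub_carrier[OF K_operator_group] by simp
next
  case (Suc q)
  interpret Kq: operator_group T0 "K q" by (rule K_operator_group)
  have "submodule {f \<in> Kc p. d f \<in> {\<zero>\<^bsub>K q\<^esub>}} T0 (K p)"
  proof (rule hom_preimage[OF K_operator_group K_operator_group operator_group.sub_carrier[OF K_operator_group]
        _ _ Kq.sub_zero_set])
    show "\<exists>r'\<in>carrier T0. \<forall>f\<in>Kc p. d (r \<odot>\<^bsub>K p\<^esub> f) = r' \<odot>\<^bsub>K q\<^esub> d f" if "r \<in> carrier T0" for r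
      using that d_op[OF that] by (intro bexI[of _ r]) (simp_all add: K_simps(4))
  qed (use Suc d_closed d_add in \<open>simp_all add: K_simps(3)\<close>)
  then show ?thesis by (simp add: K_simps(2))
qed

lemma sub_boundaries: "submodule (boundaries p) T0 (K p)"
proof (rule hom_image[OF K_operator_group K_operator_group])
  show "submodule (Kc (Suc p)) T0 (K (Suc p))" by (rule operator_group.sub_carrier[OF K_operator_group])
  show "submodule (Kc (Suc p)) T0 (K (Suc p))" by (rule operator_group.sub_carrier[OF K_operator_group])
  show "\<exists>r\<in>carrier T0. \<forall>f\<in>Kc (Suc p). d (r \<odot>\<^bsub>K (Suc p)\<^esub> f) = r' \<odot>\<^bsub>K p\<^esub> d f" if "r' \<in> carrier T0" for r'
    using that d_op[OF that] by (intro bexI[of _ r']) (simp_all add: K_simps(4))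
qed (use d_closed d_add in \<open>simp_all add: K_simps(3)\<close>)

lemma d_length:
  "sq_len T0 (K (Suc p)) (cycles (Suc p) \<inter> piece (K (Suc p)) n) (piece (K (Suc p)) n)
    = sq_len T0 (K p) {\<zero>\<^bsub>K p\<^esub>} (boundaries p \<inter> piece (K p) n)"
proof -
  interpret Kp: operator_group T0 "K p" by (rule K_operator_group)
  interpret Kq: operator_group T0 "K (Suc p)" by (rule K_operator_group)
  have sB: "submodule (boundaries p \<inter> piece (K p) n) T0 (K p)"
    by (rule Kp.sub_inter[OF sub_boundaries sub_K_piece])
  have pK: "f \<in> Kc (Suc p)" if "f \<in> piece (K (Suc p)) n" for f using that by (simp add: K_simps(5))
  show ?thesis
  proof (rule sq_len_hom[OF K_operator_group K_operator_group sub_K_piece sB Kp.sub_zero_set, where f = d])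
    show "{\<zero>\<^bsub>K p\<^esub>} \<subseteq> boundaries p \<inter> piece (K p) n" using Kp.sub_zero[OF sB] by blast
    show "d f \<in> boundaries p \<inter> piece (K p) n" if "f \<in> piece (K (Suc p)) n" for f
      using d_piece[OF that] pK[OF that] by blast
    show "d (f \<oplus>\<^bsub>K (Suc p)\<^esub> g) = d f \<oplus>\<^bsub>K p\<^esub> d g" if "f \<in> piece (K (Suc p)) n" "g \<in> piece (K (Suc p)) n" for f g
      using d_add[OF pK[OF that(1)] pK[OF that(2)]] by (simp add: K_simps(3))
    show "\<exists>r'\<in>carrier T0. \<forall>f\<in>piece (K (Suc p)) n. d (r \<odot>\<^bsub>K (Suc p)\<^esub> f) = r' \<odot>\<^bsub>K p\<^esub> d f"
      if "r \<in> carrier T0" for r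
      using that d_op[OF that pK] by (intro bexI[of _ r]) (simp_all add: K_simps(4))
    show "\<exists>r\<in>carrier T0. \<forall>f\<in>piece (K (Suc p)) n. d (r \<odot>\<^bsub>K (Suc p)\<^esub> f) = r' \<odot>\<^bsub>K p\<^esub> d f"
      if "r' \<in> carrier T0" for r'
      using that d_op[OF that pK] by (intro bexI[of _ r']) (simp_all add: K_simps(4))
    show "cycles (Suc p) \<inter> piece (K (Suc p)) n = {f \<in> piece (K (Suc p)) n. d f \<in> {\<zero>\<^bsub>K p\<^esub>}}"
      using pK by (auto simp: K_simps(2))
    fix b assume b: "b \<in> boundaries p \<inter> piece (K p) n"
    then obtain f where f: "f \<in> Kc (Suc p)" "b = d f" by blast
    have "d (Kproj (Suc p) n f) = b" using d_Kproj[OF f(1)] f(2) b by simp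
    moreover have "b \<oplus>\<^bsub>K p\<^esub> \<zero>\<^bsub>K p\<^esub> = b" using Kp.r_zero[OF Kp.sub_carr[OF sB b]] .
    ultimately show "\<exists>f\<in>piece (K (Suc p)) n. \<exists>z\<in>{\<zero>\<^bsub>K p\<^esub>}. b = d f \<oplus>\<^bsub>K p\<^esub> z"
      using Kproj_piece[OF f(1), of n] by (intro bexI[of _ "Kproj (Suc p) n f"] bexI[of _ "\<zero>\<^bsub>K p\<^esub>"]) simp_all
  qed
qed

end

lemma the_enat_sum:
  assumes "finite A" "\<And>x. x \<in> A \<Longrightarrow> f x \<noteq> \<infinity>"
  shows "sum f A \<noteq> \<infinity> \<and> int (the_enat (sum f A)) = (\<Sum>x\<in>A. int (the_enat (f x)))"
  using assms
proof (induction rule: finite_induct)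
  case empty
  then show ?case by (simp add: zero_enat_def)
next
  case (insert a A)
  then show ?case by (cases "f a"; cases "sum f A") auto
qed

definition koszul_sum :: "(nat \<times> 't) list \<Rightarrow> ((nat \<Rightarrow> nat) \<Rightarrow> int) \<Rightarrow> (nat \<Rightarrow> nat) \<Rightarrow> int" where
  "koszul_sum ys H n = (\<Sum>S\<in>Pow {..<length ys}. (- 1) ^ card S *
     (if koszul_deg ys S \<le> n then H (\<lambda>l. n l - koszul_deg ys S l) else 0))"

context koszul
begin

text \<open>In each degree, the length of the Koszul module is the sum of those of the boundaries, of the
  homology, and of the boundaries one index below. In the alternating sum the boundaries cancel.\<close>

theorem euler_in_degree:
  assumes fin: "\<And>n. sq_len T0 G {\<zero>} (piece G n) \<noteq> \<infinity>"
  shows "(\<Sum>p\<le>length ys. (- 1) ^ p * int (the_enat (mod_length T0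
        ((koszul_homology ys G p)\<lparr>carrier := piece (koszul_homology ys G p) n\<rparr>))))
    = koszul_sum ys (\<lambda>n. int (the_enat (sq_len T0 G {\<zero>} (piece G n)))) n"
proof -
  let ?H = "\<lambda>n. int (the_enat (sq_len T0 G {\<zero>} (piece G n)))"
  define P where "P p = piece (K p) n" for p
  define k where "k p = sq_len T0 (K p) {\<zero>\<^bsub>K p\<^esub>} (P p)" for p
  define b where "b p = sq_len T0 (K p) {\<zero>\<^bsub>K p\<^esub>} (boundaries p \<inter> P p)" for p
  define h where "h p = sq_len T0 (K p) (boundaries p \<inter> P p) (cycles p \<inter> P p)" for p
  define z where "z p = sq_len T0 (K p) (cycles p \<inter> P p) (P p)" for p
  let ?c = "\<lambda>S. sq_len T0 G {\<zero>} (pc n S)"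
  have cfin: "?c S \<noteq> \<infinity>" for S
    using fin sq_len_self[OF sub_zero_set] by (auto simp: pc_def zero_enat_def)
  have cval: "int (the_enat (?c S)) = (if koszul_deg ys S \<le> n then ?H (\<lambda>l. n l - koszul_deg ys S l) else 0)" for S
    using sq_len_self[OF sub_zero_set] by (simp add: pc_def zero_enat_def)
  have kc: "k p = (\<Sum>S\<in>idx p. ?c S)" for p unfolding k_def P_def by (rule K_piece_length)
  have kfin: "k p \<noteq> \<infinity>" and kval: "int (the_enat (k p)) = (\<Sum>S\<in>idx p. int (the_enat (?c S)))" for p
    unfolding kc using the_enat_sum[OF finite_idx, of p ?c] cfin by auto
  have split: "k p = b p + h p + z p" for p
  proof -
    interpret Kp: operator_group T0 "K p" by (rule K_operator_group)
    note sP = sub_K_piece[of p n, folded P_def]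
    have sB: "submodule (boundaries p \<inter> P p) T0 (K p)" and sZ: "submodule (cycles p \<inter> P p) T0 (K p)"
      by (rule Kp.sub_inter[OF sub_boundaries sP], rule Kp.sub_inter[OF sub_cycles sP])
    have BZ: "boundaries p \<inter> P p \<subseteq> cycles p \<inter> P p" using boundaries_subset_cycles by blast
    have 0: "{\<zero>\<^bsub>K p\<^esub>} \<subseteq> boundaries p \<inter> P p" using Kp.sub_zero[OF sB] by blast
    have "k p = b p + sq_len T0 (K p) (boundaries p \<inter> P p) (P p)"
      unfolding k_def b_def by (rule Kp.sq_len_add[OF Kp.sub_zero_set sB sP 0]) simp
    also have "sq_len T0 (K p) (boundaries p \<inter> P p) (P p) = h p + z p"
      unfolding h_def z_def by (rule Kp.sq_len_add[OF sB sZ sP BZ]) simp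
    finally show ?thesis by (simp add: add.assoc)
  qed
  have zS: "z (Suc p) = b p" for p unfolding z_def b_def P_def by (rule d_length)
  have z0: "z 0 = 0"
  proof -
    interpret K0: operator_group T0 "K 0" by (rule K_operator_group)
    have "P 0 \<subseteq> cycles 0" using d_Kc_0 by (auto simp: P_def K_simps(5))
    then have "cycles 0 \<inter> P 0 = P 0" by blast
    then show ?thesis unfolding z_def using K0.sq_len_self[OF sub_K_piece[of 0 n]] by (simp add: P_def)
  qed
  have bL: "b (length ys) = 0"
  proof -
    interpret KL: operator_group T0 "K (length ys)" by (rule K_operator_group)
    have "idx (Suc (length ys)) = {}"
    proof -
      have "S \<notin> idx (Suc (length ys))" for S
      proof
        assume "S \<in> idx (Suc (length ys))"
        then have S: "S \<subseteq> L" "card S = Suc (length ys)" by (simp_all add: idx_def)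
        show False using card_mono[OF finite_lessThan S(1)] S(2) by simp
      qed
      then show ?thesis by blast
    qed
    then have "f = (\<lambda>_. \<zero>)" if "f \<in> Kc (Suc (length ys))" for f
      using Kc_zero[OF that] by (intro ext) simp
    then have "Kc (Suc (length ys)) \<subseteq> {\<lambda>_. \<zero>}" by blast
    moreover have "d (\<lambda>_. \<zero>) S = (\<Oplus>s\<in>L - S. \<zero>)" for S
      unfolding diff_eq by (rule M.finsum_cong') (use act_zero in auto)
    then have "d (\<lambda>_. \<zero>) = \<zero>\<^bsub>K (length ys)\<^esub>" by (intro ext) (simp add: K_simps(2))
    ultimately have "boundaries (length ys) \<subseteq> {\<zero>\<^bsub>K (length ys)\<^esub>}" by auto
    then have "boundaries (length ys) \<inter> P (length ys) = {\<zero>\<^bsub>K (length ys)\<^esub>}"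
      using KL.sub_zero[OF KL.sub_inter[OF sub_boundaries[of "length ys"] sub_K_piece[of "length ys" n]]]
      by (auto simp: P_def)
    then show ?thesis unfolding b_def using KL.sq_len_self[OF KL.sub_zero_set] by simp
  qed
  define k' b' h' where "k' p = int (the_enat (k p))" and "b' p = int (the_enat (b p))"
    and "h' p = int (the_enat (h p))" for p
  have hfin: "b p \<noteq> \<infinity> \<and> h p \<noteq> \<infinity>" for p
    using kfin[of p] split[of p] by (cases "b p"; cases "h p") auto
  have k'0: "k' 0 = b' 0 + h' 0"
    using split[of 0] z0 hfin[of 0] unfolding k'_def b'_def h'_def by (cases "b 0"; cases "h 0") auto
  have k'S: "k' (Suc p) = b' (Suc p) + h' (Suc p) + b' p" for p
    using split[of "Suc p"] zS[of p] hfin[of "Suc p"] hfin[of p] unfolding k'_def b'_def h'_def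
    by (cases "b (Suc p)"; cases "h (Suc p)"; cases "b p") auto
  have tele: "(\<Sum>p\<le>l. (- 1) ^ p * k' p) = (\<Sum>p\<le>l. (- 1) ^ p * h' p) + (- 1) ^ l * b' l" for l
    by (induction l) (simp_all add: k'0 k'S algebra_simps)
  have "mod_length T0 ((koszul_homology ys G p)\<lparr>carrier := piece (koszul_homology ys G p) n\<rparr>) = h p" for p
    unfolding koszul_homology_def h_def P_def
    by (rule mod_length_graded_quot[OF K_operator_group sub_cycles sub_boundaries boundaries_subset_cycles sub_K_piece])
  then have "(\<Sum>p\<le>length ys. (- 1) ^ p * int (the_enat (mod_length T0
        ((koszul_homology ys G p)\<lparr>carrier := piece (koszul_homology ys G p) n\<rparr>))))
      = (\<Sum>p\<le>length ys. (- 1) ^ p * k' p)"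
    unfolding tele using bL by (simp add: h'_def b'_def zero_enat_def)
  also have "\<dots> = (\<Sum>p\<le>length ys. \<Sum>S\<in>{S \<in> Pow L. card S = p}. (- 1) ^ card S * int (the_enat (?c S)))"
  proof (rule sum.cong[OF refl])
    fix p
    have "idx p = {S \<in> Pow L. card S = p}" by (auto simp: idx_def)
    then show "(- 1) ^ p * k' p = (\<Sum>S\<in>{S \<in> Pow L. card S = p}. (- 1) ^ card S * int (the_enat (?c S)))"
      unfolding k'_def kval by (simp add: sum_distrib_left)
  qed
  also have "\<dots> = (\<Sum>S\<in>Pow L. (- 1) ^ card S * int (the_enat (?c S)))"
  proof (rule sum.group)
    show "card ` Pow L \<subseteq> {..length ys}" using card_mono[of L] by fastforce
  qed auto
  also have "\<dots> = koszul_sum ys ?H n" unfolding koszul_sum_def cval ..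
  finally show ?thesis .
qed

end

text \<open>Splitting the subsets according to whether they contain the last index gives the difference in
  the direction of the last element. The degree must be large enough for all shifts.\<close>

lemma koszul_sum_nabl:
  "\<forall>y\<in>set ys. length ys \<le> n (fst y) \<Longrightarrow> koszul_sum ys H n = nabl (map fst ys) H n"
proof (induction ys arbitrary: n rule: rev_induct)
  case Nil
  show ?case by (simp add: koszul_sum_def le_fun_def koszul_deg_def)
next
  case (snoc y ys)
  let ?L = "length ys" and ?i = "fst y"
  have ni: "n ?i \<noteq> 0" using snoc.prems by auto
  have deg1: "koszul_deg (ys @ [y]) S = koszul_deg ys S" if "S \<subseteq> {..<?L}" for S
  proof
    fix l
    have "{s \<in> S. fst ((ys @ [y]) ! s) = l} = {s \<in> S. fst (ys ! s) = l}" using that by (auto simp: nth_append)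
    then show "koszul_deg (ys @ [y]) S l = koszul_deg ys S l" by (simp add: koszul_deg_def)
  qed
  have deg2: "koszul_deg (ys @ [y]) (insert ?L S) = raise ?i (koszul_deg ys S)" if S: "S \<subseteq> {..<?L}" for S
  proof
    fix l
    have fin: "finite S" and n: "?L \<notin> S" using S finite_subset by auto
    have "{s \<in> insert ?L S. fst ((ys @ [y]) ! s) = l}
      = (if ?i = l then insert ?L {s \<in> S. fst (ys ! s) = l} else {s \<in> S. fst (ys ! s) = l})"
      using S by (auto simp: nth_append)
    then show "koszul_deg (ys @ [y]) (insert ?L S) l = raise ?i (koszul_deg ys S) l"
      using fin n by (auto simp: koszul_deg_def raise_def)
  qed
  let ?t = "\<lambda>ys n S. (- 1) ^ card S * (if koszul_deg ys S \<le> n then H (\<lambda>l. n l - koszul_deg ys S l) else 0)"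
  have Pow: "Pow {..<length (ys @ [y])} = Pow {..<?L} \<union> insert ?L ` Pow {..<?L}"
    by (simp add: lessThan_Suc Pow_insert)
  have "koszul_sum (ys @ [y]) H n = (\<Sum>S\<in>Pow {..<?L}. ?t (ys @ [y]) n S) + (\<Sum>S\<in>insert ?L ` Pow {..<?L}. ?t (ys @ [y]) n S)"
    unfolding koszul_sum_def Pow by (rule sum.union_disjoint) auto
  also have "(\<Sum>S\<in>insert ?L ` Pow {..<?L}. ?t (ys @ [y]) n S) = (\<Sum>S\<in>Pow {..<?L}. ?t (ys @ [y]) n (insert ?L S))"
  proof (rule sum.reindex_cong[of "insert ?L"])
    show "inj_on (insert ?L) (Pow {..<?L})"
    proof (rule inj_onI)
      fix A B assume AB: "A \<in> Pow {..<?L}" "B \<in> Pow {..<?L}" "insert ?L A = insert ?L B"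
      have "?L \<notin> A" "?L \<notin> B" using AB(1,2) by auto
      then show "A = B" using AB(3) insert_ident[of ?L A B] by simp
    qed
  qed simp_all
  also have "\<dots> = (\<Sum>S\<in>Pow {..<?L}. - ?t ys (lower ?i n) S)"
  proof (rule sum.cong[OF refl])
    fix S assume "S \<in> Pow {..<?L}"
    then have S: "S \<subseteq> {..<?L}" by simp
    have fin: "finite S" and n: "?L \<notin> S" using S finite_subset by auto
    let ?D = "koszul_deg ys S"
    have 1: "raise ?i ?D \<le> n \<longleftrightarrow> ?D \<le> lower ?i n"
      by (rule le_lower_iff[of n "fst y", OF ni])
    have 2: "(\<lambda>l. n l - raise ?i ?D l) = (\<lambda>l. lower ?i n l - ?D l)" by (simp add: raise_def lower_def fun_eq_iff)
    show "?t (ys @ [y]) n (insert ?L S) = - ?t ys (lower ?i n) S"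
      unfolding deg2[OF S] 1 2 using fin n by simp
  qed
  also have "\<dots> = - koszul_sum ys H (lower ?i n)" unfolding koszul_sum_def by (simp add: sum_negf)
  also have "(\<Sum>S\<in>Pow {..<?L}. ?t (ys @ [y]) n S) = koszul_sum ys H n"
    unfolding koszul_sum_def by (rule sum.cong[OF refl]) (simp add: deg1)
  finally have "koszul_sum (ys @ [y]) H n = koszul_sum ys H n - koszul_sum ys H (lower ?i n)" by simp
  moreover have "koszul_sum ys H n = nabl (map fst ys) H n" by (rule snoc.IH) (use snoc.prems in auto)
  moreover have "koszul_sum ys H (lower ?i n) = nabl (map fst ys) H (lower ?i n)"
    by (rule snoc.IH) (use snoc.prems in \<open>auto simp: lower_def\<close>)
  ultimately show ?case by (simp add: nabl_append nab_def)
qed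

section \<open>The associated graded module\<close>

lemma finite_below:
  assumes n: "n \<in> degs d"
  shows "finite {v. v \<le> n}"
proof -
  have "{v. v \<le> n} \<subseteq> (\<lambda>g i. if i \<le> d then g i else 0) ` (PiE {..d} (\<lambda>i. {..n i}))"
  proof
    fix v assume "v \<in> {v. v \<le> n}"
    then have v: "v i \<le> n i" for i by (simp add: le_fun_def)
    have "v = (\<lambda>i. if i \<le> d then restrict v {..d} i else 0)"
    proof
      fix i
      show "v i = (if i \<le> d then restrict v {..d} i else 0)"
        using v[of i] n by (cases "i \<le> d") (simp_all add: degs_def)
    qed
    moreover have "restrict v {..d} \<in> PiE {..d} (\<lambda>i. {..n i})" using v by simp
    ultimately show "v \<in> (\<lambda>g i. if i \<le> d then g i else 0) ` (PiE {..d} (\<lambda>i. {..n i}))" by (rule image_eqI)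
  qed
  then show ?thesis by (rule finite_subset) (intro finite_imageI finite_PiE finite_atMost)
qed

lemma below_degs: "n \<in> degs d \<Longrightarrow> v \<le> n \<Longrightarrow> v \<in> degs d"
proof -
  assume n: "n \<in> degs d" and v: "v \<le> n"
  have "v i = 0" if "d < i" for i using that n le_funD[OF v, of i] by (simp add: degs_def)
  then show ?thesis by (simp add: degs_def)
qed

lemma diff_degs: "n \<in> degs d \<Longrightarrow> (\<lambda>i. n i - v i) \<in> degs d"
  by (simp add: degs_def)

lemma (in cring) self_operator_group: "operator_group R (self_module R)"
proof -
  have "abelian_group (self_module R)"
  proof (rule abelian_groupI)
    fix x assume "x \<in> carrier (self_module R)"
    then show "\<exists>y\<in>carrier (self_module R). y \<oplus>\<^bsub>self_module R\<^esub> x = \<zero>\<^bsub>self_module R\<^esub>"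
      by (intro bexI[of _ "\<ominus> x"]) (simp_all add: self_module_def l_neg)
  qed (simp_all add: self_module_def a_ac)
  then show ?thesis
    by (rule operator_group.intro, unfold_locales) (simp_all add: self_module_def r_distr)
qed

lemma (in cring) ideal_self_submodule:
  assumes K: "ideal K R"
  shows "submodule K R (self_module R)"
proof -
  interpret S: operator_group R "self_module R" by (rule self_operator_group)
  have c: "x \<in> carrier R" if "x \<in> K" for x using ideal.Icarr[OF K that] .
  have inv: "\<ominus>\<^bsub>self_module R\<^esub> x = \<ominus> x" if "x \<in> carrier R" for x
    by (rule S.minus_equality) (use that in \<open>simp_all add: self_module_def l_neg\<close>)
  show ?thesis
  proof (rule S.subI)
    show "K \<subseteq> carrier (self_module R)" using c by (auto simp: self_module_def)
    show "\<zero>\<^bsub>self_module R\<^esub> \<in> K"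
      using additive_subgroup.zero_closed[OF ideal.axioms(1)[OF K]] by (simp add: self_module_def)
    show "\<ominus>\<^bsub>self_module R\<^esub> a \<in> K" if "a \<in> K" for a
      using additive_subgroup.a_inv_closed[OF ideal.axioms(1)[OF K] that] inv[OF c[OF that]] by simp
    show "a \<oplus>\<^bsub>self_module R\<^esub> b \<in> K" if "a \<in> K" "b \<in> K" for a b
      using additive_subgroup.a_closed[OF ideal.axioms(1)[OF K] that] by (simp add: self_module_def)
    show "r \<odot>\<^bsub>self_module R\<^esub> a \<in> K" if "r \<in> carrier R" "a \<in> K" for r a
      using ideal.I_l_closed[OF K that(2,1)] by (simp add: self_module_def)
  qed
qed

lemma (in cring) set_smult_self:
  assumes K: "ideal K R"
  shows "set_smult R (self_module R) K = K"
proof -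
  interpret S: operator_group R "self_module R" by (rule self_operator_group)
  have c: "x \<in> carrier R" if "x \<in> K" for x using ideal.Icarr[OF K that] .
  show ?thesis
  proof
    show "set_smult R (self_module R) K \<subseteq> K"
      unfolding set_smult_def
      by (rule S.submodule_gen_least[OF ideal_self_submodule[OF K]])
        (use ideal.I_r_closed[OF K] in \<open>auto simp: self_module_def\<close>)
    show "K \<subseteq> set_smult R (self_module R) K"
    proof
      fix x assume x: "x \<in> K"
      have "x = x \<odot>\<^bsub>self_module R\<^esub> \<one>" using c[OF x] by (simp add: self_module_def)
      then show "x \<in> set_smult R (self_module R) K"
        unfolding set_smult_def using x by (intro S.submodule_gen_mem) (auto simp: self_module_def)
    qed
  qed
qed

context ideal_system
begin

abbreviation D :: "(nat \<Rightarrow> nat) \<Rightarrow> 'm set" where "D n \<equiv> U (raise 0 n)"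

abbreviation GN :: "((nat \<Rightarrow> nat) \<Rightarrow> 'a set, (nat \<Rightarrow> nat) \<Rightarrow> 'm set) graded_module" where
  "GN \<equiv> assoc_module R I d N"

abbreviation elem :: "(nat \<Rightarrow> nat) \<Rightarrow> 'a \<Rightarrow> (nat \<Rightarrow> nat) \<Rightarrow> 'a set" where
  "elem \<equiv> gr_elem R I d (self_module R)"

lemma gr_den_N: "gr_den R I d N n = D n"
  by (simp add: gr_den_def U_def raise_def)

lemma gr_comp_N: "gr_comp R I d N n = quot_mod N (U n) (D n)"
  by (simp add: gr_comp_def gr_den_N U_def)

lemma gr_den_self: "gr_den R I d (self_module R) n = mpow (raise 0 n)"
  unfolding gr_den_def by (simp add: R.set_smult_self[OF ideal_mpow] raise_def)

lemma gr_comp_self: "gr_comp R I d (self_module R) n = quot_mod (self_module R) (mpow n) (mpow (raise 0 n))"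
  unfolding gr_comp_def gr_den_self by (simp add: R.set_smult_self[OF ideal_mpow])

lemma D_subset_U: "D n \<subseteq> U n"
  by (rule U_antimono) (simp add: raise_def)

text \<open>Elements of the associated graded module are represented by functions that choose an
  element of each coset.\<close>

definition reps :: "((nat \<Rightarrow> nat) \<Rightarrow> 'm) set" where
  "reps = {g. (\<forall>n\<in>degs d. g n \<in> U n) \<and> finite {n \<in> degs d. g n \<notin> D n}}"

definition cosets :: "((nat \<Rightarrow> nat) \<Rightarrow> 'm) \<Rightarrow> (nat \<Rightarrow> nat) \<Rightarrow> 'm set" where
  "cosets g = (\<lambda>n\<in>degs d. D n +> g n)"

lemma reps_U: "g \<in> reps \<Longrightarrow> n \<in> degs d \<Longrightarrow> g n \<in> U n"
  and reps_carr: "g \<in> reps \<Longrightarrow> n \<in> degs d \<Longrightarrow> g n \<in> carrier N"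
  and reps_finite: "g \<in> reps \<Longrightarrow> finite {n \<in> degs d. g n \<notin> D n}"
  using sub_carr[OF sub_U] by (auto simp: reps_def)

lemma repsI:
  assumes "\<And>n. n \<in> degs d \<Longrightarrow> g n \<in> U n" "finite F" "\<And>n. n \<in> degs d \<Longrightarrow> n \<notin> F \<Longrightarrow> g n \<in> D n"
  shows "g \<in> reps"
proof -
  have "{n \<in> degs d. g n \<notin> D n} \<subseteq> F" using assms(3) by blast
  then have "finite {n \<in> degs d. g n \<notin> D n}" using assms(2) by (rule finite_subset)
  then show ?thesis using assms(1) by (simp add: reps_def)
qed

lemma reps_zero: "(\<lambda>_. \<zero>) \<in> reps"
  by (rule repsI[of _ "{}"]) (simp_all add: sub_zero[OF sub_U])

lemma reps_add: "g \<in> reps \<Longrightarrow> h \<in> reps \<Longrightarrow> (\<lambda>n. g n \<oplus> h n) \<in> reps"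
  by (rule repsI[of _ "{n \<in> degs d. g n \<notin> D n} \<union> {n \<in> degs d. h n \<notin> D n}"])
    (simp_all add: sub_add[OF sub_U] reps_U reps_finite)

lemma reps_neg: "g \<in> reps \<Longrightarrow> (\<lambda>n. \<ominus> g n) \<in> reps"
  by (rule repsI[of _ "{n \<in> degs d. g n \<notin> D n}"])
    (simp_all add: sub_neg[OF sub_U] reps_U reps_finite)

definition shift :: "(nat \<Rightarrow> nat) \<Rightarrow> 'a \<Rightarrow> ((nat \<Rightarrow> nat) \<Rightarrow> 'm) \<Rightarrow> (nat \<Rightarrow> nat) \<Rightarrow> 'm" where
  "shift u x g n = (if u \<le> n then x \<odot> g (\<lambda>i. n i - u i) else \<zero>)"

lemma add_diff: "u \<le> n \<Longrightarrow> (\<lambda>i. u i + (n i - u i)) = (n :: nat \<Rightarrow> nat)"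
  by (simp add: le_fun_def)

lemma U_shift: "u \<le> n \<Longrightarrow> x \<in> mpow u \<Longrightarrow> v \<in> U (\<lambda>i. n i - u i) \<Longrightarrow> x \<odot> v \<in> U n"
  using U_mult[of x u v "\<lambda>i. n i - u i"] by (simp add: add_diff)

lemma raise_diff: "u \<le> n \<Longrightarrow> raise 0 (\<lambda>i. n i - u i) = (\<lambda>i. raise 0 n i - u i)"
  unfolding le_fun_def raise_def fun_eq_iff by (simp add: Suc_diff_le)

lemma le_raise: "u \<le> n \<Longrightarrow> u \<le> raise i n"
  unfolding le_fun_def raise_def by (simp add: le_SucI)

lemma D_shift: "u \<le> n \<Longrightarrow> x \<in> mpow u \<Longrightarrow> v \<in> D (\<lambda>i. n i - u i) \<Longrightarrow> x \<odot> v \<in> D n"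
  using U_shift[OF le_raise, of u n x v 0] by (simp add: raise_diff)

lemma D_shift': "u \<le> n \<Longrightarrow> x \<in> mpow (raise 0 u) \<Longrightarrow> v \<in> U (\<lambda>i. n i - u i) \<Longrightarrow> x \<odot> v \<in> D n"
proof -
  assume u: "u \<le> n" and x: "x \<in> mpow (raise 0 u)" and v: "v \<in> U (\<lambda>i. n i - u i)"
  have "(\<lambda>i. raise 0 u i + (n i - u i)) = raise 0 n"
    using u unfolding le_fun_def raise_def fun_eq_iff by simp
  then show ?thesis using U_mult[OF x v] by simp
qed

lemma reps_shift:
  assumes g: "g \<in> reps" and x: "x \<in> mpow u"
  shows "shift u x g \<in> reps"
proof (rule repsI[of _ "(\<lambda>m i. m i + u i) ` {n \<in> degs d. g n \<notin> D n}"])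
  fix n assume n: "n \<in> degs d"
  note w = diff_degs[OF n, of u]
  show "shift u x g n \<in> U n"
    using U_shift[OF _ x reps_U[OF g w]] sub_zero[OF sub_U] by (simp add: shift_def)
  assume F: "n \<notin> (\<lambda>m i. m i + u i) ` {n \<in> degs d. g n \<notin> D n}"
  show "shift u x g n \<in> D n"
  proof (cases "u \<le> n")
    case True
    have e: "(\<lambda>i. n i - u i + u i) = n" using True by (simp add: le_fun_def)
    have "(\<lambda>i. n i - u i) \<notin> {n \<in> degs d. g n \<notin> D n}"
    proof
      assume "(\<lambda>i. n i - u i) \<in> {n \<in> degs d. g n \<notin> D n}"
      then have "(\<lambda>m i. m i + u i) (\<lambda>i. n i - u i) \<in> (\<lambda>m i. m i + u i) ` {n \<in> degs d. g n \<notin> D n}"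
        by (rule imageI)
      then show False using F unfolding e by simp
    qed
    then have "g (\<lambda>i. n i - u i) \<in> D (\<lambda>i. n i - u i)" using w by blast
    then show ?thesis using D_shift[OF True x] True by (simp add: shift_def)
  next
    case False
    then show ?thesis using sub_zero[OF sub_U] by (simp add: shift_def)
  qed
qed (use reps_finite[OF g] in simp)

lemma cosets_eqI:
  assumes "g \<in> reps" "h \<in> reps" "\<And>n. n \<in> degs d \<Longrightarrow> g n \<ominus> h n \<in> D n"
  shows "cosets g = cosets h"
  unfolding cosets_def
  by (rule restrict_ext) (use assms coset_eq_iff[OF sub_U] reps_carr in blast)

lemma assoc_carrier: "carrier GN = cosets ` reps"
proof
  show "carrier GN \<subseteq> cosets ` reps"
  proof
    fix f assume "f \<in> carrier GN"
    then have f: "f \<in> (\<Pi>\<^sub>E n\<in>degs d. (\<lambda>a. D n +> a) ` U n)" and fin: "finite {n \<in> degs d. f n \<noteq> D n}"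
      by (simp_all add: assoc_module_def Let_def gr_comp_N quot_mod_simps)
    have "\<forall>n\<in>degs d. \<exists>m. m \<in> U n \<and> f n = D n +> m" using PiE_mem[OF f] by blast
    then obtain g where g: "\<forall>n\<in>degs d. g n \<in> U n \<and> f n = D n +> g n" using bchoice by metis
    have "g \<in> reps"
      by (rule repsI[OF _ fin]) (use g coset_eq_self_iff[OF sub_U] sub_carr[OF sub_U] in auto)
    moreover have "f = cosets g"
    proof
      show "f n = cosets g n" for n
        using g PiE_arb[OF f] by (cases "n \<in> degs d") (simp_all add: cosets_def)
    qed
    ultimately show "f \<in> cosets ` reps" by blast
  qed
  show "cosets ` reps \<subseteq> carrier GN"
  proof
    fix f assume "f \<in> cosets ` reps"
    then obtain g where g: "g \<in> reps" "f = cosets g" by blast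
    have "{n \<in> degs d. f n \<noteq> D n} \<subseteq> {n \<in> degs d. g n \<notin> D n}"
      using coset_eq_self_iff[OF sub_U reps_carr[OF g(1)]] g(2) by (auto simp: cosets_def)
    then have "finite {n \<in> degs d. f n \<noteq> D n}" using reps_finite[OF g(1)] by (rule finite_subset)
    moreover have "f \<in> (\<Pi>\<^sub>E n\<in>degs d. (\<lambda>a. D n +> a) ` U n)"
      using g reps_U by (auto simp: cosets_def)
    ultimately show "f \<in> carrier GN"
      by (simp add: assoc_module_def Let_def gr_comp_N quot_mod_simps)
  qed
qed

lemma assoc_zero: "\<zero>\<^bsub>GN\<^esub> = cosets (\<lambda>_. \<zero>)"
  by (simp add: assoc_module_def Let_def gr_comp_N quot_mod_simps cosets_def coset_zero[OF sub_U])

lemma assoc_add: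
  assumes "g \<in> reps" "h \<in> reps"
  shows "cosets g \<oplus>\<^bsub>GN\<^esub> cosets h = cosets (\<lambda>n. g n \<oplus> h n)"
proof -
  have "cosets g \<oplus>\<^bsub>GN\<^esub> cosets h = (\<lambda>n\<in>degs d. cosets g n <+> cosets h n)"
    by (simp add: assoc_module_def Let_def gr_comp_N quot_mod_simps)
  also have "\<dots> = cosets (\<lambda>n. g n \<oplus> h n)"
    unfolding cosets_def by (rule restrict_ext) (use assms reps_carr coset_add[OF sub_U] in simp)
  finally show ?thesis .
qed

lemma assoc_piece: "piece GN n = {f \<in> carrier GN. \<forall>u\<in>degs d. u \<noteq> n \<longrightarrow> f u = D u}"
  by (simp add: assoc_module_def Let_def gr_comp_N quot_mod_simps)

lemma elem_apply: "v \<in> degs d \<Longrightarrow>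
    elem u x v = (if v = u then mpow (raise 0 u) +>\<^bsub>self_module R\<^esub> x else mpow (raise 0 v))"
  by (simp add: gr_elem_def gr_den_self)

lemma self_coset: "mpow w +>\<^bsub>self_module R\<^esub> x = {b \<oplus>\<^bsub>R\<^esub> x | b. b \<in> mpow w}"
  by (auto simp: a_r_coset_def' self_module_def)

lemma UN_UN_const:
  "A \<noteq> {} \<Longrightarrow> B \<noteq> {} \<Longrightarrow> (\<And>a b. a \<in> A \<Longrightarrow> b \<in> B \<Longrightarrow> F a b = c) \<Longrightarrow> (\<Union>a\<in>A. \<Union>b\<in>B. F a b) = c"
  by auto

text \<open>The component of the ring element in a degree \<open>v\<close> other than \<open>u\<close> is the zero coset, that is, the
  set of denominators; its products with \<open>U\<close> lie in the denominator of degree \<open>n\<close>.\<close>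

lemma product_of_cosets:
  assumes u: "u \<in> degs d" and x: "x \<in> mpow u" and g: "g \<in> reps" and n: "n \<in> degs d" and v: "v \<le> n"
  shows "(\<Union>a\<in>elem u x v. \<Union>m\<in>cosets g (\<lambda>i. n i - v i). D n +> (a \<odot> m))
    = (if u = v then D n +> x \<odot> g (\<lambda>i. n i - v i) else D n)"
proof -
  let ?w = "\<lambda>i. n i - v i"
  have w: "?w \<in> degs d" by (rule diff_degs[OF n])
  have vd: "v \<in> degs d" by (rule below_degs[OF n v])
  have cw: "cosets g ?w = D ?w +> g ?w" using w by (simp add: cosets_def)
  have gw: "g ?w \<in> U ?w" "g ?w \<in> carrier N" using reps_U[OF g w] reps_carr[OF g w] .
  have mU: "m \<in> U ?w" if "m \<in> cosets g ?w" for m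
    using that gw(1) D_subset_U[of ?w] sub_add[OF sub_U] unfolding cw by (blast elim!: cosetE)
  have ne: "cosets g ?w \<noteq> {}" using coset_self[OF sub_U gw(2)] cw by auto
  have z: "\<zero>\<^bsub>R\<^esub> \<in> mpow k" for k
    using additive_subgroup.zero_closed[OF ideal.axioms(1)[OF ideal_mpow]] .
  show ?thesis
  proof (cases "u = v")
    case False
    then have t: "elem u x v = mpow (raise 0 v)" using vd by (simp add: elem_apply)
    have "(\<Union>a\<in>elem u x v. \<Union>m\<in>cosets g ?w. D n +> (a \<odot> m)) = D n"
    proof (rule UN_UN_const[OF _ ne])
      show "elem u x v \<noteq> {}" unfolding t using z by blast
      fix a m assume a: "a \<in> elem u x v" and m: "m \<in> cosets g ?w"
      have "a \<odot> m \<in> D n" by (rule D_shift'[OF v _ mU[OF m]]) (use a t in simp)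
      then show "D n +> (a \<odot> m) = D n" using coset_eq_self_iff[OF sub_U] sub_carr[OF sub_U] by simp
    qed
    then show ?thesis using False by simp
  next
    case True
    have xv: "x \<in> mpow v" and xc: "x \<in> carrier R" using x True mpow_carr by auto
    have t: "elem u x v = {b \<oplus>\<^bsub>R\<^esub> x | b. b \<in> mpow (raise 0 v)}" using vd True by (simp add: elem_apply self_coset)
    have "(\<Union>a\<in>elem u x v. \<Union>m\<in>cosets g ?w. D n +> (a \<odot> m)) = D n +> x \<odot> g ?w"
    proof (rule UN_UN_const[OF _ ne])
      show "elem u x v \<noteq> {}" unfolding t using z by blast
      fix a m assume a: "a \<in> elem u x v" and m: "m \<in> cosets g ?w"
      obtain b where b: "b \<in> mpow (raise 0 v)" "a = b \<oplus>\<^bsub>R\<^esub> x" using a t by blast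
      obtain e where e: "e \<in> D ?w" "m = e \<oplus> g ?w" using m unfolding cw by (rule cosetE)
      have bc: "b \<in> carrier R" and ec: "e \<in> carrier N" and mc: "m \<in> carrier N"
        using mpow_carr[OF b(1)] sub_carr[OF sub_U e(1)] sub_carr[OF sub_U mU[OF m]] .
      have 1: "b \<odot> m \<in> D n" by (rule D_shift'[OF v b(1) mU[OF m]])
      have 2: "x \<odot> e \<in> D n" by (rule D_shift[OF v xv e(1)])
      have "a \<odot> m = b \<odot> m \<oplus> (x \<odot> e \<oplus> x \<odot> g ?w)"
        using bc ec mc xc gw(2) by (simp only: b(2) smult_l_distr) (simp only: e(2) op_add)
      also have "\<dots> \<ominus> x \<odot> g ?w = b \<odot> m \<oplus> x \<odot> e"
        using bc ec mc xc gw(2) by (simp add: a_minus_def M.a_assoc M.r_neg)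
      finally have "a \<odot> m \<ominus> x \<odot> g ?w \<in> D n" using sub_add[OF sub_U 1 2] by simp
      then show "D n +> (a \<odot> m) = D n +> x \<odot> g ?w"
        using coset_eq_iff[OF sub_U] b(2) bc mc xc gw(2) by simp
    qed
    then show ?thesis using True by simp
  qed
qed

lemma smult_elem:
  assumes u: "u \<in> degs d" and x: "x \<in> mpow u" and g: "g \<in> reps"
  shows "elem u x \<odot>\<^bsub>GN\<^esub> cosets g = cosets (shift u x g)"
proof -
  have "elem u x \<odot>\<^bsub>GN\<^esub> cosets g = (\<lambda>n\<in>degs d. \<Oplus>\<^bsub>quot_mod N (U n) (D n)\<^esub> v \<in> {v. v \<le> n}.
      (\<Union>a\<in>elem u x v. \<Union>m\<in>cosets g (\<lambda>i. n i - v i). D n +> (a \<odot> m)))"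
    by (simp add: assoc_module_def Let_def gr_comp_N gr_den_N)
  also have "\<dots> = cosets (shift u x g)"
    unfolding cosets_def[of "shift u x g"]
  proof (rule restrict_ext)
    fix n assume n: "n \<in> degs d"
    let ?Q = "quot_mod N (U n) (D n)"
    interpret Q: operator_group R ?Q by (rule quot_operator_group[OF sub_U sub_U])
    let ?h = "\<lambda>v. D n +> x \<odot> g (\<lambda>i. n i - v i)"
    let ?h' = "\<lambda>v. if u = v then ?h u else \<zero>\<^bsub>?Q\<^esub>"
    have hc: "?h u \<in> carrier ?Q" if "u \<le> n"
      using U_shift[OF that x reps_U[OF g diff_degs[OF n]]] by (simp add: quot_mod_simps)
    have "(\<Oplus>\<^bsub>?Q\<^esub> v \<in> {v. v \<le> n}. (\<Union>a\<in>elem u x v. \<Union>m\<in>cosets g (\<lambda>i. n i - v i). D n +> (a \<odot> m)))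
        = (\<Oplus>\<^bsub>?Q\<^esub> v \<in> {v. v \<le> n}. ?h' v)"
    proof (rule Q.finsum_cong')
      show "?h' \<in> {v. v \<le> n} \<rightarrow> carrier ?Q" using hc Q.zero_closed by auto
      fix v assume "v \<in> {v. v \<le> n}"
      then show "(\<Union>a\<in>elem u x v. \<Union>m\<in>cosets g (\<lambda>i. n i - v i). D n +> (a \<odot> m)) = ?h' v"
        using product_of_cosets[OF u x g n, of v] by (simp add: quot_mod_simps)
    qed simp
    also have "\<dots> = D n +> shift u x g n"
    proof (cases "u \<le> n")
      case True
      have "(\<Oplus>\<^bsub>?Q\<^esub> v \<in> {v. v \<le> n}. ?h' v) = ?h u"
        using Q.finsum_singleton[of u "{v. v \<le> n}" "\<lambda>_. ?h u"] finite_below[OF n] hc[OF True] True by simp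
      then show ?thesis using True by (simp add: shift_def)
    next
      case False
      have "(\<Oplus>\<^bsub>?Q\<^esub> v \<in> {v. v \<le> n}. ?h' v) = (\<Oplus>\<^bsub>?Q\<^esub> v \<in> {v. v \<le> n}. \<zero>\<^bsub>?Q\<^esub>)"
        by (rule Q.finsum_cong') (use False in auto)
      also have "\<dots> = \<zero>\<^bsub>?Q\<^esub>" by simp
      also have "\<dots> = D n" by (simp only: quot_mod_simps(2))
      finally show ?thesis using False coset_zero[OF sub_U] by (simp add: shift_def)
    qed
    finally show "(\<Oplus>\<^bsub>?Q\<^esub> v \<in> {v. v \<le> n}. (\<Union>a\<in>elem u x v. \<Union>m\<in>cosets g (\<lambda>i. n i - v i). D n +> (a \<odot> m)))
        = D n +> shift u x g n" .
  qed
  finally show ?thesis .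
qed


lemma assoc_abelian_group: "abelian_group GN"
proof (rule abelian_groupI)
  show "\<zero>\<^bsub>GN\<^esub> \<in> carrier GN" unfolding assoc_carrier assoc_zero using reps_zero by blast
  fix x assume "x \<in> carrier GN"
  then obtain g where g: "g \<in> reps" "x = cosets g" unfolding assoc_carrier by blast
  note gc = reps_carr[OF g(1)]
  show "\<zero>\<^bsub>GN\<^esub> \<oplus>\<^bsub>GN\<^esub> x = x"
    unfolding g(2) assoc_zero assoc_add[OF reps_zero g(1)]
    unfolding cosets_def by (rule restrict_ext) (simp add: gc)
  have "cosets (\<lambda>n. \<ominus> g n) \<oplus>\<^bsub>GN\<^esub> x = \<zero>\<^bsub>GN\<^esub>"
    unfolding g(2) assoc_zero assoc_add[OF reps_neg[OF g(1)] g(1)]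
    unfolding cosets_def by (rule restrict_ext) (simp add: gc M.l_neg)
  then show "\<exists>y\<in>carrier GN. y \<oplus>\<^bsub>GN\<^esub> x = \<zero>\<^bsub>GN\<^esub>"
    unfolding assoc_carrier using reps_neg[OF g(1)] by blast
  fix y assume "y \<in> carrier GN"
  then obtain h where h: "h \<in> reps" "y = cosets h" unfolding assoc_carrier by blast
  note hc = reps_carr[OF h(1)]
  show "x \<oplus>\<^bsub>GN\<^esub> y \<in> carrier GN"
    unfolding g(2) h(2) assoc_add[OF g(1) h(1)] assoc_carrier using reps_add[OF g(1) h(1)] by blast
  show "x \<oplus>\<^bsub>GN\<^esub> y = y \<oplus>\<^bsub>GN\<^esub> x"
    unfolding g(2) h(2) assoc_add[OF g(1) h(1)] assoc_add[OF h(1) g(1)]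
    unfolding cosets_def by (rule restrict_ext) (simp add: gc hc M.a_comm)
  fix z assume "z \<in> carrier GN"
  then obtain k where k: "k \<in> reps" "z = cosets k" unfolding assoc_carrier by blast
  show "x \<oplus>\<^bsub>GN\<^esub> y \<oplus>\<^bsub>GN\<^esub> z = x \<oplus>\<^bsub>GN\<^esub> (y \<oplus>\<^bsub>GN\<^esub> z)"
    unfolding g(2) h(2) k(2) assoc_add[OF g(1) h(1)] assoc_add[OF h(1) k(1)]
      assoc_add[OF reps_add[OF g(1) h(1)] k(1)] assoc_add[OF g(1) reps_add[OF h(1) k(1)]]
    unfolding cosets_def by (rule restrict_ext) (simp add: gc hc reps_carr[OF k(1)] M.a_assoc)
qed

lemma elem_op_closed:
  assumes "u \<in> degs d" "x \<in> mpow u" "f \<in> carrier GN"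
  shows "elem u x \<odot>\<^bsub>GN\<^esub> f \<in> carrier GN"
  using assms(3) smult_elem[OF assms(1,2)] reps_shift[OF _ assms(2)] unfolding assoc_carrier by auto

lemma elem_op_add:
  assumes u: "u \<in> degs d" "x \<in> mpow u" and f: "f \<in> carrier GN" and f': "f' \<in> carrier GN"
  shows "elem u x \<odot>\<^bsub>GN\<^esub> (f \<oplus>\<^bsub>GN\<^esub> f') = elem u x \<odot>\<^bsub>GN\<^esub> f \<oplus>\<^bsub>GN\<^esub> elem u x \<odot>\<^bsub>GN\<^esub> f'"
proof -
  obtain g where g: "g \<in> reps" "f = cosets g" using f unfolding assoc_carrier by blast
  obtain h where h: "h \<in> reps" "f' = cosets h" using f' unfolding assoc_carrier by blast
  note c = reps_carr[OF g(1)] reps_carr[OF h(1)] and xc = mpow_carr[OF u(2)]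
  show ?thesis
    unfolding g(2) h(2) assoc_add[OF g(1) h(1)] smult_elem[OF u g(1)] smult_elem[OF u h(1)]
      smult_elem[OF u reps_add[OF g(1) h(1)]] assoc_add[OF reps_shift[OF g(1) u(2)] reps_shift[OF h(1) u(2)]]
    unfolding cosets_def
    by (rule restrict_ext) (simp add: shift_def c diff_degs xc op_add)
qed

lemma elem_commute:
  assumes u: "u \<in> degs d" "x \<in> mpow u" and v: "v \<in> degs d" "y \<in> mpow v" and f: "f \<in> carrier GN"
  shows "elem u x \<odot>\<^bsub>GN\<^esub> (elem v y \<odot>\<^bsub>GN\<^esub> f) = elem v y \<odot>\<^bsub>GN\<^esub> (elem u x \<odot>\<^bsub>GN\<^esub> f)"
proof -
  obtain g where g: "g \<in> reps" "f = cosets g" using f unfolding assoc_carrier by blast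
  note xc = mpow_carr[OF u(2)] mpow_carr[OF v(2)]
  have le: "v \<le> (\<lambda>i. n i - u i) \<and> u \<le> n \<longleftrightarrow> u \<le> (\<lambda>i. n i - v i) \<and> v \<le> n" for n :: "nat \<Rightarrow> nat"
  proof -
    have "v i \<le> n i - u i \<and> u i \<le> n i \<longleftrightarrow> u i \<le> n i - v i \<and> v i \<le> n i" for i by auto
    then show ?thesis unfolding le_fun_def by blast
  qed
  have "shift u x (shift v y g) n = shift v y (shift u x g) n" if n: "n \<in> degs d" for n
  proof -
    have e: "(\<lambda>i. n i - u i - v i) = (\<lambda>i. n i - v i - u i)" by (simp add: add.commute)
    have c: "g (\<lambda>i. n i - u i - v i) \<in> carrier N"
      by (rule reps_carr[OF g(1) diff_degs[OF diff_degs[OF n]]])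
    show ?thesis
      using le[of n] smult_commute[OF xc c] op_zero[OF xc(1)] op_zero[OF xc(2)] unfolding shift_def e by auto
  qed
  then show ?thesis
    unfolding g(2) smult_elem[OF u g(1)] smult_elem[OF v g(1)] smult_elem[OF u reps_shift[OF g(1) v(2)]]
      smult_elem[OF v reps_shift[OF g(1) u(2)]]
    unfolding cosets_def by (intro restrict_ext) simp
qed

definition T0 :: "((nat \<Rightarrow> nat) \<Rightarrow> 'a set) graded_ring" where
  "T0 = (assoc_ring R I d)\<lparr>carrier := rpiece (assoc_ring R I d) (\<lambda>_. 0)\<rparr>"

lemma zero_degs: "(\<lambda>_. 0) \<in> degs d"
  by (simp add: degs_def)

text \<open>So lengths over the degree zero part are lengths over the ground ring.\<close>

lemma T0_carrier: "carrier T0 = elem (\<lambda>_. 0) ` carrier R"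
proof -
  interpret S: operator_group R "self_module R" by (rule R.self_operator_group)
  let ?o = "\<lambda>_::nat. 0::nat"
  let ?co = "\<lambda>n a. mpow (raise 0 n) +>\<^bsub>self_module R\<^esub> a"
  have sK: "submodule (mpow n) R (self_module R)" for n
    by (rule R.ideal_self_submodule[OF ideal_mpow])
  have T: "carrier T0 = {f. f \<in> (\<Pi>\<^sub>E n\<in>degs d. ?co n ` mpow n) \<and>
      finite {n \<in> degs d. f n \<noteq> mpow (raise 0 n)} \<and> (\<forall>u\<in>degs d. u \<noteq> ?o \<longrightarrow> f u = mpow (raise 0 u))}"
    by (auto simp: T0_def assoc_ring_def assoc_module_def Let_def gr_comp_self S.quot_mod_simps)
  show ?thesis
  proof
    show "carrier T0 \<subseteq> elem ?o ` carrier R"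
    proof
      fix f assume "f \<in> carrier T0"
      then have f: "f \<in> (\<Pi>\<^sub>E n\<in>degs d. ?co n ` mpow n)"
        and f0: "\<forall>u\<in>degs d. u \<noteq> ?o \<longrightarrow> f u = mpow (raise 0 u)" unfolding T by auto
      obtain r where r: "r \<in> carrier R" "f ?o = ?co ?o r" using PiE_mem[OF f zero_degs] mpow_0 by auto
      have "f = elem ?o r"
      proof
        fix n
        show "f n = elem ?o r n"
        proof (cases "n \<in> degs d")
          case True
          then show ?thesis using f0 r(2) by (simp add: elem_apply)
        next
          case False
          then show ?thesis using PiE_arb[OF f False] by (simp add: gr_elem_def)
        qed
      qed
      then show "f \<in> elem ?o ` carrier R" using r(1) by blast
    qed
    show "elem ?o ` carrier R \<subseteq> carrier T0"
    proof
      fix f assume "f \<in> elem ?o ` carrier R"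
      then obtain r where r: "r \<in> carrier R" "f = elem ?o r" by blast
      have a: "f n = (if n = ?o then ?co ?o r else mpow (raise 0 n))" if "n \<in> degs d" for n
        using that r(2) by (simp add: elem_apply)
      have "f n \<in> ?co n ` mpow n" if n: "n \<in> degs d" for n
      proof (cases "n = ?o")
        case True
        then show ?thesis using a[OF n] r(1) mpow_0 by simp
      next
        case False
        have "\<zero>\<^bsub>self_module R\<^esub> \<in> mpow n" by (rule S.sub_zero[OF sK])
        moreover have "?co n \<zero>\<^bsub>self_module R\<^esub> = f n" using a[OF n] False S.coset_zero[OF sK] by simp
        ultimately show ?thesis by (metis image_eqI)
      qed
      moreover have "f \<in> extensional (degs d)" using r(2) by (simp add: gr_elem_def)
      ultimately have "f \<in> (\<Pi>\<^sub>E n\<in>degs d. ?co n ` mpow n)" by (simp add: PiE_iff)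
      moreover have "finite {n \<in> degs d. f n \<noteq> mpow (raise 0 n)}"
        by (rule finite_subset[of _ "{?o}"]) (use a in auto)
      ultimately show "f \<in> carrier T0" unfolding T using a by simp
    qed
  qed
qed

lemma T0_operator_group: "operator_group T0 GN"
proof -
  interpret abelian_group GN by (rule assoc_abelian_group)
  show ?thesis
    by unfold_locales (auto simp: T0_carrier mpow_0 zero_degs elem_op_closed elem_op_add)
qed

subsection \<open>Graded submodules\<close>

definition between :: "((nat \<Rightarrow> nat) \<Rightarrow> 'm set) \<Rightarrow> bool" where
  "between A \<longleftrightarrow> (\<forall>n\<in>degs d. sub (A n) \<and> D n \<subseteq> A n \<and> A n \<subseteq> U n)"

lemma betweenD:
  assumes "between A" "n \<in> degs d"
  shows "sub (A n)" "D n \<subseteq> A n" "A n \<subseteq> U n"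
  using assms by (simp_all add: between_def)

text \<open>The recursion for the mixed multiplicity symbol runs over subsets of the associated graded
  module. All of them have this form, which reduces the recursion to families of submodules of \<open>N\<close>.\<close>

definition graded_sub :: "((nat \<Rightarrow> nat) \<Rightarrow> 'm set) \<Rightarrow> ((nat \<Rightarrow> nat) \<Rightarrow> 'm set) set" where
  "graded_sub A = {f \<in> carrier GN. \<forall>n\<in>degs d. f n \<subseteq> A n}"

lemma cosets_apply: "n \<in> degs d \<Longrightarrow> cosets g n = D n +> g n"
  by (simp add: cosets_def)

lemma graded_sub_cosets:
  assumes A: "between A" and g: "g \<in> reps"
  shows "cosets g \<in> graded_sub A \<longleftrightarrow> (\<forall>n\<in>degs d. g n \<in> A n)"
proof -
  have "cosets g n \<subseteq> A n \<longleftrightarrow> g n \<in> A n" if n: "n \<in> degs d" for n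
    unfolding cosets_apply[OF n]
    by (rule coset_sub_iff[OF sub_U betweenD(1,2)[OF A n] reps_carr[OF g n]])
  then show ?thesis using g by (simp add: graded_sub_def assoc_carrier)
qed

lemma graded_subE:
  assumes A: "between A" and f: "f \<in> graded_sub A"
  obtains g where "g \<in> reps" "f = cosets g" "\<forall>n\<in>degs d. g n \<in> A n"
proof -
  have "f \<in> cosets ` reps" using f by (simp add: graded_sub_def assoc_carrier)
  then obtain g where g: "g \<in> reps" "f = cosets g" by blast
  show ?thesis using that[OF g] graded_sub_cosets[OF A g(1)] f g(2) by simp
qed

lemma assoc_neg:
  assumes g: "g \<in> reps"
  shows "\<ominus>\<^bsub>GN\<^esub> cosets g = cosets (\<lambda>n. \<ominus> g n)"
proof -
  interpret G: operator_group T0 GN by (rule T0_operator_group)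
  show ?thesis
  proof (rule G.minus_equality)
    show "cosets (\<lambda>n. \<ominus> g n) \<oplus>\<^bsub>GN\<^esub> cosets g = \<zero>\<^bsub>GN\<^esub>"
      unfolding assoc_zero assoc_add[OF reps_neg[OF g] g] unfolding cosets_def
      by (rule restrict_ext) (simp add: reps_carr[OF g] M.l_neg)
  qed (use g reps_neg[OF g] in \<open>simp_all add: assoc_carrier\<close>)
qed

lemma T0_smult:
  assumes "g \<in> reps" "r \<in> carrier R"
  shows "elem (\<lambda>_. 0) r \<odot>\<^bsub>GN\<^esub> cosets g = cosets (\<lambda>n. r \<odot> g n)"
  using smult_elem[OF zero_degs _ assms(1), of r] assms(2) by (simp add: mpow_0 shift_def[abs_def] le_fun_def)

lemma reps_smult: "g \<in> reps \<Longrightarrow> r \<in> carrier R \<Longrightarrow> (\<lambda>n. r \<odot> g n) \<in> reps"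
  using reps_shift[of g r "\<lambda>_. 0"] by (simp add: mpow_0 shift_def[abs_def] le_fun_def)

lemma sub_graded_sub:
  assumes A: "between A"
  shows "submodule (graded_sub A) T0 GN"
proof -
  interpret G: operator_group T0 GN by (rule T0_operator_group)
  note s = betweenD(1)[OF A]
  show ?thesis
  proof (rule G.subI)
    show "graded_sub A \<subseteq> carrier GN" by (auto simp: graded_sub_def)
    show "\<zero>\<^bsub>GN\<^esub> \<in> graded_sub A"
      unfolding assoc_zero graded_sub_cosets[OF A reps_zero] using sub_zero[OF s] by blast
    fix f assume "f \<in> graded_sub A"
    then obtain g where g: "g \<in> reps" "f = cosets g" "\<forall>n\<in>degs d. g n \<in> A n" by (rule graded_subE[OF A])
    show "\<ominus>\<^bsub>GN\<^esub> f \<in> graded_sub A"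
      unfolding g(2) assoc_neg[OF g(1)] graded_sub_cosets[OF A reps_neg[OF g(1)]]
      using g(3) sub_neg[OF s] by simp
    show "r \<odot>\<^bsub>GN\<^esub> f \<in> graded_sub A" if rT: "r \<in> carrier T0" for r
    proof -
      obtain r' where r: "r' \<in> carrier R" "r = elem (\<lambda>_. 0) r'" using rT unfolding T0_carrier by blast
      show ?thesis
        unfolding r(2) g(2) T0_smult[OF g(1) r(1)] graded_sub_cosets[OF A reps_smult[OF g(1) r(1)]]
        using g(3) r(1) sub_op[OF s] by simp
    qed
    fix f' assume "f' \<in> graded_sub A"
    then obtain h where h: "h \<in> reps" "f' = cosets h" "\<forall>n\<in>degs d. h n \<in> A n" by (rule graded_subE[OF A])
    show "f \<oplus>\<^bsub>GN\<^esub> f' \<in> graded_sub A"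
      unfolding g(2) h(2) assoc_add[OF g(1) h(1)] graded_sub_cosets[OF A reps_add[OF g(1) h(1)]]
      using g(3) h(3) sub_add[OF s] by simp
  qed
qed

lemma between_U: "between U"
  by (simp add: between_def sub_U D_subset_U)

lemma between_D: "between D"
  by (simp add: between_def sub_U D_subset_U)

lemma graded_sub_U: "graded_sub U = carrier GN"
proof -
  have "cosets g \<in> graded_sub U" if "g \<in> reps" for g
    using graded_sub_cosets[OF between_U that] reps_U[OF that] by simp
  then show ?thesis unfolding assoc_carrier by (auto simp: graded_sub_def assoc_carrier)
qed

lemma graded_sub_D: "graded_sub D = {\<zero>\<^bsub>GN\<^esub>}"
proof -
  interpret G: operator_group T0 GN by (rule T0_operator_group)
  have "f = \<zero>\<^bsub>GN\<^esub>" if f: "f \<in> graded_sub D" for f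
  proof -
    obtain g where g: "g \<in> reps" "f = cosets g" "\<forall>n\<in>degs d. g n \<in> D n"
      using f by (rule graded_subE[OF between_D])
    show ?thesis
      unfolding g(2) assoc_zero cosets_def
      by (rule restrict_ext) (use g(3) coset_eq_self_iff[OF sub_U reps_carr[OF g(1)]] coset_zero[OF sub_U] in simp)
  qed
  then show ?thesis using G.sub_zero[OF sub_graded_sub[OF between_D]] by blast
qed

lemma between_at: "between A \<Longrightarrow> between (\<lambda>u. if u = n then A u else D u)"
  by (simp add: between_def sub_U D_subset_U)

lemma graded_sub_piece:
  assumes A: "between A"
  shows "graded_sub A \<inter> piece GN n = graded_sub (\<lambda>u. if u = n then A u else D u)" (is "_ = graded_sub ?A")
proof -
  have e: "cosets g u = D u \<longleftrightarrow> g u \<in> D u" if "g \<in> reps" "u \<in> degs d" for g u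
    unfolding cosets_apply[OF that(2)] by (rule coset_eq_self_iff[OF sub_U reps_carr[OF that]])
  have "cosets g \<in> graded_sub A \<inter> piece GN n \<longleftrightarrow> cosets g \<in> graded_sub ?A" if g: "g \<in> reps" for g
  proof -
    have "cosets g \<in> piece GN n \<longleftrightarrow> (\<forall>u\<in>degs d. u \<noteq> n \<longrightarrow> g u \<in> D u)"
      using g e[OF g] by (simp add: assoc_piece assoc_carrier)
    then show ?thesis
      unfolding Int_iff graded_sub_cosets[OF A g] graded_sub_cosets[OF between_at[OF A] g]
      using betweenD(2)[OF A] by auto
  qed
  moreover have "graded_sub A \<inter> piece GN n \<subseteq> cosets ` reps" "graded_sub ?A \<subseteq> cosets ` reps"
    by (auto simp: graded_sub_def assoc_carrier)
  ultimately show ?thesis by blast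
qed

lemma piece_eq: "piece GN n = graded_sub (\<lambda>u. if u = n then U u else D u)"
proof -
  have "carrier GN \<inter> piece GN n = piece GN n" by (auto simp: assoc_piece)
  then show ?thesis using graded_sub_piece[OF between_U, of n] by (simp add: graded_sub_U)
qed

lemma sub_piece: "submodule (piece GN n) T0 GN"
  unfolding piece_eq by (rule sub_graded_sub[OF between_at[OF between_U]])

lemma graded_sub_mono: "(\<And>n. n \<in> degs d \<Longrightarrow> A n \<subseteq> B n) \<Longrightarrow> graded_sub A \<subseteq> graded_sub B"
  unfolding graded_sub_def by blast

definition single :: "(nat \<Rightarrow> nat) \<Rightarrow> 'm \<Rightarrow> (nat \<Rightarrow> nat) \<Rightarrow> 'm" where
  "single n v = (\<lambda>u. if u = n then v else \<zero>)"

lemma reps_single: "v \<in> U n \<Longrightarrow> single n v \<in> reps"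
  by (rule repsI[of _ "{n}"]) (simp_all add: single_def sub_zero[OF sub_U])

lemma graded_sub_length:
  assumes A: "between A" and B: "between B" and BA: "B n \<subseteq> A n" and n: "n \<in> degs d"
  shows "sq_len T0 GN (graded_sub B \<inter> piece GN n) (graded_sub A \<inter> piece GN n) = sq_len R N (B n) (A n)"
proof -
  interpret G: operator_group T0 GN by (rule T0_operator_group)
  let ?A = "\<lambda>u. if u = n then A u else D u" and ?B = "\<lambda>u. if u = n then B u else D u"
  note bA = between_at[OF A, of n] and bB = between_at[OF B, of n]
  note sA = betweenD(1)[OF A n]
  have r: "single n v \<in> reps" if "v \<in> A n" for v using reps_single betweenD(3)[OF A n] that by blast
  have mem: "cosets (single n v) \<in> graded_sub ?A" if "v \<in> A n" for v
    unfolding graded_sub_cosets[OF bA r[OF that]] using that sub_zero[OF sub_U] by (simp add: single_def)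
  have rep: "\<exists>v\<in>A n. f = cosets (single n v)" if f: "f \<in> graded_sub ?A" for f
  proof -
    obtain g where g: "g \<in> reps" "f = cosets g" "\<forall>u\<in>degs d. g u \<in> ?A u" using f by (rule graded_subE[OF bA])
    have gn: "g n \<in> A n" using g(3) n by auto
    have neg0: "\<ominus> \<zero> = \<zero>" using M.minus_equality[of \<zero> \<zero>] by simp
    have "cosets g = cosets (single n (g n))"
    proof (rule cosets_eqI[OF g(1) r[OF gn]])
      fix u assume u: "u \<in> degs d"
      show "g u \<ominus> single n (g n) u \<in> D u"
      proof (cases "u = n")
        case True
        then show ?thesis using reps_carr[OF g(1) u] sub_zero[OF sub_U] by (simp add: single_def a_minus_def M.r_neg)
      next
        case False
        have "g u \<ominus> single n (g n) u = g u \<oplus> \<zero>"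
          unfolding single_def a_minus_def using False by (simp only: if_False neg0)
        then show ?thesis using bspec[OF g(3) u] reps_carr[OF g(1) u] False by simp
      qed
    qed
    then show ?thesis using gn g(2) by blast
  qed
  have sm: "cosets (single n (r \<odot> v)) = elem (\<lambda>_. 0) r \<odot>\<^bsub>GN\<^esub> cosets (single n v)"
    if "r \<in> carrier R" "v \<in> A n" for r v
  proof -
    have "single n (r \<odot> v) = (\<lambda>u. r \<odot> single n v u)"
      using op_zero[OF that(1)] by (simp add: single_def fun_eq_iff)
    then show ?thesis using T0_smult[OF r[OF that(2)] that(1)] by simp
  qed
  have "sq_len R N (B n) (A n) = sq_len T0 GN (graded_sub ?B) (graded_sub ?A)"
  proof (rule sq_len_hom[OF operator_group T0_operator_group sA sub_graded_sub[OF bA] sub_graded_sub[OF bB],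
        where f = "\<lambda>v. cosets (single n v)"])
    show "graded_sub ?B \<subseteq> graded_sub ?A" by (rule graded_sub_mono) (use BA in auto)
    show "cosets (single n v) \<in> graded_sub ?A" if "v \<in> A n" for v by (rule mem[OF that])
    show "cosets (single n (v \<oplus> w)) = cosets (single n v) \<oplus>\<^bsub>GN\<^esub> cosets (single n w)"
      if "v \<in> A n" "w \<in> A n" for v w
    proof -
      have "single n (v \<oplus> w) = (\<lambda>u. single n v u \<oplus> single n w u)" by (simp add: single_def fun_eq_iff)
      then show ?thesis using assoc_add[OF r[OF that(1)] r[OF that(2)]] by simp
    qed
    show "\<exists>v\<in>A n. \<exists>b\<in>graded_sub ?B. f = cosets (single n v) \<oplus>\<^bsub>GN\<^esub> b" if f: "f \<in> graded_sub ?A" for f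
    proof -
      obtain v where v: "v \<in> A n" "f = cosets (single n v)" using rep[OF f] by blast
      have "f = cosets (single n v) \<oplus>\<^bsub>GN\<^esub> \<zero>\<^bsub>GN\<^esub>"
        using v G.sub_carr[OF sub_graded_sub[OF bA] mem[OF v(1)]] by simp
      then show ?thesis using v(1) G.sub_zero[OF sub_graded_sub[OF bB]] by blast
    qed
    show "\<exists>r'\<in>carrier T0. \<forall>v\<in>A n. cosets (single n (r \<odot> v)) = r' \<odot>\<^bsub>GN\<^esub> cosets (single n v)"
      if "r \<in> carrier R" for r
      unfolding T0_carrier using sm that by blast
    show "\<exists>r\<in>carrier R. \<forall>v\<in>A n. cosets (single n (r \<odot> v)) = r' \<odot>\<^bsub>GN\<^esub> cosets (single n v)"
      if "r' \<in> carrier T0" for r'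
      using that sm unfolding T0_carrier by blast
    show "B n = {v \<in> A n. cosets (single n v) \<in> graded_sub ?B}"
    proof -
      have "cosets (single n v) \<in> graded_sub ?B \<longleftrightarrow> v \<in> B n" if "v \<in> A n" for v
        unfolding graded_sub_cosets[OF bB r[OF that]] using n sub_zero[OF sub_U] by (auto simp: single_def)
      then show ?thesis using BA by blast
    qed
  qed
  then show ?thesis by (simp add: graded_sub_piece[OF A] graded_sub_piece[OF B])
qed

subsection \<open>Homogeneous operators\<close>

definition proj :: "(nat \<Rightarrow> nat) \<Rightarrow> ((nat \<Rightarrow> nat) \<Rightarrow> 'm set) \<Rightarrow> (nat \<Rightarrow> nat) \<Rightarrow> 'm set" where
  "proj n f = (\<lambda>u\<in>degs d. if u = n then f u else D u)"

definition cut :: "(nat \<Rightarrow> nat) \<Rightarrow> ((nat \<Rightarrow> nat) \<Rightarrow> 'm) \<Rightarrow> (nat \<Rightarrow> nat) \<Rightarrow> 'm" where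
  "cut n g = (\<lambda>u. if u = n then g u else \<zero>)"

lemma proj_cosets: "proj n (cosets g) = cosets (cut n g)"
  unfolding proj_def cosets_def
  by (rule restrict_ext) (auto simp: cut_def coset_zero[OF sub_U])

lemma reps_cut: "g \<in> reps \<Longrightarrow> cut n g \<in> reps"
  by (rule repsI[of _ "{n}"]) (auto simp: cut_def sub_zero[OF sub_U] reps_U)

lemma piece_cosets:
  assumes "g \<in> reps"
  shows "cosets g \<in> piece GN n \<longleftrightarrow> (\<forall>u\<in>degs d. u \<noteq> n \<longrightarrow> g u \<in> D u)"
  unfolding piece_eq graded_sub_cosets[OF between_at[OF between_U] assms]
  using reps_U[OF assms] by auto

lemma graded_operators_assoc: "graded_operators T0 GN proj"
proof -
  interpret G: operator_group T0 GN by (rule T0_operator_group)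
  show ?thesis
  proof (rule graded_operators.intro[OF T0_operator_group], rule graded_operators_axioms.intro)
    show "submodule (piece GN n) T0 GN" for n by (rule sub_piece)
    fix f n assume "f \<in> carrier GN"
    then obtain g where g: "g \<in> reps" "f = cosets g" unfolding assoc_carrier by blast
    show "proj n f \<in> piece GN n"
      unfolding g(2) proj_cosets piece_cosets[OF reps_cut[OF g(1)]]
      using sub_zero[OF sub_U] by (simp add: cut_def)
    fix f' assume "f' \<in> carrier GN"
    then obtain h where h: "h \<in> reps" "f' = cosets h" unfolding assoc_carrier by blast
    show "proj n (f \<oplus>\<^bsub>GN\<^esub> f') = proj n f \<oplus>\<^bsub>GN\<^esub> proj n f'"
      unfolding g(2) h(2) assoc_add[OF g(1) h(1)] proj_cosets assoc_add[OF reps_cut[OF g(1)] reps_cut[OF h(1)]]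
      by (rule arg_cong[of _ _ cosets]) (simp add: cut_def fun_eq_iff)
  next
    fix f n assume f: "f \<in> piece GN n"
    then have "f \<in> carrier GN" "\<forall>u\<in>degs d. u \<noteq> n \<longrightarrow> f u = D u" by (auto simp: assoc_piece)
    then obtain g where g: "f = cosets g" and fu: "\<forall>u\<in>degs d. u \<noteq> n \<longrightarrow> f u = D u" unfolding assoc_carrier by blast
    show "proj n f = f"
    proof
      fix u
      show "proj n f u = f u"
        using fu g by (cases "u \<in> degs d") (auto simp: proj_def cosets_def)
    qed
  qed
qed

lemma unit_degs: "i \<le> d \<Longrightarrow> unit_deg i \<in> degs d"
  by (simp add: degs_def unit_deg_def)

lemma shift_unit: "shift (unit_deg i) x g n = (if n i = 0 then \<zero> else x \<odot> g (lower i n))"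
proof -
  have "unit_deg i \<le> n \<longleftrightarrow> n i \<noteq> 0"
  proof
    assume "unit_deg i \<le> n"
    then have "unit_deg i i \<le> n i" by (rule le_funD)
    then show "n i \<noteq> 0" by (simp add: unit_deg_def)
  next
    assume "n i \<noteq> 0"
    then have "unit_deg i j \<le> n j" for j by (cases "j = i") (simp_all add: unit_deg_def)
    then show "unit_deg i \<le> n" by (rule le_funI)
  qed
  moreover have "(\<lambda>j. n j - unit_deg i j) = lower i n" by (simp add: unit_deg_def lower_def fun_eq_iff)
  ultimately show ?thesis by (simp add: shift_def)
qed

lemma smult_star:
  assumes "i \<le> d" "x \<in> I i" "g \<in> reps"
  shows "elem (unit_deg i) x \<odot>\<^bsub>GN\<^esub> cosets g = cosets (shift (unit_deg i) x g)" "shift (unit_deg i) x g \<in> reps"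
  using smult_elem[OF unit_degs, of i x g] reps_shift[of g x "unit_deg i"] assms mpow_unit by auto

lemma D_raise_mem: "i \<le> d \<Longrightarrow> x \<in> I i \<Longrightarrow> v \<in> D n \<Longrightarrow> x \<odot> v \<in> D (raise i n)"
  using U_raise_mem[of i x v "raise 0 n"] by (simp add: raise_commute[of i 0])

lemma homogeneous_elem:
  assumes i: "i \<le> d" and x: "x \<in> I i"
  shows "graded_operators.homogeneous T0 GN proj i (elem (unit_deg i) x)"
proof -
  interpret G: graded_operators T0 GN proj by (rule graded_operators_assoc)
  have u: "unit_deg i \<in> degs d" "x \<in> mpow (unit_deg i)" using unit_degs[OF i] mpow_unit[OF i] x by auto
  have z: "(\<lambda>_. 0) \<in> degs d" "r \<in> carrier R \<Longrightarrow> r \<in> mpow (\<lambda>_. 0)" for r using zero_degs mpow_0 by auto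
  have xc: "x \<in> carrier R" by (rule mpow_carr[OF u(2)])
  show ?thesis
    unfolding G.homogeneous_def
  proof (intro conjI ballI allI)
    fix f assume f: "f \<in> carrier GN"
    then obtain g where g: "g \<in> reps" "f = cosets g" unfolding assoc_carrier by blast
    show "elem (unit_deg i) x \<odot>\<^bsub>GN\<^esub> f \<in> carrier GN" by (rule elem_op_closed[OF u f])
    show "elem (unit_deg i) x \<odot>\<^bsub>GN\<^esub> (f \<oplus>\<^bsub>GN\<^esub> f') = elem (unit_deg i) x \<odot>\<^bsub>GN\<^esub> f \<oplus>\<^bsub>GN\<^esub> elem (unit_deg i) x \<odot>\<^bsub>GN\<^esub> f'"
      if "f' \<in> carrier GN" for f' by (rule elem_op_add[OF u f that])
    show "elem (unit_deg i) x \<odot>\<^bsub>GN\<^esub> (r \<odot>\<^bsub>GN\<^esub> f) = r \<odot>\<^bsub>GN\<^esub> (elem (unit_deg i) x \<odot>\<^bsub>GN\<^esub> f)"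
      if "r \<in> carrier T0" for r
      using that elem_commute[OF u z(1) z(2) f] unfolding T0_carrier by blast
    fix n
    have "shift (unit_deg i) x (cut (lower i n) g) u = cut n (shift (unit_deg i) x g) u" if ni: "n i \<noteq> 0" for u
    proof (cases "u i = 0")
      case True
      then show ?thesis using ni by (auto simp: shift_unit cut_def)
    next
      case False
      then have "lower i u = lower i n \<longleftrightarrow> u = n" using raise_lower[of u i] raise_lower[of n i] ni by metis
      then show ?thesis using False ni op_zero[OF xc] by (simp add: shift_unit cut_def)
    qed
    then have "shift (unit_deg i) x (cut (lower i n) g) = cut n (shift (unit_deg i) x g)" if "n i \<noteq> 0"
      using that by blast
    moreover have "cut n (shift (unit_deg i) x g) = (\<lambda>_. \<zero>)" if "n i = 0"
      using that by (simp add: shift_unit cut_def fun_eq_iff)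
    ultimately show "proj n (elem (unit_deg i) x \<odot>\<^bsub>GN\<^esub> f)
        = (if n i = 0 then \<zero>\<^bsub>GN\<^esub> else elem (unit_deg i) x \<odot>\<^bsub>GN\<^esub> proj (lower i n) f)"
      unfolding g(2) smult_star(1)[OF i x g(1)] proj_cosets smult_star(1)[OF i x reps_cut[OF g(1)]] assoc_zero by simp
  next
    fix n f assume f: "f \<in> piece GN n"
    then obtain g where g: "g \<in> reps" "f = cosets g" unfolding assoc_piece assoc_carrier by blast
    have gn: "\<forall>u\<in>degs d. u \<noteq> n \<longrightarrow> g u \<in> D u" using f piece_cosets[OF g(1)] g(2) by simp
    show "elem (unit_deg i) x \<odot>\<^bsub>GN\<^esub> f \<in> piece GN (raise i n)"
      unfolding g(2) smult_star(1)[OF i x g(1)] piece_cosets[OF smult_star(2)[OF i x g(1)]]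
    proof (intro ballI impI)
      fix u assume u: "u \<in> degs d" "u \<noteq> raise i n"
      show "shift (unit_deg i) x g u \<in> D u"
      proof (cases "u i = 0")
        case True
        then show ?thesis using sub_zero[OF sub_U] by (simp add: shift_unit)
      next
        case False
        have "lower i u \<noteq> n" using raise_lower[of u i] False u(2) by auto
        then have "g (lower i u) \<in> D (lower i u)" using gn lower_degs[OF u(1)] by blast
        then show ?thesis using D_raise_mem[OF i x, of _ "lower i u"] False raise_lower[of u i] by (simp add: shift_unit)
      qed
    qed
  qed
qed

lemma koszul_assoc:
  assumes xs: "\<forall>y\<in>set xs. fst y \<le> d \<and> snd y \<in> I (fst y)"
  shows "koszul T0 GN proj (star_seq R I d xs)"
proof -
  have s: "\<exists>i x. i \<le> d \<and> x \<in> I i \<and> y = (i, elem (unit_deg i) x)" if y: "y \<in> set (star_seq R I d xs)" for y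
  proof -
    obtain p where p: "p \<in> set xs" "y = (fst p, elem (unit_deg (fst p)) (snd p))"
      using y by (auto simp: star_seq_def)
    then show ?thesis using xs by blast
  qed
  show ?thesis
  proof (rule koszul.intro[OF graded_operators_assoc], rule koszul_axioms.intro)
    fix y assume "y \<in> set (star_seq R I d xs)"
    then obtain i x where y: "i \<le> d" "x \<in> I i" "y = (i, elem (unit_deg i) x)" using s by blast
    show "graded_operators.homogeneous T0 GN proj (fst y) (snd y)" using homogeneous_elem[OF y(1,2)] y(3) by simp
    fix y' f assume "y' \<in> set (star_seq R I d xs)" and f: "f \<in> carrier GN"
    then obtain j x' where y': "j \<le> d" "x' \<in> I j" "y' = (j, elem (unit_deg j) x')" using s by blast
    show "snd y \<odot>\<^bsub>GN\<^esub> (snd y' \<odot>\<^bsub>GN\<^esub> f) = snd y' \<odot>\<^bsub>GN\<^esub> (snd y \<odot>\<^bsub>GN\<^esub> f)"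
      using elem_commute[OF unit_degs[OF y(1)] _ unit_degs[OF y'(1)] _ f] y y' mpow_unit by simp
  qed
qed

subsection \<open>The subquotients of the mixed multiplicity symbol\<close>

lemma graded_sub_colon:
  assumes A: "between A" and B: "between B" and i: "i \<le> d" and x: "x \<in> I i"
  shows "between (\<lambda>n. {v \<in> A n. x \<odot> v \<in> B (raise i n)})"
    "{f \<in> graded_sub A. elem (unit_deg i) x \<odot>\<^bsub>GN\<^esub> f \<in> graded_sub B}
      = graded_sub (\<lambda>n. {v \<in> A n. x \<odot> v \<in> B (raise i n)})" (is "?L = graded_sub ?C")
proof -
  have xc: "x \<in> carrier R" using x mpow_unit[OF i] mpow_carr by blast
  show C: "between ?C"
    unfolding between_def
  proof (intro ballI conjI)
    fix n assume n: "n \<in> degs d"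
    note rn = raise_degs[OF n i]
    show "sub (?C n)" by (rule sub_preimage[OF xc betweenD(1)[OF A n] betweenD(1)[OF B rn]])
    show "D n \<subseteq> ?C n" using betweenD(2)[OF A n] betweenD(2)[OF B rn] D_raise_mem[OF i x, of _ n] by blast
    show "?C n \<subseteq> U n" using betweenD(3)[OF A n] by blast
  qed
  have eq: "cosets g \<in> ?L \<longleftrightarrow> cosets g \<in> graded_sub ?C" if g: "g \<in> reps" for g
  proof -
    have "(\<forall>n\<in>degs d. shift (unit_deg i) x g n \<in> B n) \<longleftrightarrow> (\<forall>n\<in>degs d. x \<odot> g n \<in> B (raise i n))"
    proof (intro iffI ballI)
      fix n assume h: "\<forall>n\<in>degs d. shift (unit_deg i) x g n \<in> B n" and n: "n \<in> degs d"
      have "shift (unit_deg i) x g (raise i n) \<in> B (raise i n)" using h raise_degs[OF n i] by blast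
      then show "x \<odot> g n \<in> B (raise i n)" unfolding shift_unit lower_raise by (simp add: raise_def)
    next
      fix n assume h: "\<forall>n\<in>degs d. x \<odot> g n \<in> B (raise i n)" and n: "n \<in> degs d"
      show "shift (unit_deg i) x g n \<in> B n"
      proof (cases "n i = 0")
        case True
        then show ?thesis using sub_zero[OF betweenD(1)[OF B n]] by (simp add: shift_unit)
      next
        case False
        have "x \<odot> g (lower i n) \<in> B (raise i (lower i n))" using h lower_degs[OF n] by blast
        then show ?thesis using False raise_lower[of n i] by (simp add: shift_unit)
      qed
    qed
    then show ?thesis
      unfolding mem_Collect_eq smult_star(1)[OF i x g] graded_sub_cosets[OF A g]
        graded_sub_cosets[OF B smult_star(2)[OF i x g]] graded_sub_cosets[OF C g] by blast
  qed
  have "?L \<subseteq> cosets ` reps" "graded_sub ?C \<subseteq> cosets ` reps" by (auto simp: graded_sub_def assoc_carrier)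
  then show "?L = graded_sub ?C" using eq by blast
qed

lemma graded_sub_sum:
  assumes A: "between A" and B: "between B" and i: "i \<le> d" and x: "x \<in> I i"
  shows "between (fam_sum B (fam_mul i x A))"
    "graded_sub B <+>\<^bsub>GN\<^esub> ((\<lambda>f. elem (unit_deg i) x \<odot>\<^bsub>GN\<^esub> f) ` graded_sub A)
      = graded_sub (fam_sum B (fam_mul i x A))" (is "?L = graded_sub ?C")
proof -
  interpret G: operator_group T0 GN by (rule T0_operator_group)
  have xc: "x \<in> carrier R" using x mpow_unit[OF i] mpow_carr by blast
  have sm: "sub (fam_mul i x A n)" if n: "n \<in> degs d" for n
    using sub_image[OF xc betweenD(1)[OF A lower_degs[OF n]]] sub_zero_set by (simp add: fam_mul_def)
  have mU: "fam_mul i x A n \<subseteq> U n" if n: "n \<in> degs d" for n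
  proof (cases "n i = 0")
    case True
    then show ?thesis using sub_zero[OF sub_U] by (simp add: fam_mul_0)
  next
    case False
    have "x \<odot> v \<in> U n" if "v \<in> A (lower i n)" for v
      using U_raise_mem[OF i x, of v "lower i n"] that betweenD(3)[OF A lower_degs[OF n]] raise_lower[of n i, OF False]
      by auto
    then show ?thesis using False by (auto simp: fam_mul_pos)
  qed
  show C: "between ?C"
    unfolding between_def fam_sum_def
  proof (intro ballI conjI)
    fix n assume n: "n \<in> degs d"
    show "sub (B n <+> fam_mul i x A n)" by (rule sub_sum[OF betweenD(1)[OF B n] sm[OF n]])
    show "D n \<subseteq> B n <+> fam_mul i x A n"
      using betweenD(2)[OF B n] subset_sum_left[OF sm[OF n] sub_subset[OF betweenD(1)[OF B n]]] by blast
    show "B n <+> fam_mul i x A n \<subseteq> U n" by (rule sum_subset[OF sub_U betweenD(3)[OF B n] mU[OF n]])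
  qed
  show "?L = graded_sub ?C"
  proof
    show "?L \<subseteq> graded_sub ?C"
    proof
      fix f assume "f \<in> ?L"
      then obtain f1 f2 where f: "f1 \<in> graded_sub B" "f2 \<in> graded_sub A"
        "f = f1 \<oplus>\<^bsub>GN\<^esub> (elem (unit_deg i) x \<odot>\<^bsub>GN\<^esub> f2)"
        by (blast elim!: G.set_addE)
      obtain h where h: "h \<in> reps" "f1 = cosets h" "\<forall>n\<in>degs d. h n \<in> B n" using f(1) by (rule graded_subE[OF B])
      obtain g where g: "g \<in> reps" "f2 = cosets g" "\<forall>n\<in>degs d. g n \<in> A n" using f(2) by (rule graded_subE[OF A])
      note s = smult_star[OF i x g(1)]
      have "shift (unit_deg i) x g n \<in> fam_mul i x A n" if "n \<in> degs d" for n
        using g(3) lower_degs[OF that] by (auto simp: shift_unit fam_mul_def)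
      then show "f \<in> graded_sub ?C"
        unfolding f(3) h(2) g(2) s(1) assoc_add[OF h(1) s(2)] graded_sub_cosets[OF C reps_add[OF h(1) s(2)]]
        unfolding fam_sum_def using h(3) set_addI by blast
    qed
    show "graded_sub ?C \<subseteq> ?L"
    proof
      fix f assume "f \<in> graded_sub ?C"
      then obtain g where g: "g \<in> reps" "f = cosets g" "\<forall>n\<in>degs d. g n \<in> ?C n" by (rule graded_subE[OF C])
      \<comment> \<open>The last condition keeps the supports of the chosen representatives finite.\<close>
      define good where "good n b a \<longleftrightarrow> b \<in> B n \<and> a \<in> A (lower i n) \<and> (n i = 0 \<longrightarrow> a = \<zero>) \<and>
          b \<oplus> x \<odot> a = g n \<and> (g n \<in> D n \<longrightarrow> a = \<zero> \<and> b = g n)" for n b a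
      have ex: "\<exists>b a. good n b a" if n: "n \<in> degs d" for n
      proof -
        note z = sub_zero[OF betweenD(1)[OF A lower_degs[OF n]]]
        have gc: "g n \<in> carrier N" by (rule reps_carr[OF g(1) n])
        obtain b c where bc: "b \<in> B n" "c \<in> fam_mul i x A n" "g n = b \<oplus> c"
          using g(3) n unfolding fam_sum_def by (blast elim!: set_addE)
        show ?thesis
        proof (cases "g n \<in> D n \<or> n i = 0")
          case True
          have "g n \<in> B n"
          proof (cases "n i = 0")
            case True
            then have "g n = b" using bc sub_carr[OF betweenD(1)[OF B n] bc(1)] by (simp add: fam_mul_0)
            then show ?thesis using bc(1) by simp
          next
            case False
            then have "g n \<in> D n" using \<open>g n \<in> D n \<or> n i = 0\<close> by simp
            then show ?thesis by (rule subsetD[OF betweenD(2)[OF B n]])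
          qed
          then have "good n (g n) \<zero>" using z gc op_zero[OF xc] by (simp add: good_def)
          then show ?thesis by blast
        next
          case False
          then have nz: "n i \<noteq> 0" "g n \<notin> D n" by simp_all
          obtain a where "a \<in> A (lower i n)" "c = x \<odot> a" using bc(2) fam_mul_pos[of n i x A, OF nz(1)] by blast
          then have "good n b a" unfolding good_def using bc(1,3) nz by simp
          then show ?thesis by blast
        qed
      qed
      have goodD: "b \<in> B n" "a \<in> A (lower i n)" "n i = 0 \<Longrightarrow> a = \<zero>" "g n = b \<oplus> x \<odot> a"
        "g n \<in> D n \<Longrightarrow> a = \<zero>" "g n \<in> D n \<Longrightarrow> b = g n" if h: "good n b a" for n b a
      proof -
        note c = h[unfolded good_def]
        show "b \<in> B n" by (rule conjunct1[OF c])
        note c = conjunct2[OF c]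
        show "a \<in> A (lower i n)" by (rule conjunct1[OF c])
        note c = conjunct2[OF c]
        show "a = \<zero>" if "n i = 0" by (rule mp[OF conjunct1[OF c] that])
        note c = conjunct2[OF c]
        show "g n = b \<oplus> x \<odot> a" by (rule conjunct1[OF c, symmetric])
        note c = conjunct2[OF c]
        show "a = \<zero>" if "g n \<in> D n" by (rule conjunct1[OF mp[OF c that]])
        show "b = g n" if "g n \<in> D n" by (rule conjunct2[OF mp[OF c that]])
      qed
      obtain b a where good: "\<And>n. n \<in> degs d \<Longrightarrow> good n (b n) (a n)" using ex by metis
      have ba: "b n \<in> B n" "a n \<in> A (lower i n)" "n i = 0 \<Longrightarrow> a n = \<zero>" "g n = b n \<oplus> x \<odot> a n"
        "g n \<in> D n \<Longrightarrow> a n = \<zero>" "g n \<in> D n \<Longrightarrow> b n = g n" if n: "n \<in> degs d" for n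
        by (fact goodD[OF good[OF n]])+
      define a' where "a' n = a (raise i n)" for n
      have a'A: "a' n \<in> A n" if "n \<in> degs d" for n
        using ba(2)[OF raise_degs[OF that i]] unfolding a'_def lower_raise .
      have bR: "b \<in> reps"
      proof (rule repsI[OF _ reps_finite[OF g(1)]])
        show "b n \<in> U n" if "n \<in> degs d" for n
          by (rule subsetD[OF betweenD(3)[OF B that] ba(1)[OF that]])
        show "b n \<in> D n" if "n \<in> degs d" "n \<notin> {n \<in> degs d. g n \<notin> D n}" for n
        proof -
          have gD: "g n \<in> D n" using that by blast
          show ?thesis using ba(6)[OF that(1) gD] gD by simp
        qed
      qed
      have aR: "a' \<in> reps"
      proof (rule repsI[OF _ finite_imageI[OF reps_finite[OF g(1)], of "lower i"]])
        show "a' n \<in> U n" if "n \<in> degs d" for n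
          by (rule subsetD[OF betweenD(3)[OF A that] a'A[OF that]])
        show "a' n \<in> D n" if n: "n \<in> degs d" "n \<notin> lower i ` {n \<in> degs d. g n \<notin> D n}" for n
        proof -
          have r: "raise i n \<in> degs d" by (rule raise_degs[OF n(1) i])
          have "raise i n \<notin> {n \<in> degs d. g n \<notin> D n}"
          proof
            assume "raise i n \<in> {n \<in> degs d. g n \<notin> D n}"
            then have "lower i (raise i n) \<in> lower i ` {n \<in> degs d. g n \<notin> D n}" by (rule imageI)
            then show False using n(2) by simp
          qed
          then have "g (raise i n) \<in> D (raise i n)" using r by blast
          then have "a' n = \<zero>" using ba(5)[OF r] by (simp add: a'_def)
          then show ?thesis using sub_zero[OF sub_U] by simp
        qed
      qed
      note s = smult_star[OF i x aR]
      have "g n = b n \<oplus> shift (unit_deg i) x a' n" if n: "n \<in> degs d" for n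
      proof (cases "n i = 0")
        case True
        then show ?thesis using ba(3,4)[OF n] op_zero[OF xc] by (simp add: shift_unit)
      next
        case False
        then show ?thesis using ba(4)[OF n] raise_lower[of n i, OF False] by (simp add: shift_unit a'_def)
      qed
      then have "f = cosets (\<lambda>n. b n \<oplus> shift (unit_deg i) x a' n)"
        unfolding g(2) cosets_def by (intro restrict_ext) simp
      then have "f = cosets b \<oplus>\<^bsub>GN\<^esub> (elem (unit_deg i) x \<odot>\<^bsub>GN\<^esub> cosets a')"
        using assoc_add[OF bR s(2)] s(1) by simp
      moreover have "cosets b \<in> graded_sub B" using graded_sub_cosets[OF B bR] ba(1) by simp
      moreover have "cosets a' \<in> graded_sub A" using graded_sub_cosets[OF A aR] a'A by simp
      ultimately show "f \<in> ?L" using G.set_addI[OF _ imageI, of "cosets b" "graded_sub B" "cosets a'" "graded_sub A"] by simp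
    qed
  qed
qed

end

section \<open>The mixed multiplicity symbol as an iterated difference\<close>

lemma lower_commute: "lower i (lower j n) = lower j (lower i n)"
  by (cases "i = j") (simp_all add: lower_def fun_upd_twist)

lemma nabl_lower: "nabl cs (\<lambda>n. f (lower i n)) = (\<lambda>n. nabl cs f (lower i n))"
proof (induction cs arbitrary: f)
  case (Cons c cs)
  have "nab c (\<lambda>n. f (lower i n)) = (\<lambda>n. nab c f (lower i n))"
    by (simp add: nab_def lower_commute[of i c])
  then show ?case using Cons by simp
qed simp

context ideal_system
begin

abbreviation T :: "((nat \<Rightarrow> nat) \<Rightarrow> 'a set) graded_ring" where "T \<equiv> assoc_ring R I d"

definition len :: "((nat \<Rightarrow> nat) \<Rightarrow> 'm set) \<Rightarrow> ((nat \<Rightarrow> nat) \<Rightarrow> 'm set) \<Rightarrow> (nat \<Rightarrow> nat) \<Rightarrow> int" where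
  "len B A n = int (the_enat (sq_len R N (B n) (A n)))"

definition subquotient :: "(nat \<times> 'a) list \<Rightarrow> ((nat \<Rightarrow> nat) \<Rightarrow> 'm set) \<Rightarrow> ((nat \<Rightarrow> nat) \<Rightarrow> 'm set) \<Rightarrow> bool" where
  "subquotient gs B A \<longleftrightarrow> family gs A \<and> family gs B \<and> (\<forall>n. B n \<subseteq> A n) \<and> (\<forall>n. den gs n \<subseteq> B n)"

definition kills :: "((nat \<Rightarrow> nat) \<Rightarrow> 'm set) \<Rightarrow> ((nat \<Rightarrow> nat) \<Rightarrow> 'm set) \<Rightarrow> nat \<times> 'a \<Rightarrow> bool" where
  "kills B A y \<longleftrightarrow> (\<forall>n. \<forall>v\<in>A n. snd y \<odot> v \<in> B (raise (fst y) n))"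

lemma subquotientD:
  assumes "subquotient gs B A"
  shows "family gs A" "family gs B" "B n \<subseteq> A n" "den gs n \<subseteq> B n"
  using assms by (simp_all add: subquotient_def)

lemma killsD: "kills B A y \<Longrightarrow> v \<in> A n \<Longrightarrow> snd y \<odot> v \<in> B (raise (fst y) n)"
  by (simp add: kills_def)

lemma kills_mono:
  assumes "kills B A y" "\<And>n. A' n \<subseteq> A n" "\<And>n. B n \<subseteq> B' n"
  shows "kills B' A' y"
  unfolding kills_def
proof (intro allI ballI)
  fix n v assume "v \<in> A' n"
  then have "v \<in> A n" using assms(2)[of n] by (rule subsetD[rotated])
  from killsD[OF assms(1) this] show "snd y \<odot> v \<in> B' (raise (fst y) n)" by (rule subsetD[OF assms(3)])
qed

lemma family_between:
  assumes gs: "generating gs" and A: "family gs A" and den: "\<And>n. den gs n \<subseteq> A n"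
  shows "between A"
  unfolding between_def
proof (intro ballI conjI)
  fix n assume n: "n \<in> degs d"
  show "sub (A n)" by (rule family_sub[OF A])
  show "D n \<subseteq> A n" using den[of n] den_eq[OF gs n] by simp
  show "A n \<subseteq> U n" using family_span[OF A, of n] gen_span_eq_U[OF gs n] by simp
qed

lemma subquotient_between:
  assumes gs: "generating gs" and s: "subquotient gs B A"
  shows "between A" "between B"
proof -
  have "den gs n \<subseteq> A n" for n using subquotientD(3,4)[OF s, of n] by (rule subset_trans[rotated])
  then show "between A" by (rule family_between[OF gs subquotientD(1)[OF s]])
  show "between B" by (rule family_between[OF gs subquotientD(2)[OF s] subquotientD(4)[OF s]])
qed

lemma piece_length_quot:
  assumes gs: "generating gs" and s: "subquotient gs B A" and n: "n \<in> degs d"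
  shows "piece_length T (graded_quot GN (graded_sub A) (graded_sub B)) n = len B A n"
proof -
  note b = subquotient_between[OF gs s]
  have BA: "graded_sub B \<subseteq> graded_sub A" by (rule graded_sub_mono[OF subquotientD(3)[OF s]])
  have "mod_length T0 ((graded_quot GN (graded_sub A) (graded_sub B))
      \<lparr>carrier := piece (graded_quot GN (graded_sub A) (graded_sub B)) n\<rparr>) = sq_len R N (B n) (A n)"
    using mod_length_graded_quot[OF T0_operator_group sub_graded_sub[OF b(1)] sub_graded_sub[OF b(2)] BA sub_piece]
      graded_sub_length[OF b(1,2) subquotientD(3)[OF s] n] by simp
  then show ?thesis by (simp add: piece_length_def T0_def len_def)
qed

lemma subquotient_finite:
  assumes gs: "generating gs" and fin: "sq_len R N (D (\<lambda>_. 0)) (carrier N) \<noteq> \<infinity>" and s: "subquotient gs B A"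
  shows "sq_len R N (B n) (A n) \<noteq> \<infinity>"
proof -
  have gi: "gens_in d gs" using gs by (simp add: generating_def)
  note f = subquotientD[OF s]
  have "D (\<lambda>_. 0) \<subseteq> B (\<lambda>_. 0)" using f(4)[of "\<lambda>_. 0"] den_eq[OF gs zero_degs] by simp
  then have "hilb gs B n \<noteq> \<infinity>" using hilb_rational[OF gi sub_U fin f(2)] by blast
  moreover have "sq_len R N (B n) (A n) \<le> hilb gs B n"
    unfolding hilb_def
    by (rule sq_len_mono[OF family_sub[OF f(2)] family_sub[OF f(2)] sub_gen_span[OF gi] family_sub[OF f(1)]
          order_refl f(3) family_span[OF f(1)]])
  ultimately show ?thesis by (cases "sq_len R N (B n) (A n)"; cases "hilb gs B n") auto
qed

lemma subquotient_colon:
  assumes gs: "generating gs" and s: "subquotient gs B A" and i: "i \<le> d" and x: "x \<in> I i"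
  defines "C \<equiv> \<lambda>n. {v \<in> A n. x \<odot> v \<in> B (raise i n)}"
  shows "subquotient gs B C" "kills B C (i, x)" "\<And>n. C n \<subseteq> A n"
proof -
  have gi: "gens_in d gs" using gs by (simp add: generating_def)
  note f = subquotientD[OF s] and ac = acts_ideal[OF gs i x]
  have xc: "x \<in> carrier R" by (rule acts_carr[OF ac])
  have xB: "x \<odot> v \<in> B (raise i n)" if "v \<in> B n" for v n by (rule actsD[OF ac f(2) that])
  have "family gs C"
  proof (rule familyI)
    show "sub (C n)" for n
      unfolding C_def by (rule sub_preimage[OF xc family_sub[OF f(1)] family_sub[OF f(2)]])
    show "v \<in> gen_span gs n" if "v \<in> C n" for n v
      using that subsetD[OF family_span[OF f(1)], of v n] unfolding C_def by simp
    show "g \<odot> v \<in> C (raise j n)" if g: "(j, g) \<in> set gs" and v: "v \<in> C n" for j g n v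
    proof -
      have v': "v \<in> A n" "x \<odot> v \<in> B (raise i n)" using v unfolding C_def by simp_all
      have c: "g \<in> carrier R" "v \<in> carrier N" using gi g sub_carr[OF family_sub[OF f(1)] v'(1)] by (auto simp: gens_in_def)
      have "x \<odot> (g \<odot> v) \<in> B (raise i (raise j n))"
        using family_closed[OF f(2), OF g v'(2)] smult_commute[OF c(1) xc c(2)] raise_commute[of i j n] by simp
      then show ?thesis using family_closed[OF f(1), OF g v'(1)] unfolding C_def by simp
    qed
  qed
  moreover have "B n \<subseteq> C n" for n
  proof
    fix v assume "v \<in> B n"
    then show "v \<in> C n" using xB[of v n] subsetD[OF f(3), of v n] unfolding C_def by simp
  qed
  ultimately show "subquotient gs B C" using f(2,4) by (simp add: subquotient_def)
  show "kills B C (i, x)" by (simp add: kills_def C_def)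
  show "C n \<subseteq> A n" for n unfolding C_def by blast
qed

lemma subquotient_sum:
  assumes gs: "generating gs" and s: "subquotient gs B A" and i: "i \<le> d" and x: "x \<in> I i"
  defines "C \<equiv> fam_sum B (fam_mul i x A)"
  shows "subquotient gs C A" "kills C A (i, x)" "\<And>n. B n \<subseteq> C n"
proof -
  have gi: "gens_in d gs" using gs by (simp add: generating_def)
  note f = subquotientD[OF s] and ac = acts_ideal[OF gs i x]
  note fm = family_mul[OF gi ac f(1)]
  have fC: "family gs C" unfolding C_def by (rule family_sum[OF gi f(2) fm])
  show BC: "B n \<subseteq> C n" for n unfolding C_def by (rule fam_sum_left[OF f(2) fm])
  have "C n \<subseteq> A n" for n
    unfolding C_def fam_sum_def by (rule sum_subset[OF family_sub[OF f(1)] f(3) fam_mul_subset[OF ac f(1)]])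
  moreover have "den gs n \<subseteq> C n" for n using f(4)[of n] BC[of n] by (rule subset_trans)
  ultimately show "subquotient gs C A" using f(1) fC by (simp add: subquotient_def)
  show "kills C A (i, x)"
    unfolding kills_def fst_conv snd_conv
  proof (intro allI ballI)
    fix n v assume "v \<in> A n"
    then have "x \<odot> v \<in> fam_mul i x A (raise i n)" by (rule fam_mul_raise)
    then show "x \<odot> v \<in> C (raise i n)" unfolding C_def by (rule subsetD[OF fam_sum_right[OF f(2) fm]])
  qed
qed

text \<open>Multiplication by \<open>x\<close> gives an exact sequence
  \<open>0 \<rightarrow> (0 : x) \<rightarrow> M \<rightarrow> M \<rightarrow> M/xM \<rightarrow> 0\<close> in which the middle map raises degrees.\<close>

lemma len_difference:
  assumes gs: "generating gs" and fin: "sq_len R N (D (\<lambda>_. 0)) (carrier N) \<noteq> \<infinity>"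
    and s: "subquotient gs B A" and i: "i \<le> d" and x: "x \<in> I i" and n: "n i \<noteq> 0"
  shows "nab i (len B A) n
    = len (fam_sum B (fam_mul i x A)) A n - len B (\<lambda>n. {v \<in> A n. x \<odot> v \<in> B (raise i n)}) (lower i n)"
proof -
  define S where "S = fam_sum B (fam_mul i x A)"
  define C where "C = (\<lambda>n. {v \<in> A n. x \<odot> v \<in> B (raise i n)})"
  let ?l = "lower i n"
  note f = subquotientD[OF s]
  have sS: "subquotient gs S A" and BS: "\<And>n. B n \<subseteq> S n"
    using subquotient_sum[OF gs s i x] unfolding S_def by auto
  have sC: "subquotient gs B C" and CA: "\<And>n. C n \<subseteq> A n"
    using subquotient_colon[OF gs s i x] unfolding C_def by auto
  have xc: "x \<in> carrier R" by (rule acts_carr[OF acts_ideal[OF gs i x]])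
  have rl: "raise i ?l = n" by (rule raise_lower[of n i, OF n])
  note sA = family_sub[OF f(1)] and sB = family_sub[OF f(2)] and sS' = family_sub[OF subquotientD(2)[OF sS]]
    and sC' = family_sub[OF subquotientD(1)[OF sC]]
  have Sn: "S n = B n <+> (\<lambda>v. x \<odot> v) ` A ?l" unfolding S_def fam_sum_def fam_mul_pos[of n i, OF n] ..
  have "sq_len R N {v \<in> A ?l. x \<odot> v \<in> B n} (A ?l) = sq_len R N (B n) (S n)"
  proof (rule sq_len_smult[OF xc sA sS' sB BS])
    show "x \<odot> v \<in> S n" if "v \<in> A ?l" for v
    proof -
      have "x \<odot> v \<in> (\<lambda>v. x \<odot> v) ` A ?l" using that by (rule imageI)
      then show ?thesis unfolding Sn
        by (rule subsetD[OF subset_sum_right[OF sB sub_subset[OF sub_image[OF xc sA]]]])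
    qed
    show "\<exists>a\<in>A ?l. \<exists>b\<in>B n. w = x \<odot> a \<oplus> b" if w: "w \<in> S n" for w
    proof -
      obtain b c where bc: "b \<in> B n" "c \<in> (\<lambda>v. x \<odot> v) ` A ?l" "w = b \<oplus> c"
        using w unfolding Sn by (rule set_addE)
      obtain a where a: "a \<in> A ?l" "c = x \<odot> a" using bc(2) by (rule imageE)
      have "w = x \<odot> a \<oplus> b"
        using bc a M.a_comm[OF sub_carr[OF sB bc(1)] op_closed[OF xc sub_carr[OF sA a(1)]]] by simp
      then show ?thesis using a(1) bc(1) by (intro bexI)
    qed
  qed
  then have 1: "sq_len R N (C ?l) (A ?l) = sq_len R N (B n) (S n)" unfolding C_def rl .
  have 2: "sq_len R N (B n) (A n) = sq_len R N (B n) (S n) + sq_len R N (S n) (A n)"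
    by (rule sq_len_add[OF sB sS' sA BS subquotientD(3)[OF sS]])
  have 3: "sq_len R N (B ?l) (A ?l) = sq_len R N (B ?l) (C ?l) + sq_len R N (C ?l) (A ?l)"
    by (rule sq_len_add[OF sB sC' sA subquotientD(3)[OF sC] CA])
  have "sq_len R N (B n) (A n) \<noteq> \<infinity>" "sq_len R N (B ?l) (A ?l) \<noteq> \<infinity>"
    by (rule subquotient_finite[OF gs fin s])+
  then have "len B A n - len B A ?l = len S A n - len B C ?l"
    unfolding len_def 2 3 1
    by (cases "sq_len R N (B n) (S n)"; cases "sq_len R N (S n) (A n)"; cases "sq_len R N (B ?l) (C ?l)") auto
  then show ?thesis by (simp add: nab_def S_def C_def)
qed

text \<open>The bound for the quotient by the sequence, known when \<open>B\<close> is the family of denominators, only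
  improves when \<open>B\<close> grows.\<close>

lemma leaf_value:
  assumes gs: "generating gs" and fin: "sq_len R N (D (\<lambda>_. 0)) (carrier N) \<noteq> \<infinity>"
    and xs: "\<forall>y\<in>set xs. fst y \<le> d \<and> snd y \<in> I (fst y)"
    and b: "large_bounded d (hilb gs (fam_sum (den gs) (fam_mul_list gs xs)))"
    and s: "subquotient gs B A" and k: "\<forall>y\<in>set xs. kills B A y"
  shows "\<exists>c. for_large d (\<lambda>n. len B A n = c)"
proof -
  have gi: "gens_in d gs" using gs by (simp add: generating_def)
  note f = subquotientD[OF s]
  have ac: "\<forall>y\<in>set xs. fst y \<le> d \<and> acts gs (fst y) (snd y)" using xs acts_ideal[OF gs] by blast
  have fm: "family gs (fam_mul_list gs xs)" by (rule family_mul_list[OF gi]) (use ac in blast)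
  let ?F = "fam_sum (den gs) (fam_mul_list gs xs)" and ?G = "fam_sum B (fam_mul_list gs xs)"
  have sF: "family gs ?F" by (rule family_sum[OF gi family_den[OF gs] fm])
  have sG: "family gs ?G" by (rule family_sum[OF gi f(2) fm])
  have "hilb gs ?G n \<le> hilb gs ?F n" for n
    unfolding hilb_def
  proof (rule sq_len_mono[OF family_sub[OF sF] family_sub[OF sG] sub_gen_span[OF gi] sub_gen_span[OF gi]])
    show "?F n \<subseteq> ?G n" unfolding fam_sum_def by (rule set_add_mono[OF f(4) order_refl])
    show "?G n \<subseteq> gen_span gs n" by (rule family_span[OF sG])
  qed simp
  from large_bounded_le[OF b this] have b': "large_bounded d (hilb gs ?G)" .
  have ZB: "D (\<lambda>_. 0) \<subseteq> B (\<lambda>_. 0)" using f(4)[of "\<lambda>_. 0"] den_eq[OF gs zero_degs] by simp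
  have BA: "\<forall>n. B n \<subseteq> A n" using f(3) by (intro allI)
  have "\<forall>y\<in>set xs. \<forall>n. \<forall>v\<in>A n. snd y \<odot> v \<in> B (raise (fst y) n)" using k unfolding kills_def .
  from leaf_constant[OF gi sub_U fin ac f(1,2) BA ZB this b'] show ?thesis unfolding len_def .
qed

text \<open>The recursion for the symbol matches the recursion for iterated differences. Each step yields
  two subquotients annihilated by one more element of the sequence, and at the end all elements
  of \<open>xs\<close> annihilate the subquotient, so that its length is constant in large degrees.\<close>

theorem symbol_difference:
  assumes gs: "generating gs" and fin: "sq_len R N (D (\<lambda>_. 0)) (carrier N) \<noteq> \<infinity>"
    and xs: "\<forall>y\<in>set xs. fst y \<le> d \<and> snd y \<in> I (fst y)"
    and b: "large_bounded d (hilb gs (fam_sum (den gs) (fam_mul_list gs xs)))"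
  shows "subquotient gs B A \<Longrightarrow> set ys \<subseteq> set xs \<Longrightarrow> \<forall>y\<in>set xs - set ys. kills B A y \<Longrightarrow>
    for_large d (\<lambda>n. nabl (map fst ys) (len B A) n
      = mm_symbol_sub d T (star_seq R I d ys) GN (graded_sub A) (graded_sub B))"
proof (induction ys arbitrary: A B)
  case Nil
  obtain c where c: "for_large d (\<lambda>n. len B A n = c)"
    using leaf_value[OF gs fin xs b Nil.prems(1)] Nil.prems(3) by auto
  have "for_large d (\<lambda>n. piece_length T (graded_quot GN (graded_sub A) (graded_sub B)) n = c)"
    by (rule for_large_mono[OF c]) (simp add: piece_length_quot[OF gs Nil.prems(1)])
  then have "mm_symbol_sub d T (star_seq R I d []) GN (graded_sub A) (graded_sub B) = c"
    unfolding star_seq_def by (simp add: eventual_value_eq)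
  then show ?case using c by simp
next
  case (Cons y ys)
  obtain i x where y: "y = (i, x)" by (cases y)
  have i: "i \<le> d" and x: "x \<in> I i" using xs Cons.prems(2) y by auto
  note s = Cons.prems(1) and b' = subquotient_between[OF gs Cons.prems(1)]
  define S where "S = fam_sum B (fam_mul i x A)"
  define C where "C = (\<lambda>n. {v \<in> A n. x \<odot> v \<in> B (raise i n)})"
  have sS: "subquotient gs S A" and kS: "kills S A y" and BS: "\<And>n. B n \<subseteq> S n"
    using subquotient_sum[OF gs s i x] unfolding S_def y by auto
  have sC: "subquotient gs B C" and kC: "kills B C y" and CA: "\<And>n. C n \<subseteq> A n"
    using subquotient_colon[OF gs s i x] unfolding C_def y by auto
  have ys: "set ys \<subseteq> set xs" using Cons.prems(2) by simp
  have "kills S A z" "kills B C z" if z: "z \<in> set xs - set ys" for z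
  proof -
    have "z = y \<or> kills B A z" using z Cons.prems(3) by auto
    then show "kills S A z" using kS kills_mono[of B A z A S, OF _ order_refl BS] by blast
    show "kills B C z" using \<open>z = y \<or> kills B A z\<close> kC kills_mono[of B A z C B, OF _ CA order_refl] by blast
  qed
  then have k: "\<forall>z\<in>set xs - set ys. kills S A z" "\<forall>z\<in>set xs - set ys. kills B C z" by blast+
  let ?m = "mm_symbol_sub d T (star_seq R I d ys) GN"
  have 1: "for_large d (\<lambda>n. nabl (map fst ys) (len S A) n = ?m (graded_sub A) (graded_sub S))"
    by (rule Cons.IH[OF sS ys k(1)])
  have 2: "for_large d (\<lambda>n. nabl (map fst ys) (len B C) (lower i n) = ?m (graded_sub C) (graded_sub B))"
    by (rule for_large_lower[OF Cons.IH[OF sC ys k(2)]])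
  have "for_large d (\<lambda>n. nab i (len B A) n = len S A n - len B C (lower i n))"
  proof (rule for_large_mono[OF for_large_ge[of d 1]])
    fix n :: "nat \<Rightarrow> nat" assume "\<forall>j\<le>d. 1 \<le> n j"
    then have "n i \<noteq> 0" using i by auto
    then show "nab i (len B A) n = len S A n - len B C (lower i n)"
      unfolding S_def C_def by (rule len_difference[OF gs fin s i x, of n])
  qed
  from for_large_nabl_cong[OF this, of "map fst ys"]
  have 3: "for_large d (\<lambda>n. nabl (map fst (y # ys)) (len B A) n
      = nabl (map fst ys) (len S A) n - nabl (map fst ys) (len B C) (lower i n))"
    by (simp add: y nabl_diff nabl_lower)
  have "mm_symbol_sub d T (star_seq R I d (y # ys)) GN (graded_sub A) (graded_sub B)
      = ?m (graded_sub A) (graded_sub S) - ?m (graded_sub C) (graded_sub B)"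
    using graded_sub_sum(2)[OF b' i x] graded_sub_colon(2)[OF b' i x]
    by (simp add: star_seq_def y S_def C_def)
  then show ?case
    using for_large_mono[OF for_large_conj[OF 3 for_large_conj[OF 1 2]],
      of "\<lambda>n. nabl (map fst (y # ys)) (len B A) n
        = mm_symbol_sub d T (star_seq R I d (y # ys)) GN (graded_sub A) (graded_sub B)"] by simp
qed

section \<open>The three invariants of a mixed multiplicity system\<close>

lemma graded_sub_cong: "(\<And>n. n \<in> degs d \<Longrightarrow> A n = B n) \<Longrightarrow> graded_sub A = graded_sub B"
  unfolding graded_sub_def by simp

lemma piece_length_assoc:
  assumes "n \<in> degs d"
  shows "piece_length T GN n = len D U n"
    "sq_len T0 GN {\<zero>\<^bsub>GN\<^esub>} (piece GN n) = sq_len R N (D n) (U n)"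
proof -
  interpret G: operator_group T0 GN by (rule T0_operator_group)
  have "{\<zero>\<^bsub>GN\<^esub>} \<inter> piece GN n = {\<zero>\<^bsub>GN\<^esub>}" using G.sub_zero[OF sub_piece] by blast
  moreover have "carrier GN \<inter> piece GN n = piece GN n" by (auto simp: assoc_piece)
  ultimately show e: "sq_len T0 GN {\<zero>\<^bsub>GN\<^esub>} (piece GN n) = sq_len R N (D n) (U n)"
    using graded_sub_length[OF between_U between_D D_subset_U assms] by (simp add: graded_sub_U graded_sub_D)
  then show "piece_length T GN n = len D U n"
    using G.mod_length_restrict[OF sub_piece, of n] by (simp add: piece_length_def T0_def len_def)
qed

lemma piece_outside: "n \<notin> degs d \<Longrightarrow> piece GN n = {\<zero>\<^bsub>GN\<^esub>}"
  unfolding piece_eq graded_sub_D[symmetric] by (rule graded_sub_cong) auto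

end

lemma hilbert_coeffs_const: "hilbert_coeffs d (\<lambda>n. c) (\<lambda>k. if k = (\<lambda>_. 0) then c else 0)"
proof -
  let ?e = "\<lambda>k::nat \<Rightarrow> nat. if k = (\<lambda>_. 0) then c else 0"
  have sub: "{k. ?e k \<noteq> 0} \<subseteq> {\<lambda>_. 0}" by auto
  have "(\<Sum>k | ?e k \<noteq> 0. ?e k * (\<Prod>i\<le>d. int ((n i + k i) choose k i))) = c" for n
    by (subst hilbert_sum_superset[OF _ sub]) auto
  moreover have "{k. ?e k \<noteq> 0} \<subseteq> degs d" using sub by (auto simp: degs_def)
  moreover have "finite {k. ?e k \<noteq> 0}" using sub by (rule finite_subset) simp
  ultimately show ?thesis unfolding hilbert_coeffs_def by (auto intro: for_large_all)
qed

lemma seq_type_count: "seq_type xs = count_list (map fst xs)"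
proof
  show "seq_type xs i = count_list (map fst xs) i" for i by (induction xs) (auto simp: seq_type_def)
qed

context ideal_system
begin

text \<open>The symbol and the Euler-Poincare characteristic are both the constant value \<open>c\<close>, in large
  degrees, of the iterated difference of the Hilbert function along the sequence. Since that
  difference shifts the coefficients of the Hilbert polynomial by \<open>k\<close>, the coefficient at \<open>k\<close> is \<open>c\<close>
  and those at larger degrees vanish.\<close>

theorem invariants_agree:
  assumes loc: "local_ring R nn" and fin: "sq_len R N (D (\<lambda>_. 0)) (carrier N) \<noteq> \<infinity>"
    and sys: "mm_system R I d N xs k"
  shows "mixed_mult_defined R I d N k \<and>
    mixed_mult R I d N k = euler_char d T (star_seq R I d xs) GN \<and>
    euler_char d T (star_seq R I d xs) GN = mm_symbol d T (star_seq R I d xs) GN"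
proof -
  have sup: "rees_superficial_seq R I d N xs" and k: "seq_type xs = k"
    and dim: "module_dim R (quot_mod N (carrier N) (colon_infty R N (seq_smult R N xs) (mpow ones))) \<le> 1"
    using sys by (simp_all add: mm_system_def)
  obtain gs where gs: "generating gs" using ex_generating by blast
  then have gi: "gens_in d gs" by (simp add: generating_def)
  have xs: "\<forall>y\<in>set xs. fst y \<le> d \<and> snd y \<in> I (fst y)" using superficial_seq_mem[OF sup] by blast
  note b = mixed_system_bounded[OF gs loc sup dim]
  define c where "c = mm_symbol d T (star_seq R I d xs) GN"
  have s: "subquotient gs (den gs) (gen_span gs)"
    unfolding subquotient_def using family_gen_span[OF gi] family_den[OF gs] family_span[OF family_den[OF gs]] by simp
  have gU: "graded_sub (gen_span gs) = carrier GN" "graded_sub (den gs) = {\<zero>\<^bsub>GN\<^esub>}"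
    unfolding graded_sub_U[symmetric] graded_sub_D[symmetric]
    by (rule graded_sub_cong, simp add: gen_span_eq_U[OF gs], rule graded_sub_cong, simp add: den_eq[OF gs])
  let ?H = "len (den gs) (gen_span gs)"
  have Hlen: "?H n = len D U n" if "n \<in> degs d" for n
    unfolding len_def den_eq[OF gs that] gen_span_eq_U[OF gs that] ..
  have sym: "for_large d (\<lambda>n. nabl (map fst xs) ?H n = c)"
    using symbol_difference[OF gs fin xs b s order_refl] unfolding gU c_def mm_symbol_def by simp

  have "euler_char d T (star_seq R I d xs) GN = c"
    unfolding euler_char_def
  proof (rule eventual_value_eq)
    interpret K: koszul T0 GN proj "star_seq R I d xs" by (rule koszul_assoc[OF xs])
    let ?h = "\<lambda>n. int (the_enat (sq_len T0 GN {\<zero>\<^bsub>GN\<^esub>} (piece GN n)))"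
    have finp: "sq_len T0 GN {\<zero>\<^bsub>GN\<^esub>} (piece GN n) \<noteq> \<infinity>" for n
    proof (cases "n \<in> degs d")
      case True
      then show ?thesis
        using subquotient_finite[OF gs fin s, of n] piece_length_assoc(2)[OF True]
        by (simp add: den_eq[OF gs True] gen_span_eq_U[OF gs True])
    next
      case False
      then show ?thesis using K.sq_len_self[OF K.sub_zero_set] by (simp add: piece_outside)
    qed
    have hH: "?h n = ?H n" if "n \<in> degs d" for n
      using piece_length_assoc(2)[OF that] Hlen[OF that] by (simp add: len_def)
    have mf: "map fst (star_seq R I d xs) = map fst xs" by (simp add: star_seq_def case_prod_beta)
    have "for_large d (\<lambda>n. nabl (map fst xs) ?h n = nabl (map fst xs) ?H n)"
      by (rule for_large_nabl_cong[OF for_large_all[OF hH]])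
    from for_large_conj[OF for_large_ge[of d "length xs"] for_large_conj[OF this sym]]
    show "for_large d (\<lambda>n. (\<Sum>p\<le>length (star_seq R I d xs).
        (- 1) ^ p * piece_length T (koszul_homology (star_seq R I d xs) GN p) n) = c)"
    proof (rule for_large_mono)
      fix n assume h: "(\<forall>i\<le>d. length xs \<le> n i) \<and>
        nabl (map fst xs) ?h n = nabl (map fst xs) ?H n \<and> nabl (map fst xs) ?H n = c"
      have l: "\<forall>y\<in>set (star_seq R I d xs). length (star_seq R I d xs) \<le> n (fst y)"
        using h xs by (auto simp: star_seq_def)
      show "(\<Sum>p\<le>length (star_seq R I d xs).
          (- 1) ^ p * piece_length T (koszul_homology (star_seq R I d xs) GN p) n) = c"
        unfolding piece_length_def T0_def[symmetric] K.euler_in_degree[OF finp] koszul_sum_nabl[OF l] mf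
        using h by simp
    qed
  qed
  moreover have "mixed_mult_defined R I d N k \<and> mixed_mult R I d N k = c"
  proof -
    have "D (\<lambda>_. 0) \<subseteq> den gs (\<lambda>_. 0)" using den_eq[OF gs zero_degs] by simp
    then have "rational_series d ?H"
      using hilb_rational[OF gi sub_U fin family_den[OF gs]] unfolding len_def[abs_def] hilb_def[abs_def] by blast
    then obtain e where e: "hilbert_coeffs d ?H e" using rational_series_polynomial by blast
    have pl: "for_large d (\<lambda>n. ?H n = piece_length T GN n)"
      by (rule for_large_all) (simp add: piece_length_assoc(1) Hlen)
    have e': "hilbert_coeffs d (piece_length T GN) e" by (rule hilbert_coeffs_cong[OF e pl])
    have me: "mm_coeff R I d N = e"
      unfolding mm_coeff_def
      by (rule the_equality[of "hilbert_coeffs d (piece_length T GN)" e, OF e']) (rule hilbert_coeffs_unique[OF _ e'])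
    have "set (map fst xs) \<subseteq> {..d}" using xs by auto
    from hilbert_coeffs_nabl[OF e this]
    have "hilbert_coeffs d (\<lambda>n. c) (\<lambda>h. e (\<lambda>i. h i + k i))"
      unfolding seq_type_count[symmetric] k by (rule hilbert_coeffs_cong[OF _ sym])
    from hilbert_coeffs_unique[OF this hilbert_coeffs_const]
    have eh: "e (\<lambda>i. h i + k i) = (if h = (\<lambda>_. 0) then c else 0)" for h by (rule fun_cong)
    have "e h = 0" if "h \<noteq> k" "k \<le> h" for h
    proof -
      have "(\<lambda>i. (h i - k i) + k i) = h" using that(2) by (simp add: le_fun_def)
      moreover have "(\<lambda>i. h i - k i) \<noteq> (\<lambda>_. 0)"
      proof
        assume z: "(\<lambda>i. h i - k i) = (\<lambda>_. 0)"
        have "h i = k i" for i using fun_cong[OF z, of i] le_funD[OF that(2), of i] by simp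
        then show False using that(1) by blast
      qed
      ultimately show ?thesis using eh[of "\<lambda>i. h i - k i"] by simp
    qed
    moreover have "e k = c" using eh[of "\<lambda>_. 0"] by simp
    ultimately show ?thesis unfolding mixed_mult_defined_def mixed_mult_def me by blast
  qed
  ultimately show ?thesis unfolding c_def by simp
qed

end

section \<open>Primary ideals and the comparison theorem\<close>

text \<open>A prime that contains the annihilator of \<open>N/JN\<close> contains \<open>J\<close> and hence its radical.\<close>

lemma (in ideal_system) primary_finite_length:
  assumes loc: "local_ring R nn" and rad: "ideal_radical R (I 0) = nn"
  shows "sq_len R N (D (\<lambda>_. 0)) (carrier N) \<noteq> \<infinity>"
proof (rule finite_length[OF noetherian _ sub_U])
  show "maximalideal nn R" using loc by (simp add: local_ring_def)
  fix P assume P: "primeideal P R" and ann: "{r \<in> carrier R. \<forall>v\<in>carrier N. r \<odot> v \<in> D (\<lambda>_. 0)} \<subseteq> P"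
  have idP: "ideal P R" using P by (simp add: primeideal_def)
  have "raise 0 (\<lambda>_. 0) = unit_deg 0" by (simp add: raise_def unit_deg_def fun_eq_iff)
  then have m: "mpow (raise 0 (\<lambda>_. 0)) = I 0" using mpow_unit[of 0] by simp
  have "I 0 \<subseteq> P"
  proof
    fix r assume r: "r \<in> I 0"
    have "r \<odot> v \<in> D (\<lambda>_. 0)" if "v \<in> carrier N" for v by (rule U_mem) (use m r that in simp_all)
    moreover have "r \<in> carrier R" using mpow_carr[of r "raise 0 (\<lambda>_. 0)"] m r by simp
    ultimately show "r \<in> P" using ann by blast
  qed
  have "nn \<subseteq> P"
  proof
    fix a assume "a \<in> nn"
    then obtain t :: nat where "a \<in> carrier R" "a [^]\<^bsub>R\<^esub> t \<in> I 0" unfolding rad[symmetric] ideal_radical_def by blast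
    then show "a \<in> P" using prime_pow_mem[OF P, of a t] \<open>I 0 \<subseteq> P\<close> by blast
  qed
  moreover have "P \<noteq> carrier R" using primeideal.I_notcarr[OF P] by simp
  then have "P \<subseteq> nn" by (rule NR.proper_in_local[OF loc idP])
  ultimately show "P = nn" by simp
qed

theorem theorem3p13:
  fixes R :: "('a, 'r) ring_scheme"
    and nn J :: "'a set"
    and N :: "('a, 'm, 'z) module_scheme"
    and d :: nat
    and I :: "nat \<Rightarrow> 'a set"
    and k :: "nat \<Rightarrow> nat"
    and xs :: "(nat \<times> 'a) list"
  assumes "noetherian_ring R" and "local_ring R nn"
    and "infinite (carrier (R Quot nn))"
    and "module R N" and "fin_gen_module R N"
    and "d \<ge> 1"
    and "primary_ideal J R" and "ideal_radical R J = nn"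
    and "I 0 = J" and "\<And>i. 1 \<le> i \<Longrightarrow> i \<le> d \<Longrightarrow> ideal (I i) R"
    and "k \<in> degs d"
    and "mm_system R I d N xs k"
  shows "mixed_mult_defined R I d N k \<and>
    mixed_mult R I d N k
      = euler_char d (assoc_ring R I d) (star_seq R I d xs) (assoc_module R I d N) \<and>
    euler_char d (assoc_ring R I d) (star_seq R I d xs) (assoc_module R I d N)
      = mm_symbol d (assoc_ring R I d) (star_seq R I d xs) (assoc_module R I d N)"
proof -
  have ideals: "ideal (I i) R" if "i \<le> d" for i
    using assms(7,9,10) that by (cases "i = 0") (auto simp: primary_ideal_def)
  interpret ideal_system R N I d
    by (rule ideal_system.intro[OF module.fin_gen_noetherian_module[OF assms(4,1,5)]],
        rule ideal_system_axioms.intro[OF assms(1)], rule ideals)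
  have "sq_len R N (D (\<lambda>_. 0)) (carrier N) \<noteq> \<infinity>"
    by (rule primary_finite_length[OF assms(2)]) (simp add: assms(8,9))
  then show ?thesis by (rule invariants_agree[OF assms(2) _ assms(12)])
qed

end
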